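(* Let $\mathcal{M}$ be a semi-finite von Neumann algebra with a distinguished faithful, normal, semi-finite trace $\tau$. Let $E$ be an order-continuous symmetric quasi-Banach function space on $\mathbb{R}^+$ that is $\alpha$-convex with constant $1$ for some $0<\alpha\le 1$, and suppose that $E$ satisfies a lower $q$-estimate with constant $1$ for some $q\ge\alpha$. Let $\{x_n\}_{n=1}^\infty$ be a bounded sequence in $E(\mathcal{M},\tau)$. Then there exist a subsequence $\{x_{n_k}\}_{k=1}^\infty$ of $\{x_n\}_{n=1}^\infty$, bounded sequences $\{y_k\}_{k=1}^\infty$ and $\{z_k\}_{k=1}^\infty$ in $E(\mathcal{M},\tau)$, and a decreasing sequence of projections $p_k\downarrow_k 0$ in $\mathcal{M}$ such that: (i) $x_{n_k}=y_k+z_k$ for all $k\ge 1$; (ii) $\{y_k : k\ge 1\}$ is $E$-equi-integrable and $p_k y_k p_k=0$ for all $k\ge 1$; (iii) $p_k z_k p_k=z_k$ for all $k\ge 1$.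
   Context: $\mathcal{M}$ acts on a Hilbert space $H$. A closed densely defined operator $x$ affiliated with $\mathcal{M}$ is $\tau$-measurable if for every $\epsilon>0$ there is a projection $p\in\mathcal{M}$ with $p(H)\subseteq \operatorname{dom}(x)$, $\tau(\mathbf{1}-p)<\epsilon$ and $xp\in\mathcal{M}$; $\widetilde{\mathcal{M}}$ is the $*$-algebra of all $\tau$-measurable operators (strong sum, strong product, adjoint). For $x\in\widetilde{\mathcal{M}}$ and $t\ge0$, $\mu_t(x)=\inf\{s\ge 0:\tau(e^{|x|}(s,\infty))\le t\}$, where $e^{|x|}$ is the spectral measure of $|x|$; $\mu(x)$ denotes the function $t\mapsto\mu_t(x)$. $\mathbb{R}^+=[0,\infty)$ carries Lebesgue measure $m$ and $L^0(\mathbb{R}^+,m)$ is the space of (classes of) measurable functions. A symmetric quasi-Banach function space $E$ on $\mathbb{R}^+$ is a quasi-Banach lattice of measurable functions that is an order ideal in $L^0(\mathbb{R}^+,m)$, is rearrangement invariant (if $f\in E$ and $g\in L^0(\mathbb{R}^+,m)$ have the same decreasing rearrangement of absolute values, then $g\in E$ and $\|g\|_E=\|f\|_E$), and contains all finitely supported simple functions. $E$ is order-continuous if $\|f_\beta\|_E\to0$ whenever $f_\beta\downarrow 0$ is a downward directed net in $E$. $E$ is $\alpha$-convex with constant $1$ if $\|(\sum_i|f_i|^\alpha)^{1/\alpha}\|_E\le(\sum_i\|f_i\|_E^\alpha)^{1/\alpha}$ for all finite families in $E$. $E$ satisfies a lower $q$-estimate with constant $1$ if $(\sum\|f_n\|_E^q)^{1/q}\le\|\sum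 f_n\|_E$ for all finite sequences of mutually disjoint elements of $E$. $E(\mathcal{M},\tau)=\{x\in\widetilde{\mathcal{M}}:\mu(x)\in E\}$ with $\|x\|_{E(\mathcal{M},\tau)}=\|\mu(x)\|_E$. Projections are self-adjoint; $p_k\downarrow_k 0$ means that the sequence is decreasing with infimum $0$. A bounded subset $K$ of $E(\mathcal{M},\tau)$ is $E$-equi-integrable if $\lim_{n\to\infty}\sup_{x\in K}\|e_nxe_n\|_{E(\mathcal{M},\tau)}=0$ for every decreasing sequence $\{e_n\}_{n=1}^\infty$ of projections in $\mathcal{M}$ with $e_n\downarrow_n0$. *)

theory Defs
  imports "HOL-Analysis.Analysis"
begin

section \<open>Complex Hilbert spaces\<close>

text \<open>The library has only real inner products, so a complex Hilbert space is introduced as a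
  complete \<open>real_inner\<close> space with a compatible complex structure. The complex inner product is
  linear in its first argument; \<open>inner\<close> is its real part, so the norm and topology are the
  library's.\<close>

class scaleC =
  fixes scaleC :: "complex \<Rightarrow> 'a \<Rightarrow> 'a"  (infixr \<open>*\<^sub>C\<close> 75)

class chilbert_space = real_inner + complete_space + scaleC +
  fixes cinner :: "'a \<Rightarrow> 'a \<Rightarrow> complex"
  assumes scaleC_add_right: "a *\<^sub>C (x + y) = a *\<^sub>C x + a *\<^sub>C y"
    and scaleC_add_left: "(a + b) *\<^sub>C x = a *\<^sub>C x + b *\<^sub>C x"
    and scaleC_scaleC: "a *\<^sub>C b *\<^sub>C x = (a * b) *\<^sub>C x"
    and scaleC_of_real: "complex_of_real r *\<^sub>C x = r *\<^sub>R x"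
    and cinner_commute: "cinner x y = cnj (cinner y x)"
    and cinner_add_left: "cinner (x + y) z = cinner x z + cinner y z"
    and cinner_scaleC_left: "cinner (a *\<^sub>C x) y = a * cinner x y"
    and inner_eq_Re_cinner: "inner x y = Re (cinner x y)"

instantiation complex :: chilbert_space
begin

definition scaleC_complex :: "complex \<Rightarrow> complex \<Rightarrow> complex"
  where "scaleC_complex a x = a * x"

definition cinner_complex :: "complex \<Rightarrow> complex \<Rightarrow> complex"
  where "cinner_complex x y = x * cnj y"

instance
  by standard
    (simp_all add: scaleC_complex_def cinner_complex_def algebra_simps scaleR_conv_of_real
      inner_complex_def)

end

section \<open>Operators\<close>

text \<open>A possibly unbounded, partially defined operator is identified with its graph, so equality
  of operators includes equality of domains, \<open>Domain x\<close> is the domain of \<open>x\<close>, and \<open>x\<close> is a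
  closed operator iff it is a closed subset of the product. Bounded operators are the everywhere
  defined ones with a norm bound; \<open>Id\<close> is the identity operator.\<close>

type_synonym 'h op = "('h \<times> 'h) set"

definition linear_op :: "'h::chilbert_space op \<Rightarrow> bool"
  where "linear_op x \<longleftrightarrow> single_valued x \<and> (0, 0) \<in> x \<and>
    (\<forall>\<xi> \<eta> \<xi>' \<eta>'. (\<xi>, \<eta>) \<in> x \<longrightarrow> (\<xi>', \<eta>') \<in> x \<longrightarrow> (\<xi> + \<xi>', \<eta> + \<eta>') \<in> x) \<and>
    (\<forall>c \<xi> \<eta>. (\<xi>, \<eta>) \<in> x \<longrightarrow> (c *\<^sub>C \<xi>, c *\<^sub>C \<eta>) \<in> x)"

definition op_apply :: "'h op \<Rightarrow> 'h \<Rightarrow> 'h"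
  where "op_apply x \<xi> = (THE \<eta>. (\<xi>, \<eta>) \<in> x)"

definition bounded_op :: "'h::chilbert_space op \<Rightarrow> bool"
  where "bounded_op x \<longleftrightarrow> linear_op x \<and> Domain x = UNIV \<and>
    (\<exists>K. \<forall>(\<xi>, \<eta>)\<in>x. norm \<eta> \<le> K * norm \<xi>)"

definition closed_densely_defined :: "'h::chilbert_space op \<Rightarrow> bool"
  where "closed_densely_defined x \<longleftrightarrow> linear_op x \<and> closed x \<and> closure (Domain x) = UNIV"

definition op_zero :: "'h::chilbert_space op"
  where "op_zero = UNIV \<times> {0}"

definition op_plus :: "'h::chilbert_space op \<Rightarrow> 'h op \<Rightarrow> 'h op"
  where "op_plus x y = {(\<xi>, \<eta> + \<zeta>) | \<xi> \<eta> \<zeta>. (\<xi>, \<eta>) \<in> x \<and> (\<xi>, \<zeta>) \<in> y}"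

definition op_scale :: "complex \<Rightarrow> 'h::chilbert_space op \<Rightarrow> 'h op"
  where "op_scale c x = {(\<xi>, c *\<^sub>C \<eta>) | \<xi> \<eta>. (\<xi>, \<eta>) \<in> x}"

definition op_minus :: "'h::chilbert_space op \<Rightarrow> 'h op \<Rightarrow> 'h op"
  where "op_minus x y = op_plus x (op_scale (- 1) y)"

text \<open>\<open>op_times x y\<close> applies \<open>y\<close> first, whereas relational composition \<open>y O x\<close> is written in
  diagrammatic order.\<close>

definition op_times :: "'h op \<Rightarrow> 'h op \<Rightarrow> 'h op"
  where "op_times x y = y O x"

definition op_adj :: "'h::chilbert_space op \<Rightarrow> 'h op"
  where "op_adj x = {(\<xi>', \<eta>'). \<forall>(\<xi>, \<eta>)\<in>x. cinner \<eta> \<xi>' = cinner \<xi> \<eta>'}"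

text \<open>Strong sum and strong product are the closures of the algebraic sum and product.\<close>

definition strong_plus :: "'h::chilbert_space op \<Rightarrow> 'h op \<Rightarrow> 'h op"
  where "strong_plus x y = closure (op_plus x y)"

definition strong_times :: "'h::chilbert_space op \<Rightarrow> 'h op \<Rightarrow> 'h op"
  where "strong_times x y = closure (op_times x y)"

definition self_adjoint_op :: "'h::chilbert_space op \<Rightarrow> bool"
  where "self_adjoint_op x \<longleftrightarrow> linear_op x \<and> closure (Domain x) = UNIV \<and> op_adj x = x"

definition positive_op :: "'h::chilbert_space op \<Rightarrow> bool"
  where "positive_op x \<longleftrightarrow> linear_op x \<and>
    (\<forall>(\<xi>, \<eta>)\<in>x. Im (cinner \<eta> \<xi>) = 0 \<and> 0 \<le> Re (cinner \<eta> \<xi>))"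

definition op_le :: "'h::chilbert_space op \<Rightarrow> 'h op \<Rightarrow> bool"
  where "op_le a b \<longleftrightarrow> positive_op (op_minus b a)"

definition projection_op :: "'h::chilbert_space op \<Rightarrow> bool"
  where "projection_op p \<longleftrightarrow> bounded_op p \<and> op_adj p = p \<and> op_times p p = p"

definition unitary_op :: "'h::chilbert_space op \<Rightarrow> bool"
  where "unitary_op u \<longleftrightarrow> bounded_op u \<and> op_times (op_adj u) u = Id \<and> op_times u (op_adj u) = Id"

section \<open>Absolute value and spectral measure\<close>

text \<open>The absolute value of a closed densely defined operator is the unique positive self-adjoint
  square root of \<open>x\<^sup>*x\<close>.\<close>

definition op_abs :: "'h::chilbert_space op \<Rightarrow> 'h op"
  where "op_abs x = (THE h. self_adjoint_op h \<and> positive_op h \<and>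
    op_times h h = op_times (op_adj x) x)"

definition projection_valued_measure :: "(real set \<Rightarrow> 'h::chilbert_space op) \<Rightarrow> bool"
  where "projection_valued_measure P \<longleftrightarrow>
    (\<forall>B\<in>sets borel. projection_op (P B)) \<and>
    P {} = op_zero \<and> P UNIV = Id \<and>
    (\<forall>A\<in>sets borel. \<forall>B\<in>sets borel. P (A \<inter> B) = op_times (P A) (P B)) \<and>
    (\<forall>B :: nat \<Rightarrow> real set. range B \<subseteq> sets borel \<longrightarrow> disjoint_family B \<longrightarrow>
      (\<forall>\<xi>. (\<lambda>n. op_apply (P (B n)) \<xi>) sums op_apply (P (\<Union>n. B n)) \<xi>))"

text \<open>The scalar measure \<open>B \<mapsto> (P(B)\<xi>|\<xi>) = \<parallel>P(B)\<xi>\<parallel>\<^sup>2\<close>.\<close>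

definition scalar_spectral_measure ::
    "(real set \<Rightarrow> 'h::chilbert_space op) \<Rightarrow> 'h \<Rightarrow> real measure"
  where "scalar_spectral_measure P \<xi> =
    measure_of UNIV (sets borel) (\<lambda>B. ennreal ((norm (op_apply (P B) \<xi>))\<^sup>2))"

text \<open>\<open>h = \<integral>s dP(s)\<close>: the domain consists of the \<open>\<xi>\<close> with \<open>\<integral>s\<^sup>2 d(P\<xi>|\<xi>) < \<infinity>\<close>, and
  \<open>(h\<xi>|\<xi>) = \<integral>s d(P\<xi>|\<xi>)\<close> there, which by polarization determines \<open>h\<close> on that domain.\<close>

definition spectral_measure_of :: "(real set \<Rightarrow> 'h::chilbert_space op) \<Rightarrow> 'h op \<Rightarrow> bool"
  where "spectral_measure_of P h \<longleftrightarrow> projection_valued_measure P \<and>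
    Domain h = {\<xi>. (\<integral>\<^sup>+s. ennreal (s\<^sup>2) \<partial>scalar_spectral_measure P \<xi>) < \<infinity>} \<and>
    (\<forall>(\<xi>, \<eta>)\<in>h. cinner \<eta> \<xi> = complex_of_real (\<integral>s. s \<partial>scalar_spectral_measure P \<xi>))"

text \<open>By the spectral theorem a self-adjoint operator has a spectral measure, unique on Borel
  sets; only its values on Borel sets are used, so the choice is immaterial.\<close>

definition spectral_measure :: "'h::chilbert_space op \<Rightarrow> real set \<Rightarrow> 'h op"
  where "spectral_measure h = (SOME P. spectral_measure_of P h)"

section \<open>Semi-finite von Neumann algebras\<close>

definition commutant :: "'h::chilbert_space op set \<Rightarrow> 'h op set"
  where "commutant S = {a. bounded_op a \<and> (\<forall>b\<in>S. op_times a b = op_times b a)}"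

locale von_neumann_algebra =
  fixes M :: "'h::chilbert_space op set"
  assumes bounded: "a \<in> M \<Longrightarrow> bounded_op a"
    and plus_closed: "a \<in> M \<Longrightarrow> b \<in> M \<Longrightarrow> op_plus a b \<in> M"
    and scale_closed: "a \<in> M \<Longrightarrow> op_scale c a \<in> M"
    and times_closed: "a \<in> M \<Longrightarrow> b \<in> M \<Longrightarrow> op_times a b \<in> M"
    and adj_closed: "a \<in> M \<Longrightarrow> op_adj a \<in> M"
    and bicommutant: "commutant (commutant M) = M"

definition pos_cone :: "'h::chilbert_space op set \<Rightarrow> 'h op set"
  where "pos_cone M = {a \<in> M. positive_op a}"

text \<open>A von Neumann algebra with a faithful normal semi-finite trace, defined on its positive cone
  with values in \<open>[0,\<infinity>]\<close>; the values of \<open>\<tau>\<close> elsewhere are irrelevant. In \<open>ennreal\<close>,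
  \<open>0 * \<infinity> = 0\<close>. Increasing nets are represented by their ranges, the upward directed sets.\<close>

locale semifinite_von_neumann_algebra = von_neumann_algebra M
  for M :: "'h::chilbert_space op set" +
  fixes \<tau> :: "'h op \<Rightarrow> ennreal"
  assumes trace_plus:
      "a \<in> pos_cone M \<Longrightarrow> b \<in> pos_cone M \<Longrightarrow> \<tau> (op_plus a b) = \<tau> a + \<tau> b"
    and trace_scale:
      "a \<in> pos_cone M \<Longrightarrow> 0 \<le> r \<Longrightarrow> \<tau> (op_scale (complex_of_real r) a) = ennreal r * \<tau> a"
    and tracial:
      "a \<in> M \<Longrightarrow> \<tau> (op_times (op_adj a) a) = \<tau> (op_times a (op_adj a))"
    and faithful:
      "a \<in> pos_cone M \<Longrightarrow> \<tau> a = 0 \<Longrightarrow> a = op_zero"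
    and normal:
      "D \<subseteq> pos_cone M \<Longrightarrow> D \<noteq> {} \<Longrightarrow>
       (\<And>b c. b \<in> D \<Longrightarrow> c \<in> D \<Longrightarrow> \<exists>d\<in>D. op_le b d \<and> op_le c d) \<Longrightarrow>
       a \<in> pos_cone M \<Longrightarrow> (\<And>d. d \<in> D \<Longrightarrow> op_le d a) \<Longrightarrow>
       (\<And>b. b \<in> pos_cone M \<Longrightarrow> (\<And>d. d \<in> D \<Longrightarrow> op_le d b) \<Longrightarrow> op_le a b) \<Longrightarrow>
       \<tau> a = (SUP d\<in>D. \<tau> d)"
    and semifinite:
      "a \<in> pos_cone M \<Longrightarrow> a \<noteq> op_zero \<Longrightarrow>
       \<exists>b\<in>pos_cone M. b \<noteq> op_zero \<and> op_le b a \<and> \<tau> b < \<infinity>"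

definition affiliated :: "'h::chilbert_space op set \<Rightarrow> 'h op \<Rightarrow> bool"
  where "affiliated M x \<longleftrightarrow>
    (\<forall>u\<in>commutant M. unitary_op u \<longrightarrow> op_times u (op_times x (op_adj u)) = x)"

definition projections :: "'h::chilbert_space op set \<Rightarrow> 'h op set"
  where "projections M = {p \<in> M. projection_op p}"

definition tau_measurable ::
    "'h::chilbert_space op set \<Rightarrow> ('h op \<Rightarrow> ennreal) \<Rightarrow> 'h op \<Rightarrow> bool"
  where "tau_measurable M \<tau> x \<longleftrightarrow> closed_densely_defined x \<and> affiliated M x \<and>
    (\<forall>\<epsilon>>0. \<exists>p\<in>projections M. Range p \<subseteq> Domain x \<and>
      \<tau> (op_minus Id p) < ennreal \<epsilon> \<and> op_times x p \<in> M)"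

text \<open>Generalized singular values, with \<open>Inf {} = \<infinity>\<close>.\<close>

definition singular_value ::
    "('h::chilbert_space op \<Rightarrow> ennreal) \<Rightarrow> 'h op \<Rightarrow> real \<Rightarrow> ennreal"
  where "singular_value \<tau> x t =
    Inf {ennreal s | s. 0 \<le> s \<and> \<tau> (spectral_measure (op_abs x) {s<..}) \<le> ennreal t}"

definition proj_decreasing_to_zero ::
    "'h::chilbert_space op set \<Rightarrow> (nat \<Rightarrow> 'h op) \<Rightarrow> bool"
  where "proj_decreasing_to_zero M p \<longleftrightarrow>
    (\<forall>n. p n \<in> projections M) \<and> (\<forall>n. op_le (p (Suc n)) (p n)) \<and>
    (\<forall>r\<in>projections M. (\<forall>n. op_le r (p n)) \<longrightarrow> r = op_zero)"

section \<open>Symmetric quasi-Banach function spaces\<close>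

text \<open>Elements of \<open>L\<^sup>0(\<real>\<^sup>+, m)\<close> are represented by real functions that are measurable on
  \<open>[0,\<infinity>)\<close>; values at negative arguments are ignored, and functions equal almost everywhere are
  identified through the axioms rather than by a quotient.\<close>

abbreviation Rplus :: "real measure"
  where "Rplus \<equiv> lebesgue_on {0..}"

definition decreasing_rearrangement :: "(real \<Rightarrow> real) \<Rightarrow> real \<Rightarrow> ennreal"
  where "decreasing_rearrangement f t =
    Inf {ennreal s | s. 0 \<le> s \<and> emeasure Rplus {u \<in> {0..}. s < \<bar>f u\<bar>} \<le> ennreal t}"

text \<open>\<open>E\<close> is the set of representatives and \<open>N\<close> the quasi-norm. By \<open>ideal\<close>, both are invariant
  under almost-everywhere equality.\<close>

locale symmetric_quasi_banach_space =
  fixes E :: "(real \<Rightarrow> real) set" and N :: "(real \<Rightarrow> real) \<Rightarrow> real"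
  assumes measurable: "f \<in> E \<Longrightarrow> f \<in> borel_measurable Rplus"
    and add_mem: "f \<in> E \<Longrightarrow> g \<in> E \<Longrightarrow> (\<lambda>t. f t + g t) \<in> E"
    and scale_mem: "f \<in> E \<Longrightarrow> (\<lambda>t. c * f t) \<in> E"
    and norm_nonneg: "f \<in> E \<Longrightarrow> 0 \<le> N f"
    and norm_eq_0: "f \<in> E \<Longrightarrow> N f = 0 \<longleftrightarrow> (AE t in Rplus. f t = 0)"
    and norm_scale: "f \<in> E \<Longrightarrow> N (\<lambda>t. c * f t) = \<bar>c\<bar> * N f"
    and quasi_triangle: "\<exists>C. \<forall>f\<in>E. \<forall>g\<in>E. N (\<lambda>t. f t + g t) \<le> C * (N f + N g)"
    and complete:
      "(\<And>n. F n \<in> E) \<Longrightarrow>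
       (\<And>\<epsilon>. \<epsilon> > 0 \<Longrightarrow> \<exists>n0. \<forall>m\<ge>n0. \<forall>n\<ge>n0. N (\<lambda>t. F m t - F n t) < \<epsilon>) \<Longrightarrow>
       \<exists>f\<in>E. (\<lambda>n. N (\<lambda>t. F n t - f t)) \<longlonglongrightarrow> 0"
    and ideal:
      "g \<in> E \<Longrightarrow> f \<in> borel_measurable Rplus \<Longrightarrow> (AE t in Rplus. \<bar>f t\<bar> \<le> \<bar>g t\<bar>) \<Longrightarrow>
       f \<in> E \<and> N f \<le> N g"
    and rearrangement_invariant:
      "f \<in> E \<Longrightarrow> g \<in> borel_measurable Rplus \<Longrightarrow>
       (\<And>t. 0 \<le> t \<Longrightarrow> decreasing_rearrangement g t = decreasing_rearrangement f t) \<Longrightarrow>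
       g \<in> E \<and> N g = N f"
    and simple_mem:
      "simple_function Rplus f \<Longrightarrow> emeasure Rplus {t \<in> {0..}. f t \<noteq> 0} < \<infinity> \<Longrightarrow> f \<in> E"

text \<open>A decreasing net is represented by its range \<open>D\<close>, a downward directed set; \<open>D \<down> 0\<close> means
  that \<open>0\<close> is the greatest lower bound of \<open>D\<close> for the almost-everywhere order.\<close>

definition order_continuous_space ::
    "(real \<Rightarrow> real) set \<Rightarrow> ((real \<Rightarrow> real) \<Rightarrow> real) \<Rightarrow> bool"
  where "order_continuous_space E N \<longleftrightarrow>
    (\<forall>D. D \<subseteq> E \<and> D \<noteq> {} \<and>
      (\<forall>f\<in>D. \<forall>g\<in>D. \<exists>h\<in>D. (AE t in Rplus. h t \<le> f t) \<and> (AE t in Rplus. h t \<le> g t)) \<and>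
      (\<forall>f\<in>D. AE t in Rplus. 0 \<le> f t) \<and>
      (\<forall>g\<in>E. (\<forall>f\<in>D. AE t in Rplus. g t \<le> f t) \<longrightarrow> (AE t in Rplus. g t \<le> 0)) \<longrightarrow>
      (\<forall>\<epsilon>>0. \<exists>f\<in>D. \<forall>g\<in>D. (AE t in Rplus. g t \<le> f t) \<longrightarrow> N g < \<epsilon>))"

definition convex_const_one ::
    "real \<Rightarrow> (real \<Rightarrow> real) set \<Rightarrow> ((real \<Rightarrow> real) \<Rightarrow> real) \<Rightarrow> bool"
  where "convex_const_one \<alpha> E N \<longleftrightarrow>
    (\<forall>n (f :: nat \<Rightarrow> real \<Rightarrow> real). (\<forall>i<n. f i \<in> E) \<longrightarrow>
      N (\<lambda>t. (\<Sum>i<n. \<bar>f i t\<bar> powr \<alpha>) powr (1 / \<alpha>)) \<le> (\<Sum>i<n. N (f i) powr \<alpha>) powr (1 / \<alpha>))"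

definition lower_estimate_const_one ::
    "real \<Rightarrow> (real \<Rightarrow> real) set \<Rightarrow> ((real \<Rightarrow> real) \<Rightarrow> real) \<Rightarrow> bool"
  where "lower_estimate_const_one q E N \<longleftrightarrow>
    (\<forall>n (f :: nat \<Rightarrow> real \<Rightarrow> real). (\<forall>i<n. f i \<in> E) \<longrightarrow>
      (\<forall>i<n. \<forall>j<n. i \<noteq> j \<longrightarrow> (AE t in Rplus. f i t = 0 \<or> f j t = 0)) \<longrightarrow>
      (\<Sum>i<n. N (f i) powr q) powr (1 / q) \<le> N (\<lambda>t. \<Sum>i<n. f i t))"

section \<open>The spaces \<open>E(M,\<tau>)\<close>\<close>

text \<open>For \<open>\<tau>\<close>-measurable \<open>x\<close> the singular values are finite for \<open>t > 0\<close>, so \<open>enn2real\<close>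
  only affects the null set \<open>{0}\<close>.\<close>

definition singular_value_fun ::
    "('h::chilbert_space op \<Rightarrow> ennreal) \<Rightarrow> 'h op \<Rightarrow> real \<Rightarrow> real"
  where "singular_value_fun \<tau> x = (\<lambda>t. enn2real (singular_value \<tau> x t))"

definition nc_space ::
    "'h::chilbert_space op set \<Rightarrow> ('h op \<Rightarrow> ennreal) \<Rightarrow> (real \<Rightarrow> real) set \<Rightarrow> 'h op set"
  where "nc_space M \<tau> E = {x. tau_measurable M \<tau> x \<and> singular_value_fun \<tau> x \<in> E}"

definition nc_norm ::
    "('h::chilbert_space op \<Rightarrow> ennreal) \<Rightarrow> ((real \<Rightarrow> real) \<Rightarrow> real) \<Rightarrow> 'h op \<Rightarrow> real"
  where "nc_norm \<tau> N x = N (singular_value_fun \<tau> x)"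

definition nc_bounded ::
    "'h::chilbert_space op set \<Rightarrow> ('h op \<Rightarrow> ennreal) \<Rightarrow> (real \<Rightarrow> real) set \<Rightarrow>
      ((real \<Rightarrow> real) \<Rightarrow> real) \<Rightarrow> 'h op set \<Rightarrow> bool"
  where "nc_bounded M \<tau> E N K \<longleftrightarrow> K \<subseteq> nc_space M \<tau> E \<and> (\<exists>C. \<forall>x\<in>K. nc_norm \<tau> N x \<le> C)"

definition compress :: "'h::chilbert_space op \<Rightarrow> 'h op \<Rightarrow> 'h op"
  where "compress e x = strong_times (strong_times e x) e"

definition equi_integrable ::
    "'h::chilbert_space op set \<Rightarrow> ('h op \<Rightarrow> ennreal) \<Rightarrow> (real \<Rightarrow> real) set \<Rightarrow>
      ((real \<Rightarrow> real) \<Rightarrow> real) \<Rightarrow> 'h op set \<Rightarrow> bool"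
  where "equi_integrable M \<tau> E N K \<longleftrightarrow> nc_bounded M \<tau> E N K \<and>
    (\<forall>e. proj_decreasing_to_zero M e \<longrightarrow>
      (\<lambda>n. SUP x\<in>K. ennreal (nc_norm \<tau> N (compress (e n) x))) \<longlonglongrightarrow> 0)"

end

theory Submission
  imports Defs
begin

text \<open>Fix levels \<open>K\<^sub>k \<rightarrow> \<infinity>\<close> with \<open>\<tau>(e\<^bsup>|x_n|\<^esup>(K\<^sub>k, \<infinity>)) \<le> 2\<^bsup>-k\<^esup>\<close> for all \<open>n\<close>, and finite-trace projections \<open>g\<^sub>k\<close>
  increasing to the supremum \<open>G\<close> of all supports of the \<open>x\<^sub>n\<close>. The projection \<open>p\<^sub>k\<close> is generated
  by \<open>G - g\<^sub>k\<close> and by the left and right supports of the parts of \<open>x\<^bsub>n_j\<^esub>\<close> above \<open>K\<^sub>j\<close> for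
  \<open>j \<ge> k\<close>, which have summable traces; hence \<open>p\<^sub>k \<down> 0\<close>. If \<open>w\<^sub>k\<close> is \<open>x\<^bsub>n_k\<^esub>\<close> truncated at \<open>K\<^sub>k\<close>,
  then \<open>y\<^sub>k = w\<^sub>k - p\<^sub>k w\<^sub>k p\<^sub>k\<close> and \<open>z\<^sub>k = x\<^bsub>n_k\<^esub> - y\<^sub>k\<close> satisfy (i), (iii) and \<open>p\<^sub>k y\<^sub>k p\<^sub>k = 0\<close>.

  For the equi-integrability of the \<open>y\<^sub>k\<close>, let \<open>L\<^sub>k\<close> be so small that operators of norm \<open>L\<^sub>k\<close> supported
  by \<open>g\<^sub>k\<close> have norm at most \<open>2\<^bsup>-k\<^esup>\<close> in the space. A diagonal argument makes the norms of the parts of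
  \<open>x\<^bsub>n_k\<^esub>\<close> above \<open>K\<^sub>m\<close> and below \<open>L\<^sub>m\<close> converge as \<open>k \<rightarrow> \<infinity>\<close>, so that, by the lower \<open>q\<close>-estimate, the parts
  in \<open>(K\<^sub>m, K\<^sub>k]\<close> and \<open>(L\<^sub>k, L\<^sub>m]\<close> are small uniformly in \<open>k \<ge> m\<close>. The part below \<open>L\<^sub>k\<close> contributes
  to \<open>y\<^sub>k\<close> only through \<open>1 - p\<^sub>k\<close>, that is, inside \<open>g\<^sub>k\<close>. The remaining part, in \<open>(L\<^sub>m, K\<^sub>m]\<close>, is bounded
  in operator norm with supports of bounded trace, so that its smallness is governed by the trace
  norm of order two, for which \<open>c - p c p\<close> is estimated by Pythagoras.\<close>

section \<open>Bounded operators on a complex Hilbert space\<close>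

text \<open>Two obstacles shape the construction. Projections e_n decreasing to 0 converge only
  strongly, so \<open>tr (g * e n * g)\<close> tends to 0 only for g of finite trace; the part of
  y_k outside a fixed g_i must be small by itself. Hence G - g_k is put under p_k, and the corners
  of the middle part at G - g_i and at G - g_k are compared uniformly in k. Secondly, the quasi-norm
  gives no hold on \<open>c - p * c * p\<close> in terms of the norms of c and p c p, whereas
  \<open>t2\<close> splits exactly over corners: its drop from G - g_i to G - g_k bounds what lies
  between, just as the drop of the q-th power of \<open>N\<close> bounds a middle piece of a
  singular value function. All these drops are monotone in the level, so one subsequence controls
  them together. Unbounded operators enter only as x_n and z_k, where z_k is the graph of x - y_k
  with y_k bounded; x itself is reached through spectral projections of |x|, which come from the
  bounded inverse of 1 + x* x. Traces of projections are compared by one principle: if an element of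
  the algebra is injective on the range of e and has its range under f, then tr e is at most tr
  f.\<close>

lemma parallelogram_law:
  fixes x y :: "'a::real_inner"
  shows "(norm (x + y))^2 + (norm (x - y))^2 = 2 * (norm x)^2 + 2 * (norm y)^2"
  by (simp add: power2_norm_eq_inner algebra_simps inner_commute)

text \<open>A minimizing sequence for the distance is Cauchy by the parallelogram law, because
  midpoints stay in S. Only real linearity is asked for, so the lemma serves graphs in the product
  space as well as complex subspaces.\<close>

lemma closed_subspace_projection:
  fixes S :: "'a::{real_inner,complete_space} set"
  assumes S: "subspace S" and cl: "closed S"
  shows "\<exists>p\<in>S. \<forall>y\<in>S. inner (x - p) y = 0"
proof -
  define d where "d = infdist x S"
  have ne: "S \<noteq> {}" using subspace_0[OF S] by auto
  have d0: "0 \<le> d" by (simp add: d_def infdist_nonneg)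
  have ex: "\<exists>y\<in>S. dist x y < d + e" if "e > 0" for e
  proof (rule ccontr)
    assume "\<not> ?thesis"
    then have "d + e \<le> (INF y\<in>S. dist x y)"
      by (intro cINF_greatest ne) (auto simp: not_less)
    then show False using that ne by (simp add: d_def infdist_def)
  qed
  have "\<forall>n. \<exists>y\<in>S. dist x y < d + 1 / real (Suc n)" by (intro allI ex) simp
  then obtain f where f: "f n \<in> S" "dist x (f n) < d + 1 / real (Suc n)" for n by metis
  have key: "(norm (u - v))^2 \<le> 2 * (norm (x - u))^2 + 2 * (norm (x - v))^2 - 4 * d^2"
    if "u \<in> S" "v \<in> S" for u v
  proof -
    have "(1/2) *\<^sub>R (u + v) \<in> S" using S that by (intro subspace_scale subspace_add)
    then have "d \<le> norm (x - (1/2) *\<^sub>R (u + v))"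
      using infdist_le[of _ S x] by (simp add: d_def dist_norm)
    then have "d^2 \<le> (norm (x - (1/2) *\<^sub>R (u + v)))^2" using d0 by (intro power_mono)
    moreover have "(x - u) + (x - v) = 2 *\<^sub>R (x - (1/2) *\<^sub>R (u + v))"
      by (simp add: algebra_simps scaleR_2)
    then have "(norm ((x - u) + (x - v)))^2 = 4 * (norm (x - (1/2) *\<^sub>R (u + v)))^2"
      by (simp add: power_mult_distrib)
    moreover have "(x - u) - (x - v) = v - u" by simp
    ultimately show ?thesis
      using parallelogram_law[of "x - u" "x - v"] by (simp add: norm_minus_commute)
  qed
  have "Cauchy f"
  proof (rule metric_CauchyI)
    fix e :: real assume e: "0 < e"
    have lim: "(\<lambda>n. 4 * (d + 1 / real (Suc n))^2 - 4 * d^2) \<longlonglongrightarrow> 4 * (d + 0)^2 - 4 * d^2"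
      by (intro tendsto_intros LIMSEQ_Suc[OF lim_1_over_n])
    then have "\<forall>\<^sub>F n in sequentially. 4 * (d + 1 / real (Suc n))^2 - 4 * d^2 < e^2"
      using e by (intro order_tendstoD(2)[OF lim]) auto
    then obtain K where K: "\<And>n. n \<ge> K \<Longrightarrow> 4 * (d + 1 / real (Suc n))^2 - 4 * d^2 < e^2"
      by (auto simp: eventually_sequentially)
    show "\<exists>M. \<forall>m\<ge>M. \<forall>n\<ge>M. dist (f m) (f n) < e"
    proof (intro exI allI impI)
      fix m n assume mn: "K \<le> m" "K \<le> n"
      have b: "(norm (x - f i))^2 \<le> (d + 1 / real (Suc K))^2" if "K \<le> i" for i
      proof -
        have "norm (x - f i) \<le> d + 1 / real (Suc i)" using f(2)[of i] by (simp add: dist_norm)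
        also have "\<dots> \<le> d + 1 / real (Suc K)" using that by (simp add: frac_le)
        finally show ?thesis by (intro power_mono) auto
      qed
      have "(norm (f m - f n))^2 < e^2"
        using key[OF f(1) f(1), of m n] b[OF mn(1)] b[OF mn(2)] K[of K] by linarith
      then show "dist (f m) (f n) < e"
        using e by (simp add: dist_norm power_less_imp_less_base)
    qed
  qed
  then obtain p where p: "f \<longlonglongrightarrow> p" using Cauchy_convergent convergentD by blast
  have pS: "p \<in> S" using closed_sequentially[OF cl] f(1) p by blast
  have "(\<lambda>n. d + 1 / real (Suc n)) \<longlonglongrightarrow> d + 0"
    by (intro tendsto_intros LIMSEQ_Suc[OF lim_1_over_n])
  moreover have "(\<lambda>n. dist x (f n)) \<longlonglongrightarrow> dist x p" by (intro tendsto_intros p)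
  ultimately have le: "dist x p \<le> d" using f(2) by (auto intro: LIMSEQ_le less_imp_le)
  have "inner (x - p) y = 0" if y: "y \<in> S" for y
  proof (cases "y = 0")
    case False
    \<comment> \<open>This \<open>t\<close> gives the point of the line p + t y closest to x; a
      nonzero inner product would beat the minimal distance.\<close>
    define t where "t = inner (x - p) y / (norm y)^2"
    have "p + t *\<^sub>R y \<in> S" using S pS y by (intro subspace_add subspace_scale)
    then have "d \<le> dist x (p + t *\<^sub>R y)" by (simp add: d_def infdist_le)
    then have "(norm (x - p))^2 \<le> (norm (x - p - t *\<^sub>R y))^2"
      using le by (intro power_mono) (auto simp: dist_norm algebra_simps)
    also have "\<dots> = (norm (x - p))^2 - 2 * t * inner (x - p) y + t^2 * (norm y)^2"
      unfolding power2_norm_eq_inner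
      by (simp add: inner_diff_left inner_diff_right inner_commute power2_eq_square algebra_simps)
    also have "\<dots> = (norm (x - p))^2 - (inner (x - p) y)^2 / (norm y)^2"
      using False by (simp add: t_def field_simps power2_eq_square)
    finally have "(inner (x - p) y)^2 / (norm y)^2 \<le> 0" by simp
    then show ?thesis using False
      by (metis divide_le_0_iff norm_eq_zero order_antisym power_eq_0_iff zero_le_power2 zero_less_power2 not_le)
  qed auto
  then show ?thesis using pS by blast
qed

lemma riesz_representation:
  fixes f :: "'a::{real_inner,complete_space} \<Rightarrow> real"
  assumes f: "bounded_linear f"
  shows "\<exists>y. \<forall>x. f x = inner x y"
proof (cases "\<forall>x. f x = 0")
  case True
  then show ?thesis by (intro exI[of _ 0]) auto
next
  case False
  interpret bounded_linear f by (rule f)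
  obtain x0 where x0: "f x0 \<noteq> 0" using False by auto
  define K where "K = {x. f x = 0}"
  have sub: "subspace K" by (auto simp: subspace_def K_def add scale zero)
  have "closed K" unfolding K_def
    by (intro closed_Collect_eq continuous_intros linear_continuous_on f)
  then obtain p where p: "p \<in> K" "\<And>y. y \<in> K \<Longrightarrow> inner (x0 - p) y = 0"
    using closed_subspace_projection[OF sub] by blast
  define w where "w = x0 - p"
  have fw: "f w \<noteq> 0" using x0 p(1) by (simp add: w_def diff K_def)
  then have w0: "w \<noteq> 0" using zero by auto
  have "f x = inner x ((f w / (norm w)^2) *\<^sub>R w)" for x
  proof -
    have "x - (f x / f w) *\<^sub>R w \<in> K" using fw by (simp add: K_def diff scale)
    then have "inner w (x - (f x / f w) *\<^sub>R w) = 0" using p(2) by (simp add: w_def)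
    then have "inner x w = f x / f w * (norm w)^2"
      by (simp add: algebra_simps inner_commute power2_norm_eq_inner)
    then show ?thesis using w0 fw by simp
  qed
  then show ?thesis by blast
qed

lemma scaleC_one [simp]: "1 *\<^sub>C (x::'h::chilbert_space) = x"
  using scaleC_of_real[of 1 x] by simp

lemma scaleC_zero_right [simp]: "c *\<^sub>C (0::'h::chilbert_space) = 0"
  using scaleC_add_right[of c "0::'h" 0] by simp

lemma scaleC_minus_one: "(- 1) *\<^sub>C (x::'h::chilbert_space) = - x"
  using scaleC_of_real[of "- 1" x] by simp

lemma scaleC_minus_right: "c *\<^sub>C (- x::'h::chilbert_space) = - (c *\<^sub>C x)"
  using scaleC_add_right[of c x "- x"] by (simp add: eq_neg_iff_add_eq_0 add.commute)

lemma scaleC_diff_right: "c *\<^sub>C (x - y::'h::chilbert_space) = c *\<^sub>C x - c *\<^sub>C y"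
  using scaleC_add_right[of c x "- y"] by (simp add: scaleC_minus_right)

lemma scaleC_scaleR: "c *\<^sub>C (r *\<^sub>R (x::'h::chilbert_space)) = r *\<^sub>R (c *\<^sub>C x)"
  by (simp add: scaleC_of_real[symmetric] scaleC_scaleC mult.commute)

lemma cinner_scaleC_right: "cinner x (a *\<^sub>C y) = cnj a * cinner x (y::'h::chilbert_space)"
  by (metis cinner_commute cinner_scaleC_left complex_cnj_mult)

lemma cinner_add_right: "cinner x (y + z) = cinner x y + cinner x (z::'h::chilbert_space)"
  by (metis cinner_commute cinner_add_left complex_cnj_add)

lemma cinner_eq_inner:
  "cinner x y = complex_of_real (inner x y) + \<i> * complex_of_real (inner x (\<i> *\<^sub>C (y::'h::chilbert_space)))"
  by (simp add: complex_eq_iff inner_eq_Re_cinner cinner_scaleC_right)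

lemma inner_scaleC_left:
  "inner (c *\<^sub>C x) y = inner x (cnj c *\<^sub>C (y::'h::chilbert_space))"
  by (simp add: inner_eq_Re_cinner cinner_scaleC_left cinner_scaleC_right)

lemma cinner_self: "cinner x x = complex_of_real ((norm (x::'h::chilbert_space))^2)"
proof -
  have "Im (cinner x x) = 0"
    using arg_cong[OF cinner_commute[of x x], of Im] by simp
  then show ?thesis by (simp add: complex_eq_iff inner_eq_Re_cinner[symmetric] power2_norm_eq_inner)
qed

lemma norm_scaleC: "norm (c *\<^sub>C (x::'h::chilbert_space)) = cmod c * norm x"
proof -
  have "complex_of_real ((norm (c *\<^sub>C x))^2) = c * cnj c * complex_of_real ((norm x)^2)"
    unfolding cinner_self[symmetric] by (simp add: cinner_scaleC_left cinner_scaleC_right)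
  also have "\<dots> = complex_of_real ((cmod c * norm x)^2)"
    by (simp add: complex_norm_square[symmetric] power_mult_distrib)
  finally have "(norm (c *\<^sub>C x))^2 = (cmod c * norm x)^2"
    by (simp only: of_real_eq_iff)
  then show ?thesis by (simp add: power2_eq_iff_nonneg)
qed

lemma tendsto_scaleC:
  fixes f :: "'a \<Rightarrow> 'h::chilbert_space"
  assumes "(f \<longlongrightarrow> l) F"
  shows "((\<lambda>n. c *\<^sub>C f n) \<longlongrightarrow> c *\<^sub>C l) F"
proof -
  have "bounded_linear (\<lambda>x::'h. c *\<^sub>C x)"
    by (intro bounded_linear_intro[of _ "cmod c"])
      (auto simp: scaleC_add_right scaleC_scaleR norm_scaleC mult.commute)
  then show ?thesis using assms by (rule bounded_linear.tendsto)
qed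

text \<open>Bounded operators get a type of their own so that sums and products obey ring laws;
  \<open>graph\<close> later links them to the operators of the statement.\<close>

typedef (overloaded) 'h bop = "{f :: 'h::chilbert_space \<Rightarrow> 'h.
    (\<forall>x y. f (x + y) = f x + f y) \<and> (\<forall>c x. f (c *\<^sub>C x) = c *\<^sub>C f x) \<and>
    (\<exists>K. \<forall>x. norm (f x) \<le> K * norm x)}"
  morphisms bapply Bop
  by (rule exI[of _ "\<lambda>x. 0"]) (auto intro: exI[of _ 0])

notation bapply (infixr "\<odot>" 75)

lemma bop_eqI: "(\<And>x. a \<odot> x = b \<odot> x) \<Longrightarrow> a = b"
  by (metis bapply_inject ext)

lemma bapply_add [simp]: "a \<odot> (x + y) = a \<odot> x + a \<odot> y"
  using bapply[of a] by simp

lemma bapply_scaleC [simp]: "a \<odot> (c *\<^sub>C x) = c *\<^sub>C (a \<odot> x)"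
  using bapply[of a] by simp

lemma bapply_bounded: "\<exists>K. 0 \<le> K \<and> (\<forall>x. norm (a \<odot> x) \<le> K * norm x)"
proof -
  obtain K where K: "\<And>x. norm (a \<odot> x) \<le> K * norm x" using bapply[of a] by auto
  have "norm (a \<odot> x) \<le> \<bar>K\<bar> * norm x" for x
    by (rule order_trans[OF K]) (auto intro: mult_right_mono)
  then show ?thesis by (intro exI[of _ "\<bar>K\<bar>"]) auto
qed

lemma bapply_bounded_linear: "bounded_linear (bapply a)"
proof -
  obtain K where "\<And>x. norm (a \<odot> x) \<le> K * norm x" using bapply_bounded by blast
  then show ?thesis
    by (intro bounded_linear_intro[of _ K])
      (auto simp: mult.commute scaleC_of_real[symmetric])
qed

lemma bapply_zero [simp]: "a \<odot> 0 = 0"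
  using bapply_add[of a 0 0] by (metis add_cancel_right_right)

lemma bapply_minus [simp]: "a \<odot> (- x) = - (a \<odot> x)"
  by (metis bapply_scaleC scaleC_minus_one)

lemma bapply_diff [simp]: "a \<odot> (x - y) = a \<odot> x - a \<odot> y"
  using bapply_add[of a x "- y"] by simp

lemma bapply_scaleR [simp]: "a \<odot> (r *\<^sub>R x) = r *\<^sub>R (a \<odot> x)"
  by (metis bapply_scaleC scaleC_of_real)

lemma bapply_tendsto: "(f \<longlongrightarrow> l) F \<Longrightarrow> ((\<lambda>n. a \<odot> f n) \<longlongrightarrow> a \<odot> l) F"
  by (rule bounded_linear.tendsto[OF bapply_bounded_linear])

lemma Bop_apply:
  assumes "\<And>x y. f (x + y) = f x + f y" "\<And>c x. f (c *\<^sub>C x) = c *\<^sub>C f x"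
    "\<And>x. norm (f x) \<le> K * norm x"
  shows "Bop f \<odot> x = f x"
  using assms by (subst Bop_inverse) auto

instantiation bop :: (chilbert_space) "{real_algebra, monoid_mult, scaleC}"
begin

definition "0 = Bop (\<lambda>x. 0)"
definition "1 = Bop (\<lambda>x. x)"
definition "a + b = Bop (\<lambda>x. a \<odot> x + b \<odot> x)"
definition "a - b = Bop (\<lambda>x. a \<odot> x - b \<odot> x)"
definition "- a = Bop (\<lambda>x. - (a \<odot> x))"
definition "a * b = Bop (\<lambda>x. a \<odot> b \<odot> x)"
definition "r *\<^sub>R a = Bop (\<lambda>x. r *\<^sub>R (a \<odot> x))"
definition "c *\<^sub>C a = Bop (\<lambda>x. c *\<^sub>C (a \<odot> x))"

lemma bop_apply [simp]:
  "0 \<odot> x = 0" "1 \<odot> x = x" "(a + b) \<odot> x = a \<odot> x + b \<odot> x" "(a - b) \<odot> x = a \<odot> x - b \<odot> x"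
  "(- a) \<odot> x = - (a \<odot> x)" "(a * b) \<odot> x = a \<odot> b \<odot> x"
  "(r *\<^sub>R a) \<odot> x = r *\<^sub>R (a \<odot> x)" "(c *\<^sub>C a) \<odot> x = c *\<^sub>C (a \<odot> x)"
proof -
  obtain K where K: "0 \<le> K" "\<And>x. norm (a \<odot> x) \<le> K * norm x" using bapply_bounded by blast
  obtain L where L: "0 \<le> L" "\<And>x. norm (b \<odot> x) \<le> L * norm x" using bapply_bounded by blast
  show "0 \<odot> x = 0" unfolding zero_bop_def by (rule Bop_apply[of _ 0]) auto
  show "1 \<odot> x = x" unfolding one_bop_def by (rule Bop_apply[of _ 1]) auto
  show "(a + b) \<odot> x = a \<odot> x + b \<odot> x" unfolding plus_bop_def
    by (rule Bop_apply[of _ "K + L"])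
      (auto simp: scaleC_add_right algebra_simps intro!: order_trans[OF norm_triangle_ineq] add_mono K L)
  show "(a - b) \<odot> x = a \<odot> x - b \<odot> x" unfolding minus_bop_def
    by (rule Bop_apply[of _ "K + L"])
      (auto simp: scaleC_diff_right algebra_simps intro!: order_trans[OF norm_triangle_ineq4] add_mono K L)
  show "(- a) \<odot> x = - (a \<odot> x)" unfolding uminus_bop_def
    by (rule Bop_apply[of _ "K"]) (auto simp: scaleC_minus_right K)
  show "(a * b) \<odot> x = a \<odot> b \<odot> x" unfolding times_bop_def
  proof (rule Bop_apply[of _ "K * L"])
    show "norm (a \<odot> b \<odot> x) \<le> K * L * norm x" for x
      using order_trans[OF K(2) mult_left_mono[OF L(2) K(1)]] by (simp add: mult.assoc)
  qed auto
  show "(r *\<^sub>R a) \<odot> x = r *\<^sub>R (a \<odot> x)" unfolding scaleR_bop_def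
    by (rule Bop_apply[of _ "\<bar>r\<bar> * K"])
      (auto simp: scaleR_add_right scaleC_scaleR mult.assoc intro!: mult_left_mono K)
  show "(c *\<^sub>C a) \<odot> x = c *\<^sub>C (a \<odot> x)" unfolding scaleC_bop_def
    by (rule Bop_apply[of _ "cmod c * K"])
      (auto simp: scaleC_add_right scaleC_scaleC norm_scaleC mult.assoc mult.commute[of c]
        intro!: mult_left_mono K)
qed

instance
  by standard (auto intro!: bop_eqI simp: algebra_simps)

end

lemma bapply_sum [simp]: "sum f A \<odot> x = (\<Sum>i\<in>A. f i \<odot> x)"
  by (induction A rule: infinite_finite_induct) auto

text \<open>An upper bound for the operator norm rather than the norm itself: all estimates below
  only need some bound, and bounds multiply and add without suprema.\<close>

definition nbound :: "'h::chilbert_space bop \<Rightarrow> real \<Rightarrow> bool"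
  where "nbound a K \<longleftrightarrow> 0 \<le> K \<and> (\<forall>x. norm (a \<odot> x) \<le> K * norm x)"

lemma nboundD: "nbound a K \<Longrightarrow> norm (a \<odot> x) \<le> K * norm x"
  by (simp add: nbound_def)

lemma nbound_exists: "\<exists>K. nbound a K"
  using bapply_bounded by (auto simp: nbound_def)

lemma nbound_mult: "nbound a K \<Longrightarrow> nbound b L \<Longrightarrow> nbound (a * b) (K * L)"
  unfolding nbound_def
proof (intro conjI allI)
  fix x assume *: "0 \<le> K \<and> (\<forall>x. norm (a \<odot> x) \<le> K * norm x)" "0 \<le> L \<and> (\<forall>x. norm (b \<odot> x) \<le> L * norm x)"
  have "norm (a \<odot> b \<odot> x) \<le> K * norm (b \<odot> x)" using * by blast
  also have "\<dots> \<le> K * (L * norm x)" using * by (intro mult_left_mono) auto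
  finally show "norm ((a * b) \<odot> x) \<le> K * L * norm x" by (simp add: mult.assoc)
qed auto

lemma nbound_add: "nbound a K \<Longrightarrow> nbound b L \<Longrightarrow> nbound (a + b) (K + L)"
  unfolding nbound_def
  by (auto simp: algebra_simps intro!: order_trans[OF norm_triangle_ineq] add_mono)

lemma nbound_minus: "nbound a K \<Longrightarrow> nbound b L \<Longrightarrow> nbound (a - b) (K + L)"
  unfolding nbound_def
  by (auto simp: algebra_simps intro!: order_trans[OF norm_triangle_ineq4] add_mono)

lemma strong_limit_bop:
  assumes lim: "\<And>x. (\<lambda>n. a n \<odot> x) \<longlonglongrightarrow> f x" and K: "\<And>n. nbound (a n) K"
  shows "\<exists>b. nbound b K \<and> (\<forall>x. b \<odot> x = f x)"
proof -
  have n: "norm (f x) \<le> K * norm x" for x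
    by (rule LIMSEQ_le_const2[OF tendsto_norm[OF lim]]) (use K in \<open>auto simp: nbound_def\<close>)
  have add: "f (x + y) = f x + f y" for x y
    using LIMSEQ_unique[OF lim[of "x + y"]] tendsto_add[OF lim[of x] lim[of y]] by simp
  have sc: "f (c *\<^sub>C x) = c *\<^sub>C f x" for c x
    using LIMSEQ_unique[OF lim[of "c *\<^sub>C x"]] tendsto_scaleC[OF lim[of x]] by simp
  have "Bop f \<odot> x = f x" for x by (rule Bop_apply[OF add sc n])
  moreover have "0 \<le> K" using K[of 0] by (simp add: nbound_def)
  ultimately show ?thesis using n by (intro exI[of _ "Bop f"]) (auto simp: nbound_def)
qed

text \<open>The adjoint for the real inner product. Complex linearity of \<open>a\<close> makes it
  complex linear and hence the complex adjoint too, see \<open>cinner_adj\<close>.\<close>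

definition adj :: "'h::chilbert_space bop \<Rightarrow> 'h bop"
  where "adj a = (SOME b. \<forall>x y. inner (a \<odot> x) y = inner x (b \<odot> y))"

lemma inner_eqI: "(\<And>x. inner x y = inner x z) \<Longrightarrow> y = (z::'a::real_inner)"
  by (metis inner_diff_right inner_eq_zero_iff right_minus_eq)

lemma adj_exists: "\<exists>b. \<forall>x y. inner (a \<odot> x) y = inner x (b \<odot> y)"
proof -
  have "\<exists>z. \<forall>x. inner (a \<odot> x) y = inner x z" for y
    by (rule riesz_representation) (intro bounded_linear_intros bapply_bounded_linear)
  then obtain f where f: "\<And>x y. inner (a \<odot> x) y = inner x (f y)" by metis
  obtain K where K: "0 \<le> K" "\<And>x. norm (a \<odot> x) \<le> K * norm x" using bapply_bounded by blast
  have n: "norm (f y) \<le> K * norm y" for y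
  proof -
    have "(norm (f y))^2 = inner (a \<odot> f y) y" by (simp add: f power2_norm_eq_inner)
    also have "\<dots> \<le> norm (a \<odot> f y) * norm y" by (rule norm_cauchy_schwarz)
    also have "\<dots> \<le> K * norm (f y) * norm y" by (intro mult_right_mono K) auto
    finally have "norm (f y) * norm (f y) \<le> norm (f y) * (K * norm y)"
      by (simp add: power2_eq_square algebra_simps)
    then show ?thesis using K(1) by (cases "norm (f y) = 0") (auto simp: mult_le_cancel_left)
  qed
  have "Bop f \<odot> y = f y" for y
  proof (rule Bop_apply[OF _ _ n])
    show "f (x + y) = f x + f y" for x y
      by (rule inner_eqI) (simp add: inner_add_right f[symmetric])
    show "f (c *\<^sub>C x) = c *\<^sub>C f x" for c x
    proof (rule inner_eqI)
      fix z
      have "inner z (f (c *\<^sub>C x)) = inner (a \<odot> z) (c *\<^sub>C x)" by (simp add: f)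
      also have "\<dots> = inner (a \<odot> (cnj c *\<^sub>C z)) x" by (simp add: inner_scaleC_left)
      also have "\<dots> = inner z (c *\<^sub>C f x)" by (simp only: f) (simp add: inner_scaleC_left)
      finally show "inner z (f (c *\<^sub>C x)) = inner z (c *\<^sub>C f x)" .
    qed
  qed
  then show ?thesis using f by (intro exI[of _ "Bop f"]) auto
qed

lemma inner_adj: "inner (a \<odot> x) y = inner x (adj a \<odot> y)"
  using someI_ex[OF adj_exists, of a] unfolding adj_def by blast

lemma inner_adj': "inner (adj a \<odot> x) y = inner x (a \<odot> y)"
  by (metis inner_adj inner_commute)

lemma adjI: "(\<And>x y. inner (a \<odot> x) y = inner x (b \<odot> y)) \<Longrightarrow> adj a = b"
  by (rule bop_eqI, rule inner_eqI) (simp add: inner_adj[symmetric])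

lemma adj_simps [simp]:
  "adj (adj a) = a" "adj (a + b) = adj a + adj b" "adj (a - b) = adj a - adj b"
  "adj (a * b) = adj b * adj a" "adj 0 = 0" "adj 1 = 1" "adj (r *\<^sub>R a) = r *\<^sub>R adj a"
  "adj (c *\<^sub>C a) = cnj c *\<^sub>C adj a" "adj (- a) = - adj a"
proof -
  show "adj (adj a) = a" by (rule adjI) (rule inner_adj')
qed (auto intro!: adjI simp: inner_adj inner_add_left inner_add_right inner_diff_left
      inner_diff_right inner_scaleC_left)

lemma adj_sum [simp]: "adj (sum f A) = (\<Sum>i\<in>A. adj (f i))"
  by (induction A rule: infinite_finite_induct) auto

lemma adj_power [simp]: "adj (a ^ n) = adj a ^ n"
  by (induction n) (auto simp: power_commutes)

lemma cinner_adj: "cinner (a \<odot> x) y = cinner x (adj a \<odot> y)"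
  by (simp add: cinner_eq_inner inner_adj)

lemma nbound_adj: "nbound a K \<Longrightarrow> nbound (adj a) K"
proof -
  assume a: "nbound a K"
  then have K: "0 \<le> K" by (simp add: nbound_def)
  have "norm (adj a \<odot> y) \<le> K * norm y" for y
  proof -
    have "(norm (adj a \<odot> y))^2 = inner (a \<odot> adj a \<odot> y) y" by (simp add: inner_adj power2_norm_eq_inner)
    also have "\<dots> \<le> norm (a \<odot> adj a \<odot> y) * norm y" by (rule norm_cauchy_schwarz)
    also have "\<dots> \<le> K * norm (adj a \<odot> y) * norm y" by (intro mult_right_mono nboundD a) auto
    finally have "norm (adj a \<odot> y) * norm (adj a \<odot> y) \<le> norm (adj a \<odot> y) * (K * norm y)"
      by (simp add: power2_eq_square algebra_simps)
    then show ?thesis using K by (cases "norm (adj a \<odot> y) = 0") (auto simp: mult_le_cancel_left)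
  qed
  then show ?thesis using K by (simp add: nbound_def)
qed

section \<open>Positive operators and square roots\<close>

definition pos :: "'h::chilbert_space bop \<Rightarrow> bool"
  where "pos a \<longleftrightarrow> adj a = a \<and> (\<forall>x. 0 \<le> inner (a \<odot> x) x)"

lemma quadratic_form_cauchy_schwarz:
  fixes A B C :: real
  assumes "\<And>t. 0 \<le> A + 2 * t * B + t^2 * C" "0 \<le> C"
  shows "B^2 \<le> A * C"
proof (cases "C = 0")
  case True
  have "B = 0"
  proof (rule ccontr)
    assume "B \<noteq> 0"
    \<comment> \<open>At this \<open>t\<close> the form, affine because \<open>C = 0\<close>, takes
      the value -1.\<close>
    then have "2 * (- (A + 1) / (2 * B)) * B = - (A + 1)" by simp
    then show False using assms(1)[of "- (A + 1) / (2 * B)"] True by simp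
  qed
  then show ?thesis using True by simp
next
  case False
  then have C: "0 < C" using assms(2) by simp
  have "0 \<le> A + 2 * (- B / C) * B + (- B / C)^2 * C" by (rule assms)
  also have "\<dots> = A - B^2 / C" using C by (simp add: field_simps power2_eq_square)
  finally show ?thesis using C by (simp add: field_simps)
qed

lemma pos_selfadj: "pos a \<Longrightarrow> adj a = a" by (simp add: pos_def)
lemma pos_nonneg: "pos a \<Longrightarrow> 0 \<le> inner (a \<odot> x) x" by (simp add: pos_def)

lemma pos_zero [simp]: "pos 0" and pos_one [simp]: "pos 1"
  by (auto simp: pos_def)

lemma pos_add: "pos a \<Longrightarrow> pos b \<Longrightarrow> pos (a + b)"
  by (auto simp: pos_def inner_add_left)

lemma pos_scaleR: "pos a \<Longrightarrow> 0 \<le> r \<Longrightarrow> pos (r *\<^sub>R a)"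
  by (auto simp: pos_def)

lemma pos_sum: "(\<And>i. i \<in> A \<Longrightarrow> pos (f i)) \<Longrightarrow> pos (sum f A)"
  by (induction A rule: infinite_finite_induct) (auto intro: pos_add)

lemma pos_conj: "pos a \<Longrightarrow> pos (adj b * a * b)"
  by (auto simp: pos_def mult.assoc inner_adj')

lemma pos_adj_mult: "pos (adj b * b)"
  using pos_conj[of 1 b] by simp

lemma pos_adj_mult': "pos (b * adj b)"
  using pos_adj_mult[of "adj b"] by simp

lemma pos_cauchy_schwarz:
  assumes "pos a"
  shows "(inner (a \<odot> x) y)^2 \<le> inner (a \<odot> x) x * inner (a \<odot> y) y"
proof (rule quadratic_form_cauchy_schwarz)
  fix t
  have s: "inner (a \<odot> y) x = inner (a \<odot> x) y"
    by (metis inner_adj inner_commute pos_selfadj[OF assms])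
  have "0 \<le> inner (a \<odot> (x + t *\<^sub>R y)) (x + t *\<^sub>R y)" by (rule pos_nonneg[OF assms])
  also have "\<dots> = inner (a \<odot> x) x + 2 * t * inner (a \<odot> x) y + t^2 * inner (a \<odot> y) y"
    by (simp add: inner_add_left inner_add_right s power2_eq_square algebra_simps)
  finally show "0 \<le> inner (a \<odot> x) x + 2 * t * inner (a \<odot> x) y + t^2 * inner (a \<odot> y) y" .
qed (rule pos_nonneg[OF assms])

text \<open>Cauchy--Schwarz for the form of \<open>a\<close> at the vectors x and a x. In operator
  terms, a \<le> K implies a^2 \<le> K a.\<close>

lemma pos_norm_le:
  assumes a: "pos a" and K: "\<And>x. inner (a \<odot> x) x \<le> K * (norm x)^2"
  shows "(norm (a \<odot> x))^2 \<le> K * inner (a \<odot> x) x"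
proof (cases "a \<odot> x = 0")
  case False
  have "(norm (a \<odot> x))^2 * (norm (a \<odot> x))^2 = (inner (a \<odot> x) (a \<odot> x))^2"
    by (simp only: power2_norm_eq_inner power2_eq_square[of "inner _ _"])
  also have "\<dots> \<le> inner (a \<odot> x) x * inner (a \<odot> a \<odot> x) (a \<odot> x)"
    by (rule pos_cauchy_schwarz[OF a])
  also have "\<dots> \<le> inner (a \<odot> x) x * (K * (norm (a \<odot> x))^2)"
    by (intro mult_left_mono K pos_nonneg a)
  finally have "(norm (a \<odot> x))^2 * (norm (a \<odot> x))^2 \<le> (K * inner (a \<odot> x) x) * (norm (a \<odot> x))^2"
    by (simp only: ac_simps)
  then show ?thesis by (rule mult_right_le_imp_le) (use False in simp)
qed (simp add: pos_nonneg a)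

lemma pos_nboundI:
  assumes a: "pos a" and K: "0 \<le> K" "\<And>x. inner (a \<odot> x) x \<le> K * (norm x)^2"
  shows "nbound a K"
  unfolding nbound_def
proof (intro conjI allI K(1))
  fix x
  have "(norm (a \<odot> x))^2 \<le> K * inner (a \<odot> x) x" by (rule pos_norm_le[OF a K(2)])
  also have "\<dots> \<le> K * (K * (norm x)^2)" by (intro mult_left_mono K)
  also have "\<dots> = (K * norm x)^2" by (simp add: power2_eq_square)
  finally show "norm (a \<odot> x) \<le> K * norm x"
    using K(1) by (meson mult_nonneg_nonneg norm_ge_zero power2_le_imp_le)
qed

lemma inner_le_nbound: "nbound a K \<Longrightarrow> inner (a \<odot> x) x \<le> K * (norm x)^2"
proof -
  assume a: "nbound a K"
  have "inner (a \<odot> x) x \<le> norm (a \<odot> x) * norm x" by (rule norm_cauchy_schwarz)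
  also have "\<dots> \<le> K * norm x * norm x" by (intro mult_right_mono nboundD a) auto
  finally show ?thesis by (simp add: power2_eq_square)
qed

lemma pos_one_minus: "adj a = a \<Longrightarrow> nbound a 1 \<Longrightarrow> pos (1 - a)"
  using inner_le_nbound[of a 1] by (auto simp: pos_def inner_diff_left power2_norm_eq_inner)

lemma pos_one_minus_nbound: "pos a \<Longrightarrow> pos (1 - a) \<Longrightarrow> nbound a 1"
  by (rule pos_nboundI) (auto simp: pos_def inner_diff_left power2_norm_eq_inner)

lemma pos_one_minus_adj_mult: "nbound a 1 \<Longrightarrow> pos (1 - adj a * a)"
  by (rule pos_one_minus) (use nbound_mult[OF nbound_adj] in force)+

lemma pos_form_zero:
  assumes "pos a" "\<And>x. inner (a \<odot> x) x = 0"
  shows "a = 0"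
proof (rule bop_eqI)
  fix x
  have "(norm (a \<odot> x))^2 \<le> 0 * inner (a \<odot> x) x"
    by (rule pos_norm_le[OF assms(1)]) (use assms(2) in auto)
  then show "a \<odot> x = 0 \<odot> x" by simp
qed

lemma pos_antisym:
  assumes "pos a" "pos (- a)"
  shows "a = 0"
proof (rule pos_form_zero[OF assms(1)])
  fix x show "inner (a \<odot> x) x = 0"
    using pos_nonneg[OF assms(1), of x] pos_nonneg[OF assms(2), of x] by simp
qed

lemma pos_increasing:
  assumes inc: "\<And>n. pos (a (Suc n) - a n)" and "n \<le> m" shows "pos (a m - a n)"
  using assms(2)
proof (induction m rule: dec_induct)
  case (step k)
  have "pos ((a (Suc k) - a k) + (a k - a n))" by (intro pos_add inc step)
  then show ?case by simp
qed simp

lemma pos_limit: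
  assumes a: "\<And>n. pos (a n)" and lim: "\<And>x. (\<lambda>n. a n \<odot> x) \<longlonglongrightarrow> b \<odot> x"
  shows "pos b"
proof -
  have "adj b = b"
  proof (rule adjI)
    fix x y
    have "(\<lambda>n. inner (a n \<odot> x) y) \<longlonglongrightarrow> inner (b \<odot> x) y" by (intro tendsto_intros lim)
    moreover have "inner (a n \<odot> x) y = inner x (a n \<odot> y)" for n
      using inner_adj[of "a n" x y] pos_selfadj[OF a] by simp
    moreover have "(\<lambda>n. inner x (a n \<odot> y)) \<longlonglongrightarrow> inner x (b \<odot> y)" by (intro tendsto_intros lim)
    ultimately show "inner (b \<odot> x) y = inner x (b \<odot> y)" using LIMSEQ_unique by simp
  qed
  moreover have "0 \<le> inner (b \<odot> x) x" for x
    by (rule LIMSEQ_le_const[OF tendsto_inner[OF lim tendsto_const]]) (auto intro: pos_nonneg[OF a])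
  ultimately show ?thesis by (simp add: pos_def)
qed

text \<open>Vigier's theorem for sequences: the numerical forms converge by monotonicity, and
  \<open>pos_norm_le\<close> applied to the differences turns this into convergence of the
  vectors.\<close>

lemma pos_mono_convergent:
  assumes a: "\<And>n. pos (a n)" and inc: "\<And>n. pos (a (Suc n) - a n)" and K: "\<And>n. nbound (a n) K"
  shows "\<exists>b. pos b \<and> nbound b K \<and> (\<forall>x. (\<lambda>n. a n \<odot> x) \<longlonglongrightarrow> b \<odot> x)"
proof -
  note inc' = pos_increasing[of a, OF inc]
  have K0: "0 \<le> K" using K[of 0] by (simp add: nbound_def)
  have conv: "convergent (\<lambda>n. a n \<odot> x)" for x
  proof -
    let ?f = "\<lambda>n. inner (a n \<odot> x) x"
    have mono: "incseq ?f"
      by (intro incseq_SucI) (use pos_nonneg[OF inc, of _ x] in \<open>simp add: inner_diff_left\<close>)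
    have "Bseq ?f"
      by (rule BseqI'[of _ "K * (norm x)^2"]) (auto simp: inner_le_nbound[OF K] pos_nonneg[OF a])
    then have "convergent ?f"
      by (rule Bseq_mono_convergent) (use mono in \<open>auto simp: incseq_def\<close>)
    then have C: "Cauchy ?f" by (simp add: convergent_Cauchy)
    have key: "(norm (a m \<odot> x - a n \<odot> x))^2 \<le> K * (?f m - ?f n)" if "n \<le> m" for m n
    proof -
      have "(norm ((a m - a n) \<odot> x))^2 \<le> K * inner ((a m - a n) \<odot> x) x"
      proof (rule pos_norm_le[OF inc'[OF that]])
        fix y
        show "inner ((a m - a n) \<odot> y) y \<le> K * (norm y)^2"
          using inner_le_nbound[OF K[of m], of y] pos_nonneg[OF a[of n], of y] by (simp add: inner_diff_left)
      qed
      then show ?thesis by (simp add: inner_diff_left)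
    qed
    have "Cauchy (\<lambda>n. a n \<odot> x)"
    proof (rule metric_CauchyI)
      fix e :: real assume e: "0 < e"
      \<comment> \<open>\<open>K\<close> may be 0, hence the denominator
        \<open>K + 1\<close>.\<close>
      then have "0 < e^2 / (K + 1)" using K0 by simp
      from metric_CauchyD[OF C this] obtain M where M: "\<And>m n. m \<ge> M \<Longrightarrow> n \<ge> M \<Longrightarrow> dist (?f m) (?f n) < e^2 / (K + 1)"
        by blast
      have main: "dist (a m \<odot> x) (a n \<odot> x) < e" if "M \<le> n" "n \<le> m" for m n
      proof -
        have "(norm (a m \<odot> x - a n \<odot> x))^2 \<le> K * (?f m - ?f n)" by (rule key[OF that(2)])
        also have "\<dots> \<le> K * (e^2 / (K + 1))"
          using M[of m n] that K0 by (intro mult_left_mono) (auto simp: dist_norm)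
        also have "\<dots> < e^2" using K0 e by (simp add: field_simps)
        finally show ?thesis using e by (simp add: dist_norm power_less_imp_less_base)
      qed
      show "\<exists>M. \<forall>m\<ge>M. \<forall>n\<ge>M. dist (a m \<odot> x) (a n \<odot> x) < e"
        using main by (intro exI[of _ M]) (metis dist_commute nle_le)
    qed
    then show ?thesis by (rule Cauchy_convergent)
  qed
  then have "\<forall>x. \<exists>l. (\<lambda>n. a n \<odot> x) \<longlonglongrightarrow> l" by (simp add: convergent_def)
  from choice[OF this] obtain f where f: "\<And>x. (\<lambda>n. a n \<odot> x) \<longlonglongrightarrow> f x" by blast
  from strong_limit_bop[OF f K] obtain b where b: "nbound b K" "\<And>x. b \<odot> x = f x" by blast
  have lim: "(\<lambda>n. a n \<odot> x) \<longlonglongrightarrow> b \<odot> x" for x unfolding b by (rule f)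
  then show ?thesis using pos_limit[OF a lim] b(1) by blast
qed

section \<open>Square roots of positive contractions\<close>

inductive_set power_cone :: "'h::chilbert_space bop \<Rightarrow> 'h bop set" for c where
  zero: "0 \<in> power_cone c"
| step: "a \<in> power_cone c \<Longrightarrow> 0 \<le> r \<Longrightarrow> a + r *\<^sub>R c ^ k \<in> power_cone c"

lemma power_cone_add: "b \<in> power_cone c \<Longrightarrow> a \<in> power_cone c \<Longrightarrow> a + b \<in> power_cone c"
  by (induction rule: power_cone.induct) (auto simp: add.assoc[symmetric] intro: power_cone.intros)

lemma power_cone_scaleR: "a \<in> power_cone c \<Longrightarrow> 0 \<le> r \<Longrightarrow> r *\<^sub>R a \<in> power_cone c"
  by (induction rule: power_cone.induct) (auto simp: scaleR_add_right intro: power_cone.intros)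

lemma power_cone_power: "a \<in> power_cone c \<Longrightarrow> a * c ^ k \<in> power_cone c"
  by (induction rule: power_cone.induct)
    (auto simp: distrib_right power_add[symmetric] intro: power_cone.intros)

lemma power_cone_mult: "b \<in> power_cone c \<Longrightarrow> a \<in> power_cone c \<Longrightarrow> a * b \<in> power_cone c"
  by (induction rule: power_cone.induct)
    (auto simp: distrib_left intro: power_cone.intros power_cone_add power_cone_scaleR power_cone_power)

lemma commute_power: "d * c = c * d \<Longrightarrow> d * c ^ k = c ^ k * (d::'a::monoid_mult)"
  by (induction k) (auto simp: mult.assoc, metis mult.assoc)

lemma power_cone_commute: "a \<in> power_cone c \<Longrightarrow> d * c = c * d \<Longrightarrow> d * a = a * d"
  by (induction rule: power_cone.induct) (auto simp: distrib_left distrib_right commute_power)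

lemma pos_power:
  assumes c: "pos c" shows "pos (c ^ k)"
proof -
  have s: "adj (c ^ m) = c ^ m" for m using pos_selfadj[OF c] by simp
  show ?thesis
  proof (cases "even k")
    case True
    then obtain m where "k = m + m" by (metis mult_2 evenE)
    then show ?thesis using pos_adj_mult[of "c ^ m"] by (simp only: s power_add)
  next
    case False
    then obtain m where "k = m + 1 + m" by (metis oddE mult_2 add.assoc add.commute)
    then show ?thesis using pos_conj[OF c, of "c ^ m"]
      by (simp only: s power_add power_one_right)
  qed
qed

lemma power_cone_pos: "a \<in> power_cone c \<Longrightarrow> pos c \<Longrightarrow> pos a"
  by (induction rule: power_cone.induct) (auto intro: pos_add pos_scaleR pos_power)

text \<open>With \<open>c = 1 - a\<close>, the iterates of \<open>y \<mapsto> (c + y\<^sup>2) / 2\<close> increase to \<open>1 - \<surd>a\<close>; they and their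
  increments are polynomials in \<open>c\<close> with nonnegative coefficients.\<close>

primrec sqrt_iter :: "'h::chilbert_space bop \<Rightarrow> nat \<Rightarrow> 'h bop" where
  "sqrt_iter c 0 = 0"
| "sqrt_iter c (Suc n) = (1/2) *\<^sub>R (c + sqrt_iter c n * sqrt_iter c n)"

lemma sqrt_iter_cone: "sqrt_iter c n \<in> power_cone c"
proof (induction n)
  case (Suc n)
  have "0 + 1 *\<^sub>R c ^ 1 \<in> power_cone c" by (intro power_cone.intros) auto
  then show ?case using Suc by (auto intro!: power_cone_scaleR power_cone_add power_cone_mult)
qed (auto intro: power_cone.zero)

lemma sqrt_iter_increment: "sqrt_iter c (Suc n) - sqrt_iter c n \<in> power_cone c"
proof (induction n)
  case 0
  have "0 + (1/2) *\<^sub>R c ^ 1 \<in> power_cone c" by (intro power_cone.intros) auto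
  then show ?case by simp
next
  case (Suc n)
  let ?y = "sqrt_iter c n" and ?z = "sqrt_iter c (Suc n)"
  \<comment> \<open>Consecutive iterates commute, so the difference of their squares factors into
    two members of the cone.\<close>
  have "?z * c = c * ?z"
    using power_cone_commute[OF sqrt_iter_cone, of c c] by metis
  then have "?z * ?y = ?y * ?z" by (rule power_cone_commute[OF sqrt_iter_cone])
  then have "sqrt_iter c (Suc (Suc n)) - ?z = (1/2) *\<^sub>R ((?z - ?y) * (?z + ?y))"
    unfolding sqrt_iter.simps(2)[of c "Suc n"]
    by (subst (3) sqrt_iter.simps(2)) (simp add: algebra_simps del: sqrt_iter.simps)
  then show ?case
    by (auto simp del: sqrt_iter.simps intro!: power_cone_scaleR power_cone_mult power_cone_add Suc sqrt_iter_cone)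
qed

lemma bop_sqrt_exists:
  assumes a: "pos a" "pos (1 - a)"
  shows "\<exists>b. pos b \<and> nbound b 1 \<and> b * b = a \<and> (\<forall>d. d * a = a * d \<longrightarrow> d * b = b * d)"
proof -
  define c where "c = 1 - a"
  have c: "pos c" "nbound c 1"
    using a by (auto simp: c_def intro: pos_one_minus_nbound)
  let ?y = "sqrt_iter c"
  have nb: "nbound (?y n) 1" for n
  proof (induction n)
    case (Suc n)
    from nbound_add[OF c(2) nbound_mult[OF Suc Suc]] show ?case by (simp add: nbound_def mult.commute)
  qed (simp add: nbound_def)
  obtain y where y: "pos y" "nbound y 1" "\<And>x. (\<lambda>n. ?y n \<odot> x) \<longlonglongrightarrow> y \<odot> x"
    using pos_mono_convergent[of ?y 1] nb power_cone_pos[OF sqrt_iter_cone c(1)]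
      power_cone_pos[OF sqrt_iter_increment c(1)] by blast
  \<comment> \<open>Strong limits pass to the product because the iterates are contractions: the
    error is bounded by that of a single factor.\<close>
  have yy: "(\<lambda>n. ?y n \<odot> ?y n \<odot> x) \<longlonglongrightarrow> y \<odot> y \<odot> x" for x
  proof (rule Lim_transform[OF y(3)[of "y \<odot> x"]])
    show "(\<lambda>n. ?y n \<odot> ?y n \<odot> x - ?y n \<odot> y \<odot> x) \<longlonglongrightarrow> 0"
    proof (rule Lim_null_comparison)
      show "\<forall>\<^sub>F n in sequentially. norm (?y n \<odot> ?y n \<odot> x - ?y n \<odot> y \<odot> x) \<le> norm (?y n \<odot> x - y \<odot> x)"
      proof (intro always_eventually allI)
        fix n
        show "norm (?y n \<odot> ?y n \<odot> x - ?y n \<odot> y \<odot> x) \<le> norm (?y n \<odot> x - y \<odot> x)"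
          using nboundD[OF nb, of n "?y n \<odot> x - y \<odot> x"] by simp
      qed
      show "(\<lambda>n. norm (?y n \<odot> x - y \<odot> x)) \<longlonglongrightarrow> 0"
        using tendsto_norm_zero[OF LIM_zero[OF y(3)[of x]]] by simp
    qed
  qed
  have eq: "y = (1/2) *\<^sub>R (c + y * y)"
  proof (rule bop_eqI)
    fix x
    have "(\<lambda>n. (1/2) *\<^sub>R (c \<odot> x + ?y n \<odot> ?y n \<odot> x)) \<longlonglongrightarrow> (1/2) *\<^sub>R (c \<odot> x + y \<odot> y \<odot> x)"
      by (intro tendsto_scaleR tendsto_add tendsto_const yy)
    then have "(\<lambda>n. ?y (Suc n) \<odot> x) \<longlonglongrightarrow> ((1/2) *\<^sub>R (c + y * y)) \<odot> x" by simp
    then show "y \<odot> x = ((1/2) *\<^sub>R (c + y * y)) \<odot> x"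
      by (rule LIMSEQ_unique[OF LIMSEQ_Suc[OF y(3)]])
  qed
  \<comment> \<open>The doubled fixed point equation 2 y = c + y^2 says (1 - y)^2 = 1 - c =
    a.\<close>
  have "2 *\<^sub>R y = 2 *\<^sub>R ((1/2) *\<^sub>R (c + y * y))" by (rule arg_cong[OF eq])
  then have "2 *\<^sub>R y = c + y * y" by simp
  then have sq: "(1 - y) * (1 - y) = a"
    unfolding c_def scaleR_2 by (simp add: left_diff_distrib right_diff_distrib) (simp add: algebra_simps)
  have pb: "pos (1 - y)" by (rule pos_one_minus) (use y pos_selfadj in auto)
  moreover have "nbound (1 - y) 1" by (rule pos_one_minus_nbound[OF pb]) (simp add: y)
  moreover have "d * (1 - y) = (1 - y) * d" if "d * a = a * d" for d
  proof -
    have "d * c = c * d" using that by (simp add: c_def algebra_simps)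
    then have com: "d * ?y n = ?y n * d" for n by (rule power_cone_commute[OF sqrt_iter_cone])
    have "d * y = y * d"
    proof (rule bop_eqI)
      fix x
      have "d \<odot> ?y n \<odot> x = ?y n \<odot> d \<odot> x" for n
        using arg_cong[OF com[of n], of "\<lambda>b. b \<odot> x"] by simp
      moreover have "(\<lambda>n. d \<odot> ?y n \<odot> x) \<longlonglongrightarrow> d \<odot> y \<odot> x" by (rule bapply_tendsto[OF y(3)])
      ultimately have "(\<lambda>n. ?y n \<odot> d \<odot> x) \<longlonglongrightarrow> d \<odot> y \<odot> x" by simp
      then have "d \<odot> y \<odot> x = y \<odot> d \<odot> x" by (rule LIMSEQ_unique[OF _ y(3)])
      then show "(d * y) \<odot> x = (y * d) \<odot> x" by simp
    qed
    then show ?thesis by (simp add: algebra_simps)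
  qed
  ultimately show ?thesis using sq by blast
qed

definition bsqrt :: "'h::chilbert_space bop \<Rightarrow> 'h bop"
  where "bsqrt a = (SOME b. pos b \<and> nbound b 1 \<and> b * b = a \<and> (\<forall>d. d * a = a * d \<longrightarrow> d * b = b * d))"

lemma
  assumes a: "pos a" "pos (1 - a)"
  shows bsqrt_pos: "pos (bsqrt a)" and bsqrt_nbound: "nbound (bsqrt a) 1"
    and bsqrt_square: "bsqrt a * bsqrt a = a"
    and bsqrt_commute: "d * a = a * d \<Longrightarrow> d * bsqrt a = bsqrt a * d"
  using someI_ex[OF bop_sqrt_exists[OF a]] unfolding bsqrt_def by blast+

lemma pos_square_zero: "adj d = d \<Longrightarrow> d * d = 0 \<Longrightarrow> d = 0"
proof (rule bop_eqI)
  fix x assume "adj d = d" "d * d = 0"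
  then have "inner (d \<odot> x) (d \<odot> x) = 0"
    by (metis inner_adj bop_apply(1,6) inner_zero_right)
  then show "d \<odot> x = 0 \<odot> x" by simp
qed

text \<open>For d = a - s the product (a + s) d vanishes, so the positive operators d a d and d s d
  add up to 0 and both vanish. Their difference is d^3, and a self-adjoint operator with vanishing
  fourth power is 0.\<close>

lemma bsqrt_unique:
  assumes a: "pos a" and sq: "pos (1 - a * a)"
  shows "a = bsqrt (a * a)"
proof -
  define s where "s = bsqrt (a * a)"
  have p: "pos (a * a)" using pos_adj_mult[of a] by (simp add: pos_selfadj a)
  have s: "pos s" "s * s = a * a" unfolding s_def by (intro bsqrt_pos bsqrt_square p sq)+
  have com: "a * s = s * a" unfolding s_def by (rule bsqrt_commute[OF p sq]) (simp add: mult.assoc)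
  define d where "d = a - s"
  have d: "adj d = d" by (simp add: d_def pos_selfadj a s)
  have pp: "pos (d * a * d)" "pos (d * s * d)"
    using pos_conj[OF a, of d] pos_conj[OF s(1), of d] by (simp_all add: d)
  have "(a + s) * d = 0"
    by (simp add: d_def algebra_simps com s)
  then have z: "d * a * d + d * s * d = 0"
    by (simp add: mult.assoc flip: distrib_left) (simp flip: distrib_right)
  have "d * a * d = - (d * s * d)" using z by (simp add: eq_neg_iff_add_eq_0)
  then have "d * s * d = 0" "d * a * d = 0" using pos_antisym pp by (metis, metis z add_eq_0_iff pos_antisym)
  then have "d * (a - s) * d = 0" by (simp only: left_diff_distrib right_diff_distrib) simp
  then have "d * d * d = 0" by (simp only: d_def[symmetric])
  then have "d * d * d * d = 0" by simp
  then have "(d * d) * (d * d) = 0" by (simp only: mult.assoc)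
  then have "d * d = 0" by (rule pos_square_zero[rotated]) (simp add: d)
  then have "d = 0" by (rule pos_square_zero[OF d])
  then show ?thesis by (simp add: d_def s_def)
qed

text \<open>The square root of a commutes with b, so a b is the conjugate of b by that root.\<close>

lemma pos_mult_commute:
  assumes "pos a" "pos (1 - a)" "pos b" "a * b = b * a"
  shows "pos (a * b)"
proof -
  let ?s = "bsqrt a"
  have "b * ?s = ?s * b" by (rule bsqrt_commute[OF assms(1,2)]) (simp add: assms)
  then have "?s * b * ?s = ?s * ?s * b" by (simp only: mult.assoc)
  then have "?s * b * ?s = a * b" by (simp only: bsqrt_square[OF assms(1,2)])
  then show ?thesis using pos_conj[OF assms(3), of ?s] pos_selfadj[OF bsqrt_pos[OF assms(1,2)]] by simp
qed

section \<open>Projections\<close>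

definition isproj :: "'h::chilbert_space bop \<Rightarrow> bool"
  where "isproj p \<longleftrightarrow> adj p = p \<and> p * p = p"

lemma isprojD: "isproj p \<Longrightarrow> adj p = p" "isproj p \<Longrightarrow> p * p = p" by (auto simp: isproj_def)

lemma isproj_idem [simp]: "isproj p \<Longrightarrow> p \<odot> p \<odot> x = p \<odot> x"
  by (metis isprojD(2) bop_apply(6))

lemma isproj_zero [simp]: "isproj 0" and isproj_one [simp]: "isproj 1"
  by (auto simp: isproj_def)

lemma isproj_compl: "isproj p \<Longrightarrow> isproj (1 - p)"
  by (auto simp: isproj_def algebra_simps)

lemma isproj_inner: "isproj p \<Longrightarrow> inner (p \<odot> x) y = inner x (p \<odot> y)"
  by (metis inner_adj isprojD(1))

lemma isproj_form: "isproj p \<Longrightarrow> inner (p \<odot> x) x = (norm (p \<odot> x))^2"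
  by (metis isproj_idem isproj_inner power2_norm_eq_inner)

lemma isproj_pos: "isproj p \<Longrightarrow> pos p"
  by (auto simp: pos_def isprojD isproj_form)

lemma isproj_pythagoras: "isproj p \<Longrightarrow> (norm x)^2 = (norm (p \<odot> x))^2 + (norm (x - p \<odot> x))^2"
proof -
  assume p: "isproj p"
  have "inner (p \<odot> x) (x - p \<odot> x) = 0"
    by (simp only: isproj_inner[OF p]) (simp add: p)
  then show ?thesis
    using norm_add_Pythagorean[of "p \<odot> x" "x - p \<odot> x"] by (simp add: orthogonal_def)
qed

lemma isproj_nbound: "isproj p \<Longrightarrow> nbound p 1"
  unfolding nbound_def
proof (intro conjI allI)
  fix x assume "isproj p"
  from isproj_pythagoras[OF this, of x] have "(norm (p \<odot> x))^2 \<le> (norm x)^2" by simp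
  then show "norm (p \<odot> x) \<le> 1 * norm x" by (simp only: mult_1) (rule power2_le_imp_le, auto)
qed auto

lemma isproj_norm: "isproj p \<Longrightarrow> norm (p \<odot> x) \<le> norm x"
  using isproj_nbound nboundD by fastforce

lemma isproj_norm_eq: "isproj p \<Longrightarrow> norm (p \<odot> x) = norm x \<Longrightarrow> p \<odot> x = x"
  using isproj_pythagoras[of p x] by simp

lemma isproj_adj_le: "isproj p \<Longrightarrow> isproj q \<Longrightarrow> p * q = q \<Longrightarrow> q * p = q"
proof -
  assume a: "isproj p" "isproj q" "p * q = q"
  have "q * p = adj (p * q)" by (simp only: adj_simps isprojD[OF a(1)] isprojD[OF a(2)])
  also have "\<dots> = q" by (simp only: a(3) isprojD[OF a(2)])
  finally show ?thesis .
qed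

lemma isproj_diff: "isproj p \<Longrightarrow> isproj q \<Longrightarrow> p * q = q \<Longrightarrow> isproj (p - q)"
proof -
  assume a: "isproj p" "isproj q" "p * q = q"
  from isproj_adj_le[OF this] a show ?thesis by (simp add: isproj_def algebra_simps)
qed

text \<open>Order gives |q x| \<le> |p q x|, and a projection that preserves the norm of a vector
  fixes it. From here on the order of projections is handled through the equation p q = q.\<close>

lemma isproj_le_iff:
  assumes p: "isproj p" and q: "isproj q"
  shows "pos (p - q) \<longleftrightarrow> p * q = q"
proof
  assume pq: "pos (p - q)"
  show "p * q = q"
  proof (rule bop_eqI)
    fix x
    have "(norm (q \<odot> x))^2 \<le> (norm (p \<odot> q \<odot> x))^2"
      using pos_nonneg[OF pq, of "q \<odot> x"] isproj_form[OF p, of "q \<odot> x"] isproj_form[OF q, of "q \<odot> x"] q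
      by (simp add: inner_diff_left)
    then have "norm (p \<odot> q \<odot> x) = norm (q \<odot> x)"
      by (intro antisym isproj_norm p) (rule power2_le_imp_le, auto)
    then show "(p * q) \<odot> x = q \<odot> x" using isproj_norm_eq[OF p] by simp
  qed
next
  assume "p * q = q"
  then show "pos (p - q)" by (intro isproj_pos isproj_diff p q)
qed

lemma isproj_eqI:
  assumes "isproj p" "isproj q" "\<And>x. p \<odot> x = x \<longleftrightarrow> q \<odot> x = x"
  shows "p = q"
proof -
  have "p * q = q" by (rule bop_eqI) (use assms in simp)
  moreover have "q * p = p"
  proof (rule bop_eqI)
    fix x
    have "q \<odot> p \<odot> x = p \<odot> x" using assms(3)[of "p \<odot> x"] assms(1) by simp
    then show "(q * p) \<odot> x = p \<odot> x" by simp
  qed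
  ultimately show ?thesis using isproj_adj_le[OF assms(1,2)] by simp
qed

section \<open>Projections onto closed spans, kernels, ranges and joins\<close>

definition perp :: "'h::chilbert_space set \<Rightarrow> 'h set"
  where "perp S = {y. \<forall>x\<in>S. cinner x y = 0}"

lemma cinner_zero_simps [simp]: "cinner x 0 = 0" "cinner 0 x = 0"
  by (simp_all add: cinner_eq_inner)

lemma perp_complex_subspace:
  "0 \<in> perp S" "x \<in> perp S \<Longrightarrow> y \<in> perp S \<Longrightarrow> x + y \<in> perp S" "x \<in> perp S \<Longrightarrow> c *\<^sub>C x \<in> perp S"
  by (auto simp: perp_def cinner_add_right cinner_scaleC_right)

lemma closed_perp: "closed (perp S)"
proof -
  have "perp S = (\<Inter>x\<in>S. {y. inner x y = 0} \<inter> {y. inner x (\<i> *\<^sub>C y) = 0})"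
    by (auto simp: perp_def cinner_eq_inner complex_eq_iff)
  moreover have "inner x (\<i> *\<^sub>C y) = inner (- \<i> *\<^sub>C x) y" for x y :: 'a
    by (simp add: inner_scaleC_left)
  ultimately show ?thesis
    by (auto intro!: closed_INT closed_Int closed_Collect_eq continuous_intros)
qed

text \<open>The foot of the perpendicular for the real inner product is unique, and uniqueness makes
  it complex linear as soon as V is a complex subspace.\<close>

lemma projection_onto_exists:
  assumes V: "0 \<in> V" "\<And>x y. x \<in> V \<Longrightarrow> y \<in> V \<Longrightarrow> x + y \<in> V" "\<And>c x. x \<in> V \<Longrightarrow> c *\<^sub>C x \<in> V"
    and cl: "closed V"
  shows "\<exists>p. isproj p \<and> (\<forall>x. p \<odot> x = x \<longleftrightarrow> x \<in> V)"
proof -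
  have sub: "subspace V"
    unfolding subspace_def using V by (auto simp: scaleC_of_real[symmetric])
  obtain f where f: "\<And>x. f x \<in> V" "\<And>x y. y \<in> V \<Longrightarrow> inner (x - f x) y = 0"
    using closed_subspace_projection[OF sub cl] by metis
  have uniq: "f x = z" if "z \<in> V" "\<And>y. y \<in> V \<Longrightarrow> inner (x - z) y = 0" for x z
  proof -
    have d: "f x - z \<in> V" using subspace_diff[OF sub f(1) that(1)] .
    have "inner (f x - z) (f x - z) = inner (x - z) (f x - z) - inner (x - f x) (f x - z)"
      by (simp add: inner_diff_left)
    also have "\<dots> = 0" using that(2)[OF d] f(2)[OF d] by simp
    finally show ?thesis by simp
  qed
  have add: "f (x + y) = f x + f y" for x y
  proof (rule uniq)
    show "inner (x + y - (f x + f y)) v = 0" if "v \<in> V" for v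
      using f(2)[OF that, of x] f(2)[OF that, of y] by (simp add: algebra_simps)
  qed (intro V f)
  have sc: "f (c *\<^sub>C x) = c *\<^sub>C f x" for c x
  proof (rule uniq)
    show "inner (c *\<^sub>C x - c *\<^sub>C f x) v = 0" if "v \<in> V" for v
      using f(2)[OF V(3)[OF that], of x "cnj c"] by (simp add: scaleC_diff_right[symmetric] inner_scaleC_left)
  qed (intro V f)
  have n: "norm (f x) \<le> 1 * norm x" for x
  proof -
    have "(norm (f x))^2 = inner x (f x)"
      using f(2)[OF f(1), of x x] by (simp add: inner_diff_left power2_norm_eq_inner)
    also have "\<dots> \<le> norm x * norm (f x)" by (rule norm_cauchy_schwarz)
    finally show ?thesis by (cases "norm (f x) = 0") (auto simp: power2_eq_square)
  qed
  have b: "Bop f \<odot> x = f x" for x by (rule Bop_apply[OF add sc n])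
  have fx: "f x = x" if "x \<in> V" for x by (rule uniq[OF that]) simp
  have "inner (f x) y = inner x (f y)" for x y
    using f(2)[OF f(1), of x y] f(2)[OF f(1), of y x]
    by (simp add: inner_diff_left) (simp add: inner_commute)
  then have "adj (Bop f) = Bop f" by (intro adjI) (simp add: b)
  moreover have "Bop f * Bop f = Bop f" by (rule bop_eqI) (simp add: b fx f)
  ultimately have "isproj (Bop f)" by (simp add: isproj_def)
  moreover have "f x = x \<longleftrightarrow> x \<in> V" for x using fx f(1)[of x] by auto
  ultimately show ?thesis by (intro exI[of _ "Bop f"]) (simp add: b)
qed

text \<open>The double complement is the closed complex span of S, so that the projection is
  available for arbitrary sets; supports, kernels and joins are all instances.\<close>

definition pr :: "'h::chilbert_space set \<Rightarrow> 'h bop"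
  where "pr S = (SOME p. isproj p \<and> (\<forall>x. p \<odot> x = x \<longleftrightarrow> x \<in> perp (perp S)))"

lemma pr_isproj [simp]: "isproj (pr S)" and pr_fixed: "pr S \<odot> x = x \<longleftrightarrow> x \<in> perp (perp S)"
proof -
  have "\<exists>p. isproj p \<and> (\<forall>x. p \<odot> x = x \<longleftrightarrow> x \<in> perp (perp S))"
    by (rule projection_onto_exists) (auto intro: perp_complex_subspace closed_perp)
  from someI_ex[OF this] show "isproj (pr S)" "pr S \<odot> x = x \<longleftrightarrow> x \<in> perp (perp S)"
    unfolding pr_def by auto
qed

lemma pr_member: "x \<in> S \<Longrightarrow> pr S \<odot> x = x"
  unfolding pr_fixed by (auto simp: perp_def) (metis cinner_commute complex_cnj_zero)

lemma pr_perp: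
  assumes "x \<in> perp S" shows "pr S \<odot> x = 0"
proof -
  have "pr S \<odot> x \<in> perp (perp S)" using pr_fixed[of S "pr S \<odot> x"] by simp
  then have "cinner x (pr S \<odot> x) = 0" using assms by (auto simp: perp_def)
  then have "inner x (pr S \<odot> x) = 0" by (simp add: inner_eq_Re_cinner)
  then show ?thesis using isproj_form[of "pr S" x] by (simp add: inner_commute)
qed

lemma pr_least:
  assumes q: "isproj q" and S: "\<And>x. x \<in> S \<Longrightarrow> q \<odot> x = x"
  shows "q * pr S = pr S"
proof -
  have "pr S * (1 - q) = 0"
  proof (rule bop_eqI)
    fix z
    have "cinner x ((1 - q) \<odot> z) = 0" if "x \<in> S" for x
    proof -
      have "cinner x ((1 - q) \<odot> z) = cinner ((1 - q) \<odot> x) z"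
        by (simp only: cinner_adj) (simp add: isprojD(1)[OF q])
      then show ?thesis using S[OF that] by simp
    qed
    then show "(pr S * (1 - q)) \<odot> z = 0 \<odot> z"
      using pr_perp[of "(1 - q) \<odot> z" S] by (simp add: perp_def)
  qed
  then have "pr S * q = pr S" by (simp add: algebra_simps)
  from arg_cong[OF this, of adj] show ?thesis using q by (simp add: isprojD)
qed

lemma pr_closed_subspace:
  assumes V: "0 \<in> V" "\<And>x y. x \<in> V \<Longrightarrow> y \<in> V \<Longrightarrow> x + y \<in> V" "\<And>c x. x \<in> V \<Longrightarrow> c *\<^sub>C x \<in> V"
    and cl: "closed V"
  shows "pr V \<odot> x = x \<longleftrightarrow> x \<in> V"
proof
  obtain p where p: "isproj p" "\<And>x. p \<odot> x = x \<longleftrightarrow> x \<in> V"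
    using projection_onto_exists[OF assms] by blast
  assume x: "pr V \<odot> x = x"
  have "p * pr V = pr V" by (rule pr_least) (auto simp: p)
  then have "p \<odot> x = x" using x by (metis bop_apply(6))
  then show "x \<in> V" by (simp add: p)
qed (rule pr_member)

text \<open>If the adjoint of b maps S into the closed span of S, then b leaves the orthogonal
  complement invariant, that is, p b p = p b. Used for a and for its adjoint, this makes the span
  reducing.\<close>

lemma pr_commute:
  assumes "\<And>x. x \<in> S \<Longrightarrow> pr S \<odot> a \<odot> x = a \<odot> x" "\<And>x. x \<in> S \<Longrightarrow> pr S \<odot> adj a \<odot> x = adj a \<odot> x"
  shows "a * pr S = pr S * a"
proof -
  let ?p = "pr S"
  have main: "?p * b * ?p = ?p * b" if b: "\<And>x. x \<in> S \<Longrightarrow> ?p \<odot> adj b \<odot> x = adj b \<odot> x" for b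
  proof (rule bop_eqI)
    fix z
    let ?w = "z - ?p \<odot> z"
    have w: "?p \<odot> ?w = 0" by simp
    have "cinner x (b \<odot> ?w) = 0" if "x \<in> S" for x
    proof -
      have "cinner x (b \<odot> ?w) = cinner (?p \<odot> adj b \<odot> x) ?w"
        using cinner_adj[of "adj b" x ?w] b[OF that] by simp
      also have "\<dots> = cinner (adj b \<odot> x) (?p \<odot> ?w)"
        using cinner_adj[of ?p "adj b \<odot> x" ?w] by (simp add: isprojD)
      finally show ?thesis by (simp only: w cinner_zero_simps)
    qed
    then have "?p \<odot> b \<odot> ?w = 0" by (intro pr_perp) (auto simp: perp_def)
    then show "(?p * b * ?p) \<odot> z = (?p * b) \<odot> z" by simp
  qed
  have 1: "?p * a * ?p = ?p * a" by (rule main) (rule assms)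
  have "?p * adj a * ?p = ?p * adj a" by (rule main) (simp add: assms)
  from arg_cong[OF this, of adj] have "?p * a * ?p = a * ?p"
    by (simp add: isprojD mult.assoc)
  with 1 show ?thesis by simp
qed

definition kproj :: "'h::chilbert_space bop \<Rightarrow> 'h bop"
  where "kproj a = pr {x. a \<odot> x = 0}"

lemma kproj_isproj [simp]: "isproj (kproj a)" by (simp add: kproj_def)

lemma kproj_fixed: "kproj a \<odot> x = x \<longleftrightarrow> a \<odot> x = 0"
proof -
  have "closed {x. a \<odot> x = 0}"
    by (intro closed_Collect_eq continuous_intros linear_continuous_on bapply_bounded_linear)
  then show ?thesis unfolding kproj_def by (subst pr_closed_subspace) auto
qed

lemma kproj_commute:
  assumes "d * a = a * d" "adj d * a = a * adj d"
  shows "d * kproj a = kproj a * d"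
  unfolding kproj_def
proof (rule pr_commute)
  fix x assume "x \<in> {x. a \<odot> x = 0}"
  then have "a \<odot> d \<odot> x = 0" "a \<odot> adj d \<odot> x = 0"
    using arg_cong[OF assms(1), of "\<lambda>b. b \<odot> x"] arg_cong[OF assms(2), of "\<lambda>b. b \<odot> x"] by auto
  then show "pr {x. a \<odot> x = 0} \<odot> d \<odot> x = d \<odot> x" "pr {x. a \<odot> x = 0} \<odot> adj d \<odot> x = adj d \<odot> x"
    by (auto intro: pr_member)
qed

definition lsupp :: "'h::chilbert_space bop \<Rightarrow> 'h bop"
  where "lsupp a = pr (range (bapply a))"

lemma lsupp_isproj [simp]: "isproj (lsupp a)" by (simp add: lsupp_def)

lemma lsupp_mult [simp]: "lsupp a * a = a"
  by (rule bop_eqI) (simp add: lsupp_def pr_member)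

lemma lsupp_least: "isproj q \<Longrightarrow> q * a = a \<Longrightarrow> q * lsupp a = lsupp a"
  unfolding lsupp_def by (rule pr_least) (auto, metis bop_apply(6))

text \<open>The kernel of the adjoint is the orthogonal complement of the range. This injectivity is
  the form in which left supports enter comparisons of traces.\<close>

lemma lsupp_adj_inj: "lsupp a \<odot> x = x \<Longrightarrow> adj a \<odot> x = 0 \<Longrightarrow> x = 0"
  using pr_perp[of x "range (bapply a)"] cinner_adj[of a _ x] by (auto simp: lsupp_def perp_def)

definition join :: "'h::chilbert_space bop set \<Rightarrow> 'h bop"
  where "join P = pr (\<Union>p\<in>P. range (bapply p))"

lemma join_isproj [simp]: "isproj (join P)" by (simp add: join_def)

lemma join_upper: "p \<in> P \<Longrightarrow> join P * p = p"
  unfolding join_def by (rule bop_eqI) (auto intro!: pr_member)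

lemma join_least: "isproj q \<Longrightarrow> (\<And>p. p \<in> P \<Longrightarrow> q * p = p) \<Longrightarrow> q * join P = join P"
  unfolding join_def by (rule pr_least) (auto, metis bop_apply(6))

lemma join_zero:
  assumes "\<And>p. p \<in> P \<Longrightarrow> isproj p" "\<And>p. p \<in> P \<Longrightarrow> p \<odot> x = 0"
  shows "join P \<odot> x = 0"
proof -
  have "cinner (p \<odot> y) x = 0" if "p \<in> P" for p y
    using cinner_adj[of p y x] assms[OF that] by (simp add: isprojD)
  then show ?thesis unfolding join_def by (intro pr_perp) (auto simp: perp_def)
qed

section \<open>Bounded operators as graphs\<close>

definition graph :: "'h::chilbert_space bop \<Rightarrow> 'h op"
  where "graph a = {(u, a \<odot> u) | u. True}"

lemma mem_graph [simp]: "(u, v) \<in> graph a \<longleftrightarrow> v = a \<odot> u"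
  by (auto simp: graph_def)

lemma graph_inject [simp]: "graph a = graph b \<longleftrightarrow> a = b"
proof
  assume "graph a = graph b"
  then have "(u, a \<odot> u) \<in> graph b" for u by (metis mem_graph)
  then show "a = b" by (auto intro: bop_eqI)
qed auto

lemma Domain_graph [simp]: "Domain (graph a) = UNIV"
  by (auto simp: graph_def)

lemma graph_eqI: "(\<And>u v. (u, v) \<in> x \<longleftrightarrow> v = a \<odot> u) \<Longrightarrow> x = graph a"
  by auto

lemma linear_op_graph: "linear_op (graph a)"
  unfolding linear_op_def by (auto simp: single_valued_def)

lemma bounded_op_iff: "bounded_op x \<longleftrightarrow> (\<exists>a. x = graph a)"
proof
  assume x: "bounded_op x"
  then obtain K where lin: "linear_op x" and dom: "Domain x = UNIV"
    and K': "\<forall>(v, w)\<in>x. norm w \<le> K * norm v"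
    unfolding bounded_op_def by blast
  have K: "norm w \<le> K * norm v" if "(v, w) \<in> x" for v w using K' that by auto
  have "\<forall>v. \<exists>w. (v, w) \<in> x" using dom by (metis Domain_iff UNIV_I)
  from choice[OF this] obtain f where f: "\<And>v. (v, f v) \<in> x" by blast
  have u: "(v, w) \<in> x \<longleftrightarrow> w = f v" for v w
    using lin f by (auto simp: linear_op_def single_valued_def)
  have "Bop f \<odot> v = f v" for v
  proof (rule Bop_apply)
    show "f (v + w) = f v + f w" for v w
      using lin by (simp add: linear_op_def u)
    show "f (c *\<^sub>C v) = c *\<^sub>C f v" for c v
      using lin by (simp add: linear_op_def u)
  qed (rule K[OF f])
  then have "x = graph (Bop f)" by (intro graph_eqI) (simp add: u)
  then show "\<exists>a. x = graph a" ..
next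
  assume "\<exists>a. x = graph a"
  then obtain a where x: "x = graph a" by blast
  obtain K where "\<forall>v. norm (a \<odot> v) \<le> K * norm v" using bapply_bounded by blast
  then have "\<forall>(v, w)\<in>x. norm w \<le> K * norm v" by (auto simp: x graph_def)
  then show "bounded_op x" using linear_op_graph[of a] unfolding bounded_op_def x by auto
qed

lemma bounded_op_graph [simp]: "bounded_op (graph a)"
  by (auto simp: bounded_op_iff)

lemma op_zero_graph: "op_zero = graph 0" by (auto simp: op_zero_def)

lemma Id_graph: "Id = graph 1" by auto

lemma op_plus_graph [simp]: "op_plus (graph a) (graph b) = graph (a + b)"
  by (auto simp: op_plus_def)

lemma op_times_graph [simp]: "op_times (graph a) (graph b) = graph (a * b)"
  by (auto simp: op_times_def relcomp_unfold)

lemma op_scale_graph [simp]: "op_scale c (graph a) = graph (c *\<^sub>C a)"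
  by (auto simp: op_scale_def)

lemma scaleC_minus_one_bop: "(- 1) *\<^sub>C (a::'h::chilbert_space bop) = - a"
  by (rule bop_eqI) (simp add: scaleC_minus_one)

lemma op_minus_graph [simp]: "op_minus (graph a) (graph b) = graph (a - b)"
  by (simp add: op_minus_def scaleC_minus_one_bop)

lemma op_apply_graph [simp]: "op_apply (graph a) u = a \<odot> u"
  by (simp add: op_apply_def)

lemma cinner_eqI: "(\<And>x. cinner x y = cinner x z) \<Longrightarrow> y = (z::'h::chilbert_space)"
  by (rule inner_eqI) (simp add: inner_eq_Re_cinner)

lemma op_adj_graph [simp]: "op_adj (graph a) = graph (adj a)"
proof (rule graph_eqI)
  fix u' v'
  have "(u', v') \<in> op_adj (graph a) \<longleftrightarrow> (\<forall>u. cinner u (adj a \<odot> u') = cinner u v')"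
    by (auto simp: op_adj_def graph_def cinner_adj)
  also have "\<dots> \<longleftrightarrow> v' = adj a \<odot> u'" by (metis cinner_eqI)
  finally show "(u', v') \<in> op_adj (graph a) \<longleftrightarrow> v' = adj a \<odot> u'" .
qed

lemma scaleC_minus_left: "(- c) *\<^sub>C (x::'h::chilbert_space) = - (c *\<^sub>C x)"
  using scaleC_scaleC[of "- 1" c x] by (simp add: scaleC_minus_one)

lemma Im_cinner: "Im (cinner x y) = inner x (\<i> *\<^sub>C (y::'h::chilbert_space))"
  by (simp add: cinner_eq_inner)

text \<open>On a complex space, a form with real values has a self-adjoint operator: expand the
  vanishing imaginary part at x + i y.\<close>

lemma positive_op_graph [simp]: "positive_op (graph a) \<longleftrightarrow> pos a"
proof
  assume "positive_op (graph a)"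
  then have im: "\<And>x. inner (a \<odot> x) (\<i> *\<^sub>C x) = 0" and re: "\<And>x. 0 \<le> inner (a \<odot> x) x"
    by (auto simp: positive_op_def graph_def Im_cinner inner_eq_Re_cinner[symmetric])
  have "inner (a \<odot> x) y = inner x (a \<odot> y)" for x y
  proof -
    have "inner (a \<odot> (x + \<i> *\<^sub>C y)) (\<i> *\<^sub>C (x + \<i> *\<^sub>C y)) = 0" by (rule im)
    then have "inner (a \<odot> x) (\<i> *\<^sub>C \<i> *\<^sub>C y) + inner (\<i> *\<^sub>C (a \<odot> y)) (\<i> *\<^sub>C x) = 0"
      using im[of x] im[of "\<i> *\<^sub>C y"]
      by (simp add: scaleC_add_right inner_add_left inner_add_right)
    then show ?thesis
      by (simp add: scaleC_scaleC scaleC_minus_one inner_scaleC_left inner_commute)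
  qed
  then show "pos a" using re by (auto simp: pos_def intro: adjI)
next
  assume a: "pos a"
  have "inner (a \<odot> x) (\<i> *\<^sub>C x) = 0" for x
  proof -
    have "inner (a \<odot> x) (\<i> *\<^sub>C x) = inner x (\<i> *\<^sub>C (a \<odot> x))"
      using inner_adj[of a x "\<i> *\<^sub>C x"] pos_selfadj[OF a] by simp
    also have "\<dots> = inner (cnj \<i> *\<^sub>C x) (a \<odot> x)" by (simp add: inner_scaleC_left)
    also have "\<dots> = - inner (a \<odot> x) (\<i> *\<^sub>C x)"
      by (simp add: scaleC_minus_left inner_commute)
    finally show ?thesis by simp
  qed
  then show "positive_op (graph a)"
    using pos_nonneg[OF a] linear_op_graph[of a]
    by (auto simp: positive_op_def graph_def Im_cinner inner_eq_Re_cinner[symmetric])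
qed

lemma op_le_graph [simp]: "op_le (graph a) (graph b) \<longleftrightarrow> pos (b - a)"
  by (simp add: op_le_def)

lemma projection_op_graph [simp]: "projection_op (graph p) \<longleftrightarrow> isproj p"
  by (simp add: projection_op_def isproj_def)

lemma projection_op_iff: "projection_op x \<longleftrightarrow> (\<exists>p. isproj p \<and> x = graph p)"
  by (metis bounded_op_iff projection_op_def projection_op_graph)

lemma unitary_op_graph [simp]: "unitary_op (graph u) \<longleftrightarrow> adj u * u = 1 \<and> u * adj u = 1"
  by (simp add: unitary_op_def Id_graph)

lemma continuous_bapply [continuous_intros]:
  "continuous_on A f \<Longrightarrow> continuous_on A (\<lambda>x. a \<odot> f x)"
  by (intro bounded_linear.continuous_on[OF bapply_bounded_linear])

lemma closed_graph: "closed (graph a)"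
proof -
  have "graph a = {p. snd p = a \<odot> fst p}" by (auto simp: graph_def)
  then show ?thesis by (simp, intro closed_Collect_eq continuous_intros)
qed

section \<open>Closed densely defined operators and their absolute values\<close>

lemma linear_op_add: "linear_op x \<Longrightarrow> (u, v) \<in> x \<Longrightarrow> (u', v') \<in> x \<Longrightarrow> (u + u', v + v') \<in> x"
  and linear_op_scaleC: "linear_op x \<Longrightarrow> (u, v) \<in> x \<Longrightarrow> (c *\<^sub>C u, c *\<^sub>C v) \<in> x"
  and linear_op_zero: "linear_op x \<Longrightarrow> (0, 0) \<in> x"
  and linear_op_unique: "linear_op x \<Longrightarrow> (u, v) \<in> x \<Longrightarrow> (u, v') \<in> x \<Longrightarrow> v = v'"
  unfolding linear_op_def single_valued_def by blast+

lemma linear_op_scaleR: "linear_op x \<Longrightarrow> (u, v) \<in> x \<Longrightarrow> (r *\<^sub>R u, r *\<^sub>R v) \<in> x"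
  by (metis linear_op_scaleC scaleC_of_real)

lemma linear_op_diff: "linear_op x \<Longrightarrow> (u, v) \<in> x \<Longrightarrow> (u', v') \<in> x \<Longrightarrow> (u - u', v - v') \<in> x"
  using linear_op_add[of x u v "- u'" "- v'"] linear_op_scaleC[of x u' v' "- 1"]
  by (simp add: scaleC_minus_one)

lemma linear_op_subspace: "linear_op x \<Longrightarrow> subspace x"
  unfolding subspace_def
  using linear_op_add linear_op_scaleR linear_op_zero by (auto simp: zero_prod_def)

text \<open>The imaginary part of the complex condition is the real condition at a multiple by i,
  which the complex linear graph also contains.\<close>

lemma op_adj_iff:
  assumes x: "linear_op x"
  shows "(u', v') \<in> op_adj x \<longleftrightarrow> (\<forall>u v. (u, v) \<in> x \<longrightarrow> inner v u' = inner u v')"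
proof
  assume "(u', v') \<in> op_adj x"
  then show "\<forall>u v. (u, v) \<in> x \<longrightarrow> inner v u' = inner u v'"
    by (auto simp: op_adj_def inner_eq_Re_cinner)
next
  assume a: "\<forall>u v. (u, v) \<in> x \<longrightarrow> inner v u' = inner u v'"
  have "cinner v u' = cinner u v'" if "(u, v) \<in> x" for u v
  proof -
    have "inner (cnj \<i> *\<^sub>C v) u' = inner (cnj \<i> *\<^sub>C u) v'"
      using a linear_op_scaleC[OF x that] by blast
    then show ?thesis using a that by (simp add: cinner_eq_inner inner_scaleC_left)
  qed
  then show "(u', v') \<in> op_adj x" by (auto simp: op_adj_def)
qed

lemma continuous_cinner_right:
  fixes f :: "'a::topological_space \<Rightarrow> 'h::chilbert_space"
  assumes "continuous_on A f" shows "continuous_on A (\<lambda>p. cinner a (f p))"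
proof -
  have "inner a (\<i> *\<^sub>C y) = inner (cnj \<i> *\<^sub>C a) y" for y :: 'h
    by (simp add: inner_scaleC_left)
  then show ?thesis unfolding cinner_eq_inner by (simp, intro continuous_intros assms)
qed

lemma closed_op_adj: "closed (op_adj x)"
proof -
  have "op_adj x = (\<Inter>p\<in>x. {q. cinner (snd p) (fst q) = cinner (fst p) (snd q)})"
    by (force simp: op_adj_def)
  then show ?thesis
    by (auto intro!: closed_INT closed_Collect_eq continuous_cinner_right continuous_intros)
qed

lemma op_adj_antimono: "x \<subseteq> y \<Longrightarrow> op_adj y \<subseteq> op_adj x"
  by (auto simp: op_adj_def)

lemma dense_orthogonal_zero:
  assumes "closure V = UNIV" "\<And>v. v \<in> V \<Longrightarrow> inner v z = 0"
  shows "z = (0::'h::real_inner)"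
proof -
  have "z \<in> closure V" using assms by simp
  then obtain f where f: "\<And>n. f n \<in> V" "f \<longlonglongrightarrow> z" by (auto simp: closure_sequential)
  have "(\<lambda>n. inner (f n) z) \<longlonglongrightarrow> inner z z" by (intro tendsto_intros f)
  then have "inner z z = 0" using assms(2)[OF f(1)] by (simp add: LIMSEQ_const_iff)
  then show ?thesis by simp
qed

lemma subspace_closure:
  fixes V :: "'a::real_normed_vector set"
  assumes V: "subspace V" shows "subspace (closure V)"
  unfolding subspace_def
proof (intro conjI ballI allI)
  show "0 \<in> closure V" using subspace_0[OF V] closure_subset by blast
next
  fix x y assume "x \<in> closure V" "y \<in> closure V"
  then obtain f g where f: "\<And>n. f n \<in> V" "f \<longlonglongrightarrow> x" and g: "\<And>n. g n \<in> V" "g \<longlonglongrightarrow> y"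
    unfolding closure_sequential by blast
  show "x + y \<in> closure V" unfolding closure_sequential
    by (intro exI[of _ "\<lambda>n. f n + g n"] conjI allI subspace_add[OF V] tendsto_add f g)
next
  fix x and c :: real assume "x \<in> closure V"
  then obtain f where f: "\<And>n. f n \<in> V" "f \<longlonglongrightarrow> x" unfolding closure_sequential by blast
  show "c *\<^sub>R x \<in> closure V" unfolding closure_sequential
    by (intro exI[of _ "\<lambda>n. c *\<^sub>R f n"] conjI allI subspace_scale[OF V] tendsto_scaleR tendsto_const f)
qed

lemma dense_if_orthogonal_zero:
  fixes V :: "'h::{real_inner,complete_space} set"
  assumes V: "subspace V" and z: "\<And>z. (\<And>v. v \<in> V \<Longrightarrow> inner v z = 0) \<Longrightarrow> z = 0"
  shows "closure V = UNIV"
proof -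
  have "x \<in> closure V" for x
  proof -
    obtain p where p: "p \<in> closure V" "\<And>y. y \<in> closure V \<Longrightarrow> inner (x - p) y = 0"
      using closed_subspace_projection[of "closure V" x] subspace_closure[OF V] by auto
    have "x - p = 0"
      by (rule z) (metis p(2) closure_subset subsetD inner_commute)
    then show ?thesis using p(1) by simp
  qed
  then show ?thesis by auto
qed

definition resolvent_of :: "'h::chilbert_space op \<Rightarrow> 'h bop \<Rightarrow> bool"
  where "resolvent_of x T \<longleftrightarrow> pos T \<and> pos (1 - T) \<and> (\<forall>z. T \<odot> z = 0 \<longrightarrow> z = 0) \<and>
    (\<forall>u v. (u, v) \<in> op_times (op_adj x) x \<longleftrightarrow> T \<odot> (u + v) = u)"

text \<open>\<open>T = (1 + x\<^sup>*x)\<inverse>\<close>: the vector \<open>T z\<close> is the first component of the projection of \<open>(z, 0)\<close>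
  onto the graph of \<open>x\<close>.\<close>

lemma resolvent_exists:
  assumes "closed_densely_defined x"
  shows "\<exists>T. resolvent_of x T"
proof -
  have lin: "linear_op x" and cl: "closed x" and dense: "closure (Domain x) = UNIV"
    using assms by (auto simp: closed_densely_defined_def)
  note adj_iff = op_adj_iff[OF lin]
  have ex: "\<exists>u h. (u, h) \<in> x \<and> (h, z - u) \<in> op_adj x" for z
  proof -
    obtain p where p: "p \<in> x" "\<And>y. y \<in> x \<Longrightarrow> inner ((z, 0) - p) y = 0"
      using closed_subspace_projection[OF linear_op_subspace[OF lin] cl] by blast
    obtain u h where "p = (u, h)" by fastforce
    with p have *: "(u, h) \<in> x" "\<And>a b. (a, b) \<in> x \<Longrightarrow> inner (z - u) a = inner h b"
      by (fastforce simp: inner_prod_def)+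
    have "(h, z - u) \<in> op_adj x" unfolding adj_iff using *(2) by (metis inner_commute)
    with * show ?thesis by blast
  qed
  have adj_diff: "(a - a', b - b') \<in> op_adj x" if "(a, b) \<in> op_adj x" "(a', b') \<in> op_adj x" for a a' b b'
    using that unfolding adj_iff by (simp add: inner_diff_right)
  \<comment> \<open>For the difference of two solutions the adjoint relation gives |h - h'|^2 = - |u
    - u'|^2, so both sides vanish.\<close>
  have uniq: "u = u' \<and> h = h'"
    if "(u, h) \<in> x" "(h, z - u) \<in> op_adj x" "(u', h') \<in> x" "(h', z - u') \<in> op_adj x" for z u h u' h'
  proof -
    have "(u - u', h - h') \<in> x" by (intro linear_op_diff lin that)
    moreover have "(h - h', (z - u) - (z - u')) \<in> op_adj x" by (intro adj_diff that)
    ultimately have "inner (h - h') (h - h') = inner (u - u') ((z - u) - (z - u'))"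
      unfolding adj_iff by blast
    also have "\<dots> = - inner (u - u') (u - u')" by (simp add: algebra_simps)
    finally have "(norm (h - h'))^2 + (norm (u - u'))^2 = 0" by (simp add: power2_norm_eq_inner)
    then show ?thesis by (simp add: sum_power2_eq_zero_iff)
  qed
  obtain f g where fg: "\<And>z. (f z, g z) \<in> x" "\<And>z. (g z, z - f z) \<in> op_adj x"
    using ex by metis
  have f_eq: "f z = u" "g z = h" if "(u, h) \<in> x" "(h, z - u) \<in> op_adj x" for z u h
    using uniq[OF fg that] by auto
  have form: "inner (f z) w = inner (f z) (f w) + inner (g z) (g w)" for z w
    using fg(1)[of z] fg(2)[of w] unfolding adj_iff by (auto simp: inner_diff_right)
  have add: "f (z + w) = f z + f w" for z w
  proof (rule f_eq)
    show "(f z + f w, g z + g w) \<in> x" by (intro linear_op_add lin fg)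
    show "(g z + g w, z + w - (f z + f w)) \<in> op_adj x"
      using fg(2)[of z] fg(2)[of w] unfolding adj_iff by (auto simp: inner_add_right inner_diff_right)
  qed
  have sc: "f (c *\<^sub>C z) = c *\<^sub>C f z" for c z
  proof (rule f_eq)
    show "(c *\<^sub>C f z, c *\<^sub>C g z) \<in> x" by (intro linear_op_scaleC lin fg)
    have "cinner b (c *\<^sub>C g z) = cinner a (c *\<^sub>C (z - f z))" if "(a, b) \<in> x" for a b
      using fg(2)[of z] that by (auto simp: op_adj_def cinner_scaleC_right)
    then show "(c *\<^sub>C g z, c *\<^sub>C z - c *\<^sub>C f z) \<in> op_adj x"
      by (auto simp: op_adj_def scaleC_diff_right)
  qed
  have bound: "norm (f z) \<le> 1 * norm z" for z
  proof -
    have "(norm (f z))^2 \<le> inner (f z) z" using form[of z z] by (simp add: power2_norm_eq_inner)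
    also have "\<dots> \<le> norm (f z) * norm z" by (rule norm_cauchy_schwarz)
    finally show ?thesis by (cases "norm (f z) = 0") (auto simp: power2_eq_square)
  qed
  define T where "T = Bop f"
  have T: "T \<odot> z = f z" for z unfolding T_def by (rule Bop_apply[OF add sc bound])
  have sa: "adj T = T"
  proof (rule adjI)
    fix z w show "inner (T \<odot> z) w = inner z (T \<odot> w)"
      using form[of z w] form[of w z] by (simp add: T inner_commute)
  qed
  have "pos T"
  proof -
    have "0 \<le> inner (f z) z" for z using form[of z z] by simp
    then show ?thesis by (simp add: pos_def sa T)
  qed
  moreover have "pos (1 - T)"
    by (rule pos_one_minus[OF sa]) (use bound in \<open>auto simp: nbound_def T\<close>)
  \<comment> \<open>T z = 0 places (0, z) in the adjoint, which says that z is orthogonal to the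
    dense domain.\<close>
  moreover have "z = 0" if "T \<odot> z = 0" for z
  proof -
    have "f z = 0" using that by (simp add: T)
    moreover from this have "g z = 0" using fg(1)[of z] linear_op_unique[OF lin] linear_op_zero[OF lin] by metis
    ultimately have "(0, z) \<in> op_adj x" using fg(2)[of z] by simp
    then have "\<And>v. v \<in> Domain x \<Longrightarrow> inner v z = 0" unfolding adj_iff by auto
    then show ?thesis by (rule dense_orthogonal_zero[OF dense])
  qed
  moreover have "(u, k) \<in> op_times (op_adj x) x \<longleftrightarrow> T \<odot> (u + k) = u" for u k
  proof
    assume "(u, k) \<in> op_times (op_adj x) x"
    then obtain h where "(u, h) \<in> x" "(h, k) \<in> op_adj x" by (auto simp: op_times_def)
    then show "T \<odot> (u + k) = u" using f_eq(1)[of u h "u + k"] by (simp add: T del: bapply_add)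
  next
    assume a: "T \<odot> (u + k) = u"
    have "(u, g (u + k)) \<in> x" "(g (u + k), k) \<in> op_adj x"
      using fg[of "u + k"] a by (auto simp: T simp del: bapply_add)
    then show "(u, k) \<in> op_times (op_adj x) x" by (auto simp: op_times_def)
  qed
  ultimately show ?thesis unfolding resolvent_of_def by blast
qed

text \<open>\<open>|x| = S C\<inverse>\<close> for \<open>C = \<surd>T\<close> and \<open>S = \<surd>(1 - T)\<close>; since \<open>C\<^sup>2 + S\<^sup>2 = 1\<close>, the map
  \<open>z \<mapsto> (C z, S z)\<close> parametrizes its graph isometrically.\<close>

definition root_graph :: "'h::chilbert_space bop \<Rightarrow> 'h op"
  where "root_graph T = {(bsqrt T \<odot> z, bsqrt (1 - T) \<odot> z) | z. True}"

locale injective_contraction =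
  fixes T :: "'h::chilbert_space bop"
  assumes T_pos: "pos T" and T_le_one: "pos (1 - T)" and T_inj: "T \<odot> z = 0 \<Longrightarrow> z = 0"
begin

abbreviation "C \<equiv> bsqrt T"
abbreviation "S \<equiv> bsqrt (1 - T)"

lemma T_le_one': "pos (1 - (1 - T))" using T_pos by simp

lemmas C_pos = bsqrt_pos[OF T_pos T_le_one]
  and C_nbound = bsqrt_nbound[OF T_pos T_le_one]
  and CC = bsqrt_square[OF T_pos T_le_one]
  and C_commute = bsqrt_commute[OF T_pos T_le_one]
  and S_pos = bsqrt_pos[OF T_le_one T_le_one']
  and S_nbound = bsqrt_nbound[OF T_le_one T_le_one']
  and SS = bsqrt_square[OF T_le_one T_le_one']

lemma S_commute: "d * T = T * d \<Longrightarrow> d * S = S * d"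
  by (rule bsqrt_commute[OF T_le_one T_le_one']) (simp add: right_diff_distrib left_diff_distrib)

lemma SC: "S * C = C * S"
  by (rule C_commute, rule S_commute[of T, symmetric]) simp

lemma CC_apply: "C \<odot> C \<odot> z = T \<odot> z" using arg_cong[OF CC, of "\<lambda>a. a \<odot> z"] by simp
lemma SS_apply: "S \<odot> S \<odot> z = z - T \<odot> z" using arg_cong[OF SS, of "\<lambda>a. a \<odot> z"] by simp
lemma SC_apply: "S \<odot> C \<odot> z = C \<odot> S \<odot> z" using arg_cong[OF SC, of "\<lambda>a. a \<odot> z"] by simp

lemma ST_apply: "S \<odot> T \<odot> z = T \<odot> S \<odot> z"
  using arg_cong[OF S_commute[of T], of "\<lambda>a. a \<odot> z"] by simp

lemma CT_apply: "C \<odot> T \<odot> z = T \<odot> C \<odot> z"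
  using arg_cong[OF C_commute[of T], of "\<lambda>a. a \<odot> z"] by simp

lemma C_inner: "inner (C \<odot> z) w = inner z (C \<odot> w)" using inner_adj[of C] pos_selfadj[OF C_pos] by simp
lemma S_inner: "inner (S \<odot> z) w = inner z (S \<odot> w)" using inner_adj[of S] pos_selfadj[OF S_pos] by simp

lemma C_inj: "C \<odot> z = 0 \<Longrightarrow> z = 0"
  using T_inj CC_apply[of z] by simp

lemma mem_root_graph: "(u, v) \<in> root_graph T \<longleftrightarrow> S \<odot> u = C \<odot> v"
proof
  assume "(u, v) \<in> root_graph T"
  then show "S \<odot> u = C \<odot> v" by (auto simp: root_graph_def SC_apply)
next
  assume a: "S \<odot> u = C \<odot> v"
  \<comment> \<open>As C^2 + S^2 = 1, the parameter of a point (C z, S z) is recovered as C u + S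
    v.\<close>
  define z where "z = C \<odot> u + S \<odot> v"
  have "C \<odot> z = u" unfolding z_def by (simp add: CC_apply SC_apply[symmetric] a[symmetric] SS_apply)
  moreover have "S \<odot> z = v" unfolding z_def by (simp add: SS_apply SC_apply a CC_apply)
  ultimately show "(u, v) \<in> root_graph T" unfolding root_graph_def by blast
qed

lemma root_graph_linear: "linear_op (root_graph T)"
proof -
  have "u = u'" if "C \<odot> u = C \<odot> u'" for u u'
    using C_inj[of "u - u'"] that by simp
  then show ?thesis
    unfolding linear_op_def single_valued_def mem_root_graph by auto
qed

lemma root_graph_closed: "closed (root_graph T)"
proof -
  have "root_graph T = {p. S \<odot> fst p = C \<odot> snd p}" using mem_root_graph by auto
  then show ?thesis by (simp, intro closed_Collect_eq continuous_intros)
qed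

lemma range_C_dense: "closure (range (bapply C)) = UNIV"
proof (rule dense_if_orthogonal_zero)
  show "subspace (range (bapply C))"
    by (intro linear_subspace_image bounded_linear.linear bapply_bounded_linear subspace_UNIV)
  fix z assume "\<And>v. v \<in> range (bapply C) \<Longrightarrow> inner v z = 0"
  then have "inner (C \<odot> C \<odot> z) z = 0" by blast
  then have "inner (C \<odot> z) (C \<odot> z) = 0" by (simp only: C_inner)
  then show "z = 0" using C_inj by simp
qed

lemma root_graph_dense: "closure (Domain (root_graph T)) = UNIV"
proof -
  have "range (bapply C) = Domain (root_graph T)" by (auto simp: root_graph_def)
  then show ?thesis using range_C_dense by simp
qed

lemma root_graph_adj: "op_adj (root_graph T) = root_graph T"
proof -
  have "(u', v') \<in> op_adj (root_graph T) \<longleftrightarrow> S \<odot> u' = C \<odot> v'" for u' v'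
  proof -
    have "(u', v') \<in> op_adj (root_graph T) \<longleftrightarrow> (\<forall>z. inner z (S \<odot> u') = inner z (C \<odot> v'))"
    proof -
      have "(u', v') \<in> op_adj (root_graph T) \<longleftrightarrow> (\<forall>z. inner (S \<odot> z) u' = inner (C \<odot> z) v')"
        unfolding op_adj_iff[OF root_graph_linear] by (unfold root_graph_def) blast
      then show ?thesis by (simp add: C_inner S_inner)
    qed
    then show ?thesis using inner_eqI by metis
  qed
  then show ?thesis using mem_root_graph by auto
qed

lemma CS_pos: "pos (C * S)"
  by (rule pos_mult_commute[OF C_pos pos_one_minus[OF pos_selfadj[OF C_pos] C_nbound] S_pos SC[symmetric]])

lemma root_graph_positive: "positive_op (root_graph T)"
proof -
  have "Im (cinner (S \<odot> z) (C \<odot> z)) = 0 \<and> 0 \<le> Re (cinner (S \<odot> z) (C \<odot> z))" for z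
  proof -
    have "cinner (S \<odot> z) (C \<odot> z) = cinner ((C * S) \<odot> z) z"
      using cinner_adj[of C "S \<odot> z" z] pos_selfadj[OF C_pos] by simp
    moreover have "positive_op (graph (C * S))" using CS_pos by simp
    ultimately show ?thesis by (simp add: positive_op_def graph_def del: positive_op_graph)
  qed
  then show ?thesis using root_graph_linear by (auto simp: positive_op_def root_graph_def)
qed

lemma root_graph_square: "(u, v) \<in> op_times (root_graph T) (root_graph T) \<longleftrightarrow> T \<odot> (u + v) = u"
proof
  assume "(u, v) \<in> op_times (root_graph T) (root_graph T)"
  then obtain \<eta> where e: "S \<odot> u = C \<odot> \<eta>" "S \<odot> \<eta> = C \<odot> v"
    by (auto simp: op_times_def mem_root_graph)
  have "u - T \<odot> u = T \<odot> v"
    by (metis SS_apply CC_apply SC_apply e)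
  then show "T \<odot> (u + v) = u" by (simp add: algebra_simps)
next
  assume "T \<odot> (u + v) = u"
  then have e: "C \<odot> C \<odot> v = S \<odot> S \<odot> u" by (simp add: CC_apply SS_apply algebra_simps)
  \<comment> \<open>The only possible intermediate vector: C \<eta> = S u and S \<eta> = C v force
    \<eta> = C C \<eta> + S S \<eta> = C S u + S C v.\<close>
  define \<eta> where "\<eta> = C \<odot> S \<odot> u + S \<odot> C \<odot> v"
  have "C \<odot> \<eta> = S \<odot> u"
  proof -
    have "C \<odot> S \<odot> C \<odot> v = S \<odot> (C \<odot> C \<odot> v)" by (simp only: SC_apply)
    then have "C \<odot> S \<odot> C \<odot> v = S \<odot> S \<odot> S \<odot> u" by (simp only: e)
    then show ?thesis by (simp add: \<eta>_def CC_apply SS_apply ST_apply CT_apply)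
  qed
  moreover have "S \<odot> \<eta> = C \<odot> v"
  proof -
    have "S \<odot> C \<odot> S \<odot> u = C \<odot> (S \<odot> S \<odot> u)" by (simp only: SC_apply)
    then have "S \<odot> C \<odot> S \<odot> u = C \<odot> C \<odot> C \<odot> v" by (simp only: e)
    then show ?thesis by (simp add: \<eta>_def CC_apply SS_apply ST_apply CT_apply)
  qed
  ultimately show "(u, v) \<in> op_times (root_graph T) (root_graph T)"
    unfolding op_times_def by (intro relcompI[of _ \<eta>]) (auto simp: mem_root_graph)
qed

lemma self_adjoint_root_graph: "self_adjoint_op (root_graph T)"
  unfolding self_adjoint_op_def using root_graph_linear root_graph_dense root_graph_adj by simp

text \<open>The operator A = k T is bounded and positive, and A^2 = T (1 - T) = (C S)^2. Uniqueness
  of bounded positive roots gives A = C S, so k agrees with \<open>root_graph T\<close> on the range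
  of T; closedness extends this to an inclusion of graphs.\<close>

lemma root_graph_unique:
  assumes k: "self_adjoint_op k" "positive_op k"
    and sq: "\<And>u y. (u, y) \<in> op_times k k \<longleftrightarrow> T \<odot> (u + y) = u"
  shows "k = root_graph T"
proof -
  have lin: "linear_op k" and kk: "op_adj k = k" using k by (auto simp: self_adjoint_op_def)
  have cl: "closed k" using closed_op_adj[of k] kk by simp
  have sym: "inner v u' = inner u v'" if "(u, v) \<in> k" "(u', v') \<in> k" for u v u' v'
    using op_adj_iff[OF lin, of u' v'] that kk by auto
  have nonneg: "0 \<le> inner v u" if "(u, v) \<in> k" for u v
    using k(2) that by (auto simp: positive_op_def inner_eq_Re_cinner)
  have "\<exists>w. (T \<odot> z, w) \<in> k \<and> (w, z - T \<odot> z) \<in> k" for z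
    using sq[of "T \<odot> z" "z - T \<odot> z"] by (auto simp: op_times_def)
  then obtain f where f: "\<And>z. (T \<odot> z, f z) \<in> k" "\<And>z. (f z, z - T \<odot> z) \<in> k" by metis
  have f_eq: "f z = w" if "(T \<odot> z, w) \<in> k" for z w using linear_op_unique[OF lin f(1) that] .
  have add: "f (z + w) = f z + f w" for z w
    by (rule f_eq) (use linear_op_add[OF lin f(1) f(1)] in simp)
  have sc: "f (c *\<^sub>C z) = c *\<^sub>C f z" for c z
    by (rule f_eq) (use linear_op_scaleC[OF lin f(1)] in simp)
  have bound: "norm (f z) \<le> 1 * norm z" for z
  proof -
    have "(norm (f z))^2 = inner (T \<odot> z) (z - T \<odot> z)"
      using sym[OF f(1) f(2), of z z] by (simp add: power2_norm_eq_inner)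
    also have "\<dots> \<le> inner (T \<odot> z) z" by (simp add: inner_diff_right)
    also have "\<dots> \<le> (norm z)^2"
      using inner_le_nbound[OF pos_one_minus_nbound[OF T_pos T_le_one], of z] by simp
    finally show ?thesis using power2_le_imp_le[of "norm (f z)" "norm z"] by simp
  qed
  define A where "A = Bop f"
  have A: "A \<odot> z = f z" for z unfolding A_def by (rule Bop_apply[OF add sc bound])
  have "adj A = A"
  proof (rule adjI)
    fix z w
    have "inner (f z) w = inner (f z) (T \<odot> w) + inner (f z) (w - T \<odot> w)" by (simp add: inner_diff_right)
    also have "\<dots> = inner (T \<odot> z) (f w) + inner (z - T \<odot> z) (f w)"
      using sym[OF f(1) f(1)] sym[OF f(2) f(2)] by metis
    finally show "inner (A \<odot> z) w = inner z (A \<odot> w)" by (simp add: A inner_diff_left)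
  qed
  moreover have "0 \<le> inner (A \<odot> z) z" for z
  proof -
    have "inner (f z) z = inner (f z) (T \<odot> z) + inner (z - T \<odot> z) (f z)"
      by (simp only: inner_commute[of "z - _"]) (simp add: inner_diff_right)
    then show ?thesis using nonneg[OF f(1)] nonneg[OF f(2)] by (simp add: A)
  qed
  ultimately have Apos: "pos A" by (simp add: pos_def)
  have com: "f u = T \<odot> v" if "(u, v) \<in> k" for u v
  proof -
    have "(u - T \<odot> u, v - f u) \<in> k" by (intro linear_op_diff lin that f)
    then have "(f u, v - f u) \<in> op_times k k" using f(2)[of u] by (auto simp: op_times_def)
    then show ?thesis unfolding sq by simp
  qed
  have AA: "A * A = T * (1 - T)"
    by (rule bop_eqI) (simp add: A com[OF f(2)])
  have CSCS: "(C * S) * (C * S) = T * (1 - T)"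
  proof -
    have "(C * S) * (C * S) = C * (S * C) * S" by (simp only: mult.assoc)
    also have "\<dots> = (C * C) * (S * S)" by (simp only: SC mult.assoc)
    finally show ?thesis by (simp only: CC SS)
  qed
  have p: "pos (1 - T * (1 - T))"
  proof (rule pos_one_minus)
    show "adj (T * (1 - T)) = T * (1 - T)" by (simp add: pos_selfadj[OF T_pos] algebra_simps)
    show "nbound (T * (1 - T)) 1"
      using nbound_mult[OF pos_one_minus_nbound[OF T_pos T_le_one] pos_one_minus_nbound[OF T_le_one T_le_one']] by simp
  qed
  have AeqCS: "A = C * S"
    using bsqrt_unique[OF Apos] bsqrt_unique[OF CS_pos] p by (simp add: AA CSCS)
  have on_range: "(C \<odot> C \<odot> z, S \<odot> C \<odot> z) \<in> k" for z
    using f(1)[of z] A[of z] by (simp add: AeqCS CC_apply SC_apply)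
  have sub: "root_graph T \<subseteq> k"
  proof
    fix p assume "p \<in> root_graph T"
    then obtain z where p: "p = (C \<odot> z, S \<odot> z)" by (auto simp: root_graph_def)
    have "z \<in> closure (range (bapply C))" using range_C_dense by simp
    then obtain w where w: "\<And>n. w n \<in> range (bapply C)" "w \<longlonglongrightarrow> z" by (auto simp: closure_sequential)
    have "(C \<odot> w n, S \<odot> w n) \<in> k" for n using w(1)[of n] on_range by auto
    moreover have "(\<lambda>n. (C \<odot> w n, S \<odot> w n)) \<longlonglongrightarrow> p"
      unfolding p by (intro tendsto_Pair bapply_tendsto w)
    ultimately show "p \<in> k" by (rule closed_sequentially[OF cl])
  qed
  \<comment> \<open>Adjoints reverse inclusions, and both operators are self-adjoint.\<close>
  have "k \<subseteq> root_graph T" using op_adj_antimono[OF sub] kk root_graph_adj by simp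
  with sub show ?thesis by blast
qed

lemma root_graph_cdd: "closed_densely_defined (root_graph T)"
  unfolding closed_densely_defined_def using root_graph_linear root_graph_closed root_graph_dense by simp

lemma root_graph_resolvent: "resolvent_of (root_graph T) T"
  unfolding resolvent_of_def root_graph_adj root_graph_square using T_pos T_le_one T_inj by blast

end

lemma resolvent_injective_contraction: "resolvent_of x T \<Longrightarrow> injective_contraction T"
  by unfold_locales (auto simp: resolvent_of_def)

lemma op_abs_eq:
  assumes "resolvent_of x T"
  shows "op_abs x = root_graph T"
proof -
  interpret injective_contraction T by (rule resolvent_injective_contraction[OF assms])
  have sq: "(u, v) \<in> op_times (op_adj x) x \<longleftrightarrow> T \<odot> (u + v) = u" for u v
    using assms by (simp add: resolvent_of_def)
  have eq: "op_times (root_graph T) (root_graph T) = op_times (op_adj x) x"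
    using sq root_graph_square by auto
  show ?thesis unfolding op_abs_def
  proof (rule the_equality)
    fix h assume h: "self_adjoint_op h \<and> positive_op h \<and> op_times h h = op_times (op_adj x) x"
    then show "h = root_graph T" by (intro root_graph_unique) (auto simp: sq)
  qed (use self_adjoint_root_graph root_graph_positive eq in blast)
qed

text \<open>The range of \<open>T\<close> is a core for \<open>x\<close>, on which \<open>\<parallel>x\<xi>\<parallel>\<close> is determined by \<open>T\<close>; hence \<open>x\<close> and
  \<open>|x|\<close> have the same domain and norms.\<close>

lemma resolvent_core:
  assumes x: "closed_densely_defined x" and T: "resolvent_of x T" and m: "(u, h) \<in> x"
  shows "\<exists>z w. (\<forall>n. (T \<odot> z n, w n) \<in> x) \<and> (\<lambda>n. T \<odot> z n) \<longlonglongrightarrow> u \<and> w \<longlonglongrightarrow> h"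
proof -
  have lin: "linear_op x" and cl: "closed x" using x by (auto simp: closed_densely_defined_def)
  define G where "G = {p \<in> x. \<exists>z. fst p = T \<odot> z}"
  have sub: "subspace G"
  proof -
    have "(0, 0) \<in> G" using linear_op_zero[OF lin] by (auto simp: G_def intro: exI[of _ 0])
    moreover have "(a + a', b + b') \<in> G" if "(a, b) \<in> G" "(a', b') \<in> G" for a b a' b'
    proof -
      from that obtain z z' where z: "a = T \<odot> z" "a' = T \<odot> z'" "(a, b) \<in> x" "(a', b') \<in> x"
        by (auto simp: G_def)
      then have "a + a' = T \<odot> (z + z')" by simp
      then have "\<exists>z. a + a' = T \<odot> z" ..
      then show ?thesis using linear_op_add[OF lin z(3,4)] by (simp add: G_def)
    qed
    moreover have "(r *\<^sub>R a, r *\<^sub>R b) \<in> G" if "(a, b) \<in> G" for a b r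
    proof -
      from that obtain z where z: "a = T \<odot> z" "(a, b) \<in> x" by (auto simp: G_def)
      then have "r *\<^sub>R a = T \<odot> (r *\<^sub>R z)" by simp
      then have "\<exists>z. r *\<^sub>R a = T \<odot> z" ..
      then show ?thesis using linear_op_scaleR[OF lin z(2)] by (simp add: G_def)
    qed
    ultimately show ?thesis by (auto simp: subspace_def zero_prod_def)
  qed
  have Gx: "closure G \<subseteq> x" by (rule closure_minimal[OF _ cl]) (auto simp: G_def)
  obtain p where p: "p \<in> closure G" "\<And>y. y \<in> closure G \<Longrightarrow> inner ((u, h) - p) y = 0"
    using closed_subspace_projection[of "closure G" "(u, h)"] subspace_closure[OF sub] by auto
  obtain a b where ab: "(u, h) - p = (a, b)" by fastforce
  have abx: "(a, b) \<in> x" using linear_op_diff[OF lin m, of "fst p" "snd p"] p(1) Gx ab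
    by (cases p) auto
  \<comment> \<open>Orthogonality of (a, b) to (T z, x T z) reads (a | T z) + (a | x* x T z) = 0,
    and T z + x* x T z = z.\<close>
  have "inner z a = 0" for z
  proof -
    have "(T \<odot> z, z - T \<odot> z) \<in> op_times (op_adj x) x" using T by (simp add: resolvent_of_def)
    then obtain w where w: "(T \<odot> z, w) \<in> x" "(w, z - T \<odot> z) \<in> op_adj x" by (auto simp: op_times_def)
    then have "(T \<odot> z, w) \<in> G" by (auto simp: G_def)
    then have "(T \<odot> z, w) \<in> closure G" using closure_subset by blast
    then have "inner a (T \<odot> z) + inner b w = 0" using p(2)[of "(T \<odot> z, w)"] ab by (simp add: inner_prod_def)
    moreover have "inner b w = inner a (z - T \<odot> z)" using w(2) abx op_adj_iff[OF lin] by blast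
    ultimately show ?thesis by (simp add: inner_diff_right inner_commute)
  qed
  then have "a = 0" using inner_eq_zero_iff by blast
  moreover from this have "b = 0" using abx linear_op_unique[OF lin] linear_op_zero[OF lin] by blast
  ultimately have "(u, h) \<in> closure G" using ab p(1) by (metis eq_iff_diff_eq_0 zero_prod_def)
  then obtain v where v: "\<And>n. v n \<in> G" "v \<longlonglongrightarrow> (u, h)" by (auto simp: closure_sequential)
  have "\<forall>n. \<exists>z. fst (v n) = T \<odot> z" using v(1) by (simp add: G_def)
  from choice[OF this] obtain z where z: "\<And>n. fst (v n) = T \<odot> z n" by blast
  have vx: "v n \<in> x" for n using v(1)[of n] by (simp add: G_def)
  show ?thesis
  proof (intro exI conjI allI)
    show "(T \<odot> z n, snd (v n)) \<in> x" for n using vx[of n] by (simp flip: z)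
    show "(\<lambda>n. T \<odot> z n) \<longlonglongrightarrow> u" using tendsto_fst[OF v(2)] z by simp
    show "(\<lambda>n. snd (v n)) \<longlonglongrightarrow> h" using tendsto_snd[OF v(2)] by simp
  qed
qed

lemma resolvent_norm:
  assumes "linear_op x" "resolvent_of x T" "(T \<odot> z, w) \<in> x"
  shows "(norm w)^2 = inner (T \<odot> z) (z - T \<odot> z)"
proof -
  have "(T \<odot> z, z - T \<odot> z) \<in> op_times (op_adj x) x" using assms by (simp add: resolvent_of_def)
  then obtain w' where w: "(T \<odot> z, w') \<in> x" "(w', z - T \<odot> z) \<in> op_adj x" by (auto simp: op_times_def)
  then have "w' = w" using assms linear_op_unique by blast
  then show ?thesis using w assms(1) op_adj_iff[OF assms(1)] by (auto simp: power2_norm_eq_inner)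
qed

lemma resolvent_domain: "resolvent_of x T \<Longrightarrow> \<exists>w. (T \<odot> z, w) \<in> x"
proof -
  assume "resolvent_of x T"
  then have "(T \<odot> z, z - T \<odot> z) \<in> op_times (op_adj x) x" by (simp add: resolvent_of_def)
  then show ?thesis by (auto simp: op_times_def)
qed

lemma same_resolvent:
  assumes x: "closed_densely_defined x" "resolvent_of x T"
    and k: "closed_densely_defined k" "resolvent_of k T" and m: "(u, y) \<in> x"
  shows "\<exists>y'. (u, y') \<in> k \<and> norm y' = norm y"
proof -
  have lx: "linear_op x" and lk: "linear_op k" and ck: "closed k"
    using x k by (auto simp: closed_densely_defined_def)
  obtain z w where z: "\<And>n. (T \<odot> z n, w n) \<in> x" "(\<lambda>n. T \<odot> z n) \<longlonglongrightarrow> u" "w \<longlonglongrightarrow> y"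
    using resolvent_core[OF x m] by blast
  have "\<forall>n. \<exists>w. (T \<odot> z n, w) \<in> k" using resolvent_domain[OF k(2)] by blast
  from choice[OF this] obtain v where v: "\<And>n. (T \<odot> z n, v n) \<in> k" by blast
  have d: "norm (v n - v m) = norm (w n - w m)" for n m
  proof -
    have "(T \<odot> (z n - z m), w n - w m) \<in> x" "(T \<odot> (z n - z m), v n - v m) \<in> k"
      using linear_op_diff[OF lx z(1) z(1)] linear_op_diff[OF lk v v] by auto
    then have "(norm (v n - v m))^2 = (norm (w n - w m))^2"
      using resolvent_norm[OF lx x(2)] resolvent_norm[OF lk k(2)] by metis
    then show ?thesis by (simp add: power2_eq_iff_nonneg)
  qed
  have "Cauchy w" using z(3) LIMSEQ_imp_Cauchy by blast
  then have "Cauchy v" unfolding Cauchy_def by (simp add: dist_norm d)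
  then obtain y' where e: "v \<longlonglongrightarrow> y'" using Cauchy_convergent convergent_def by blast
  have "(u, y') \<in> k"
    by (rule closed_sequentially[OF ck v tendsto_Pair[OF z(2) e]])
  moreover have "norm (v n) = norm (w n)" for n
  proof -
    have "(norm (v n))^2 = (norm (w n))^2"
      using resolvent_norm[OF lx x(2) z(1)] resolvent_norm[OF lk k(2) v] by simp
    then show ?thesis by (simp add: power2_eq_iff_nonneg)
  qed
  then have "norm y' = norm y"
    using LIMSEQ_unique[OF tendsto_norm[OF e]] tendsto_norm[OF z(3)] by simp
  ultimately show ?thesis by blast
qed

section \<open>The spectral measure of the absolute value\<close>

lemma proj_chain:
  assumes "\<And>n. p (Suc n) * p n = p n" "\<And>n. isproj (p n)" "n \<le> m"
  shows "p m * p n = p n"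
  using assms(3)
proof (induction m rule: dec_induct)
  case base then show ?case using assms(2) by (simp add: isprojD)
next
  case (step k)
  have "p (Suc k) * p n = p (Suc k) * (p k * p n)" by (simp only: step)
  also have "\<dots> = p k * p n" by (simp only: mult.assoc[symmetric] assms(1))
  finally show ?case by (simp only: step)
qed

text \<open>The strong limit b exists by monotonicity. From p_n b = p_n it follows that b is
  idempotent, and comparison in both directions identifies it with the join.\<close>

lemma proj_increasing_limit:
  assumes p: "\<And>n. isproj (p n)" and inc: "\<And>n. p (Suc n) * p n = p n"
  shows "(\<lambda>n. p n \<odot> x) \<longlonglongrightarrow> join (range p) \<odot> x"
proof -
  note ch = proj_chain[of p, OF inc p]
  have ch': "p n * p m = p n" if "n \<le> m" for n m
    by (rule isproj_adj_le[OF p p ch[OF that]])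
  obtain b where b: "pos b" "\<And>x. (\<lambda>n. p n \<odot> x) \<longlonglongrightarrow> b \<odot> x"
    using pos_mono_convergent[of p 1] isproj_pos[OF p] isproj_nbound[OF p]
      isproj_pos[OF isproj_diff[OF p p inc]] by blast
  have pb: "p n \<odot> b \<odot> x = p n \<odot> x" for n x
  proof (rule LIMSEQ_unique)
    show "(\<lambda>m. p n \<odot> p m \<odot> x) \<longlonglongrightarrow> p n \<odot> b \<odot> x" by (rule bapply_tendsto[OF b(2)])
    have "p n \<odot> p m \<odot> x = p n \<odot> x" if "n \<le> m" for m
      using arg_cong[OF ch'[OF that], of "\<lambda>a. a \<odot> x"] by simp
    then have "\<forall>\<^sub>F m in sequentially. p n \<odot> x = p n \<odot> p m \<odot> x"
      by (auto simp: eventually_sequentially intro!: exI[of _ n])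
    then show "(\<lambda>m. p n \<odot> p m \<odot> x) \<longlonglongrightarrow> p n \<odot> x" by (rule tendsto_eventually[OF eventually_mono]) simp
  qed
  have bp: "b \<odot> p n \<odot> x = p n \<odot> x" for n x
  proof (rule LIMSEQ_unique[OF b(2)])
    have "p m \<odot> p n \<odot> x = p n \<odot> x" if "n \<le> m" for m
      using arg_cong[OF ch[OF that], of "\<lambda>a. a \<odot> x"] by simp
    then have "\<forall>\<^sub>F m in sequentially. p m \<odot> p n \<odot> x = p n \<odot> x"
      by (auto simp: eventually_sequentially intro!: exI[of _ n])
    then show "(\<lambda>m. p m \<odot> p n \<odot> x) \<longlonglongrightarrow> p n \<odot> x" by (rule tendsto_eventually)
  qed
  have "b \<odot> b \<odot> x = b \<odot> x" for x
  proof (rule LIMSEQ_unique)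
    show "(\<lambda>n. p n \<odot> b \<odot> x) \<longlonglongrightarrow> b \<odot> b \<odot> x" by (rule b)
    show "(\<lambda>n. p n \<odot> b \<odot> x) \<longlonglongrightarrow> b \<odot> x" unfolding pb by (rule b)
  qed
  then have "b * b = b" by (intro bop_eqI) simp
  then have "isproj b" using pos_selfadj[OF b(1)] by (simp add: isproj_def)
  moreover have "join (range p) * b = b"
  proof (rule bop_eqI)
    fix x
    have "(\<lambda>n. join (range p) \<odot> p n \<odot> x) \<longlonglongrightarrow> join (range p) \<odot> b \<odot> x" by (rule bapply_tendsto[OF b(2)])
    moreover have "join (range p) \<odot> p n \<odot> x = p n \<odot> x" for n
      using arg_cong[OF join_upper[of "p n" "range p"], of "\<lambda>a. a \<odot> x"] by simp
    ultimately show "(join (range p) * b) \<odot> x = b \<odot> x"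
      by (simp, intro LIMSEQ_unique[OF _ b(2)[of x]])
  qed
  moreover have "b * join (range p) = join (range p)"
  proof (rule join_least[OF \<open>isproj b\<close>])
    fix q assume "q \<in> range p"
    then show "b * q = q" by (auto intro!: bop_eqI simp: bp)
  qed
  ultimately have "b = join (range p)"
    using isproj_adj_le[of b "join (range p)"] by simp
  then show ?thesis using b by simp
qed

text \<open>With R the square root of A^2, Q projects onto the kernel of R - A, the spectral
  subspace of A for [0, \<infinity>). Since (R - A)(R + A) = 0, the range of R + A lies under Q; so
  R + A kills the complement, where A acts as -R. The sign there is strict because the kernel of A
  lies under Q.\<close>

lemma spectral_split:
  assumes A: "adj A = A" "nbound A 1"
  shows "\<exists>Q. isproj Q \<and> (\<forall>d. d * A = A * d \<and> adj d * A = A * adj d \<longrightarrow> d * Q = Q * d) \<and>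
    (\<forall>u. Q \<odot> u = u \<longrightarrow> 0 \<le> inner (A \<odot> u) u) \<and>
    (\<forall>u. Q \<odot> u = 0 \<longrightarrow> u \<noteq> 0 \<longrightarrow> inner (A \<odot> u) u < 0)"
proof -
  have p: "pos (A * A)" using pos_adj_mult[of A] A by simp
  have p1: "pos (1 - A * A)" using pos_one_minus_adj_mult[OF A(2)] A(1) by simp
  define R where "R = bsqrt (A * A)"
  have R: "pos R" "R * R = A * A" "nbound R 1" unfolding R_def
    by (rule bsqrt_pos[OF p p1] bsqrt_square[OF p p1] bsqrt_nbound[OF p p1])+
  have Rcom: "d * R = R * d" if "d * A = A * d" for d
  proof -
    have "d * (A * A) = A * A * d" using that by (metis mult.assoc)
    then show ?thesis unfolding R_def by (rule bsqrt_commute[OF p p1])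
  qed
  define Q where "Q = kproj (R - A)"
  have split: "(R - A) * (R + A) = 0"
    using Rcom[of A] by (simp add: left_diff_distrib distrib_left R)
  have form_R: "(norm (R \<odot> u))^2 \<le> inner (R \<odot> u) u" for u
    using pos_norm_le[OF R(1), of 1] inner_le_nbound[OF R(3)] by simp
  have "isproj Q" by (simp add: Q_def)
  moreover have "d * Q = Q * d" if "d * A = A * d" "adj d * A = A * adj d" for d
    unfolding Q_def
    by (rule kproj_commute) (simp_all add: left_diff_distrib right_diff_distrib that Rcom)
  moreover have "0 \<le> inner (A \<odot> u) u" if "Q \<odot> u = u" for u
    using that pos_nonneg[OF R(1), of u] by (simp add: Q_def kproj_fixed inner_diff_left)
  moreover have "inner (A \<odot> u) u < 0" if "Q \<odot> u = 0" "u \<noteq> 0" for u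
  proof -
    have sa: "adj (R + A) = R + A" using pos_selfadj[OF R(1)] A by simp
    have "inner v ((R + A) \<odot> u) = 0" for v
    proof -
      have "(R - A) \<odot> (R + A) \<odot> v = 0" using arg_cong[OF split, of "\<lambda>a. a \<odot> v"] by (simp only: bop_apply)
      then have "Q \<odot> (R + A) \<odot> v = (R + A) \<odot> v" by (simp only: Q_def kproj_fixed)
      then have "inner ((R + A) \<odot> v) u = inner ((R + A) \<odot> v) (Q \<odot> u)"
        using isproj_inner[OF \<open>isproj Q\<close>] by metis
      then show ?thesis using inner_adj[of "R + A" v u] that(1) by (simp only: sa inner_zero_right)
    qed
    then have "(R + A) \<odot> u = 0" using inner_eq_zero_iff by blast
    then have eq: "A \<odot> u = - (R \<odot> u)" by (simp add: eq_neg_iff_add_eq_0 add.commute)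
    have "inner (R \<odot> u) u \<noteq> 0"
    proof
      assume "inner (R \<odot> u) u = 0"
      then have "R \<odot> u = 0" using form_R[of u] by simp
      then have "(R - A) \<odot> u = 0" by (simp add: eq)
      then have "Q \<odot> u = u" by (simp only: Q_def kproj_fixed)
      then show False using that by simp
    qed
    then show ?thesis using pos_nonneg[OF R(1), of u] by (simp add: eq)
  qed
  ultimately show ?thesis by blast
qed

text \<open>For \<open>T = (1 + h\<^sup>2)\<inverse>\<close>, \<open>cut T s\<close> is the spectral projection of \<open>h\<close> for \<open>(-\<infinity>, s]\<close>, that
  is, the one of \<open>T\<close> for \<open>[1 / (1 + s\<^sup>2), 1]\<close>.\<close>

definition cut :: "'h::chilbert_space bop \<Rightarrow> real \<Rightarrow> 'h bop"
  where "cut T s = (if s < 0 then 0 else SOME Q. isproj Q \<and>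
    (\<forall>d. d * T = T * d \<and> adj d * T = T * adj d \<longrightarrow> d * Q = Q * d) \<and>
    (\<forall>u. Q \<odot> u = u \<longrightarrow> (norm u)^2 \<le> (1 + s^2) * inner (T \<odot> u) u) \<and>
    (\<forall>u. Q \<odot> u = 0 \<longrightarrow> u \<noteq> 0 \<longrightarrow> (1 + s^2) * inner (T \<odot> u) u < (norm u)^2))"

lemma mono_seq_right_continuous:
  fixes F :: "real \<Rightarrow> real"
  assumes mono: "\<And>s t. s \<le> t \<Longrightarrow> F s \<le> F t" and lim: "(\<lambda>n. F (a + 1 / real (Suc n))) \<longlonglongrightarrow> F a"
  shows "continuous (at_right a) F"
  unfolding continuous_within
proof (rule order_tendstoI)
  fix l assume "l < F a"
  show "\<forall>\<^sub>F s in at_right a. l < F s"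
    by (rule eventually_mono[OF eventually_at_right_less]) (use \<open>l < F a\<close> mono in \<open>force intro: less_le_trans\<close>)
next
  fix u assume "F a < u"
  then have "\<forall>\<^sub>F n in sequentially. F (a + 1 / real (Suc n)) < u" by (rule order_tendstoD(2)[OF lim])
  then obtain n where n: "F (a + 1 / real (Suc n)) < u" by (auto simp: eventually_sequentially)
  have "\<forall>\<^sub>F s in at_right a. s < a + 1 / real (Suc n)"
    by (rule eventually_at_rightI[of a "a + 1 / real (Suc n)"]) auto
  then show "\<forall>\<^sub>F s in at_right a. F s < u"
    by (rule eventually_mono) (meson mono n le_less_trans less_imp_le)
qed

context injective_contraction
begin

lemma T_nbound: "nbound T 1" by (rule pos_one_minus_nbound[OF T_pos T_le_one])

lemma cut_exists:
  "\<exists>Q. isproj Q \<and>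
    (\<forall>d. d * T = T * d \<and> adj d * T = T * adj d \<longrightarrow> d * Q = Q * d) \<and>
    (\<forall>u. Q \<odot> u = u \<longrightarrow> (norm u)^2 \<le> (1 + s^2) * inner (T \<odot> u) u) \<and>
    (\<forall>u. Q \<odot> u = 0 \<longrightarrow> u \<noteq> 0 \<longrightarrow> (1 + s^2) * inner (T \<odot> u) u < (norm u)^2)"
proof -
  define t where "t = 1 / (1 + s^2)"
  have s1: "0 < 1 + s^2" by (simp add: add_pos_nonneg)
  have t: "0 < t" "t \<le> 1" using s1 by (auto simp: t_def)
  \<comment> \<open>\<open>spectral_split\<close> expects a contraction; the factor 1/2 pays for
    subtracting \<open>t \<le> 1\<close> from a contraction.\<close>
  define A where "A = (1/2) *\<^sub>R (T - t *\<^sub>R 1)"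
  have "nbound (t *\<^sub>R 1) 1" using t by (auto simp: nbound_def intro: mult_left_le_one_le)
  from nbound_minus[OF T_nbound this] have "nbound A 1" by (simp add: nbound_def A_def mult.commute)
  moreover have "adj A = A" by (simp add: A_def pos_selfadj[OF T_pos])
  ultimately obtain Q where Q: "isproj Q" "\<And>d. d * A = A * d \<and> adj d * A = A * adj d \<Longrightarrow> d * Q = Q * d"
    "\<And>u. Q \<odot> u = u \<Longrightarrow> 0 \<le> inner (A \<odot> u) u" "\<And>u. Q \<odot> u = 0 \<Longrightarrow> u \<noteq> 0 \<Longrightarrow> inner (A \<odot> u) u < 0"
    using spectral_split[of A] by metis
  have form: "inner (A \<odot> u) u = ((1 + s^2) * inner (T \<odot> u) u - (norm u)^2) / (2 * (1 + s^2))" for u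
  proof -
    have "inner (A \<odot> u) u = (inner (T \<odot> u) u - t * (norm u)^2) / 2"
      by (simp add: A_def inner_diff_left power2_norm_eq_inner)
    then show ?thesis using s1 by (simp add: t_def field_simps)
  qed
  have "d * A = A * d" if "d * T = T * d" for d
    using that by (simp add: A_def left_diff_distrib right_diff_distrib)
  then have 2: "d * Q = Q * d" if "d * T = T * d \<and> adj d * T = T * adj d" for d
    using Q(2)[of d] that by blast
  have 3: "(norm u)^2 \<le> (1 + s^2) * inner (T \<odot> u) u" if "Q \<odot> u = u" for u
    using Q(3)[OF that] s1 unfolding form by (simp add: zero_le_divide_iff)
  have 4: "(1 + s^2) * inner (T \<odot> u) u < (norm u)^2" if "Q \<odot> u = 0" "u \<noteq> 0" for u
    using Q(4)[OF that] s1 unfolding form by (simp add: divide_less_0_iff)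
  show ?thesis using Q(1) 2 3 4 by blast
qed

lemma cut_neg: "s < 0 \<Longrightarrow> cut T s = 0" by (simp add: cut_def)

lemma cut_spec:
  assumes "\<not> s < 0"
  shows "isproj (cut T s) \<and>
    (\<forall>d. d * T = T * d \<and> adj d * T = T * adj d \<longrightarrow> d * cut T s = cut T s * d) \<and>
    (\<forall>u. cut T s \<odot> u = u \<longrightarrow> (norm u)^2 \<le> (1 + s^2) * inner (T \<odot> u) u) \<and>
    (\<forall>u. cut T s \<odot> u = 0 \<longrightarrow> u \<noteq> 0 \<longrightarrow> (1 + s^2) * inner (T \<odot> u) u < (norm u)^2)"
  unfolding cut_def if_not_P[OF assms] by (rule someI_ex[OF cut_exists])

lemma cut_isproj [simp]: "isproj (cut T s)"
  using cut_spec[of s] by (cases "s < 0") (simp add: cut_neg, blast)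

lemma cut_commute:
  assumes "d * T = T * d" "adj d * T = T * adj d"
  shows "d * cut T s = cut T s * d"
proof (cases "s < 0")
  case False
  show ?thesis using cut_spec[OF False] assms by blast
qed (simp add: cut_neg)

lemma cut_lower: "0 \<le> s \<Longrightarrow> cut T s \<odot> u = u \<Longrightarrow> (norm u)^2 \<le> (1 + s^2) * inner (T \<odot> u) u"
  using cut_spec[of s] by (meson not_less)

lemma cut_upper:
  "0 \<le> s \<Longrightarrow> cut T s \<odot> u = 0 \<Longrightarrow> u \<noteq> 0 \<Longrightarrow> (1 + s^2) * inner (T \<odot> u) u < (norm u)^2"
  using cut_spec[of s] by (meson not_less)

lemma cut_T: "cut T s * T = T * cut T s"
  by (rule cut_commute[symmetric]) (simp_all add: pos_selfadj[OF T_pos])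

lemma cut_cut: "cut T s * cut T t = cut T t * cut T s"
  by (rule cut_commute) (simp_all add: cut_T isprojD)

text \<open>A nonzero vector fixed by \<open>cut T s\<close> and killed by \<open>cut T t\<close>
  would satisfy the lower bound at s and the strict upper bound at t, which contradict each other
  for s \<le> t.\<close>

lemma cut_mono: "s \<le> t \<Longrightarrow> cut T t * cut T s = cut T s"
proof (cases "s < 0")
  case False
  assume st: "s \<le> t"
  show ?thesis
  proof (rule bop_eqI)
    fix u
    define \<eta> where "\<eta> = cut T s \<odot> u - cut T t \<odot> cut T s \<odot> u"
    have com: "cut T s \<odot> cut T t \<odot> z = cut T t \<odot> cut T s \<odot> z" for z
      using arg_cong[OF cut_cut[of s t], of "\<lambda>a. a \<odot> z"] by simp
    have "\<eta> = 0"
    proof (rule ccontr)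
      assume n: "\<eta> \<noteq> 0"
      have "(norm \<eta>)^2 \<le> (1 + s^2) * inner (T \<odot> \<eta>) \<eta>"
        by (rule cut_lower) (use False in \<open>simp_all add: \<eta>_def com\<close>)
      also have "\<dots> \<le> (1 + t^2) * inner (T \<odot> \<eta>) \<eta>"
        by (intro mult_right_mono add_left_mono power_mono pos_nonneg[OF T_pos]) (use False st in auto)
      also have "\<dots> < (norm \<eta>)^2"
        by (rule cut_upper[OF _ _ n]) (use False st in \<open>simp_all add: \<eta>_def\<close>)
      finally show False by simp
    qed
    then show "(cut T t * cut T s) \<odot> u = cut T s \<odot> u" by (simp add: \<eta>_def)
  qed
qed (simp add: cut_neg)

lemma cut_mono': "s \<le> t \<Longrightarrow> cut T s * cut T t = cut T s"
  using cut_mono[of s t] cut_cut[of s t] by simp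

lemma cut_cut_apply: "s \<le> t \<Longrightarrow> cut T t \<odot> cut T s \<odot> u = cut T s \<odot> u" "s \<le> t \<Longrightarrow> cut T s \<odot> cut T t \<odot> u = cut T s \<odot> u"
  using arg_cong[OF cut_mono[of s t], of "\<lambda>a. a \<odot> u"] arg_cong[OF cut_mono'[of s t], of "\<lambda>a. a \<odot> u"] by simp_all

text \<open>The complements increase to J. A vector orthogonal to J and to \<open>cut T s\<close> is
  fixed by all cuts to the right of s, so the lower bound passes to the limit s and contradicts the
  strict upper bound there.\<close>

lemma cut_right_limit:
  assumes s: "0 \<le> s" shows "(\<lambda>n. cut T (s + 1 / real (Suc n)) \<odot> u) \<longlonglongrightarrow> cut T s \<odot> u"
proof -
  define q where "q n = 1 - cut T (s + 1 / real (Suc n))" for n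
  have q: "isproj (q n)" for n by (simp add: q_def isproj_compl)
  have inc: "q (Suc n) * q n = q n" for n
  proof -
    have "cut T (s + 1 / real (Suc (Suc n))) * cut T (s + 1 / real (Suc n)) = cut T (s + 1 / real (Suc (Suc n)))"
      by (rule cut_mono') (simp add: frac_le)
    then show ?thesis by (simp add: q_def left_diff_distrib right_diff_distrib)
  qed
  define J where "J = join (range q)"
  have lim: "(\<lambda>n. q n \<odot> x) \<longlonglongrightarrow> J \<odot> x" for x unfolding J_def by (rule proj_increasing_limit[of q, OF q inc])
  have qJ: "q n \<odot> J \<odot> x = q n \<odot> x" for n x
    using arg_cong[OF isproj_adj_le[OF _ q join_upper[of "q n" "range q"]], of "\<lambda>a. a \<odot> x"] by (simp add: J_def)
  have "J \<odot> x = x - cut T s \<odot> x" for x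
  proof -
    define \<eta> where "\<eta> = (x - J \<odot> x) - cut T s \<odot> (x - J \<odot> x)"
    have "\<eta> = 0"
    proof (rule ccontr)
      assume n: "\<eta> \<noteq> 0"
      have up: "(1 + s^2) * inner (T \<odot> \<eta>) \<eta> < (norm \<eta>)^2"
        by (rule cut_upper[OF s _ n]) (simp add: \<eta>_def)
      have "q n \<odot> \<eta> = 0" for n
      proof -
        have "cut T (s + 1 / real (Suc n)) \<odot> cut T s \<odot> z = cut T s \<odot> z" for z by (rule cut_cut_apply) simp
        then have "q n \<odot> cut T s \<odot> z = 0" for z by (simp add: q_def)
        then show ?thesis unfolding \<eta>_def by (simp only: bapply_diff qJ)  simp
      qed
      then have "cut T (s + 1 / real (Suc n)) \<odot> \<eta> = \<eta>" for n by (simp add: q_def)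
      then have "(norm \<eta>)^2 \<le> (1 + (s + 1 / real (Suc n))^2) * inner (T \<odot> \<eta>) \<eta>" for n
        by (rule cut_lower[rotated]) (use s in simp)
      moreover have "(\<lambda>n. (1 + (s + 1 / real (Suc n))^2) * inner (T \<odot> \<eta>) \<eta>) \<longlonglongrightarrow> (1 + (s + 0)^2) * inner (T \<odot> \<eta>) \<eta>"
        by (intro tendsto_intros LIMSEQ_Suc[OF lim_1_over_n])
      ultimately have "(norm \<eta>)^2 \<le> (1 + (s + 0)^2) * inner (T \<odot> \<eta>) \<eta>"
        by (intro LIMSEQ_le_const) auto
      then show False using up by simp
    qed
    moreover have "cut T s \<odot> J \<odot> x = 0"
    proof (rule LIMSEQ_unique[OF bapply_tendsto[OF lim]])
      have "cut T s \<odot> q n \<odot> x = 0" for n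
        by (simp add: q_def cut_cut_apply)
      then show "(\<lambda>n. cut T s \<odot> q n \<odot> x) \<longlonglongrightarrow> 0" by simp
    qed
    ultimately show ?thesis by (simp add: \<eta>_def algebra_simps)
  qed
  then have "(\<lambda>n. u - q n \<odot> u) \<longlonglongrightarrow> u - (u - cut T s \<odot> u)" by (intro tendsto_intros) (metis lim)
  then show ?thesis by (simp add: q_def)
qed

text \<open>A nonzero \<eta> killed by all cuts would satisfy (1 + n^2) (T \<eta> | \<eta>) <
  |\<eta>|^2 for every n, although injectivity of T makes (T \<eta> | \<eta>) positive.\<close>

lemma cut_limit: "(\<lambda>n. cut T (real n) \<odot> u) \<longlonglongrightarrow> u"
proof -
  have inc: "cut T (real (Suc n)) * cut T (real n) = cut T (real n)" for n by (rule cut_mono) simp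
  define p where "p n = cut T (real n)" for n
  define J where "J = join (range p)"
  have p: "isproj (p n)" for n by (simp add: p_def)
  have lim: "(\<lambda>n. p n \<odot> x) \<longlonglongrightarrow> J \<odot> x" for x unfolding J_def
    by (rule proj_increasing_limit) (use inc in \<open>simp_all add: p_def\<close>)
  have pJ: "p n \<odot> J \<odot> x = p n \<odot> x" for n x
    using arg_cong[OF isproj_adj_le[OF _ p join_upper[of "p n" "range p"]], of "\<lambda>a. a \<odot> x"] by (simp add: J_def)
  have "u - J \<odot> u = 0"
  proof (rule ccontr)
    define \<eta> where "\<eta> = u - J \<odot> u"
    assume "u - J \<odot> u \<noteq> 0"
    then have n: "\<eta> \<noteq> 0" by (simp add: \<eta>_def)
    have z: "cut T (real n) \<odot> \<eta> = 0" for n using pJ[of n u] by (simp add: \<eta>_def p_def)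
    have up: "(1 + (real n)^2) * inner (T \<odot> \<eta>) \<eta> < (norm \<eta>)^2" for n
      by (rule cut_upper[OF _ z n]) simp
    have "0 < inner (T \<odot> \<eta>) \<eta>"
    proof -
      have "(norm (T \<odot> \<eta>))^2 \<le> 1 * inner (T \<odot> \<eta>) \<eta>"
        by (rule pos_norm_le[OF T_pos inner_le_nbound[OF T_nbound]])
      moreover have "T \<odot> \<eta> \<noteq> 0" using T_inj n by blast
      moreover from this have "0 < (norm (T \<odot> \<eta>))^2" by simp
      ultimately show ?thesis by linarith
    qed
    then obtain m where "(norm \<eta>)^2 < real m * inner (T \<odot> \<eta>) \<eta>" using reals_Archimedean3 by blast
    moreover have "real m \<le> 1 + (real m)^2"
    proof -
      have "0 \<le> (real m - 1/2)^2" by simp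
      then show ?thesis by (simp add: power2_diff power_divide)
    qed
    then have "real m * inner (T \<odot> \<eta>) \<eta> \<le> (1 + (real m)^2) * inner (T \<odot> \<eta>) \<eta>"
      using \<open>0 < inner (T \<odot> \<eta>) \<eta>\<close> by (intro mult_right_mono) auto
    ultimately show False using up[of m] by linarith
  qed
  then show ?thesis using lim[of u] by (simp add: p_def)
qed

section \<open>The projection-valued measure determined by the cuts\<close>

definition specF :: "'h \<Rightarrow> real \<Rightarrow> real" where "specF u s = (norm (cut T s \<odot> u))^2"

lemma specF_mono: "s \<le> t \<Longrightarrow> specF u s \<le> specF u t"
  unfolding specF_def using isproj_norm[OF cut_isproj, of s "cut T t \<odot> u"]
  by (simp add: cut_cut_apply power_mono)

lemma specF_neg: "s < 0 \<Longrightarrow> specF u s = 0"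
  by (simp add: specF_def cut_neg)

lemma specF_right: "continuous (at_right a) (specF u)"
proof (cases "a < 0")
  case True
  have "\<forall>\<^sub>F s in at_right a. s < 0"
    by (rule eventually_at_rightI[of a 0]) (use True in auto)
  then have "((specF u) \<longlongrightarrow> 0) (at_right a)"
    by (intro tendsto_eventually) (auto elim: eventually_mono simp: specF_neg)
  then show ?thesis using True by (simp add: continuous_within specF_neg)
next
  case False
  show ?thesis
  proof (rule mono_seq_right_continuous[OF specF_mono])
    show "(\<lambda>n. specF u (a + 1 / real (Suc n))) \<longlonglongrightarrow> specF u a"
      unfolding specF_def by (intro tendsto_intros cut_right_limit) (use False in simp)
  qed
qed

definition mu :: "'h \<Rightarrow> real measure" where "mu u = interval_measure (specF u)"

lemma sets_mu [simp, measurable_cong]: "sets (mu u) = sets borel" and space_mu [simp]: "space (mu u) = UNIV"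
  by (simp_all add: mu_def)

lemma mu_Ioc: "a \<le> b \<Longrightarrow> emeasure (mu u) {a<..b} = ennreal (specF u b - specF u a)"
  unfolding mu_def by (rule emeasure_interval_measure_Ioc[OF _ specF_mono specF_right])

lemma mu_neg: "emeasure (mu u) {..<0} = 0"
proof -
  have "emeasure (mu u) (\<Union>n. {- real n <.. - (1 / real (Suc n))}) = 0"
  proof (rule emeasure_UN_eq_0)
    fix n
    show "emeasure (mu u) {- real n <.. - (1 / real (Suc n))} = 0"
    proof (cases "- real n \<le> - (1 / real (Suc n))")
      case True
      then have "n \<noteq> 0" by (cases n) auto
      then show ?thesis using mu_Ioc[OF True] by (simp add: specF_neg)
    next
      case False
      then have "{- real n <.. - (1 / real (Suc n))} = {}" by auto
      then show ?thesis by simp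
    qed
  qed auto
  moreover have "{..<0} \<subseteq> (\<Union>n. {- real n <.. - (1 / real (Suc n))})"
  proof
    fix x :: real assume "x \<in> {..<0}"
    then have x: "0 < - x" by simp
    obtain n1 where n1: "1 / real (Suc n1) < - x" using x nat_approx_posE by metis
    obtain n2 where n2: "- x < real n2" using reals_Archimedean2 by blast
    define n where "n = max n1 n2"
    have "1 / real (Suc n) \<le> 1 / real (Suc n1)" by (intro frac_le) (auto simp: n_def)
    then have "x \<le> - (1 / real (Suc n))" using n1 by simp
    moreover have "- real n < x" using n2 by (simp add: n_def)
    ultimately show "x \<in> (\<Union>n. {- real n <.. - (1 / real (Suc n))})" by auto
  qed
  then have "emeasure (mu u) {..<0} \<le> emeasure (mu u) (\<Union>n. {- real n <.. - (1 / real (Suc n))})"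
    by (intro emeasure_mono) auto
  ultimately show ?thesis by simp
qed

lemma mu_atMost: "emeasure (mu u) {..b} = ennreal (specF u b)"
proof (cases "b < 0")
  case True
  then have "emeasure (mu u) {..b} \<le> emeasure (mu u) {..<0}" by (intro emeasure_mono) auto
  then show ?thesis using True mu_neg by (simp add: specF_neg)
next
  case False
  have s1: "specF u (- 1) = 0" by (simp add: specF_neg)
  have "emeasure (mu u) {..-1} \<le> emeasure (mu u) {..<0}" by (intro emeasure_mono) auto
  then have z: "emeasure (mu u) {..-1} = 0" using mu_neg by simp
  have "{..b} = {..-1} \<union> {-1<..b}" using False by auto
  then have "emeasure (mu u) {..b} = emeasure (mu u) {..-1} + emeasure (mu u) {-1<..b}"
    by (simp only:) (rule plus_emeasure[symmetric], auto)
  then show ?thesis using mu_Ioc[of "-1" b u] False by (simp add: s1 z)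
qed

lemma mu_UNIV: "emeasure (mu u) UNIV = ennreal ((norm u)^2)"
proof (rule LIMSEQ_unique)
  have "(\<lambda>n. emeasure (mu u) {..real n}) \<longlonglongrightarrow> emeasure (mu u) (\<Union>n. {..real n})"
    by (rule Lim_emeasure_incseq) (auto simp: incseq_def)
  moreover have "(\<Union>n. {..real n}) = UNIV" using real_arch_simple by auto
  ultimately show "(\<lambda>n. emeasure (mu u) {..real n}) \<longlonglongrightarrow> emeasure (mu u) UNIV" by simp
  show "(\<lambda>n. emeasure (mu u) {..real n}) \<longlonglongrightarrow> ennreal ((norm u)^2)"
    unfolding mu_atMost specF_def by (intro tendsto_ennrealI tendsto_intros cut_limit)
qed

lemma finite_measure_mu: "finite_measure (mu u)"
  by standard (simp add: mu_UNIV)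

lemma orthogonal_proj_sums:
  assumes p: "\<And>n. isproj (p n)" and o: "\<And>i j. i \<noteq> j \<Longrightarrow> p i * p j = 0"
  shows "\<exists>b. isproj b \<and> (\<forall>x. (\<lambda>n. p n \<odot> x) sums (b \<odot> x)) \<and> (\<forall>x. (\<lambda>n. (norm (p n \<odot> x))^2) sums (norm (b \<odot> x))^2)"
proof -
  define S where "S n = (\<Sum>i<n. p i)" for n
  have pS: "p n * S m = (if n < m then p n else 0)" for n m
    by (induction m) (auto simp: S_def o distrib_left isprojD(2)[OF p] less_Suc_eq)
  have "S n * S n = S n" for n
  proof -
    have "S n * S n = (\<Sum>i<n. p i * S n)" by (simp add: S_def sum_distrib_right)
    also have "\<dots> = (\<Sum>i<n. p i)" by (intro sum.cong) (auto simp: pS)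
    finally show ?thesis by (simp add: S_def)
  qed
  moreover have "adj (S n) = S n" for n by (simp add: S_def isprojD(1)[OF p])
  ultimately have Sp: "isproj (S n)" for n by (simp add: isproj_def)
  have SpA: "S n * p n = 0" for n
  proof -
    have "S n * p n = (\<Sum>i<n. p i * p n)" by (simp add: S_def sum_distrib_right)
    then show ?thesis by (simp add: o)
  qed
  have inc: "S (Suc n) * S n = S n" for n
    using pS[of n n] Sp[of n] by (simp add: S_def distrib_right isprojD(2) isprojD(2)[unfolded S_def])
  have lim: "(\<lambda>n. S n \<odot> x) \<longlonglongrightarrow> join (range S) \<odot> x" for x by (rule proj_increasing_limit[of S, OF Sp inc])
  have nS: "(norm (S n \<odot> x))^2 = (\<Sum>i<n. (norm (p i \<odot> x))^2)" for n x
  proof -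
    have "(norm (S n \<odot> x))^2 = inner (S n \<odot> x) x" by (rule isproj_form[OF Sp, symmetric])
    then show ?thesis by (simp add: isproj_form[OF p, symmetric] S_def inner_sum_left)
  qed
  show ?thesis
  proof (intro exI[of _ "join (range S)"] conjI allI)
    show "(\<lambda>n. p n \<odot> x) sums (join (range S) \<odot> x)" for x
      using lim[of x] by (simp add: sums_def S_def)
    show "(\<lambda>n. (norm (p n \<odot> x))^2) sums (norm (join (range S) \<odot> x))^2" for x
      using tendsto_power[OF tendsto_norm[OF lim[of x]], of 2] by (simp add: sums_def nS)
  qed simp
qed

text \<open>For the vector P x the set A already carries the whole mass |P x|^2, so nothing remains
  for the disjoint set B.\<close>

lemma mu_proj_orthogonal:
  assumes "isproj P" "isproj Q" "A \<in> sets borel" "B \<in> sets borel" "A \<inter> B = {}"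
    and P: "\<And>u. emeasure (mu u) A = ennreal ((norm (P \<odot> u))^2)"
    and Q: "\<And>u. emeasure (mu u) B = ennreal ((norm (Q \<odot> u))^2)"
  shows "Q * P = 0"
proof (rule bop_eqI)
  fix x
  let ?u = "P \<odot> x"
  have "emeasure (mu ?u) A + emeasure (mu ?u) B = emeasure (mu ?u) (A \<union> B)"
    by (rule plus_emeasure) (use assms in auto)
  also have "\<dots> \<le> emeasure (mu ?u) UNIV" by (rule emeasure_mono) auto
  finally have "(norm (P \<odot> ?u))^2 + (norm (Q \<odot> ?u))^2 \<le> (norm ?u)^2"
    unfolding P Q mu_UNIV by (simp flip: ennreal_plus)
  then show "(Q * P) \<odot> x = 0 \<odot> x" using assms(1) by simp
qed

text \<open>The Borel sets whose scalar masses come from a projection contain the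
  intersection-stable generator of closed half-lines and are closed under complements and countable
  disjoint unions.\<close>

lemma spectral_projection_exists:
  assumes "B \<in> sets borel"
  shows "\<exists>P. isproj P \<and> (\<forall>u. emeasure (mu u) B = ennreal ((norm (P \<odot> u))^2))"
proof -
  have B: "B \<in> sigma_sets UNIV (range (\<lambda>a::real. {..a}))"
    using assms unfolding borel_eq_atMost by (simp add: sets_measure_of)
  have sb: "sigma_sets UNIV (range (\<lambda>a::real. {..a})) = sets borel"
    unfolding borel_eq_atMost by (simp add: sets_measure_of)
  show ?thesis
  proof (rule sigma_sets_induct_disjoint[OF _ _ B])
    show "Int_stable (range (\<lambda>a::real. {..a}))"
      by (auto simp: Int_stable_def)
    show "range (\<lambda>a::real. {..a}) \<subseteq> Pow UNIV" by simp
    show "\<exists>P. isproj P \<and> (\<forall>u. emeasure (mu u) A = ennreal ((norm (P \<odot> u))^2))" if "A \<in> range atMost" for A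
      using that mu_atMost cut_isproj unfolding specF_def by blast
    show "\<exists>P. isproj P \<and> (\<forall>u. emeasure (mu u) {} = ennreal ((norm (P \<odot> u))^2))"
      by (intro exI[of _ 0]) auto
  next
    fix A assume A: "A \<in> sigma_sets UNIV (range (\<lambda>a::real. {..a}))"
      and "\<exists>P. isproj P \<and> (\<forall>u. emeasure (mu u) A = ennreal ((norm (P \<odot> u))^2))"
    then obtain P where P: "isproj P" "\<And>u. emeasure (mu u) A = ennreal ((norm (P \<odot> u))^2)" by blast
    have "emeasure (mu u) (UNIV - A) = ennreal ((norm ((1 - P) \<odot> u))^2)" for u
    proof -
      have "emeasure (mu u) (space (mu u) - A) = emeasure (mu u) (space (mu u)) - emeasure (mu u) A"
        by (rule emeasure_compl) (use A sb P in auto)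
      then show ?thesis
        using isproj_pythagoras[OF P(1), of u] by (simp add: mu_UNIV P ennreal_minus)
    qed
    then show "\<exists>P. isproj P \<and> (\<forall>u. emeasure (mu u) (UNIV - A) = ennreal ((norm (P \<odot> u))^2))"
      using isproj_compl[OF P(1)] by blast
  next
    fix A :: "nat \<Rightarrow> real set"
    assume d: "disjoint_family A" and A: "range A \<subseteq> sigma_sets UNIV (range (\<lambda>a::real. {..a}))"
      and "\<And>i. \<exists>P. isproj P \<and> (\<forall>u. emeasure (mu u) (A i) = ennreal ((norm (P \<odot> u))^2))"
    then obtain p where p: "\<And>i. isproj (p i)" "\<And>i u. emeasure (mu u) (A i) = ennreal ((norm (p i \<odot> u))^2)" by metis
    have Ab: "range A \<subseteq> sets borel" using A sb by simp
    have o: "p i * p j = 0" if "i \<noteq> j" for i j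
      by (rule mu_proj_orthogonal[OF p(1) p(1) _ _ _ p(2) p(2)])
        (use Ab d that in \<open>auto simp: disjoint_family_on_def\<close>)
    obtain b where b: "isproj b" "\<And>x. (\<lambda>n. (norm (p n \<odot> x))^2) sums (norm (b \<odot> x))^2"
      using orthogonal_proj_sums[of p, OF p(1) o] by auto
    have "emeasure (mu u) (\<Union>i. A i) = ennreal ((norm (b \<odot> u))^2)" for u
    proof -
      have "emeasure (mu u) (\<Union>i. A i) = (\<Sum>i. emeasure (mu u) (A i))"
        by (rule suminf_emeasure[symmetric]) (use Ab d in auto)
      also have "\<dots> = ennreal (\<Sum>i. (norm (p i \<odot> u))^2)"
        unfolding p by (rule suminf_ennreal2) (use b(2) sums_summable in auto)
      finally show ?thesis using sums_unique[OF b(2)] by simp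
    qed
    then show "\<exists>P. isproj P \<and> (\<forall>u. emeasure (mu u) (\<Union>i. A i) = ennreal ((norm (P \<odot> u))^2))"
      using b(1) by blast
  qed
qed

definition spm :: "real set \<Rightarrow> 'h bop"
  where "spm B = (SOME P. isproj P \<and> (\<forall>u. emeasure (mu u) B = ennreal ((norm (P \<odot> u))^2)))"

lemma spm_isproj: "B \<in> sets borel \<Longrightarrow> isproj (spm B)"
  and spm_mu: "B \<in> sets borel \<Longrightarrow> emeasure (mu u) B = ennreal ((norm (spm B \<odot> u))^2)"
  using someI_ex[OF spectral_projection_exists, of B] unfolding spm_def by blast+

lemma proj_eq_norm:
  assumes "isproj P" "isproj Q" "\<And>u. norm (P \<odot> u) = norm (Q \<odot> u)"
  shows "P = Q"
proof (rule isproj_eqI[OF assms(1,2)])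
  fix x show "P \<odot> x = x \<longleftrightarrow> Q \<odot> x = x"
    using isproj_norm_eq[OF assms(1), of x] isproj_norm_eq[OF assms(2), of x] assms(3)[of x] by auto
qed

lemma spm_eqI:
  assumes "B \<in> sets borel" "isproj P" "\<And>u. emeasure (mu u) B = ennreal ((norm (P \<odot> u))^2)"
  shows "spm B = P"
proof (rule proj_eq_norm[OF spm_isproj[OF assms(1)] assms(2)])
  fix u
  have "ennreal ((norm (spm B \<odot> u))^2) = ennreal ((norm (P \<odot> u))^2)"
    using spm_mu[OF assms(1), of u] assms(3)[of u] by simp
  then show "norm (spm B \<odot> u) = norm (P \<odot> u)" by (simp add: power2_eq_iff_nonneg)
qed

lemma spm_orthogonal: "A \<in> sets borel \<Longrightarrow> B \<in> sets borel \<Longrightarrow> A \<inter> B = {} \<Longrightarrow> spm B * spm A = 0"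
  by (rule mu_proj_orthogonal[OF spm_isproj spm_isproj _ _ _ spm_mu spm_mu])

lemma spm_sums:
  assumes "range B \<subseteq> sets borel" "disjoint_family (B :: nat \<Rightarrow> real set)"
  shows "(\<lambda>n. spm (B n) \<odot> u) sums (spm (\<Union>n. B n) \<odot> u)"
proof -
  have Bb: "B n \<in> sets borel" for n using assms(1) by auto
  have o: "spm (B i) * spm (B j) = 0" if "i \<noteq> j" for i j
    by (rule spm_orthogonal[OF Bb Bb]) (use assms(2) that in \<open>auto simp: disjoint_family_on_def\<close>)
  obtain b where b: "isproj b" "\<And>x. (\<lambda>n. spm (B n) \<odot> x) sums (b \<odot> x)"
      "\<And>x. (\<lambda>n. (norm (spm (B n) \<odot> x))^2) sums (norm (b \<odot> x))^2"
    using orthogonal_proj_sums[of "\<lambda>n. spm (B n)", OF spm_isproj[OF Bb] o] by auto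
  have "spm (\<Union>n. B n) = b"
  proof (rule spm_eqI[OF _ b(1)])
    show "(\<Union>n. B n) \<in> sets borel" using Bb by auto
    fix u
    have "emeasure (mu u) (\<Union>i. B i) = (\<Sum>i. emeasure (mu u) (B i))"
      by (rule suminf_emeasure[symmetric]) (use assms in auto)
    also have "\<dots> = ennreal (\<Sum>i. (norm (spm (B i) \<odot> u))^2)"
      unfolding spm_mu[OF Bb] by (rule suminf_ennreal2) (use b(3) sums_summable in auto)
    finally show "emeasure (mu u) (\<Union>i. B i) = ennreal ((norm (b \<odot> u))^2)" using sums_unique[OF b(3)] by simp
  qed
  then show ?thesis using b(2) by simp
qed

lemma spm_union:
  assumes "A \<in> sets borel" "B \<in> sets borel" "A \<inter> B = {}"
  shows "spm (A \<union> B) = spm A + spm B"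
proof (rule spm_eqI)
  have o: "spm A * spm B = 0" "spm B * spm A = 0" using spm_orthogonal assms by (auto simp: Int_commute)
  show pr: "isproj (spm A + spm B)"
    using spm_isproj[OF assms(1)] spm_isproj[OF assms(2)] o by (simp add: isproj_def algebra_simps)
  fix u
  have "emeasure (mu u) (A \<union> B) = emeasure (mu u) A + emeasure (mu u) B"
    by (rule plus_emeasure[symmetric]) (use assms in auto)
  also have "\<dots> = ennreal ((norm (spm A \<odot> u))^2 + (norm (spm B \<odot> u))^2)"
    by (simp add: spm_mu assms ennreal_plus)
  also have "(norm (spm A \<odot> u))^2 + (norm (spm B \<odot> u))^2 = (norm ((spm A + spm B) \<odot> u))^2"
    by (simp add: isproj_form[symmetric] spm_isproj assms pr inner_add_left del: bop_apply(3)) (simp add: inner_add_left)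
  finally show "emeasure (mu u) (A \<union> B) = ennreal ((norm ((spm A + spm B) \<odot> u))^2)" .
qed (use assms in auto)

lemma spm_Int:
  assumes A: "A \<in> sets borel" and B: "B \<in> sets borel"
  shows "spm (A \<inter> B) = spm A * spm B"
proof -
  have a: "spm A = spm (A \<inter> B) + spm (A - B)"
  proof -
    have "spm ((A \<inter> B) \<union> (A - B)) = spm (A \<inter> B) + spm (A - B)"
      by (rule spm_union) (use A B in auto)
    then show ?thesis by (simp only: Int_Diff_Un)
  qed
  have b: "spm B = spm (A \<inter> B) + spm (B - A)"
  proof -
    have "spm ((A \<inter> B) \<union> (B - A)) = spm (A \<inter> B) + spm (B - A)"
      by (rule spm_union) (use A B in auto)
    moreover have "(A \<inter> B) \<union> (B - A) = B" by auto
    ultimately show ?thesis by simp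
  qed
  have "spm (A \<inter> B) * spm (B - A) = 0" "spm (A - B) * spm (A \<inter> B) = 0" "spm (A - B) * spm (B - A) = 0"
    by (rule spm_orthogonal; use A B in auto)+
  then show ?thesis
    by (subst a, subst b) (simp add: algebra_simps isprojD(2)[OF spm_isproj[OF sets.Int[OF A B]]])
qed

lemma spm_pvm: "projection_valued_measure (\<lambda>B. graph (spm B))"
proof -
  have e: "spm {} = 0" by (rule spm_eqI) auto
  have u: "spm UNIV = 1" by (rule spm_eqI) (auto simp: mu_UNIV)
  show ?thesis
    unfolding projection_valued_measure_def
    by (auto simp: spm_isproj e u op_zero_graph Id_graph spm_Int spm_sums)
qed

lemma scalar_spectral_measure_spm: "scalar_spectral_measure (\<lambda>B. graph (spm B)) u = mu u"
proof -
  have "scalar_spectral_measure (\<lambda>B. graph (spm B)) u = measure_of UNIV (sets borel) (emeasure (mu u))"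
    unfolding scalar_spectral_measure_def
    by (rule measure_of_eq) (auto simp: spm_mu sets.sigma_sets_eq[of borel, simplified])
  also have "\<dots> = mu u" using measure_of_of_measure[of "mu u"] by simp
  finally show ?thesis .
qed

end

section \<open>Integration against the spectral measure\<close>

lemma indicator_integral_bounds:
  fixes f :: "real \<Rightarrow> real"
  assumes M: "finite_measure M" "sets M = sets borel" and f: "f \<in> borel_measurable borel"
    and A: "A \<in> sets borel" and b: "\<And>s. s \<in> A \<Longrightarrow> l \<le> f s \<and> f s \<le> u"
  shows "integrable M (\<lambda>s. indicator A s * f s)"
    and "l * measure M A \<le> (\<integral>s. indicator A s * f s \<partial>M)"
    and "(\<integral>s. indicator A s * f s \<partial>M) \<le> u * measure M A"
proof -
  interpret finite_measure M by fact
  have [measurable_cong]: "sets M = sets borel" by fact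
  have [measurable]: "f \<in> borel_measurable borel" "A \<in> sets borel" by fact+
  have sp: "space M = UNIV" using sets_eq_imp_space_eq[OF M(2)] by simp
  have int1: "integrable M (\<lambda>s. indicator A s * c)" for c :: real
    by (rule integrable_mult_left) (simp add: A M(2) emeasure_finite top.not_eq_extremum[symmetric])
  show int: "integrable M (\<lambda>s. indicator A s * f s)"
  proof (rule Bochner_Integration.integrable_bound[OF int1[of "\<bar>l\<bar> + \<bar>u\<bar>"]])
    have "\<bar>f s\<bar> \<le> \<bar>l\<bar> + \<bar>u\<bar>" if "s \<in> A" for s using b[OF that] by linarith
    then show "AE s in M. norm (indicator A s * f s) \<le> norm (indicator A s * (\<bar>l\<bar> + \<bar>u\<bar>))"
      by (intro AE_I2) (auto simp: indicator_def)
  qed measurable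
  have c: "(\<integral>s. indicator A s * c \<partial>M) = c * measure M A" for c :: real
    by (simp add: sp mult.commute)
  show "l * measure M A \<le> (\<integral>s. indicator A s * f s \<partial>M)"
    unfolding c[symmetric] by (rule integral_mono[OF int1 int]) (use b in \<open>auto simp: indicator_def\<close>)
  show "(\<integral>s. indicator A s * f s \<partial>M) \<le> u * measure M A"
    unfolding c[symmetric] by (rule integral_mono[OF int int1]) (use b in \<open>auto simp: indicator_def\<close>)
qed

text \<open>Every bisection halves the bound, because the length factor halves while the masses of
  the two halves add up.\<close>

lemma additive_interval_zero:
  fixes G :: "real \<Rightarrow> real \<Rightarrow> real"
  assumes add: "\<And>a b c. 0 \<le> a \<Longrightarrow> a \<le> b \<Longrightarrow> b \<le> c \<Longrightarrow> c \<le> B \<Longrightarrow> G a c = G a b + G b c"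
    and bd: "\<And>a b. 0 \<le> a \<Longrightarrow> a \<le> b \<Longrightarrow> b \<le> B \<Longrightarrow> \<bar>G a b\<bar> \<le> K * (b - a) * (m b - m a)"
    and ab: "0 \<le> a" "a \<le> b" "b \<le> B"
  shows "G a b = 0"
proof -
  have "\<bar>G a b\<bar> \<le> K * (b - a) / 2 ^ n * (m b - m a)" for n
    using ab
  proof (induction n arbitrary: a b)
    case (Suc n)
    define c where "c = (a + b) / 2"
    have c: "a \<le> c" "c \<le> b" "c - a = (b - a) / 2" "b - c = (b - a) / 2"
      using Suc.prems by (auto simp: c_def field_simps)
    have "\<bar>G a b\<bar> \<le> \<bar>G a c\<bar> + \<bar>G c b\<bar>"
      using add[of a c b] Suc.prems c by simp
    also have "\<dots> \<le> K * (c - a) / 2 ^ n * (m c - m a) + K * (b - c) / 2 ^ n * (m b - m c)"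
      by (intro add_mono Suc.IH) (use Suc.prems c in auto)
    also have "\<dots> = K * (b - a) / 2 ^ Suc n * (m b - m a)"
      unfolding c by (simp add: field_simps)
    finally show ?case .
  qed (use bd in simp)
  moreover have "(\<lambda>n. K * (b - a) / 2 ^ n * (m b - m a)) \<longlonglongrightarrow> 0"
    using tendsto_mult[OF tendsto_const[of "K * (b - a) * (m b - m a)"] LIMSEQ_inverse_realpow_zero[of 2]]
    by (simp add: field_simps)
  ultimately have "\<bar>G a b\<bar> \<le> 0" by (intro LIMSEQ_le_const) auto
  then show ?thesis by simp
qed

text \<open>Cauchy--Schwarz for the form of h at w and v = h w; self-adjointness turns the mixed
  term into |v|^2.\<close>

lemma positive_selfadjoint_cauchy_schwarz:
  assumes h: "self_adjoint_op h" "positive_op h" and m: "(w, v) \<in> h" "(v, y) \<in> h"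
  shows "((norm v)^2)^2 \<le> inner v w * inner y v"
proof -
  have lin: "linear_op h" and hh: "op_adj h = h" using h by (auto simp: self_adjoint_op_def)
  have nonneg: "0 \<le> inner v u" if "(u, v) \<in> h" for u v
    using h(2) that by (auto simp: positive_op_def inner_eq_Re_cinner)
  have "(v, y) \<in> op_adj h" using m(2) hh by simp
  then have s: "inner v v = inner w y" unfolding op_adj_iff[OF lin] using m(1) by blast
  have "0 \<le> inner v w + 2 * t * (norm v)^2 + t^2 * inner y v" for t
  proof -
    have "(w + t *\<^sub>R v, v + t *\<^sub>R y) \<in> h" by (intro linear_op_add linear_op_scaleR lin m)
    then have "0 \<le> inner (v + t *\<^sub>R y) (w + t *\<^sub>R v)" by (rule nonneg)
    also have "\<dots> = inner v w + t * inner v v + t * inner w y + t^2 * inner y v"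
      by (simp add: inner_add_left inner_add_right inner_commute[of y w] power2_eq_square algebra_simps)
    finally show ?thesis by (simp add: power2_norm_eq_inner s)
  qed
  from quadratic_form_cauchy_schwarz[OF this nonneg[OF m(2)]] show ?thesis .
qed

context injective_contraction
begin

lemma root_graph_commute:
  assumes d: "d * T = T * d" and m: "(u, v) \<in> root_graph T"
  shows "(d \<odot> u, d \<odot> v) \<in> root_graph T"
proof -
  have "S \<odot> d \<odot> u = d \<odot> S \<odot> u" "C \<odot> d \<odot> v = d \<odot> C \<odot> v"
    using arg_cong[OF S_commute[OF d], of "\<lambda>a. a \<odot> u"] arg_cong[OF C_commute[OF d], of "\<lambda>a. a \<odot> v"] by simp_all
  then show ?thesis using m unfolding mem_root_graph by simp
qed

lemma root_graph_cut: "(u, v) \<in> root_graph T \<Longrightarrow> (cut T s \<odot> u, cut T s \<odot> v) \<in> root_graph T"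
  by (rule root_graph_commute[OF cut_T])

lemma C_cut: "C \<odot> cut T s \<odot> z = cut T s \<odot> C \<odot> z"
  using arg_cong[OF C_commute[OF cut_T[of s]], of "\<lambda>a. a \<odot> z"] by simp

lemma root_graph_param:
  assumes "(u, v) \<in> root_graph T"
  obtains z where "u = C \<odot> z" "v = S \<odot> z" "(norm u)^2 = inner (T \<odot> z) z" "(norm v)^2 = (norm z)^2 - inner (T \<odot> z) z"
    "\<And>s. cut T s \<odot> u = u \<Longrightarrow> cut T s \<odot> z = z" "\<And>s. cut T s \<odot> u = 0 \<Longrightarrow> cut T s \<odot> z = 0"
proof -
  obtain z where z: "u = C \<odot> z" "v = S \<odot> z" using assms by (auto simp: root_graph_def)
  show ?thesis
  proof (rule that[OF z])
    show "(norm u)^2 = inner (T \<odot> z) z"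
      using C_inner[of "C \<odot> z" z] by (simp add: power2_norm_eq_inner z CC_apply)
    show "(norm v)^2 = (norm z)^2 - inner (T \<odot> z) z"
      using S_inner[of "S \<odot> z" z] by (simp add: power2_norm_eq_inner z SS_apply inner_diff_left)
    show "cut T s \<odot> z = z" if "cut T s \<odot> u = u" for s
      using C_inj[of "cut T s \<odot> z - z"] that by (simp add: C_cut z)
    show "cut T s \<odot> z = 0" if "cut T s \<odot> u = 0" for s
      using C_inj[of "cut T s \<odot> z"] that by (simp add: C_cut z)
  qed
qed

lemma cut_norm_upper:
  assumes b: "0 \<le> b" and m: "(u, v) \<in> root_graph T" and c: "cut T b \<odot> u = u"
  shows "norm v \<le> b * norm u"
proof -
  obtain z where z: "(norm u)^2 = inner (T \<odot> z) z" "(norm v)^2 = (norm z)^2 - inner (T \<odot> z) z" "cut T b \<odot> z = z"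
    using root_graph_param[OF m] c by metis
  have "(norm v)^2 \<le> (b * norm u)^2"
    using cut_lower[OF b z(3)] by (simp add: z power_mult_distrib algebra_simps)
  then show ?thesis by (rule power2_le_imp_le) (use b in simp)
qed

lemma cut_norm_lower:
  assumes a: "0 \<le> a" and m: "(u, v) \<in> root_graph T" and c: "cut T a \<odot> u = 0" and n: "u \<noteq> 0"
  shows "a * norm u < norm v"
proof -
  obtain z where z: "u = C \<odot> z" "(norm u)^2 = inner (T \<odot> z) z" "(norm v)^2 = (norm z)^2 - inner (T \<odot> z) z" "cut T a \<odot> z = 0"
    using root_graph_param[OF m] c by metis
  have "z \<noteq> 0" using n z(1) by auto
  have "(a * norm u)^2 < (norm v)^2"
    using cut_upper[OF a z(4) \<open>z \<noteq> 0\<close>] by (simp add: z power_mult_distrib algebra_simps del: z(1))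
  then show ?thesis by (rule power_less_imp_less_base) simp
qed

text \<open>On the range of a cut the operator is bounded by b where defined, so closedness carries
  it from the dense vectors to all vectors of that range.\<close>

lemma cut_domain:
  assumes b: "0 \<le> b" and c: "cut T b \<odot> u = u"
  shows "\<exists>y. (u, y) \<in> root_graph T"
proof -
  have "u \<in> closure (range (bapply C))" using range_C_dense by simp
  then obtain w where w: "\<And>n. w n \<in> range (bapply C)" "w \<longlonglongrightarrow> u" by (auto simp: closure_sequential)
  have "\<forall>n. \<exists>y. (cut T b \<odot> w n, y) \<in> root_graph T"
  proof
    fix n
    obtain v where "w n = C \<odot> v" using w(1)[of n] by auto
    then have "(w n, S \<odot> v) \<in> root_graph T" by (auto simp: root_graph_def)
    then show "\<exists>y. (cut T b \<odot> w n, y) \<in> root_graph T" using root_graph_cut by blast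
  qed
  from choice[OF this] obtain v where v: "\<And>n. (cut T b \<odot> w n, v n) \<in> root_graph T" by blast
  have d: "norm (v n - v m) \<le> b * norm (cut T b \<odot> w n - cut T b \<odot> w m)" for n m
    by (rule cut_norm_upper[OF b linear_op_diff[OF root_graph_linear v v]]) simp
  have lim: "(\<lambda>n. cut T b \<odot> w n) \<longlonglongrightarrow> u" using bapply_tendsto[OF w(2), of "cut T b"] c by simp
  have "Cauchy v"
  proof (rule metric_CauchyI)
    fix e :: real assume e: "0 < e"
    have "Cauchy (\<lambda>n. cut T b \<odot> w n)" using lim by (rule LIMSEQ_imp_Cauchy)
    moreover have "0 < e / (b + 1)" using e b by simp
    ultimately obtain M where M: "\<And>m n. m \<ge> M \<Longrightarrow> n \<ge> M \<Longrightarrow> dist (cut T b \<odot> w m) (cut T b \<odot> w n) < e / (b + 1)"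
      using metric_CauchyD by blast
    have "dist (v m) (v n) < e" if "m \<ge> M" "n \<ge> M" for m n
    proof -
      have "dist (v m) (v n) \<le> b * dist (cut T b \<odot> w m) (cut T b \<odot> w n)" using d by (simp add: dist_norm)
      also have "\<dots> \<le> b * (e / (b + 1))" using M[OF that] b by (intro mult_left_mono) auto
      also have "\<dots> < e" using e b by (simp add: field_simps)
      finally show ?thesis .
    qed
    then show "\<exists>M. \<forall>m\<ge>M. \<forall>n\<ge>M. dist (v m) (v n) < e" by blast
  qed
  then obtain y where "v \<longlonglongrightarrow> y" using Cauchy_convergent convergent_def by blast
  then have "(u, y) \<in> root_graph T"
    using closed_sequentially[OF root_graph_closed v tendsto_Pair[OF lim]] by blast
  then show ?thesis ..
qed

lemma specF_diff:
  assumes "a \<le> b"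
  shows "(norm ((cut T b - cut T a) \<odot> u))^2 = specF u b - specF u a"
proof -
  have "isproj (cut T b - cut T a)" by (intro isproj_diff cut_isproj cut_mono assms)
  from isproj_form[OF this, of u]
  have "(norm ((cut T b - cut T a) \<odot> u))^2 = inner (cut T b \<odot> u) u - inner (cut T a \<odot> u) u"
    by (simp add: inner_diff_left)
  then show ?thesis by (simp only: isproj_form[OF cut_isproj] specF_def)
qed

text \<open>For the last bound, Cauchy--Schwarz at v and u = h v gives |u|^2 \<le> b (u | v), so (u
  | v) is at least a^2 / b times |v|^2, and a^2 \<ge> (2 a - b) b because (a - b)^2 \<ge> 0. The
  linear constant 2 a - b also makes sense for b = 0.\<close>

lemma piece_bounds:
  assumes ab: "0 \<le> a" "a \<le> b" and m: "(v, u) \<in> root_graph T"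
    and E: "cut T b \<odot> v = v" "cut T a \<odot> v = 0"
  shows "a * norm v \<le> norm u" "norm u \<le> b * norm v"
    "inner u v \<le> b * (norm v)^2" "(2 * a - b) * (norm v)^2 \<le> inner u v"
proof -
  have b: "0 \<le> b" using ab by simp
  show lo: "a * norm v \<le> norm u"
    using cut_norm_lower[OF ab(1) m E(2)] by (cases "v = 0") auto
  show up: "norm u \<le> b * norm v" by (rule cut_norm_upper[OF b m E(1)])
  have "inner u v \<le> norm u * norm v" by (rule norm_cauchy_schwarz)
  also have "\<dots> \<le> b * norm v * norm v" by (intro mult_right_mono up) simp
  finally show "inner u v \<le> b * (norm v)^2" by (simp add: power2_eq_square)
  have "(v, cut T b \<odot> u) \<in> root_graph T" using root_graph_cut[OF m, of b] by (simp only: E(1))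
  then have fixed: "cut T b \<odot> u = u" by (rule linear_op_unique[OF root_graph_linear _ m])
  then obtain w where t: "(u, w) \<in> root_graph T" using cut_domain[OF b] by blast
  have form: "0 \<le> inner u v"
    using root_graph_positive m by (auto simp: positive_op_def inner_eq_Re_cinner)
  have "((norm u)^2)^2 \<le> inner u v * inner w u"
    by (rule positive_selfadjoint_cauchy_schwarz[OF self_adjoint_root_graph root_graph_positive m t])
  also have "\<dots> \<le> inner u v * (norm w * norm u)"
    by (intro mult_left_mono norm_cauchy_schwarz form)
  also have "\<dots> \<le> inner u v * ((b * norm u) * norm u)"
    by (intro mult_left_mono mult_right_mono form cut_norm_upper[OF b t fixed]) auto
  finally have "(norm u)^2 * (norm u)^2 \<le> (inner u v * b) * (norm u)^2"
    by (simp add: power2_eq_square mult.assoc)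
  note le = this
  have 1: "(norm u)^2 \<le> inner u v * b"
  proof (cases "u = 0")
    case False
    then have "0 < (norm u)^2" by simp
    then show ?thesis by (rule mult_right_le_imp_le[OF le])
  qed simp
  have "a^2 * (norm v)^2 \<le> (norm u)^2"
    using power_mono[OF lo, of 2] ab by (simp add: power_mult_distrib)
  with 1 have 2: "a^2 * (norm v)^2 \<le> inner u v * b" by simp
  show "(2 * a - b) * (norm v)^2 \<le> inner u v"
  proof (cases "b = 0")
    case True
    then show ?thesis using ab form by simp
  next
    case False
    then have b0: "0 < b" using b by simp
    have "((2 * a - b) * b) * (norm v)^2 \<le> a^2 * (norm v)^2"
    proof (rule mult_right_mono)
      have "0 \<le> (a - b)^2" by simp
      then show "(2 * a - b) * b \<le> a^2" by (simp add: power2_eq_square algebra_simps)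
    qed simp
    with 2 have "((2 * a - b) * (norm v)^2) * b \<le> inner u v * b" by (simp add: algebra_simps)
    then show ?thesis using b0 by simp
  qed
qed

lemma mu_measure_Ioc: "a \<le> b \<Longrightarrow> measure (mu u) {a<..b} = specF u b - specF u a"
  by (simp add: measure_def mu_Ioc specF_mono)

lemma indicator_Ioc_split:
  fixes f :: "real \<Rightarrow> real"
  assumes "a \<le> b" "b \<le> c"
  shows "indicator {a<..c} s * f s = indicator {a<..b} s * f s + indicator {b<..c} s * (f s :: real)"
  using assms by (auto simp: indicator_def)

text \<open>Both sides are additive over intervals and differ on (a, b] by at most 2 (f b - f a)
  times the mass of the interval. The Lipschitz bound makes this an error of second order, which
  bisection removes.\<close>

lemma interval_integral_eq:
  fixes f H m :: "real \<Rightarrow> real"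
  assumes M: "finite_measure M" "sets M = sets borel" and f: "f \<in> borel_measurable borel"
    and mono: "\<And>a b. 0 \<le> a \<Longrightarrow> a \<le> b \<Longrightarrow> f a \<le> f b"
    and lip: "\<And>a b. 0 \<le> a \<Longrightarrow> a \<le> b \<Longrightarrow> b \<le> B \<Longrightarrow> f b - f a \<le> L * (b - a)"
    and meas: "\<And>a b. a \<le> b \<Longrightarrow> measure M {a<..b} = m b - m a"
    and bd: "\<And>a b. 0 \<le> a \<Longrightarrow> a \<le> b \<Longrightarrow> b \<le> B \<Longrightarrow>
      (2 * f a - f b) * (m b - m a) \<le> H b - H a \<and> H b - H a \<le> f b * (m b - m a)"
    and ab: "0 \<le> a" "a \<le> b" "b \<le> B"
  shows "H b - H a = (\<integral>s. indicator {a<..b} s * f s \<partial>M)"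
proof -
  define G where "G a b = (H b - H a) - (\<integral>s. indicator {a<..b} s * f s \<partial>M)" for a b
  have fb: "\<And>s. s \<in> {a<..b} \<Longrightarrow> f a \<le> f s \<and> f s \<le> f b" if "0 \<le> a" for a b using that mono by auto
  note i = indicator_integral_bounds[OF M f, of "{_<.._}", OF _ fb]
  have "G a b = 0"
  proof (rule additive_interval_zero[where G = G and B = B and K = "2 * L" and m = m])
    fix a b c :: real assume abc: "0 \<le> a" "a \<le> b" "b \<le> c" "c \<le> B"
    have "(\<integral>s. indicator {a<..c} s * f s \<partial>M) = (\<integral>s. indicator {a<..b} s * f s + indicator {b<..c} s * f s \<partial>M)"
      by (rule Bochner_Integration.integral_cong[OF refl indicator_Ioc_split[OF abc(2,3)]])
    also have "\<dots> = (\<integral>s. indicator {a<..b} s * f s \<partial>M) + (\<integral>s. indicator {b<..c} s * f s \<partial>M)"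
      by (rule Bochner_Integration.integral_add; rule i(1)) (use abc in auto)
    finally show "G a c = G a b + G b c" by (simp add: G_def)
  next
    fix a b :: real assume ab: "0 \<le> a" "a \<le> b" "b \<le> B"
    have D: "0 \<le> m b - m a" using meas[OF ab(2)] measure_nonneg[of M "{a<..b}"] by simp
    have "f a * (m b - m a) \<le> (\<integral>s. indicator {a<..b} s * f s \<partial>M)" "(\<integral>s. indicator {a<..b} s * f s \<partial>M) \<le> f b * (m b - m a)"
      using i(2,3)[of a b] ab(1) by (simp_all add: meas[OF ab(2)])
    moreover have "0 \<le> (f b - f a) * (m b - m a)" using D mono[OF ab(1,2)] by simp
    ultimately have "\<bar>G a b\<bar> \<le> 2 * (f b - f a) * (m b - m a)"
      using bd[OF ab] unfolding abs_le_iff G_def by (auto simp: algebra_simps)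
    also have "\<dots> \<le> 2 * (L * (b - a)) * (m b - m a)" by (intro mult_right_mono mult_left_mono lip ab D) auto
    finally show "\<bar>G a b\<bar> \<le> 2 * L * (b - a) * (m b - m a)" by simp
  qed (use ab in auto)
  then show ?thesis by (simp add: G_def)
qed

text \<open>The two integral formulas, for s^2 and for s, below the level B, where y = h (cut_B v)
  exists for every v. Letting B grow yields the domain and the form of h.\<close>

lemma piece_integrals:
  assumes m: "(cut T B \<odot> v, y) \<in> root_graph T" and ab: "0 \<le> a" "a \<le> b" "b \<le> B"
  shows "specF y b - specF y a = (\<integral>s. indicator {a<..b} s * s^2 \<partial>mu v)"
    and "inner (cut T b \<odot> y) v - inner (cut T a \<odot> y) v = (\<integral>s. indicator {a<..b} s * s \<partial>mu v)"
proof -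
  have piece: "((cut T b - cut T a) \<odot> v, (cut T b - cut T a) \<odot> y) \<in> root_graph T"
    "cut T b \<odot> (cut T b - cut T a) \<odot> v = (cut T b - cut T a) \<odot> v"
    "cut T a \<odot> (cut T b - cut T a) \<odot> v = 0" if "a \<le> b" "b \<le> B" for a b
  proof -
    have "(cut T b \<odot> cut T B \<odot> v - cut T a \<odot> cut T B \<odot> v, cut T b \<odot> y - cut T a \<odot> y) \<in> root_graph T"
      by (intro linear_op_diff root_graph_linear root_graph_cut m)
    then show "((cut T b - cut T a) \<odot> v, (cut T b - cut T a) \<odot> y) \<in> root_graph T"
      using that by (simp add: cut_cut_apply)
  qed (use that in \<open>simp_all add: cut_cut_apply\<close>)
  have z: "(norm ((cut T b - cut T a) \<odot> v))^2 = specF v b - specF v a" if "a \<le> b" for a b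
    by (rule specF_diff[OF that])
  show "specF y b - specF y a = (\<integral>s. indicator {a<..b} s * s^2 \<partial>mu v)"
  proof (rule interval_integral_eq[OF finite_measure_mu sets_mu _ _ _ mu_measure_Ioc _ ab, where L = "2 * B"])
    fix a b :: real assume ab: "0 \<le> a" "a \<le> b" "b \<le> B"
    have "b^2 - a^2 = (b + a) * (b - a)" by (simp add: power2_eq_square algebra_simps)
    also have "\<dots> \<le> (2 * B) * (b - a)" using ab by (intro mult_right_mono) auto
    finally show "b^2 - a^2 \<le> 2 * B * (b - a)" .
    let ?u = "(cut T b - cut T a) \<odot> v"
    note bd = piece_bounds(1,2)[OF ab(1,2) piece[OF ab(2,3)]]
    have "a^2 * (norm ?u)^2 \<le> specF y b - specF y a" "specF y b - specF y a \<le> b^2 * (norm ?u)^2"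
      unfolding specF_diff[OF ab(2), symmetric] power_mult_distrib[symmetric]
      by (rule power_mono; use ab bd in simp)+
    moreover have "(2 * a^2 - b^2) * (norm ?u)^2 \<le> a^2 * (norm ?u)^2"
      using power_mono[OF ab(2,1), of 2] by (intro mult_right_mono) auto
    ultimately show "(2 * a^2 - b^2) * (specF v b - specF v a) \<le> specF y b - specF y a \<and>
        specF y b - specF y a \<le> b^2 * (specF v b - specF v a)" unfolding z[OF ab(2)] by linarith
  qed (auto intro: power_mono)
  show "inner (cut T b \<odot> y) v - inner (cut T a \<odot> y) v = (\<integral>s. indicator {a<..b} s * s \<partial>mu v)"
  proof (rule interval_integral_eq[OF finite_measure_mu sets_mu _ _ _ mu_measure_Ioc _ ab, where L = 1])
    fix a b :: real assume ab: "0 \<le> a" "a \<le> b" "b \<le> B"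
    let ?E = "cut T b - cut T a"
    have Ep: "isproj ?E" by (intro isproj_diff cut_isproj cut_mono ab)
    have "inner (?E \<odot> y) (?E \<odot> v) = inner (?E \<odot> ?E \<odot> y) v" by (rule isproj_inner[OF Ep, symmetric])
    also have "\<dots> = inner (cut T b \<odot> y) v - inner (cut T a \<odot> y) v"
      by (simp only: isproj_idem[OF Ep]) (simp add: inner_diff_left)
    finally show "(2 * a - b) * (specF v b - specF v a) \<le> inner (cut T b \<odot> y) v - inner (cut T a \<odot> y) v \<and>
        inner (cut T b \<odot> y) v - inner (cut T a \<odot> y) v \<le> b * (specF v b - specF v a)"
      using piece_bounds(3,4)[OF ab(1,2) piece[OF ab(2,3)]] by (simp only: z[OF ab(2)])
  qed auto
qed

lemma cut_fixed_of_graph: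
  assumes "(cut T b \<odot> u, v) \<in> root_graph T"
  shows "cut T b \<odot> v = v"
proof -
  have "(cut T b \<odot> u, cut T b \<odot> v) \<in> root_graph T" using root_graph_cut[OF assms, of b] by simp
  then show ?thesis by (rule linear_op_unique[OF root_graph_linear _ assms])
qed

lemma cut_zero_graph:
  assumes "(u, v) \<in> root_graph T" shows "cut T 0 \<odot> v = 0"
  using cut_norm_upper[of 0, OF _ root_graph_cut[OF assms, of 0]] by simp

lemma AE_mu_nonneg: "AE s in mu u. 0 \<le> s"
  by (rule AE_I[of _ _ "{..<0}"]) (auto simp: mu_neg)

lemma cut_graph_seq:
  obtains e where "\<And>n. (cut T (real n) \<odot> v, e n) \<in> root_graph T"
    "(\<lambda>n. ennreal ((norm (e n))^2)) \<longlonglongrightarrow> (\<integral>\<^sup>+s. ennreal (s^2) \<partial>mu v)"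
proof -
  have "\<forall>n. \<exists>w. (cut T (real n) \<odot> v, w) \<in> root_graph T"
  proof
    show "\<exists>w. (cut T (real n) \<odot> v, w) \<in> root_graph T" for n by (rule cut_domain[of "real n"]) simp_all
  qed
  from choice[OF this] obtain e where e: "\<And>n. (cut T (real n) \<odot> v, e n) \<in> root_graph T" by blast
  have en: "ennreal ((norm (e n))^2) = (\<integral>\<^sup>+s. ennreal (indicator {0<..real n} s * s^2) \<partial>mu v)" for n
  proof -
    have int: "integrable (mu v) (\<lambda>s. indicator {0<..real n} s * s^2)"
      by (rule indicator_integral_bounds(1)[OF finite_measure_mu sets_mu, where l = 0 and u = "(real n)^2"])
        (auto intro: power_mono)
    have "(norm (e n))^2 = (\<integral>s. indicator {0<..real n} s * s^2 \<partial>mu v)"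
      using piece_integrals(1)[OF e[of n], of 0 "real n"] cut_fixed_of_graph[OF e[of n]] cut_zero_graph[OF e[of n]]
      by (simp add: specF_def)
    then show ?thesis using nn_integral_eq_integral[OF int] by simp
  qed
  have "(\<lambda>n. \<integral>\<^sup>+s. ennreal (indicator {0<..real n} s * s^2) \<partial>mu v) \<longlonglongrightarrow> (\<integral>\<^sup>+s. ennreal (indicator {0<..} s * s^2) \<partial>mu v)"
  proof (rule nn_integral_LIMSEQ)
    show "incseq (\<lambda>n s. ennreal (indicator {0<..real n} s * s^2))"
      by (auto simp: incseq_def le_fun_def indicator_def intro!: ennreal_leI)
    show "(\<lambda>n. ennreal (indicator {0<..real n} s * s^2)) \<longlonglongrightarrow> ennreal (indicator {0<..} s * s^2)" for s
    proof (rule tendsto_eventually)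
      obtain N where "s \<le> real N" using real_arch_simple by blast
      then show "\<forall>\<^sub>F n in sequentially. ennreal (indicator {0<..real n} s * s^2) = ennreal (indicator {0<..} s * s^2)"
        unfolding eventually_sequentially by (intro exI[of _ N]) (auto simp: indicator_def)
    qed
  qed measurable
  also have "(\<integral>\<^sup>+s. ennreal (indicator {0<..} s * s^2) \<partial>mu v) = (\<integral>\<^sup>+s. ennreal (s^2) \<partial>mu v)"
    by (rule nn_integral_cong_AE) (use AE_mu_nonneg[of v] in \<open>auto elim!: eventually_mono simp: indicator_def\<close>)
  finally show ?thesis using that[OF e] by (simp only: en)
qed

text \<open>The squared norms of h (cut_n u) increase to the integral of s^2. If it is finite,
  Pythagoras makes these vectors Cauchy and closedness puts u into the domain.\<close>

lemma root_graph_domain: "u \<in> Domain (root_graph T) \<longleftrightarrow> (\<integral>\<^sup>+s. ennreal (s^2) \<partial>mu u) < \<infinity>"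
proof -
  obtain e where e: "\<And>n. (cut T (real n) \<odot> u, e n) \<in> root_graph T"
    and lim: "(\<lambda>n. ennreal ((norm (e n))^2)) \<longlonglongrightarrow> (\<integral>\<^sup>+s. ennreal (s^2) \<partial>mu u)" using cut_graph_seq by blast
  show ?thesis
  proof
    assume "u \<in> Domain (root_graph T)"
    then obtain v where m: "(u, v) \<in> root_graph T" by blast
    have "e n = cut T (real n) \<odot> v" for n
      by (rule linear_op_unique[OF root_graph_linear e root_graph_cut[OF m]])
    then have "norm (e n) \<le> norm v" for n using isproj_norm[OF cut_isproj] by metis
    then have "ennreal ((norm (e n))^2) \<le> ennreal ((norm v)^2)" for n
      by (intro ennreal_leI power_mono) auto
    then have "(\<integral>\<^sup>+s. ennreal (s^2) \<partial>mu u) \<le> ennreal ((norm v)^2)"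
      by (intro LIMSEQ_le_const2[OF lim]) auto
    then show "(\<integral>\<^sup>+s. ennreal (s^2) \<partial>mu u) < \<infinity>" by (auto intro: le_less_trans)
  next
    assume fin: "(\<integral>\<^sup>+s. ennreal (s^2) \<partial>mu u) < \<infinity>"
    then obtain r where r: "0 \<le> r" "(\<integral>\<^sup>+s. ennreal (s^2) \<partial>mu u) = ennreal r"
      by (metis infinity_ennreal_def ennreal_cases less_irrefl)
    have lim': "(\<lambda>n. (norm (e n))^2) \<longlonglongrightarrow> r"
      using lim r by (simp add: tendsto_ennreal_iff)
    then have C: "Cauchy (\<lambda>n. (norm (e n))^2)" by (rule LIMSEQ_imp_Cauchy)
    have en: "e n = cut T (real n) \<odot> e m" if "n \<le> m" for n m
    proof (rule linear_op_unique[OF root_graph_linear e])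
      show "(cut T (real n) \<odot> u, cut T (real n) \<odot> e m) \<in> root_graph T"
        using root_graph_cut[OF e[of m], of "real n"] that by (simp add: cut_cut_apply)
    qed
    have d: "(norm (e m - e n))^2 = (norm (e m))^2 - (norm (e n))^2" if "n \<le> m" for n m
      using isproj_pythagoras[OF cut_isproj[of "real n"], of "e m"] en[OF that] by simp
    have "Cauchy e"
    proof (rule metric_CauchyI)
      fix \<epsilon> :: real assume "0 < \<epsilon>"
      then have "0 < \<epsilon>^2" by simp
      from metric_CauchyD[OF C this] obtain M where
        M: "\<And>m n. m \<ge> M \<Longrightarrow> n \<ge> M \<Longrightarrow> dist ((norm (e m))^2) ((norm (e n))^2) < \<epsilon>^2" by blast
      have main: "dist (e m) (e n) < \<epsilon>" if "M \<le> n" "n \<le> m" for m n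
      proof -
        have "(norm (e m - e n))^2 < \<epsilon>^2" using M[of m n] that d[OF that(2)] by (simp add: dist_real_def)
        then show ?thesis using \<open>0 < \<epsilon>\<close> by (simp add: dist_norm power_less_imp_less_base)
      qed
      show "\<exists>M. \<forall>m\<ge>M. \<forall>n\<ge>M. dist (e m) (e n) < \<epsilon>"
        using main by (intro exI[of _ M]) (metis dist_commute nle_le)
    qed
    then obtain v where "e \<longlonglongrightarrow> v" using Cauchy_convergent convergent_def by blast
    then have "(u, v) \<in> root_graph T"
      using closed_sequentially[OF root_graph_closed e tendsto_Pair[OF cut_limit]] by blast
    then show "u \<in> Domain (root_graph T)" by blast
  qed
qed

lemma integrable_of_square:
  fixes M :: "real measure"
  assumes "finite_measure M" "sets M = sets borel" "(\<integral>\<^sup>+s. ennreal (s^2) \<partial>M) < \<infinity>"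
  shows "integrable M (\<lambda>s. s)"
proof -
  interpret finite_measure M by fact
  have [measurable_cong]: "sets M = sets borel" by fact
  have "integrable M (\<lambda>s. s^2)"
    by (rule integrableI_bounded) (use assms(3) in \<open>simp_all, measurable\<close>)
  then have "integrable M (\<lambda>s. 1 + s^2)" by simp
  then show ?thesis
  proof (rule Bochner_Integration.integrable_bound)
    have "\<bar>s\<bar> \<le> 1 + s^2" for s :: real
    proof -
      have "0 \<le> (\<bar>s\<bar> - 1/2)^2" by simp
      then show ?thesis by (simp add: power2_diff power_divide)
    qed
    then show "AE s in M. norm s \<le> norm (1 + s^2)" by (intro AE_I2) (auto intro: order_trans)
  qed measurable
qed

lemma root_graph_form:
  assumes m: "(u, v) \<in> root_graph T"
  shows "inner v u = (\<integral>s. s \<partial>mu u)"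
proof (rule LIMSEQ_unique)
  have e: "(cut T (real n) \<odot> u, cut T (real n) \<odot> v) \<in> root_graph T" for n by (rule root_graph_cut[OF m])
  have eq: "inner (cut T (real n) \<odot> v) u = (\<integral>s. indicator {0<..real n} s * s \<partial>mu u)" for n
    using piece_integrals(2)[OF e[of n], of 0 "real n"] cut_zero_graph[OF m] by (simp add: cut_cut_apply)
  show "(\<lambda>n. inner (cut T (real n) \<odot> v) u) \<longlonglongrightarrow> inner v u"
    by (intro tendsto_inner cut_limit tendsto_const)
  have int: "integrable (mu u) (\<lambda>s. s)"
    by (rule integrable_of_square[OF finite_measure_mu sets_mu]) (use m root_graph_domain in blast)
  have "(\<lambda>n. \<integral>s. indicator {0<..real n} s * s \<partial>mu u) \<longlonglongrightarrow> (\<integral>s. s \<partial>mu u)"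
  proof (rule integral_dominated_convergence[where w = "\<lambda>s. \<bar>s\<bar>"])
    show "integrable (mu u) (\<lambda>s. \<bar>s\<bar>)" using int by simp
    show "AE s in mu u. (\<lambda>n. indicator {0<..real n} s * s) \<longlonglongrightarrow> s"
      using AE_mu_nonneg
    proof (rule eventually_mono)
      fix s :: real assume "0 \<le> s"
      show "(\<lambda>n. indicator {0<..real n} s * s) \<longlonglongrightarrow> s"
      proof (rule tendsto_eventually)
        obtain N where "s \<le> real N" using real_arch_simple by blast
        then show "\<forall>\<^sub>F n in sequentially. indicator {0<..real n} s * s = s"
          unfolding eventually_sequentially using \<open>0 \<le> s\<close> by (intro exI[of _ N]) (auto simp: indicator_def)
      qed
    qed
    show "AE s in mu u. norm (indicator {0<..real n} s * s) \<le> \<bar>s\<bar>" for n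
      by (intro AE_I2) (auto simp: indicator_def)
  qed measurable
  then show "(\<lambda>n. inner (cut T (real n) \<odot> v) u) \<longlonglongrightarrow> (\<integral>s. s \<partial>mu u)" by (simp add: eq)
qed

lemma root_graph_spectral: "spectral_measure_of (\<lambda>B. graph (spm B)) (root_graph T)"
proof -
  have "cinner v u = complex_of_real (\<integral>s. s \<partial>mu u)" if "(u, v) \<in> root_graph T" for u v
    using root_graph_form[OF that] root_graph_positive that
    by (auto simp: positive_op_def complex_eq_iff inner_eq_Re_cinner)
  then show ?thesis
    unfolding spectral_measure_of_def scalar_spectral_measure_spm
    using spm_pvm root_graph_domain by auto
qed

end

text \<open>Conversely, an arbitrary spectral measure of \<open>|x|\<close> has \<open>P(s,\<infinity>) = 1 - cut T s\<close>, so that the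
  choice in \<^const>\<open>spectral_measure\<close> does not matter for the singular values.\<close>

locale root_spectral = injective_contraction T for T :: "'h::chilbert_space bop" +
  fixes p :: "real set \<Rightarrow> 'h bop"
  assumes p_isproj: "B \<in> sets borel \<Longrightarrow> isproj (p B)"
    and p_empty: "p {} = 0" and p_UNIV: "p UNIV = 1"
    and p_Int: "A \<in> sets borel \<Longrightarrow> B \<in> sets borel \<Longrightarrow> p (A \<inter> B) = p A * p B"
    and p_sums: "range D \<subseteq> sets borel \<Longrightarrow> disjoint_family (D :: nat \<Rightarrow> real set) \<Longrightarrow>
      (\<lambda>n. p (D n) \<odot> \<xi>) sums (p (\<Union>n. D n) \<odot> \<xi>)"
    and p_domain: "\<xi> \<in> Domain (root_graph T) \<longleftrightarrow>
      (\<integral>\<^sup>+s. ennreal (s^2) \<partial>measure_of UNIV (sets borel) (\<lambda>B. ennreal ((norm (p B \<odot> \<xi>))^2))) < \<infinity>"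
    and p_form: "(\<xi>, \<eta>) \<in> root_graph T \<Longrightarrow>
      inner \<eta> \<xi> = (\<integral>s. s \<partial>measure_of UNIV (sets borel) (\<lambda>B. ennreal ((norm (p B \<odot> \<xi>))^2)))"
begin

definition nu :: "'h \<Rightarrow> real measure"
  where "nu u = measure_of UNIV (sets borel) (\<lambda>B. ennreal ((norm (p B \<odot> u))^2))"

lemma sets_nu [simp, measurable_cong]: "sets (nu u) = sets borel" and space_nu [simp]: "space (nu u) = UNIV"
  by (simp_all add: nu_def sets.sigma_sets_eq[of borel, simplified])

lemma nu_emeasure:
  assumes "B \<in> sets borel" shows "emeasure (nu u) B = ennreal ((norm (p B \<odot> u))^2)"
proof (rule emeasure_measure_of[OF nu_def])
  show "countably_additive (sets (nu u)) (\<lambda>B. ennreal ((norm (p B \<odot> u))^2))"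
  proof (rule countably_additiveI)
    fix A :: "nat \<Rightarrow> real set"
    assume A: "range A \<subseteq> sets (nu u)" "disjoint_family A"
    then have Ab: "range A \<subseteq> sets borel" by simp
    have "(\<lambda>n. inner (p (A n) \<odot> u) u) sums inner (p (\<Union>n. A n) \<odot> u) u"
      by (rule bounded_linear.sums[OF bounded_linear_inner_left p_sums[OF Ab A(2)]])
    moreover have "A n \<in> sets borel" "(\<Union>n. A n) \<in> sets borel" for n using Ab by auto
    ultimately have "(\<lambda>n. (norm (p (A n) \<odot> u))^2) sums (norm (p (\<Union>n. A n) \<odot> u))^2"
      by (simp add: isproj_form p_isproj)
    then show "(\<Sum>n. ennreal ((norm (p (A n) \<odot> u))^2)) = ennreal ((norm (p (\<Union>n. A n) \<odot> u))^2)"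
      by (intro suminf_ennreal_eq) auto
  qed
qed (use assms in \<open>auto simp: positive_def p_empty\<close>)

lemma nu_UNIV: "emeasure (nu u) UNIV = ennreal ((norm u)^2)"
  by (simp add: nu_emeasure p_UNIV)

lemma nu_finite: "finite_measure (nu u)"
  by standard (simp add: nu_UNIV)

lemma nu_measure_UNIV: "measure (nu u) UNIV = (norm u)^2"
  by (simp add: measure_def nu_UNIV)

lemma p_compl:
  assumes B: "B \<in> sets borel" shows "p (- B) = 1 - p B"
proof (rule proj_eq_norm)
  show "isproj (p (- B))" "isproj (1 - p B)" using B by (auto intro: p_isproj isproj_compl)
  fix u
  have "emeasure (nu u) (space (nu u) - B) = emeasure (nu u) (space (nu u)) - emeasure (nu u) B"
    by (rule emeasure_compl) (use B in \<open>auto simp: nu_emeasure\<close>)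
  then have "ennreal ((norm (p (- B) \<odot> u))^2) = ennreal ((norm u)^2 - (norm (p B \<odot> u))^2)"
    using B by (simp add: nu_UNIV nu_emeasure Compl_eq_Diff_UNIV[symmetric] ennreal_minus)
  also have "(norm u)^2 - (norm (p B \<odot> u))^2 = (norm (u - p B \<odot> u))^2"
    using isproj_pythagoras[OF p_isproj[OF B], of u] by simp
  finally show "norm (p (- B) \<odot> u) = norm ((1 - p B) \<odot> u)" by (simp add: power2_eq_iff_nonneg)
qed

lemma nu_density:
  assumes B: "B \<in> sets borel" shows "nu (p B \<odot> u) = density (nu u) (indicator B)"
proof (rule measure_eqI)
  fix A assume "A \<in> sets (nu (p B \<odot> u))"
  then have A: "A \<in> sets borel" by simp
  have "p A \<odot> p B \<odot> u = p (A \<inter> B) \<odot> u" by (simp add: p_Int A B)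
  then have "emeasure (nu (p B \<odot> u)) A = emeasure (nu u) (A \<inter> B)"
    by (simp only: nu_emeasure[OF A] nu_emeasure[OF sets.Int[OF A B]])
  also have "\<dots> = (\<integral>\<^sup>+s. indicator B s * indicator A s \<partial>nu u)"
    using A B by (simp add: mult.commute flip: nn_integral_indicator indicator_inter_arith)
  also have "\<dots> = emeasure (density (nu u) (indicator B)) A"
    using A B by (subst emeasure_density) auto
  finally show "emeasure (nu (p B \<odot> u)) A = emeasure (density (nu u) (indicator B)) A" .
qed simp

lemma domain_iff: "u \<in> Domain (root_graph T) \<longleftrightarrow> (\<integral>\<^sup>+s. ennreal (s^2) \<partial>nu u) < \<infinity>"
  unfolding nu_def by (rule p_domain)

lemma form_eq: "(u, v) \<in> root_graph T \<Longrightarrow> inner v u = (\<integral>s. s \<partial>nu u)"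
  unfolding nu_def by (rule p_form)

lemma nu_integrable: "u \<in> Domain (root_graph T) \<Longrightarrow> integrable (nu u) (\<lambda>s. s)"
  by (rule integrable_of_square[OF nu_finite sets_nu]) (simp add: domain_iff)

lemma domain_p:
  assumes B: "B \<in> sets borel" and d: "u \<in> Domain (root_graph T)"
  shows "p B \<odot> u \<in> Domain (root_graph T)"
proof -
  have "(\<integral>\<^sup>+s. ennreal (s^2) \<partial>nu (p B \<odot> u)) = (\<integral>\<^sup>+s. indicator B s * ennreal (s^2) \<partial>nu u)"
    unfolding nu_density[OF B] by (rule nn_integral_density) (use B in auto)
  also have "\<dots> \<le> (\<integral>\<^sup>+s. ennreal (s^2) \<partial>nu u)"
    by (rule nn_integral_mono) (auto simp: indicator_def)
  finally show ?thesis using d unfolding domain_iff by (rule le_less_trans)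
qed

lemma rg_sym: "(u, v) \<in> root_graph T \<Longrightarrow> (u', v') \<in> root_graph T \<Longrightarrow> inner v u' = inner u v'"
  using op_adj_iff[OF root_graph_linear, of u' v'] root_graph_adj by auto

text \<open>The integral defining the form at u1 + u2 splits over B and its complement into the
  forms at u1 and u2. So the two mixed terms, which are equal by symmetry, add up to 0.\<close>

lemma split_orthogonal:
  assumes B: "B \<in> sets borel" and m: "(u1, v1) \<in> root_graph T" "(u2, v2) \<in> root_graph T"
    and p: "p B \<odot> u1 = u1" "p B \<odot> u2 = 0"
  shows "inner v1 u2 = 0"
proof -
  have m3: "(u1 + u2, v1 + v2) \<in> root_graph T" by (intro linear_op_add root_graph_linear m)
  have 1: "p B \<odot> (u1 + u2) = u1" "p (- B) \<odot> (u1 + u2) = u2" using p by (simp_all add: p_compl B)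
  have int: "integrable (nu (u1 + u2)) (\<lambda>s. s)" using m3 by (intro nu_integrable) blast
  have i: "integrable (nu (u1 + u2)) (\<lambda>s. indicator A s * s)" if "A \<in> sets borel" for A
    using integrable_mult_indicator[OF _ int, of A] that by simp
  have d: "(\<integral>s. s \<partial>nu (p A \<odot> (u1 + u2))) = (\<integral>s. indicator A s * s \<partial>nu (u1 + u2))" if A: "A \<in> sets borel" for A
  proof -
    have "(\<integral>s. s \<partial>density (nu (u1 + u2)) (\<lambda>s. ennreal (indicator A s))) = (\<integral>s. indicator A s *\<^sub>R s \<partial>nu (u1 + u2))"
      by (rule integral_density) (use A in auto)
    then show ?thesis by (simp add: nu_density[OF A] ennreal_indicator del: bapply_add)
  qed
  have "inner (v1 + v2) (u1 + u2) = (\<integral>s. s \<partial>nu (u1 + u2))" by (rule form_eq[OF m3])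
  also have "\<dots> = (\<integral>s. indicator B s * s + indicator (- B) s * s \<partial>nu (u1 + u2))"
    by (intro Bochner_Integration.integral_cong) (auto simp: indicator_def)
  also have "\<dots> = (\<integral>s. indicator B s * s \<partial>nu (u1 + u2)) + (\<integral>s. indicator (- B) s * s \<partial>nu (u1 + u2))"
    by (rule Bochner_Integration.integral_add) (use B i in auto)
  also have "\<dots> = (\<integral>s. s \<partial>nu u1) + (\<integral>s. s \<partial>nu u2)"
    using d[OF B] d[of "- B"] B unfolding 1 by simp
  also have "\<dots> = inner v1 u1 + inner v2 u2" by (simp add: form_eq[OF m(1)] form_eq[OF m(2)])
  finally have "inner v1 u2 + inner v2 u1 = 0" by (simp add: inner_add_left inner_add_right)
  then show ?thesis using rg_sym[OF m(2,1)] by (simp add: inner_commute)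
qed

text \<open>Splitting u by \<open>p B\<close> splits y as y1 + y2. By
  \<open>split_orthogonal\<close>, tested on the dense domain, y1 lies in the range of
  \<open>p B\<close> and y2 in its kernel.\<close>

lemma p_graph:
  assumes B: "B \<in> sets borel" and m: "(u, y) \<in> root_graph T"
  shows "(p B \<odot> u, p B \<odot> y) \<in> root_graph T"
proof -
  have pB: "isproj (p B)" by (rule p_isproj[OF B])
  obtain y1 where e1: "(p B \<odot> u, y1) \<in> root_graph T" using domain_p[OF B, of u] m by blast
  define y2 where "y2 = y - y1"
  have e2: "(u - p B \<odot> u, y2) \<in> root_graph T"
    unfolding y2_def by (intro linear_op_diff root_graph_linear m e1)
  have "y1 - p B \<odot> y1 = 0"
  proof (rule dense_orthogonal_zero[OF root_graph_dense])
    fix v assume v: "v \<in> Domain (root_graph T)"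
    then obtain w w' where w: "(v, w) \<in> root_graph T" "(p B \<odot> v, w') \<in> root_graph T"
      using domain_p[OF B, of v] by blast
    have "(v - p B \<odot> v, w - w') \<in> root_graph T" by (intro linear_op_diff root_graph_linear w)
    then have "inner y1 (v - p B \<odot> v) = 0"
      by (rule split_orthogonal[OF B e1]) (use pB in auto)
    then show "inner v (y1 - p B \<odot> y1) = 0"
      using isproj_inner[OF pB, of v y1] by (simp add: inner_diff_left inner_diff_right inner_commute)
  qed
  moreover have "p B \<odot> y2 = 0"
  proof (rule dense_orthogonal_zero[OF root_graph_dense])
    fix v assume v: "v \<in> Domain (root_graph T)"
    then obtain w where w: "(p B \<odot> v, w) \<in> root_graph T" using domain_p[OF B, of v] by blast
    have "inner w (u - p B \<odot> u) = 0"
      by (rule split_orthogonal[OF B w e2]) (use pB in auto)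
    then have "inner (p B \<odot> v) y2 = 0" using rg_sym[OF w e2] by simp
    then show "inner v (p B \<odot> y2) = 0" by (simp add: isproj_inner[OF pB])
  qed
  ultimately have "p B \<odot> y = y1" by (simp add: y2_def)
  then show ?thesis using e1 by simp
qed

lemma rg_nonneg: "(u, v) \<in> root_graph T \<Longrightarrow> 0 \<le> inner v u"
  using root_graph_positive by (auto simp: positive_op_def inner_eq_Re_cinner)

lemma AE_nu:
  assumes B: "B \<in> sets borel" and z: "p B \<odot> u = u" shows "AE s in nu u. s \<in> B"
proof (rule AE_I[of _ _ "- B"])
  have "p (- B) \<odot> u = 0" using z by (simp add: p_compl B)
  then show "emeasure (nu u) (- B) = 0" using B by (simp add: nu_emeasure)
qed (use B in auto)

lemma nu_zero: "AE s in nu u. False \<Longrightarrow> u = 0"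
proof -
  assume "AE s in nu u. False"
  then have "emeasure (nu u) UNIV = 0"
    using AE_iff_measurable[of UNIV "nu u" "\<lambda>_. False"] by simp
  then show ?thesis by (simp add: nu_UNIV)
qed

text \<open>On a vector of this range the form of h is an integral over negative s, yet h is
  positive; so the measure is carried by the empty set.\<close>

lemma p_neg: "p {..<0} = 0"
proof (rule bop_eqI)
  fix z
  have pB: "isproj (p {..<0})" by (rule p_isproj) simp
  have "p {..<0} \<odot> z = 0"
  proof (rule dense_orthogonal_zero[OF root_graph_dense])
    fix v assume "v \<in> Domain (root_graph T)"
    then obtain w where m: "(p {..<0} \<odot> v, w) \<in> root_graph T" using domain_p[of "{..<0}" v] by auto
    let ?u = "p {..<0} \<odot> v"
    have AE: "AE s in nu ?u. s < 0" using AE_nu[of "{..<0}" ?u] pB by simp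
    have int: "integrable (nu ?u) (\<lambda>s. s)" using m by (intro nu_integrable) blast
    have "0 \<le> (\<integral>s. s \<partial>nu ?u)" using rg_nonneg[OF m] form_eq[OF m] by simp
    moreover have "0 \<le> (\<integral>s. - s \<partial>nu ?u)" by (rule integral_nonneg_AE) (use AE in auto)
    ultimately have "(\<integral>s. - s \<partial>nu ?u) = 0" by simp
    moreover have "(\<integral>s. - s \<partial>nu ?u) = 0 \<longleftrightarrow> (AE s in nu ?u. - s = 0)"
      by (rule integral_nonneg_eq_0_iff_AE) (use AE int in auto)
    ultimately have "AE s in nu ?u. - s = 0" by simp
    with AE have "AE s in nu ?u. False" by eventually_elim simp
    then have "?u = 0" by (rule nu_zero)
    then show "inner v (p {..<0} \<odot> z) = 0" using isproj_inner[OF pB, of v z] by simp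
  qed
  then show "p {..<0} \<odot> z = 0 \<odot> z" by simp
qed

text \<open>The measure determines only the form of h, not its norm. But v = h u lies in the same
  range and again in the domain, so Cauchy--Schwarz gives |v|^4 \<le> (s |u|^2) (s |v|^2).\<close>

lemma p_atMost_graph:
  assumes s: "0 \<le> s" and z: "p {..s} \<odot> u = u"
  shows "\<exists>v. (u, v) \<in> root_graph T \<and> norm v \<le> s * norm u"
proof -
  have AE: "AE r in nu u. 0 \<le> r \<and> r \<le> s" if "p {..s} \<odot> u = u" for u
  proof -
    have "p (- {..<0}) = 1" using p_compl[of "{..<0}"] p_neg by simp
    then have 1: "AE r in nu u. r \<in> - {..<0}" by (intro AE_nu) auto
    have 2: "AE r in nu u. r \<in> {..s}" by (rule AE_nu[OF _ that]) simp
    show ?thesis by (rule AE_mp[OF 1 AE_mp[OF 2]]) (rule AE_I2, auto)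
  qed
  have form: "inner v u \<le> s * (norm u)^2" if "(u, v) \<in> root_graph T" "p {..s} \<odot> u = u" for u v
  proof -
    interpret finite_measure "nu u" by (rule nu_finite)
    have "(\<integral>r. r \<partial>nu u) \<le> (\<integral>r. s \<partial>nu u)"
      by (rule integral_mono_AE) (use AE[OF that(2)] that(1) in \<open>auto intro!: nu_integrable\<close>)
    then show ?thesis using form_eq[OF that(1)] by (simp add: nu_measure_UNIV mult.commute)
  qed
  have "(\<integral>\<^sup>+r. ennreal (r^2) \<partial>nu u) \<le> (\<integral>\<^sup>+r. ennreal (s^2) \<partial>nu u)"
    by (rule nn_integral_mono_AE, rule eventually_mono[OF AE[OF z]]) (auto intro!: ennreal_leI power_mono)
  also have "\<dots> < \<infinity>" by (simp add: nu_UNIV ennreal_mult_less_top)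
  finally obtain v where m: "(u, v) \<in> root_graph T" using domain_iff by blast
  have "(u, p {..s} \<odot> v) \<in> root_graph T" using p_graph[OF _ m, of "{..s}"] z by simp
  then have pe: "p {..s} \<odot> v = v" using linear_op_unique[OF root_graph_linear _ m] by blast
  have "(\<integral>\<^sup>+r. ennreal (r^2) \<partial>nu v) \<le> (\<integral>\<^sup>+r. ennreal (s^2) \<partial>nu v)"
    by (rule nn_integral_mono_AE, rule eventually_mono[OF AE[OF pe]]) (auto intro!: ennreal_leI power_mono)
  also have "\<dots> < \<infinity>" by (simp add: nu_UNIV ennreal_mult_less_top)
  finally obtain w where m2: "(v, w) \<in> root_graph T" using domain_iff by blast
  have "((norm v)^2)^2 \<le> inner v u * inner w v"
    by (rule positive_selfadjoint_cauchy_schwarz[OF self_adjoint_root_graph root_graph_positive m m2])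
  also have "\<dots> \<le> (s * (norm u)^2) * (s * (norm v)^2)"
    by (intro mult_mono form m m2 z pe rg_nonneg mult_nonneg_nonneg s) auto
  finally have le: "(norm v)^2 * (norm v)^2 \<le> (s * norm u)^2 * (norm v)^2"
    by (simp add: power2_eq_square ac_simps)
  have "norm v \<le> s * norm u"
  proof (cases "v = 0")
    case False
    then have "0 < (norm v)^2" by simp
    then have "(norm v)^2 \<le> (s * norm u)^2" by (rule mult_right_le_imp_le[OF le])
    then show ?thesis by (rule power2_le_imp_le) (use s in simp)
  qed (use s in simp)
  then show ?thesis using m by blast
qed

lemma p_greaterThan_graph:
  assumes s: "0 \<le> s" and z: "p {s<..} \<odot> u = u" and m: "(u, v) \<in> root_graph T" and n: "u \<noteq> 0"
  shows "s * norm u < norm v"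
proof (rule ccontr)
  assume "\<not> ?thesis"
  then have le: "norm v \<le> s * norm u" by simp
  interpret finite_measure "nu u" by (rule nu_finite)
  have AE: "AE r in nu u. s < r" using AE_nu[OF _ z] by simp
  have int: "integrable (nu u) (\<lambda>r. r - s)" using m by (intro Bochner_Integration.integrable_diff nu_integrable) auto
  have "inner v u \<le> norm v * norm u" by (rule norm_cauchy_schwarz)
  also have "\<dots> \<le> s * norm u * norm u" by (rule mult_right_mono[OF le]) simp
  finally have "inner v u \<le> s * (norm u)^2" by (simp add: power2_eq_square)
  moreover have "(\<integral>r. r - s \<partial>nu u) = inner v u - s * (norm u)^2"
  proof -
    have "(\<integral>r. r - s \<partial>nu u) = (\<integral>r. r \<partial>nu u) - (\<integral>r. s \<partial>nu u)"
      by (rule Bochner_Integration.integral_diff) (use m in \<open>auto intro!: nu_integrable\<close>)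
    then show ?thesis by (simp add: form_eq[OF m] nu_measure_UNIV mult.commute)
  qed
  moreover have "0 \<le> (\<integral>r. r - s \<partial>nu u)" by (rule integral_nonneg_AE) (use AE in auto)
  ultimately have "(\<integral>r. r - s \<partial>nu u) = 0" by simp
  moreover have "(\<integral>r. r - s \<partial>nu u) = 0 \<longleftrightarrow> (AE r in nu u. r - s = 0)"
    by (rule integral_nonneg_eq_0_iff_AE[OF int]) (use AE in auto)
  ultimately have "AE r in nu u. r - s = 0" by simp
  with AE have "AE r in nu u. False" by eventually_elim simp
  then show False using n nu_zero by blast
qed

text \<open>Both projections commute. On the range common to e and c the bounds |h \<zeta>| \<le> s
  |\<zeta>| and |h \<zeta>| > s |\<zeta>| collide, and likewise on the range common to the two
  complements; hence e = 1 - c.\<close>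

lemma p_greaterThan:
  assumes s: "0 \<le> s" shows "p {s<..} = 1 - cut T s"
proof -
  define e where "e = p {s<..}"
  define c where "c = cut T s"
  have e: "isproj e" by (simp add: e_def p_isproj)
  have c: "isproj c" by (simp add: c_def)
  have ec: "p {..s} = 1 - e" using p_compl[of "{s<..}"] by (simp add: e_def Compl_greaterThan)
  have "e * T = T * e"
  proof (rule bop_eqI)
    fix z
    have "(T \<odot> z, z - T \<odot> z) \<in> op_times (root_graph T) (root_graph T)" by (simp add: root_graph_square)
    then obtain w where w: "(T \<odot> z, w) \<in> root_graph T" "(w, z - T \<odot> z) \<in> root_graph T"
      by (auto simp: op_times_def)
    have "(e \<odot> T \<odot> z, e \<odot> w) \<in> root_graph T" "(e \<odot> w, e \<odot> (z - T \<odot> z)) \<in> root_graph T"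
      unfolding e_def by (rule p_graph; use w in simp)+
    then have "(e \<odot> T \<odot> z, e \<odot> (z - T \<odot> z)) \<in> op_times (root_graph T) (root_graph T)"
      by (auto simp: op_times_def)
    then show "(e * T) \<odot> z = (T * e) \<odot> z" by (simp add: root_graph_square)
  qed
  then have com: "e * c = c * e" unfolding c_def by (intro cut_commute) (simp_all add: isprojD[OF e])
  have com': "e \<odot> c \<odot> z = c \<odot> e \<odot> z" for z
  proof -
    have "(e * c) \<odot> z = (c * e) \<odot> z" by (simp only: com)
    then show ?thesis by (simp only: bop_apply)
  qed
  have 1: "e * c = 0"
  proof (rule bop_eqI)
    fix z
    define \<zeta> where "\<zeta> = e \<odot> c \<odot> z"
    have z: "e \<odot> \<zeta> = \<zeta>" "c \<odot> \<zeta> = \<zeta>" using e c by (simp_all add: \<zeta>_def com')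
    obtain u where m: "(\<zeta>, u) \<in> root_graph T" using cut_domain[OF s, of \<zeta>] z by (auto simp: c_def)
    have "norm u \<le> s * norm \<zeta>" by (rule cut_norm_upper[OF s m]) (use z in \<open>simp add: c_def\<close>)
    then have "\<zeta> = 0" using p_greaterThan_graph[OF s _ m] z by (fastforce simp: e_def)
    then show "(e * c) \<odot> z = 0 \<odot> z" by (simp add: \<zeta>_def)
  qed
  have 2: "(1 - e) * (1 - c) = 0"
  proof (rule bop_eqI)
    fix z
    define \<zeta> where "\<zeta> = (1 - e) \<odot> (1 - c) \<odot> z"
    have z: "(1 - e) \<odot> \<zeta> = \<zeta>" "c \<odot> \<zeta> = 0" using e c by (simp_all add: \<zeta>_def com')
    obtain u where m: "(\<zeta>, u) \<in> root_graph T" "norm u \<le> s * norm \<zeta>"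
      using p_atMost_graph[OF s, of \<zeta>] z(1) unfolding ec by blast
    have "\<zeta> = 0" using cut_norm_lower[OF s m(1)] z m(2) by (fastforce simp: c_def)
    then show "((1 - e) * (1 - c)) \<odot> z = 0 \<odot> z" by (simp add: \<zeta>_def)
  qed
  have "1 - e - c + e * c = 0" using 2 by (simp add: algebra_simps)
  then have "1 - e - c = 0" using 1 by simp
  then show ?thesis by (simp add: e_def c_def algebra_simps)
qed

end

lemma (in injective_contraction) spectral_measure_greaterThan:
  assumes P: "spectral_measure_of P (root_graph T)" and s: "0 \<le> s"
  shows "P {s<..} = graph (1 - cut T s)"
proof -
  have pvm: "projection_valued_measure P" using P by (simp add: spectral_measure_of_def)
  have "\<forall>B. \<exists>p. B \<in> sets borel \<longrightarrow> isproj p \<and> P B = graph p"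
    using pvm by (auto simp: projection_valued_measure_def projection_op_iff)
  from choice[OF this] obtain p where p: "\<And>B. B \<in> sets borel \<Longrightarrow> isproj (p B) \<and> P B = graph (p B)" by blast
  have sc: "scalar_spectral_measure P u = measure_of UNIV (sets borel) (\<lambda>B. ennreal ((norm (p B \<odot> u))^2))" for u
    unfolding scalar_spectral_measure_def
    by (rule measure_of_eq) (auto simp: p sets.sigma_sets_eq[of borel, simplified])
  interpret root_spectral T p
  proof unfold_locales
    show "isproj (p B)" if "B \<in> sets borel" for B using p[OF that] by simp
    show "p {} = 0" using pvm p[of "{}"] by (simp add: projection_valued_measure_def op_zero_graph)
    show "p UNIV = 1" using pvm p[of UNIV] by (simp add: projection_valued_measure_def Id_graph)
    show "p (A \<inter> B) = p A * p B" if "A \<in> sets borel" "B \<in> sets borel" for A B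
      using pvm p[OF that(1)] p[OF that(2)] p[OF sets.Int[OF that]] that
      by (simp add: projection_valued_measure_def)
    show "(\<lambda>n. p (A n) \<odot> u) sums (p (\<Union>n. A n) \<odot> u)"
      if A: "range A \<subseteq> sets borel" "disjoint_family A" for A :: "nat \<Rightarrow> real set" and u
    proof -
      have "(\<lambda>n. op_apply (P (A n)) u) sums op_apply (P (\<Union>n. A n)) u"
        using pvm A by (simp add: projection_valued_measure_def)
      moreover have "A n \<in> sets borel" "(\<Union>n. A n) \<in> sets borel" for n using A(1) by auto
      ultimately show ?thesis by (simp add: p)
    qed
    show "u \<in> Domain (root_graph T) \<longleftrightarrow>
      (\<integral>\<^sup>+s. ennreal (s^2) \<partial>measure_of UNIV (sets borel) (\<lambda>B. ennreal ((norm (p B \<odot> u))^2))) < \<infinity>" for u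
      using P by (simp add: spectral_measure_of_def flip: sc)
    show "inner v u = (\<integral>s. s \<partial>measure_of UNIV (sets borel) (\<lambda>B. ennreal ((norm (p B \<odot> u))^2)))"
      if "(u, v) \<in> root_graph T" for u v
      using P that by (auto simp: spectral_measure_of_def inner_eq_Re_cinner simp flip: sc)
  qed
  show ?thesis using p[of "{s<..}"] p_greaterThan[OF s] by simp
qed

section \<open>Spectral projections of a closed operator\<close>

definition resolv :: "'h::chilbert_space op \<Rightarrow> 'h bop"
  where "resolv x = (SOME T. resolvent_of x T)"

definition sproj :: "'h::chilbert_space op \<Rightarrow> real \<Rightarrow> 'h bop"
  where "sproj x s = cut (resolv x) s"

locale cdd_op =
  fixes x :: "'h::chilbert_space op"
  assumes cdd: "closed_densely_defined x"
begin

lemma resolv: "resolvent_of x (resolv x)"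
  unfolding resolv_def by (rule someI_ex[OF resolvent_exists[OF cdd]])

sublocale injective_contraction "resolv x"
  by (rule resolvent_injective_contraction[OF resolv])

lemma linear_x: "linear_op x" and closed_x: "closed x"
  using cdd by (auto simp: closed_densely_defined_def)

lemma abs_x: "op_abs x = root_graph (resolv x)"
  by (rule op_abs_eq[OF resolv])

lemma spectral_measure_abs: "0 \<le> s \<Longrightarrow> spectral_measure (op_abs x) {s<..} = graph (1 - sproj x s)"
  unfolding sproj_def abs_x spectral_measure_def
  by (rule spectral_measure_greaterThan[OF someI[of "\<lambda>P. spectral_measure_of P _", OF root_graph_spectral]])

lemma x_to_abs: "(u, v) \<in> x \<Longrightarrow> \<exists>v'. (u, v') \<in> root_graph (resolv x) \<and> norm v' = norm v"
  by (rule same_resolvent[OF cdd resolv root_graph_cdd root_graph_resolvent])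

lemma abs_to_x: "(u, v) \<in> root_graph (resolv x) \<Longrightarrow> \<exists>v'. (u, v') \<in> x \<and> norm v' = norm v"
  by (rule same_resolvent[OF root_graph_cdd root_graph_resolvent cdd resolv])

lemma sproj_isproj [simp]: "isproj (sproj x s)" by (simp add: sproj_def)

lemma sproj_mono: "s \<le> t \<Longrightarrow> sproj x t * sproj x s = sproj x s"
  and sproj_mono': "s \<le> t \<Longrightarrow> sproj x s * sproj x t = sproj x s"
  by (simp_all add: sproj_def cut_mono cut_mono')

lemma sproj_sproj: "s \<le> t \<Longrightarrow> sproj x t \<odot> sproj x s \<odot> u = sproj x s \<odot> u"
  "s \<le> t \<Longrightarrow> sproj x s \<odot> sproj x t \<odot> u = sproj x s \<odot> u"
  by (simp_all add: sproj_def cut_cut_apply)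

lemma sproj_right_limit: "0 \<le> s \<Longrightarrow> (\<lambda>n. sproj x (s + 1 / real (Suc n)) \<odot> u) \<longlonglongrightarrow> sproj x s \<odot> u"
  unfolding sproj_def by (rule cut_right_limit)

lemma sproj_upper:
  assumes "0 \<le> s" "sproj x s \<odot> u = u"
  shows "\<exists>v. (u, v) \<in> x \<and> norm v \<le> s * norm u"
proof -
  obtain v where m: "(u, v) \<in> root_graph (resolv x)" using cut_domain assms by (auto simp: sproj_def)
  have "norm v \<le> s * norm u" by (rule cut_norm_upper[OF assms(1) m]) (use assms in \<open>simp add: sproj_def\<close>)
  then show ?thesis using abs_to_x[OF m] by auto
qed

lemma sproj_lower:
  assumes "0 \<le> s" "sproj x s \<odot> u = 0" "u \<noteq> 0" "(u, v) \<in> x"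
  shows "s * norm u < norm v"
proof -
  obtain v' where m: "(u, v') \<in> root_graph (resolv x)" "norm v' = norm v" using x_to_abs assms(4) by blast
  then show ?thesis using cut_norm_lower[OF assms(1) m(1)] assms by (simp add: sproj_def)
qed

lemma sproj_split:
  assumes "(u, v) \<in> x"
  obtains v1 where "(sproj x s \<odot> u, v1) \<in> x" "(u - sproj x s \<odot> u, v - v1) \<in> x"
    "(norm v)^2 = (norm v1)^2 + (norm (v - v1))^2"
proof -
  let ?h = "root_graph (resolv x)" and ?c = "cut (resolv x) s"
  obtain w where t: "(u, w) \<in> ?h" "norm w = norm v" using x_to_abs[OF assms] by blast
  have t1: "(?c \<odot> u, ?c \<odot> w) \<in> ?h" by (rule root_graph_cut[OF t(1)])
  have t2: "(u - ?c \<odot> u, w - ?c \<odot> w) \<in> ?h" by (intro linear_op_diff root_graph_linear t t1)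
  obtain v1 where e1: "(?c \<odot> u, v1) \<in> x" "norm v1 = norm (?c \<odot> w)" using abs_to_x[OF t1] by blast
  have e2: "(u - ?c \<odot> u, v - v1) \<in> x" by (intro linear_op_diff linear_x assms e1)
  obtain w2 where "(u - ?c \<odot> u, w2) \<in> ?h" "norm w2 = norm (v - v1)" using x_to_abs[OF e2] by blast
  then have "norm (v - v1) = norm (w - ?c \<odot> w)"
    using linear_op_unique[OF root_graph_linear t2] by metis
  then have "(norm v)^2 = (norm v1)^2 + (norm (v - v1))^2"
    using isproj_pythagoras[OF cut_isproj, of w s] t(2) e1(2) by simp
  then show ?thesis using that e1(1) e2 by (simp add: sproj_def)
qed

lemma resolv_commute:
  assumes "\<And>u v. (u, v) \<in> x \<Longrightarrow> (d \<odot> u, d \<odot> v) \<in> x" "\<And>u v. (u, v) \<in> x \<Longrightarrow> (adj d \<odot> u, adj d \<odot> v) \<in> x"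
  shows "d * resolv x = resolv x * d"
proof (rule bop_eqI)
  fix z
  let ?T = "resolv x"
  have "(?T \<odot> z, z - ?T \<odot> z) \<in> op_times (op_adj x) x" using resolv by (simp add: resolvent_of_def)
  then obtain w where w: "(?T \<odot> z, w) \<in> x" "(w, z - ?T \<odot> z) \<in> op_adj x" by (auto simp: op_times_def)
  have "(d \<odot> w, d \<odot> (z - ?T \<odot> z)) \<in> op_adj x"
    unfolding op_adj_iff[OF linear_x]
  proof (intro allI impI)
    fix a b assume ab: "(a, b) \<in> x"
    have "inner (adj d \<odot> b) w = inner (adj d \<odot> a) (z - ?T \<odot> z)"
      using w(2) assms(2)[OF ab] unfolding op_adj_iff[OF linear_x] by blast
    then show "inner b (d \<odot> w) = inner a (d \<odot> (z - ?T \<odot> z))" by (simp only: inner_adj')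
  qed
  then have "(d \<odot> ?T \<odot> z, d \<odot> (z - ?T \<odot> z)) \<in> op_times (op_adj x) x"
    using assms(1)[OF w(1)] by (auto simp: op_times_def)
  then have "?T \<odot> (d \<odot> ?T \<odot> z + d \<odot> (z - ?T \<odot> z)) = d \<odot> ?T \<odot> z" using resolv by (simp only: resolvent_of_def)
  then show "(d * ?T) \<odot> z = (?T * d) \<odot> z" by simp
qed

lemma sproj_commute:
  assumes "\<And>u v. (u, v) \<in> x \<Longrightarrow> (d \<odot> u, d \<odot> v) \<in> x" "\<And>u v. (u, v) \<in> x \<Longrightarrow> (adj d \<odot> u, adj d \<odot> v) \<in> x"
  shows "d * sproj x s = sproj x s * d"
  unfolding sproj_def by (intro cut_commute resolv_commute) (use assms in auto)

text \<open>The bounded operator x e(s), with e(s) the spectral projection of |x| for [0, s].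
  Differences of two such truncations are the spectral slices of x.\<close>

definition trunc :: "real \<Rightarrow> 'h bop"
  where "trunc s = Bop (\<lambda>u. THE v. (sproj x s \<odot> u, v) \<in> x)"

lemma trunc_mem: "0 \<le> s \<Longrightarrow> (sproj x s \<odot> u, trunc s \<odot> u) \<in> x"
  and trunc_nbound: "0 \<le> s \<Longrightarrow> nbound (trunc s) s"
proof -
  assume s: "0 \<le> s"
  let ?f = "\<lambda>u. THE v. (sproj x s \<odot> u, v) \<in> x"
  have "\<exists>v. (sproj x s \<odot> u, v) \<in> x \<and> norm v \<le> s * norm (sproj x s \<odot> u)" for u
    by (rule sproj_upper[OF s]) simp
  then obtain g where g: "\<And>u. (sproj x s \<odot> u, g u) \<in> x" "\<And>u. norm (g u) \<le> s * norm (sproj x s \<odot> u)" by metis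
  have fg: "?f u = g u" for u
    by (rule the_equality) (rule g(1), rule linear_op_unique[OF linear_x _ g(1)])
  have bd: "norm (g u) \<le> s * norm u" for u
    using g(2)[of u] mult_left_mono[OF isproj_norm[OF sproj_isproj, of s u] s] by linarith
  have add: "g (u + u') = g u + g u'" for u u'
    by (rule linear_op_unique[OF linear_x g(1)]) (use linear_op_add[OF linear_x g(1) g(1)] in simp)
  have sc: "g (c *\<^sub>C u) = c *\<^sub>C g u" for c u
    by (rule linear_op_unique[OF linear_x g(1)]) (use linear_op_scaleC[OF linear_x g(1)] in simp)
  have "trunc s \<odot> u = g u" for u unfolding trunc_def fg by (rule Bop_apply[OF add sc bd])
  then show "(sproj x s \<odot> u, trunc s \<odot> u) \<in> x" "nbound (trunc s) s"
    using g bd s by (auto simp: nbound_def)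
qed

lemma trunc_sproj: "0 \<le> s \<Longrightarrow> s \<le> t \<Longrightarrow> trunc t * sproj x s = trunc s"
proof (rule bop_eqI)
  fix z assume s: "0 \<le> s" "s \<le> t"
  have "(sproj x s \<odot> z, trunc t \<odot> sproj x s \<odot> z) \<in> x"
    using trunc_mem[of t "sproj x s \<odot> z"] s by (simp add: sproj_sproj)
  then show "(trunc t * sproj x s) \<odot> z = trunc s \<odot> z"
    using linear_op_unique[OF linear_x _ trunc_mem[OF s(1)]] by simp
qed

lemma trunc_commute:
  assumes "0 \<le> s" and d: "\<And>u v. (u, v) \<in> x \<Longrightarrow> (d \<odot> u, d \<odot> v) \<in> x" "\<And>u v. (u, v) \<in> x \<Longrightarrow> (adj d \<odot> u, adj d \<odot> v) \<in> x"
  shows "d * trunc s = trunc s * d"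
proof (rule bop_eqI)
  fix z
  have "sproj x s \<odot> d \<odot> z = d \<odot> sproj x s \<odot> z"
    using arg_cong[OF sproj_commute[of d s, OF d], of "\<lambda>a. a \<odot> z"] by simp
  then have "(sproj x s \<odot> d \<odot> z, d \<odot> trunc s \<odot> z) \<in> x"
    using d(1)[OF trunc_mem[OF assms(1), of z]] by simp
  then show "(d * trunc s) \<odot> z = (trunc s * d) \<odot> z"
    using linear_op_unique[OF linear_x _ trunc_mem[OF assms(1)]] by simp
qed

end

lemma cdd_graph: "cdd_op (graph a)"
proof
  show "closed_densely_defined (graph a)"
    unfolding closed_densely_defined_def using linear_op_graph[of a] closed_graph[of a] by simp
qed

section \<open>Traces on von Neumann algebras\<close>

lemma scaleC_bop_mult [simp]:
  "(c *\<^sub>C a) * b = c *\<^sub>C (a * b)" "a * (c *\<^sub>C b) = c *\<^sub>C (a * b)" "c *\<^sub>C d *\<^sub>C a = (c * d) *\<^sub>C (a :: 'h::chilbert_space bop)"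
  by (rule bop_eqI; simp add: scaleC_scaleC)+

lemma scaleC_bop_add:
  "c *\<^sub>C (a + b) = c *\<^sub>C a + c *\<^sub>C (b :: 'h::chilbert_space bop)"
  "c *\<^sub>C (a - b) = c *\<^sub>C a - c *\<^sub>C (b :: 'h::chilbert_space bop)"
  by (rule bop_eqI; simp add: scaleC_add_right scaleC_diff_right)+

text \<open>A self-adjoint contraction c is the real part of the unitary c + i s with s^2 = 1 - c^2.
  By the last conclusion this unitary commutes with everything that commutes with c.\<close>

lemma unitary_of_selfadj:
  assumes c: "adj c = c" "nbound c 1"
  defines "s \<equiv> bsqrt (1 - c * c)"
  defines "u \<equiv> c + \<i> *\<^sub>C s"
  shows "adj u * u = 1" "u * adj u = 1" "u + adj u = 2 *\<^sub>R c" "\<And>a. a * c = c * a \<Longrightarrow> a * s = s * a"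
proof -
  have p: "pos (1 - c * c)" using pos_one_minus_adj_mult[OF c(2)] c(1) by simp
  have q: "pos (1 - (1 - c * c))" using pos_adj_mult[of c] c(1) by simp
  show com: "a * s = s * a" if "a * c = c * a" for a
  proof -
    have "a * (c * c) = (c * c) * a" using that by (metis mult.assoc)
    then have "a * (1 - c * c) = (1 - c * c) * a" by (simp add: left_diff_distrib right_diff_distrib)
    then show ?thesis unfolding s_def by (rule bsqrt_commute[OF p q])
  qed
  have ss: "s * s = 1 - c * c" unfolding s_def by (rule bsqrt_square[OF p q])
  have sa: "adj s = s" unfolding s_def by (rule pos_selfadj[OF bsqrt_pos[OF p q]])
  have cs: "c * s = s * c" by (rule com) simp
  have i: "\<i> *\<^sub>C (\<i> *\<^sub>C s) = - s" by (rule bop_eqI) (simp add: scaleC_scaleC scaleC_minus_one)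
  have au: "adj u = c - \<i> *\<^sub>C s"
    unfolding u_def by (rule bop_eqI) (simp add: c sa scaleC_minus_left)
  have z: "(- 1) *\<^sub>C a = - a" for a :: "'a bop" by (rule scaleC_minus_one_bop)
  show "adj u * u = 1" "u * adj u = 1" unfolding au unfolding u_def
    by (simp_all add: left_diff_distrib right_diff_distrib distrib_left distrib_right scaleC_bop_add z ss cs)
  show "u + adj u = 2 *\<^sub>R c" unfolding au by (simp add: u_def scaleR_2)
qed

context semifinite_von_neumann_algebra
begin

section \<open>The algebra, its commutant and the trace in terms of bounded operators\<close>

definition A :: "'h bop set" where "A = {a. graph a \<in> M}"
definition A' :: "'h bop set" where "A' = {c. \<forall>a\<in>A. c * a = a * c}"
definition tr :: "'h bop \<Rightarrow> ennreal" where "tr a = \<tau> (graph a)"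

lemma M_iff: "m \<in> M \<longleftrightarrow> (\<exists>a\<in>A. m = graph a)"
  using bounded[of m] unfolding A_def bounded_op_iff by blast

lemma commutant_iff: "m \<in> commutant M \<longleftrightarrow> (\<exists>c\<in>A'. m = graph c)"
proof
  assume m: "m \<in> commutant M"
  then obtain c where c: "m = graph c" by (auto simp: commutant_def bounded_op_iff)
  have "c * a = a * c" if "a \<in> A" for a
  proof -
    have "op_times (graph c) (graph a) = op_times (graph a) (graph c)"
      using m that unfolding c commutant_def A_def by blast
    then show ?thesis by simp
  qed
  then show "\<exists>c\<in>A'. m = graph c" using c by (auto simp: A'_def)
next
  assume "\<exists>c\<in>A'. m = graph c"
  then obtain c where c: "c \<in> A'" "m = graph c" by blast
  show "m \<in> commutant M" unfolding commutant_def c(2)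
  proof (intro CollectI conjI ballI bounded_op_graph)
    fix b assume "b \<in> M"
    then obtain a where a: "a \<in> A" "b = graph a" unfolding M_iff by blast
    then have "c * a = a * c" using c(1) by (auto simp: A'_def)
    then show "op_times (graph c) b = op_times b (graph c)" unfolding a(2) by simp
  qed
qed

lemma A_bicommutant:
  assumes "\<And>c. c \<in> A' \<Longrightarrow> d * c = c * d" shows "d \<in> A"
proof -
  have "graph d \<in> commutant (commutant M)"
    unfolding commutant_def[of "commutant M"]
  proof (intro CollectI conjI ballI bounded_op_graph)
    fix b assume "b \<in> commutant M"
    then obtain c where c: "c \<in> A'" "b = graph c" unfolding commutant_iff by blast
    show "op_times (graph d) b = op_times b (graph d)" unfolding c(2) using assms[OF c(1)] by simp
  qed
  then show ?thesis by (simp add: bicommutant A_def)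
qed

lemma A_add: "a \<in> A \<Longrightarrow> b \<in> A \<Longrightarrow> a + b \<in> A"
  and A_mult: "a \<in> A \<Longrightarrow> b \<in> A \<Longrightarrow> a * b \<in> A"
  and A_adj: "a \<in> A \<Longrightarrow> adj a \<in> A"
  and A_scaleC: "a \<in> A \<Longrightarrow> c *\<^sub>C a \<in> A"
  using plus_closed[of "graph a" "graph b"] times_closed[of "graph a" "graph b"]
    adj_closed[of "graph a"] scale_closed[of "graph a" c] by (simp_all add: A_def)

lemma A_one: "1 \<in> A" by (rule A_bicommutant) simp

lemma A_zero: "0 \<in> A" by (rule A_bicommutant) simp

lemma A_scaleR: "a \<in> A \<Longrightarrow> r *\<^sub>R a \<in> A"
proof -
  have "r *\<^sub>R a = complex_of_real r *\<^sub>C a" by (rule bop_eqI) (simp add: scaleC_of_real)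
  then show "a \<in> A \<Longrightarrow> r *\<^sub>R a \<in> A" using A_scaleC by simp
qed

lemma A_minus: "a \<in> A \<Longrightarrow> - a \<in> A" using A_scaleR[of a "- 1"] by simp

lemma A_diff: "a \<in> A \<Longrightarrow> b \<in> A \<Longrightarrow> a - b \<in> A" using A_add[OF _ A_minus, of a b] by simp

lemma A_sum: "(\<And>i. i \<in> I \<Longrightarrow> f i \<in> A) \<Longrightarrow> sum f I \<in> A"
  by (induction I rule: infinite_finite_induct) (auto intro: A_zero A_add)

lemma A_power: "a \<in> A \<Longrightarrow> a ^ n \<in> A"
  by (induction n) (auto intro: A_one A_mult)

lemmas A_closed = A_add A_mult A_adj A_scaleR A_diff A_one A_zero A_sum A_power A_minus

lemma A'_adj: "c \<in> A' \<Longrightarrow> adj c \<in> A'"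
proof -
  assume c: "c \<in> A'"
  have "adj c * a = a * adj c" if "a \<in> A" for a
  proof -
    have "c * adj a = adj a * c" using c A_adj[OF that] by (auto simp: A'_def)
    from arg_cong[OF this, of adj] show ?thesis by simp
  qed
  then show ?thesis by (auto simp: A'_def)
qed

text \<open>Elements of the commutant are combinations of self-adjoint contractions, and these of
  unitaries of the commutant. Affiliation speaks of such unitaries only, so this is the test by
  which spectral projections enter the algebra.\<close>

lemma A_unitary_commute:
  assumes d: "\<And>u. u \<in> A' \<Longrightarrow> adj u * u = 1 \<Longrightarrow> u * adj u = 1 \<Longrightarrow> d * u = u * d"
  shows "d \<in> A"
proof (rule A_bicommutant)
  have sac: "d * c = c * d" if c: "c \<in> A'" "adj c = c" "nbound c 1" for c
  proof -
    define u where "u = c + \<i> *\<^sub>C bsqrt (1 - c * c)"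
    note un = unitary_of_selfadj[OF c(2,3), folded u_def]
    have "u * a = a * u" if "a \<in> A" for a
    proof -
      have ca: "a * c = c * a" using c(1) that by (auto simp: A'_def)
      have "a * u = a * c + \<i> *\<^sub>C (a * bsqrt (1 - c * c))" by (simp add: u_def distrib_left)
      also have "\<dots> = u * a" by (simp only: un(4)[OF ca] ca u_def distrib_right scaleC_bop_mult)
      finally show ?thesis by simp
    qed
    then have uA: "u \<in> A'" by (auto simp: A'_def)
    have "d * u = u * d" by (rule d[OF uA un(1,2)])
    moreover have "d * adj u = adj u * d" by (rule d[OF A'_adj[OF uA]]) (simp_all add: un)
    ultimately have "d * (u + adj u) = (u + adj u) * d" by (simp add: distrib_left distrib_right)
    then have "2 *\<^sub>R (d * c) = 2 *\<^sub>R (c * d)" unfolding un(3) by simp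
    then show ?thesis by simp
  qed
  have sa: "d * c = c * d" if c: "c \<in> A'" "adj c = c" for c
  proof -
    obtain K where K: "nbound c K" using nbound_exists by blast
    define r where "r = 1 / (K + 1)"
    have K0: "0 \<le> K" using K by (simp add: nbound_def)
    have r: "0 < r" "r * K \<le> 1" using K0 by (simp_all add: r_def field_simps)
    have "nbound (r *\<^sub>R c) 1"
      unfolding nbound_def
    proof (intro conjI allI)
      fix x
      have "norm ((r *\<^sub>R c) \<odot> x) \<le> r * (K * norm x)"
        using nboundD[OF K, of x] r by (simp add: mult_left_mono)
      also have "\<dots> \<le> 1 * norm x" unfolding mult.assoc[symmetric] by (rule mult_right_mono[OF r(2)]) simp
      finally show "norm ((r *\<^sub>R c) \<odot> x) \<le> 1 * norm x" .
    qed simp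
    moreover have "r *\<^sub>R c \<in> A'" using c by (auto simp: A'_def)
    ultimately have "d * (r *\<^sub>R c) = (r *\<^sub>R c) * d" by (intro sac) (simp_all add: c)
    then show ?thesis using r by simp
  qed
  fix c assume c: "c \<in> A'"
  then have ca: "c * a = a * c" "adj c * a = a * adj c" if "a \<in> A" for a
    using that A'_adj[OF c] by (auto simp: A'_def)
  have "c + adj c \<in> A'" "\<i> *\<^sub>C (c - adj c) \<in> A'"
    by (auto simp: A'_def ca distrib_left distrib_right left_diff_distrib right_diff_distrib)
  moreover have "adj (\<i> *\<^sub>C (c - adj c)) = \<i> *\<^sub>C (c - adj c)"
    by (rule bop_eqI) (simp add: scaleC_minus_left scaleC_diff_right)
  ultimately have 1: "d * (c + adj c) = (c + adj c) * d" and "d * (\<i> *\<^sub>C (c - adj c)) = (\<i> *\<^sub>C (c - adj c)) * d"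
    by (intro sa; simp add: add.commute)+
  then have "(- \<i>) *\<^sub>C (\<i> *\<^sub>C (d * (c - adj c))) = (- \<i>) *\<^sub>C (\<i> *\<^sub>C ((c - adj c) * d))"
    by simp
  moreover have "(- \<i>) *\<^sub>C (\<i> *\<^sub>C a) = a" for a :: "'h bop" by (rule bop_eqI) (simp add: scaleC_scaleC)
  ultimately have 2: "d * (c - adj c) = (c - adj c) * d" by metis
  have "d * (c + adj c) + d * (c - adj c) = (c + adj c) * d + (c - adj c) * d" by (simp only: 1 2)
  then have "2 *\<^sub>R (d * c) = 2 *\<^sub>R (c * d)" by (simp add: distrib_left distrib_right left_diff_distrib right_diff_distrib scaleR_2)
  then show "d * c = c * d" by simp
qed

lemma bsqrt_A: "a \<in> A \<Longrightarrow> pos a \<Longrightarrow> pos (1 - a) \<Longrightarrow> bsqrt a \<in> A"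
proof (rule A_bicommutant)
  fix c assume a: "a \<in> A" "pos a" "pos (1 - a)" and c: "c \<in> A'"
  have "c * bsqrt a = bsqrt a * c" by (rule bsqrt_commute[OF a(2,3)]) (use a c in \<open>auto simp: A'_def\<close>)
  then show "bsqrt a * c = c * bsqrt a" by simp
qed

lemma pr_A:
  assumes "\<And>u x. u \<in> A' \<Longrightarrow> adj u * u = 1 \<Longrightarrow> u * adj u = 1 \<Longrightarrow> x \<in> S \<Longrightarrow> u \<odot> x \<in> S"
  shows "pr S \<in> A"
proof (rule A_unitary_commute)
  fix u assume u: "u \<in> A'" "adj u * u = 1" "u * adj u = 1"
  have "u * pr S = pr S * u"
  proof (rule pr_commute)
    fix x assume x: "x \<in> S"
    show "pr S \<odot> u \<odot> x = u \<odot> x" by (rule pr_member[OF assms[OF u x]])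
    have "adj u \<odot> x \<in> S" by (rule assms[OF A'_adj[OF u(1)] _ _ x]) (simp_all add: u)
    then show "pr S \<odot> adj u \<odot> x = adj u \<odot> x" by (rule pr_member)
  qed
  then show "pr S * u = u * pr S" by simp
qed

lemma A'_apply: "u \<in> A' \<Longrightarrow> a \<in> A \<Longrightarrow> u \<odot> a \<odot> x = a \<odot> u \<odot> x"
proof -
  assume "u \<in> A'" "a \<in> A"
  then have "u * a = a * u" by (auto simp: A'_def)
  from arg_cong[OF this, of "\<lambda>a. a \<odot> x"] show ?thesis by simp
qed

lemma lsupp_A: "a \<in> A \<Longrightarrow> lsupp a \<in> A"
  unfolding lsupp_def
proof (rule pr_A)
  fix u x assume a: "a \<in> A" and u: "u \<in> A'" and "x \<in> range (bapply a)"
  then obtain y where "x = a \<odot> y" by blast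
  then have "u \<odot> x = a \<odot> (u \<odot> y)" by (simp only: A'_apply[OF u a])
  then show "u \<odot> x \<in> range (bapply a)" by simp
qed

lemma kproj_A: "a \<in> A \<Longrightarrow> kproj a \<in> A"
  unfolding kproj_def
proof (rule pr_A)
  fix u x assume a: "a \<in> A" and u: "u \<in> A'" and "x \<in> {x. a \<odot> x = 0}"
  then have "u \<odot> a \<odot> x = 0" by simp
  then show "u \<odot> x \<in> {x. a \<odot> x = 0}" by (simp add: A'_apply[OF u a])
qed

lemma join_A: "P \<subseteq> A \<Longrightarrow> join P \<in> A"
  unfolding join_def
proof (rule pr_A)
  fix u x assume P: "P \<subseteq> A" and u: "u \<in> A'" and "x \<in> (\<Union>p\<in>P. range (bapply p))"
  then obtain p y where p: "p \<in> P" "x = p \<odot> y" by blast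
  have "p \<in> A" using P p by blast
  then have "u \<odot> x = p \<odot> (u \<odot> y)" by (simp only: A'_apply[OF u] p(2))
  then show "u \<odot> x \<in> (\<Union>p\<in>P. range (bapply p))" using p(1) by auto
qed

lemma pos_cone_graph: "graph a \<in> pos_cone M \<longleftrightarrow> a \<in> A \<and> pos a"
  by (simp add: pos_cone_def A_def)

lemma tr_add: "a \<in> A \<Longrightarrow> b \<in> A \<Longrightarrow> pos a \<Longrightarrow> pos b \<Longrightarrow> tr (a + b) = tr a + tr b"
  using trace_plus[of "graph a" "graph b"] by (simp add: pos_cone_graph tr_def)

lemma tr_scaleR: "a \<in> A \<Longrightarrow> pos a \<Longrightarrow> 0 \<le> r \<Longrightarrow> tr (r *\<^sub>R a) = ennreal r * tr a"
proof -
  have "r *\<^sub>R a = complex_of_real r *\<^sub>C a" by (rule bop_eqI) (simp add: scaleC_of_real)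
  then show "a \<in> A \<Longrightarrow> pos a \<Longrightarrow> 0 \<le> r \<Longrightarrow> tr (r *\<^sub>R a) = ennreal r * tr a"
    using trace_scale[of "graph a" r] by (simp add: pos_cone_graph tr_def)
qed

lemma tr_adj: "a \<in> A \<Longrightarrow> tr (adj a * a) = tr (a * adj a)"
  using tracial[of "graph a"] by (simp add: A_def tr_def)

lemma tr_faithful: "a \<in> A \<Longrightarrow> pos a \<Longrightarrow> tr a = 0 \<Longrightarrow> a = 0"
  using faithful[of "graph a"] by (simp add: pos_cone_graph tr_def op_zero_graph)

lemma tr_zero [simp]: "tr 0 = 0"
  using tr_scaleR[OF A_zero pos_zero, of 0] by simp

lemma tr_mono:
  assumes "a \<in> A" "b \<in> A" "pos a" "pos (b - a)" shows "tr a \<le> tr b"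
proof -
  have "tr (a + (b - a)) = tr a + tr (b - a)" by (rule tr_add) (use assms in \<open>auto intro: A_closed\<close>)
  then show ?thesis by simp
qed

lemma tr_sum: "finite I \<Longrightarrow> (\<And>i. i \<in> I \<Longrightarrow> f i \<in> A \<and> pos (f i)) \<Longrightarrow> tr (sum f I) = (\<Sum>i\<in>I. tr (f i))"
  by (induction I rule: finite_induct) (auto simp: tr_add A_sum pos_sum)

text \<open>The strong limit of an increasing sequence is the least upper bound of its range, so
  normality for directed sets applies.\<close>

lemma tr_normal:
  assumes a: "\<And>n. a n \<in> A" "\<And>n. pos (a n)" and inc: "\<And>n. pos (a (Suc n) - a n)"
    and b: "b \<in> A" and lim: "\<And>x. (\<lambda>n. a n \<odot> x) \<longlonglongrightarrow> b \<odot> x"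
  shows "tr b = (SUP n. tr (a n))"
proof -
  note inc' = pos_increasing[of a, OF inc]
  have upper: "pos (c - b)" if "\<And>n. pos (c - a n)" for c
    using pos_limit[of "\<lambda>n. c - a n", OF that] tendsto_diff[OF tendsto_const lim] by simp
  have lower: "pos (b - a n)" for n
    using pos_limit[of "\<lambda>m. a (m + n) - a n" "b - a n"] inc'[of n]
      tendsto_diff[OF LIMSEQ_ignore_initial_segment[OF lim] tendsto_const] by simp
  have posb: "pos b"
  proof -
    have "pos ((b - a 0) + a 0)" by (intro pos_add lower a)
    then show ?thesis by simp
  qed
  define D where "D = range (\<lambda>n. graph (a n))"
  have "\<tau> (graph b) = (SUP d\<in>D. \<tau> d)"
  proof (rule normal)
    show "D \<subseteq> pos_cone M" using a by (auto simp: D_def pos_cone_graph)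
    show "D \<noteq> {}" by (simp add: D_def)
    show "\<exists>d\<in>D. op_le b d \<and> op_le c d" if bc: "b \<in> D" "c \<in> D" for b c
    proof -
      obtain m n where "b = graph (a m)" "c = graph (a n)" using bc unfolding D_def by blast
      then show ?thesis by (intro bexI[of _ "graph (a (max m n))"]) (auto simp: D_def inc')
    qed
    show "graph b \<in> pos_cone M" using b posb by (simp add: pos_cone_graph)
    show "op_le d (graph b)" if "d \<in> D" for d using that lower by (auto simp: D_def)
    show "op_le (graph b) c" if c: "c \<in> pos_cone M" "\<And>d. d \<in> D \<Longrightarrow> op_le d c" for c
    proof -
      obtain e where e: "c = graph e" using c(1) by (auto simp: pos_cone_def M_iff)
      have "op_le (graph (a n)) c" for n by (rule c(2)) (auto simp: D_def)
      then show ?thesis unfolding e by (simp add: upper)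
    qed
  qed
  then show ?thesis by (simp add: tr_def D_def image_image)
qed

text \<open>Murray--von Neumann comparison: for \<open>b = a\<^sup>*a \<le> 1\<close>, the polynomials
  \<open>1 - (1 - b)\<^sup>n = \<Sum>i<n. (a s\<^sup>i)\<^sup>*(a s\<^sup>i)\<close> with \<open>s = \<surd>(1 - b)\<close> increase to \<open>e\<close>, while the
  corresponding \<open>\<Sum>i<n. (a s\<^sup>i)(a s\<^sup>i)\<^sup>*\<close> stay below \<open>f\<close>.\<close>

lemma tr_le_of_injective:
  assumes a0: "a0 \<in> A" and e: "e \<in> A" "isproj e" and f: "f \<in> A" "isproj f"
    and fa: "f * a0 = a0" and inj: "\<And>u. e \<odot> u = u \<Longrightarrow> a0 \<odot> u = 0 \<Longrightarrow> u = 0"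
  shows "tr e \<le> tr f"
proof -
  obtain K where K: "nbound (a0 * e) K" using nbound_exists by blast
  define r where "r = 1 / (K + 1)"
  have K0: "0 \<le> K" using K by (simp add: nbound_def)
  have r: "0 < r" "r * K \<le> 1" using K0 by (simp_all add: r_def field_simps)
  \<comment> \<open>Scaled to a contraction and restricted to e; neither affects injectivity on
    e.\<close>
  define a where "a = r *\<^sub>R (a0 * e)"
  have aA: "a \<in> A" unfolding a_def by (intro A_closed a0 e)
  have nb: "nbound a 1"
    unfolding nbound_def
  proof (intro conjI allI)
    fix x
    have "norm (a \<odot> x) \<le> r * (K * norm x)"
      using nboundD[OF K, of x] r by (simp add: a_def mult_left_mono)
    also have "\<dots> \<le> 1 * norm x" unfolding mult.assoc[symmetric] by (rule mult_right_mono[OF r(2)]) simp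
    finally show "norm (a \<odot> x) \<le> 1 * norm x" .
  qed simp
  have ae: "a * e = a" using isprojD(2)[OF e(2)] by (simp add: a_def mult.assoc)
  have fa': "f * a = a" using fa by (simp add: a_def mult.assoc[symmetric])
  define b where "b = adj a * a"
  define b' where "b' = a * adj a"
  have b: "pos b" "pos (1 - b)" and b': "pos b'" "pos (1 - b')"
    unfolding b_def b'_def using pos_adj_mult pos_adj_mult' pos_one_minus_adj_mult[OF nb]
      pos_one_minus_adj_mult[OF nbound_adj[OF nb]] by auto
  have bA: "b \<in> A" unfolding b_def by (intro A_closed aA)
  have q: "pos (1 - (1 - b))" using b by simp
  define s where "s = bsqrt (1 - b)"
  have s: "adj s = s" "s * s = 1 - b" "s \<in> A"
    unfolding s_def using pos_selfadj[OF bsqrt_pos[OF b(2) q]] bsqrt_square[OF b(2) q]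
      bsqrt_A[OF _ b(2) q] bA by (auto intro: A_closed)
  have bs: "b * s = s * b" unfolding s_def
    by (rule bsqrt_commute[OF b(2) q]) (simp add: left_diff_distrib right_diff_distrib)
  have s2: "s ^ i * s ^ i = (1 - b) ^ i" for i
    using s(2) by (simp add: power_add[symmetric] mult_2[symmetric] power_mult power2_eq_square)
  define F where "F n = 1 - (1 - b) ^ n" for n
  define G where "G n = 1 - (1 - b') ^ n" for n
  have Fsum: "F n = (\<Sum>i<n. adj (a * s ^ i) * (a * s ^ i))" for n
  proof (induction n)
    case (Suc n)
    have "adj (a * s ^ n) * (a * s ^ n) = s ^ n * b * s ^ n" by (simp add: s b_def mult.assoc)
    also have "\<dots> = b * s ^ n * s ^ n" by (simp only: commute_power[OF bs, of n, symmetric])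
    also have "\<dots> = b * (s ^ n * s ^ n)" by (simp only: mult.assoc)
    finally have "adj (a * s ^ n) * (a * s ^ n) = b * (1 - b) ^ n" by (simp only: s2)
    moreover have "F (Suc n) = F n + b * (1 - b) ^ n" by (simp add: F_def left_diff_distrib)
    ultimately show ?case using Suc by simp
  qed (simp add: F_def)
  have ab: "a * (1 - b) ^ n = (1 - b') ^ n * a" for n
  proof (induction n)
    case (Suc n)
    have "a * (1 - b) ^ Suc n = a * (1 - b) ^ n * (1 - b)" by (simp add: power_commutes mult.assoc)
    also have "\<dots> = (1 - b') ^ n * (a * (1 - b))" by (simp only: Suc mult.assoc)
    also have "a * (1 - b) = (1 - b') * a" by (simp add: b_def b'_def right_diff_distrib left_diff_distrib mult.assoc)
    finally show ?case by (simp add: power_commutes mult.assoc[symmetric])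
  qed simp
  have Gsum: "G n = (\<Sum>i<n. (a * s ^ i) * adj (a * s ^ i))" for n
  proof (induction n)
    case (Suc n)
    have "(a * s ^ n) * adj (a * s ^ n) = a * (s ^ n * s ^ n) * adj a" by (simp add: s mult.assoc)
    also have "\<dots> = (1 - b') ^ n * b'" by (simp only: s2 ab) (simp add: b'_def mult.assoc)
    finally have "(a * s ^ n) * adj (a * s ^ n) = (1 - b') ^ n * b'" .
    moreover have "G (Suc n) = G n + (1 - b') ^ n * b'"
      by (simp add: G_def right_diff_distrib power_Suc2 del: power_Suc)
    ultimately show ?case using Suc by simp
  qed (simp add: G_def)
  have asA: "a * s ^ i \<in> A" for i by (intro A_closed aA s)
  have FA: "F n \<in> A" for n unfolding F_def by (intro A_closed bA)
  have GA: "G n \<in> A" for n unfolding G_def b'_def by (intro A_closed aA)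
  have trFG: "tr (F n) = tr (G n)" for n
    unfolding Fsum Gsum
    by (subst (1 2) tr_sum) (auto intro!: A_closed asA pos_adj_mult pos_adj_mult' sum.cong tr_adj simp del: adj_simps)
  have Fpos: "pos (F n)" for n unfolding Fsum by (intro pos_sum pos_adj_mult)
  have Finc: "pos (F (Suc n) - F n)" for n unfolding Fsum by (simp add: pos_adj_mult del: adj_simps)
  have Fnb: "nbound (F n) 1" for n
    by (rule pos_one_minus_nbound[OF Fpos]) (simp add: F_def pos_power b)
  obtain g where g: "\<And>x. (\<lambda>n. F n \<odot> x) \<longlonglongrightarrow> g \<odot> x"
    using pos_mono_convergent[of F 1, OF Fpos Finc Fnb] by blast
  have eb: "e * b = b" using ae isprojD(1)[OF e(2)] by (simp add: b_def mult.assoc[symmetric]) (metis adj_simps(4))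
  have be: "b * e = b" using ae by (simp add: b_def mult.assoc)
  have Flim: "(\<lambda>n. F n \<odot> x) \<longlonglongrightarrow> e \<odot> x" for x
  proof -
    define w where "w = e \<odot> x - g \<odot> x"
    have comm: "e * (1 - b) = (1 - b) * e" by (simp add: right_diff_distrib left_diff_distrib eb be)
    have Fe: "F n * e = F n" for n
    proof (induction n)
      case (Suc n)
      have "F (Suc n) = F n + b * (1 - b) ^ n" by (simp add: F_def left_diff_distrib)
      also have "b * (1 - b) ^ n = (1 - b) ^ n * b"
        by (rule commute_power) (simp add: right_diff_distrib left_diff_distrib)
      finally show ?case using Suc be by (simp add: distrib_right mult.assoc)
    qed (simp add: F_def)
    \<comment> \<open>The limit w of (1 - b)^n e x is fixed by 1 - b, so a w = 0, and w lies under
      e; injectivity forces w = 0.\<close>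
    have powlim: "(\<lambda>n. (1 - b) ^ n \<odot> e \<odot> x) \<longlonglongrightarrow> w"
    proof -
      have "(\<lambda>n. e \<odot> x - F n \<odot> x) \<longlonglongrightarrow> w" unfolding w_def by (intro tendsto_intros g)
      moreover have "e \<odot> x - F n \<odot> x = (1 - b) ^ n \<odot> e \<odot> x" for n
      proof -
        have "F n \<odot> x = F n \<odot> e \<odot> x" using arg_cong[OF Fe[of n], of "\<lambda>a. a \<odot> x"] by simp
        then show ?thesis by (simp only:) (simp add: F_def)
      qed
      ultimately show ?thesis by simp
    qed
    have "(1 - b) \<odot> w = w"
    proof (rule LIMSEQ_unique[OF bapply_tendsto[OF powlim]])
      show "(\<lambda>n. (1 - b) \<odot> (1 - b) ^ n \<odot> e \<odot> x) \<longlonglongrightarrow> w"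
        using LIMSEQ_Suc[OF powlim] by simp
    qed
    then have "b \<odot> w = 0" by simp
    then have "inner (a \<odot> w) (a \<odot> w) = 0" by (simp add: b_def inner_adj)
    then have aw: "a \<odot> w = 0" by simp
    have ew: "e \<odot> w = w"
    proof (rule LIMSEQ_unique[OF bapply_tendsto[OF powlim]])
      have "e * (1 - b) ^ n * e = (1 - b) ^ n * e" for n
        using commute_power[OF comm, of n] isprojD(2)[OF e(2)] by (simp add: mult.assoc)
      from arg_cong[OF this, of "\<lambda>a. a \<odot> x"]
      have "e \<odot> (1 - b) ^ n \<odot> e \<odot> x = (1 - b) ^ n \<odot> e \<odot> x" for n by simp
      then show "(\<lambda>n. e \<odot> (1 - b) ^ n \<odot> e \<odot> x) \<longlonglongrightarrow> w" using powlim by simp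
    qed
    have "a0 \<odot> w = 0" using aw r ew by (simp add: a_def)
    then have "w = 0" by (rule inj[OF ew])
    then show ?thesis using g[of x] by (simp add: w_def)
  qed
  have "tr e = (SUP n. tr (F n))" by (rule tr_normal[OF FA Fpos Finc e(1) Flim])
  also have "\<dots> \<le> tr f"
  proof (rule SUP_least)
    fix n
    have fG: "f * G n = G n" unfolding Gsum
      by (simp add: sum_distrib_left fa' mult.assoc[symmetric] del: adj_simps)
    have Gsa: "adj (G n) = G n" by (simp add: G_def b'_def)
    from arg_cong[OF fG, of adj] have Gf: "G n * f = G n" using Gsa isprojD(1)[OF f(2)] by simp
    \<comment> \<open>G_n lies under f on both sides, so f - G_n is the compression of the positive
      operator (1 - b')^n to f.\<close>
    have "f - G n = adj f * (1 - b') ^ n * f"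
      using isprojD[OF f(2)] fG Gf by (simp add: G_def algebra_simps)
    then have "pos (f - G n)" using pos_conj[OF pos_power[OF b'(2)]] by simp
    then have "tr (G n) \<le> tr f"
      by (intro tr_mono GA f) (auto simp: Gsum intro!: pos_sum pos_adj_mult' simp del: adj_simps)
    then show "tr (F n) \<le> tr f" by (simp add: trFG)
  qed
  finally show ?thesis .
qed

lemma tr_proj_mono:
  assumes "p \<in> A" "q \<in> A" "isproj p" "isproj q" "q * p = p" shows "tr p \<le> tr q"
  by (rule tr_mono) (use assms isproj_pos isproj_le_iff in auto)

lemma tr_proj_limit:
  assumes p: "\<And>n. p n \<in> A" "\<And>n. isproj (p n)" and inc: "\<And>n. p (Suc n) * p n = p n"
  shows "tr (join (range p)) = (SUP n. tr (p n))"
proof (rule tr_normal)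
  show "p n \<in> A" "pos (p n)" for n using p isproj_pos by auto
  show "pos (p (Suc n) - p n)" for n using isproj_le_iff[OF p(2) p(2)] inc by simp
  show "join (range p) \<in> A" by (rule join_A) (use p in auto)
  show "(\<lambda>n. p n \<odot> x) \<longlonglongrightarrow> join (range p) \<odot> x" for x by (rule proj_increasing_limit[of p, OF p(2) inc])
qed

lemma join_mono: "P \<subseteq> Q \<Longrightarrow> join Q * join P = join P"
  by (rule join_least) (auto intro: join_upper)

text \<open>On the part of the large join orthogonal to the small one q is injective: a vector
  killed by q and by P is killed by the whole join. So the trace of that part is at most tr
  q.\<close>

lemma tr_join_insert:
  assumes P: "P \<subseteq> A" "\<And>p. p \<in> P \<Longrightarrow> isproj p" and q: "q \<in> A" "isproj q"
  shows "tr (join (insert q P)) \<le> tr (join P) + tr q"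
proof -
  let ?J = "join P" and ?K = "join (insert q P)"
  have JA: "?J \<in> A" "?K \<in> A" by (intro join_A; use P q in auto)+
  have KJ: "?K * ?J = ?J" by (rule join_mono) auto
  have e: "isproj (?K - ?J)" by (rule isproj_diff[OF _ _ KJ]) auto
  have "tr (?K - ?J) \<le> tr q"
  proof (rule tr_le_of_injective[OF q(1) _ e q])
    show "?K - ?J \<in> A" by (intro A_closed JA)
    show "q * q = q" by (rule isprojD(2)[OF q(2)])
    fix u assume x: "(?K - ?J) \<odot> u = u" "q \<odot> u = 0"
    have JK: "?J * ?K = ?J" by (rule isproj_adj_le[OF _ _ KJ]) auto
    have "?J \<odot> (?K - ?J) \<odot> u = 0"
      using arg_cong[OF JK, of "\<lambda>a. a \<odot> u"] by simp
    then have J0: "?J \<odot> u = 0" by (simp only: x(1))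
    have "p \<odot> u = 0" if "p \<in> P" for p
    proof -
      have "p * ?J = p" by (rule isproj_adj_le[OF _ P(2)[OF that] join_upper[OF that]]) simp
      from arg_cong[OF this, of "\<lambda>a. a \<odot> u"] show ?thesis using J0 by simp
    qed
    then have "?K \<odot> u = 0" using P q x(2) by (intro join_zero) auto
    then show "u = 0" using x(1) J0 by simp
  qed
  moreover have "tr (?J + (?K - ?J)) = tr ?J + tr (?K - ?J)"
    by (rule tr_add) (use JA isproj_pos[OF e] isproj_pos[OF join_isproj] in \<open>auto intro: A_closed\<close>)
  ultimately show ?thesis by (simp add: add_left_mono)
qed

lemma join_empty [simp]: "join {} = 0"
  using join_least[of 0 "{}"] by simp

lemma tr_join_finite:
  assumes "finite P" "P \<subseteq> A" "\<And>p. p \<in> P \<Longrightarrow> isproj p"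
  shows "tr (join P) \<le> (\<Sum>p\<in>P. tr p)"
  using assms
proof (induction P rule: finite_induct)
  case (insert q P)
  have "tr (join (insert q P)) \<le> tr (join P) + tr q" by (rule tr_join_insert) (use insert in auto)
  also have "\<dots> \<le> (\<Sum>p\<in>P. tr p) + tr q" by (rule add_right_mono) (use insert in auto)
  finally show ?case using insert by (simp add: add.commute)
qed simp

lemma tr_join_two:
  assumes "p \<in> A" "q \<in> A" "isproj p" "isproj q"
  shows "tr (join {p, q}) \<le> tr p + tr q"
  using tr_join_insert[of "{q}" p] tr_join_insert[of "{}" q] assms
  by (simp add: add.commute) (metis add_left_mono order_trans)

lemma join_of_partial_joins:
  fixes p :: "nat \<Rightarrow> 'h bop"
  shows "join (range (\<lambda>n. join (p ` {..<n}))) = join (range p)"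
proof -
  let ?J = "\<lambda>n. join (p ` {..<n})"
  have "join (range p) * join (range ?J) = join (range ?J)"
    by (rule join_least) (auto intro: join_mono)
  moreover have "join (range ?J) * join (range p) = join (range p)"
  proof (rule join_least)
    fix q assume "q \<in> range p"
    then obtain n where n: "q = p n" by auto
    have 1: "?J (Suc n) * q = q" by (rule join_upper) (auto simp: n)
    have 2: "join (range ?J) * ?J (Suc n) = ?J (Suc n)" by (rule join_upper) auto
    have "join (range ?J) * (?J (Suc n) * q) = ?J (Suc n) * q" by (simp only: mult.assoc[symmetric] 2)
    then show "join (range ?J) * q = q" by (simp only: 1)
  qed simp
  ultimately show ?thesis using isproj_adj_le[of "join (range ?J)" "join (range p)"] by simp
qed

lemma tr_join_countable:
  assumes p: "\<And>n. p n \<in> A" "\<And>n. isproj (p n)"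
  shows "tr (join (range p)) \<le> (\<Sum>n. tr (p n))"
proof -
  let ?J = "\<lambda>n. join (p ` {..<n})"
  have "tr (join (range ?J)) = (SUP n. tr (?J n))"
    by (rule tr_proj_limit) (use p in \<open>auto intro!: join_A join_mono\<close>)
  also have "\<dots> \<le> (\<Sum>n. tr (p n))"
  proof (rule SUP_least)
    fix n
    have "tr (?J n) \<le> (\<Sum>i<n. tr (p i))"
    proof (induction n)
      case (Suc n)
      have "tr (?J (Suc n)) \<le> tr (?J n) + tr (p n)"
        unfolding lessThan_Suc image_insert by (rule tr_join_insert) (use p in auto)
      also have "\<dots> \<le> (\<Sum>i<n. tr (p i)) + tr (p n)" by (rule add_right_mono[OF Suc])
      finally show ?case by simp
    qed simp
    also have "\<dots> \<le> (\<Sum>n. tr (p n))" by (rule sum_le_suminf) auto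
    finally show "tr (?J n) \<le> (\<Sum>n. tr (p n))" .
  qed
  finally show ?thesis by (simp add: join_of_partial_joins)
qed

end

section \<open>Distribution functions and the trace norm of order two\<close>

text \<open>Norms of x and |x| agree on the common domain, so the error equals that of the cuts
  applied to |x| u.\<close>

lemma (in cdd_op) trunc_limit:
  assumes m: "(u, v) \<in> x" shows "(\<lambda>n. trunc (real n) \<odot> u) \<longlonglongrightarrow> v"
proof -
  let ?h = "root_graph (resolv x)"
  obtain w where t: "(u, w) \<in> ?h" using x_to_abs[OF m] by blast
  have "norm (trunc (real n) \<odot> u - v) = norm (cut (resolv x) (real n) \<odot> w - w)" for n
  proof -
    have "(sproj x (real n) \<odot> u - u, trunc (real n) \<odot> u - v) \<in> x"
      by (intro linear_op_diff linear_x m trunc_mem) simp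
    from x_to_abs[OF this] obtain w' where "(sproj x (real n) \<odot> u - u, w') \<in> ?h"
      "norm w' = norm (trunc (real n) \<odot> u - v)" by blast
    moreover have "(sproj x (real n) \<odot> u - u, cut (resolv x) (real n) \<odot> w - w) \<in> ?h"
      unfolding sproj_def by (intro linear_op_diff root_graph_linear root_graph_cut t)
    ultimately show ?thesis using linear_op_unique[OF root_graph_linear] by metis
  qed
  moreover have "(\<lambda>n. norm (cut (resolv x) (real n) \<odot> w - w)) \<longlonglongrightarrow> 0"
    using tendsto_norm_zero[OF LIM_zero[OF cut_limit[of w]]] .
  ultimately have "(\<lambda>n. norm (trunc (real n) \<odot> u - v)) \<longlonglongrightarrow> 0" by simp
  then show ?thesis by (rule LIM_zero_cancel[OF tendsto_norm_zero_cancel])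
qed

section \<open>Affiliated operators and their distribution functions\<close>

context semifinite_von_neumann_algebra
begin

definition adm :: "'h op \<Rightarrow> bool"
  where "adm x \<longleftrightarrow> closed_densely_defined x \<and> affiliated M x"

lemma adm_cdd: "adm x \<Longrightarrow> cdd_op x" by (simp add: adm_def cdd_op_def)

text \<open>Invariance of the graph in one direction suffices, since the inverse unitary lies in the
  commutant as well.\<close>

lemma affiliated_iff:
  "affiliated M x \<longleftrightarrow> (\<forall>u\<in>A'. adj u * u = 1 \<longrightarrow> u * adj u = 1 \<longrightarrow> (\<forall>v w. (v, w) \<in> x \<longrightarrow> (u \<odot> v, u \<odot> w) \<in> x))"
proof -
  have mem: "(v, w) \<in> op_times (graph u) (op_times x (op_adj (graph u))) \<longleftrightarrow> (\<exists>w'. (adj u \<odot> v, w') \<in> x \<and> w = u \<odot> w')" for u v w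
    by (auto simp: op_times_def relcomp_unfold)
  have inv: "adj u \<odot> u \<odot> v = v" "u \<odot> adj u \<odot> v = v" if "adj u * u = 1" "u * adj u = 1" for u v
    using arg_cong[OF that(1), of "\<lambda>a. a \<odot> v"] arg_cong[OF that(2), of "\<lambda>a. a \<odot> v"] by simp_all
  have aff: "affiliated M x \<longleftrightarrow> (\<forall>u\<in>A'. adj u * u = 1 \<and> u * adj u = 1 \<longrightarrow> op_times (graph u) (op_times x (op_adj (graph u))) = x)"
  proof -
    have "commutant M = graph ` A'" using commutant_iff by auto
    then show ?thesis unfolding affiliated_def by simp
  qed
  show ?thesis
  proof
    assume a: "affiliated M x"
    show "\<forall>u\<in>A'. adj u * u = 1 \<longrightarrow> u * adj u = 1 \<longrightarrow> (\<forall>v w. (v, w) \<in> x \<longrightarrow> (u \<odot> v, u \<odot> w) \<in> x)"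
    proof (intro ballI impI allI)
      fix u v w assume u: "u \<in> A'" "adj u * u = 1" "u * adj u = 1" and m: "(v, w) \<in> x"
      have "(u \<odot> v, u \<odot> w) \<in> op_times (graph u) (op_times x (op_adj (graph u)))"
        unfolding mem using m inv[OF u(2,3)] by auto
      then show "(u \<odot> v, u \<odot> w) \<in> x" using a u unfolding aff by blast
    qed
  next
    assume r: "\<forall>u\<in>A'. adj u * u = 1 \<longrightarrow> u * adj u = 1 \<longrightarrow> (\<forall>v w. (v, w) \<in> x \<longrightarrow> (u \<odot> v, u \<odot> w) \<in> x)"
    show "affiliated M x" unfolding aff
    proof (intro ballI impI)
      fix u assume u: "u \<in> A'" "adj u * u = 1 \<and> u * adj u = 1"
      have 1: "(u \<odot> v, u \<odot> w) \<in> x" if "(v, w) \<in> x" for v w using r u that by blast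
      have 2: "(adj u \<odot> v, adj u \<odot> w) \<in> x" if "(v, w) \<in> x" for v w
        using r A'_adj[OF u(1)] u(2) that by simp
      have "(v, w) \<in> op_times (graph u) (op_times x (op_adj (graph u))) \<longleftrightarrow> (v, w) \<in> x" for v w
      proof
        assume "(v, w) \<in> op_times (graph u) (op_times x (op_adj (graph u)))"
        then obtain w' where "(adj u \<odot> v, w') \<in> x" "w = u \<odot> w'" unfolding mem by blast
        then show "(v, w) \<in> x" using 1[of "adj u \<odot> v" w'] inv(2)[of u v] u(2) by simp
      next
        assume "(v, w) \<in> x"
        then show "(v, w) \<in> op_times (graph u) (op_times x (op_adj (graph u)))"
          unfolding mem using 2 inv(2)[of u w] u(2) by (intro exI[of _ "adj u \<odot> w"]) simp
      qed
      then show "op_times (graph u) (op_times x (op_adj (graph u))) = x" by auto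
    qed
  qed
qed

lemma adm_unitary:
  assumes "adm x" "u \<in> A'" "adj u * u = 1" "u * adj u = 1" "(v, w) \<in> x"
  shows "(u \<odot> v, u \<odot> w) \<in> x" "(adj u \<odot> v, adj u \<odot> w) \<in> x"
  using assms A'_adj[OF assms(2)] unfolding adm_def affiliated_iff by simp_all

lemma adm_graph: "a \<in> A \<Longrightarrow> adm (graph a)"
  using cdd_graph[of a] by (auto simp: adm_def cdd_op_def affiliated_iff intro: A'_apply)

lemma sproj_A: "adm x \<Longrightarrow> sproj x s \<in> A"
proof (rule A_unitary_commute)
  fix u assume x: "adm x" and u: "u \<in> A'" "adj u * u = 1" "u * adj u = 1"
  interpret cdd_op x by (rule adm_cdd[OF x])
  show "sproj x s * u = u * sproj x s"
    by (rule sproj_commute[symmetric]) (use adm_unitary[OF x u] in auto)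
qed

lemma trunc_A: "adm x \<Longrightarrow> 0 \<le> s \<Longrightarrow> cdd_op.trunc x s \<in> A"
proof (rule A_unitary_commute)
  fix u assume x: "adm x" "0 \<le> s" and u: "u \<in> A'" "adj u * u = 1" "u * adj u = 1"
  interpret cdd_op x by (rule adm_cdd[OF x(1)])
  show "trunc s * u = u * trunc s"
    by (rule trunc_commute[OF x(2), symmetric]) (use adm_unitary[OF x(1) u] in auto)
qed

text \<open>The distribution function of |x| with respect to the trace. Singular values are its
  generalized inverse, and every estimate of the norm is made through \<open>ds\<close>.\<close>

definition ds :: "'h op \<Rightarrow> real \<Rightarrow> ennreal" where "ds x s = tr (1 - sproj x s)"

lemma singular_value_ds:
  assumes "adm x"
  shows "singular_value \<tau> x t = Inf {ennreal s | s. 0 \<le> s \<and> ds x s \<le> ennreal t}"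
proof -
  interpret cdd_op x by (rule adm_cdd[OF assms])
  have "{ennreal s | s. 0 \<le> s \<and> \<tau> (spectral_measure (op_abs x) {s<..}) \<le> ennreal t} =
      {ennreal s | s. 0 \<le> s \<and> ds x s \<le> ennreal t}"
    using spectral_measure_abs by (auto simp: ds_def tr_def)
  then show ?thesis by (simp add: singular_value_def)
qed

lemma ds_antimono:
  assumes x: "adm x" and st: "s \<le> t" shows "ds x t \<le> ds x s"
proof -
  interpret cdd_op x by (rule adm_cdd[OF x])
  have "(1 - sproj x s) * (1 - sproj x t) = 1 - sproj x t"
    using sproj_mono'[OF st] by (simp add: left_diff_distrib right_diff_distrib)
  then show ?thesis unfolding ds_def
    by (intro tr_proj_mono A_closed sproj_A x isproj_compl sproj_isproj)
qed

lemma ds_right: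
  assumes x: "adm x" and s: "0 \<le> s" shows "ds x s = (SUP n. ds x (s + 1 / real (Suc n)))"
  unfolding ds_def
proof (rule tr_normal)
  interpret cdd_op x by (rule adm_cdd[OF x])
  show "1 - sproj x (s + 1 / real (Suc n)) \<in> A" for n by (intro A_closed sproj_A x)
  show "pos (1 - sproj x (s + 1 / real (Suc n)))" for n by (intro isproj_pos isproj_compl sproj_isproj)
  show "pos (1 - sproj x (s + 1 / real (Suc (Suc n))) - (1 - sproj x (s + 1 / real (Suc n))))" for n
  proof -
    have "sproj x (s + 1 / real (Suc n)) * sproj x (s + 1 / real (Suc (Suc n))) = sproj x (s + 1 / real (Suc (Suc n)))"
      by (rule sproj_mono) (simp add: frac_le)
    then have "pos (sproj x (s + 1 / real (Suc n)) - sproj x (s + 1 / real (Suc (Suc n))))"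
      by (subst isproj_le_iff) simp_all
    then show ?thesis by (simp add: algebra_simps)
  qed
  show "1 - sproj x s \<in> A" by (intro A_closed sproj_A x)
  show "(\<lambda>n. (1 - sproj x (s + 1 / real (Suc n))) \<odot> u) \<longlonglongrightarrow> (1 - sproj x s) \<odot> u" for u
    using tendsto_diff[OF tendsto_const[of u] sproj_right_limit[OF s, of u]] by simp
qed

text \<open>Variational principle: a vector of the spectral subspace of |x| above s that is killed
  by 1 - p would satisfy both |x u| > s |u| and |x u| \<le> s |u|. So 1 - p is injective there and
  its trace dominates.\<close>

lemma ds_minmax:
  assumes x: "adm x" and s: "0 \<le> s" and p: "p \<in> A" "isproj p"
    and b: "\<And>u. p \<odot> u = u \<Longrightarrow> \<exists>v. (u, v) \<in> x \<and> norm v \<le> s * norm u"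
  shows "ds x s \<le> tr (1 - p)"
  unfolding ds_def
proof (rule tr_le_of_injective[of "1 - p"])
  interpret cdd_op x by (rule adm_cdd[OF x])
  show "1 - p \<in> A" "1 - sproj x s \<in> A" "1 - p \<in> A" by (intro A_closed p sproj_A x)+
  show "isproj (1 - sproj x s)" "isproj (1 - p)" by (intro isproj_compl sproj_isproj p)+
  then show "(1 - p) * (1 - p) = 1 - p" by (simp add: isprojD)
  fix u assume "(1 - sproj x s) \<odot> u = u" "(1 - p) \<odot> u = 0"
  then have z: "sproj x s \<odot> u = 0" "p \<odot> u = u" by simp_all
  then obtain v where "(u, v) \<in> x" "norm v \<le> s * norm u" using b by blast
  then show "u = 0" using sproj_lower[OF s z(1)] by fastforce
qed

text \<open>Off the join of the two upper spectral projections both summands are bounded by their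
  levels, so the min-max principle applies to the complement of the join.\<close>

lemma ds_add:
  assumes xyz: "adm x" "adm y" "adm z" and st: "0 \<le> s" "0 \<le> t"
    and sub: "\<And>u v w. (u, v) \<in> x \<Longrightarrow> (u, w) \<in> y \<Longrightarrow> (u, v + w) \<in> z"
  shows "ds z (s + t) \<le> ds x s + ds y t"
proof -
  interpret x: cdd_op x by (rule adm_cdd[OF xyz(1)])
  interpret y: cdd_op y by (rule adm_cdd[OF xyz(2)])
  define P where "P = {1 - sproj x s, 1 - sproj y t}"
  have PA: "P \<subseteq> A" unfolding P_def using xyz by (auto intro!: A_closed sproj_A)
  have "ds z (s + t) \<le> tr (1 - (1 - join P))"
  proof (rule ds_minmax[OF xyz(3)])
    show "0 \<le> s + t" using st by simp
    show "1 - join P \<in> A" "isproj (1 - join P)" by (intro A_closed join_A PA isproj_compl join_isproj)+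
    fix u assume "(1 - join P) \<odot> u = u"
    then have J: "join P \<odot> u = 0" by simp
    have pz: "p \<odot> u = 0" if p: "p \<in> P" "isproj p" for p
    proof -
      have "p * join P = p" by (rule isproj_adj_le[OF _ p(2) join_upper[OF p(1)]]) simp
      from arg_cong[OF this, of "\<lambda>a. a \<odot> u"] show ?thesis using J by simp
    qed
    have "(1 - sproj x s) \<odot> u = 0" "(1 - sproj y t) \<odot> u = 0"
      by (rule pz; simp add: P_def isproj_compl)+
    then have f: "sproj x s \<odot> u = u" "sproj y t \<odot> u = u" by simp_all
    obtain v w where m: "(u, v) \<in> x" "norm v \<le> s * norm u" "(u, w) \<in> y" "norm w \<le> t * norm u"
      using x.sproj_upper[OF st(1) f(1)] y.sproj_upper[OF st(2) f(2)] by blast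
    have "norm (v + w) \<le> (s + t) * norm u"
      using norm_triangle_ineq[of v w] m(2,4) by (simp add: distrib_right)
    then show "\<exists>v. (u, v) \<in> z \<and> norm v \<le> (s + t) * norm u" using sub[OF m(1,3)] by blast
  qed
  also have "\<dots> = tr (join P)" by simp
  also have "\<dots> \<le> ds x s + ds y t"
    unfolding P_def ds_def using xyz
    by (intro tr_join_two) (auto intro!: A_closed sproj_A isproj_compl)
  finally show ?thesis .
qed

lemma ds_graph_le:
  assumes "a \<in> A" "0 \<le> s" "p \<in> A" "isproj p" "\<And>u. p \<odot> u = u \<Longrightarrow> norm (a \<odot> u) \<le> s * norm u"
  shows "ds (graph a) s \<le> tr (1 - p)"
  by (rule ds_minmax) (use assms adm_graph in auto)

lemma ds_graph_sproj:
  assumes "0 \<le> s" "sproj (graph a) s \<odot> u = u" shows "norm (a \<odot> u) \<le> s * norm u"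
  using cdd_op.sproj_upper[OF cdd_graph assms] by auto

lemma ds_graph_add:
  "a \<in> A \<Longrightarrow> b \<in> A \<Longrightarrow> 0 \<le> s \<Longrightarrow> 0 \<le> t \<Longrightarrow> ds (graph (a + b)) (s + t) \<le> ds (graph a) s + ds (graph b) t"
  by (rule ds_add) (auto intro: adm_graph A_closed)

lemma tr_compl_kproj:
  assumes b: "b \<in> A" and f: "f \<in> A" "isproj f" "f * b = b"
  shows "tr (1 - kproj b) \<le> tr f"
proof (rule tr_le_of_injective[OF b _ _ f(1,2,3)])
  show "1 - kproj b \<in> A" "isproj (1 - kproj b)" by (intro A_closed kproj_A b isproj_compl kproj_isproj)+
  fix u assume a: "(1 - kproj b) \<odot> u = u" "b \<odot> u = 0"
  have "kproj b \<odot> u = u" using a(2) by (simp add: kproj_fixed)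
  then show "u = 0" using a(1) by simp
qed

lemma tr_lsupp:
  assumes b: "b \<in> A" and f: "f \<in> A" "isproj f" "b * f = b"
  shows "tr (lsupp b) \<le> tr f"
proof (rule tr_le_of_injective[OF A_adj[OF b] lsupp_A[OF b] lsupp_isproj f(1,2)])
  show "f * adj b = adj b" using arg_cong[OF f(3), of adj] f(2) by (simp add: isprojD)
qed (rule lsupp_adj_inj)

lemma ds_left_mult:
  assumes a: "a \<in> A" "u \<in> A" "nbound u 1" "0 \<le> s"
  shows "ds (graph (u * a)) s \<le> ds (graph a) s"
proof -
  interpret cdd_op "graph a" by (rule cdd_graph)
  show ?thesis unfolding ds_def[of "graph a"]
  proof (rule ds_graph_le)
    fix v assume "sproj (graph a) s \<odot> v = v"
    then show "norm ((u * a) \<odot> v) \<le> s * norm v"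
      using ds_graph_sproj[OF a(4)] nboundD[OF a(3), of "a \<odot> v"] by fastforce
  qed (use a in \<open>auto intro!: A_closed sproj_A adm_graph\<close>)
qed

text \<open>The test projection consists of the vectors that v maps into the spectral subspace of a
  up to s. This is the kernel of e v, and e v is injective on its complement.\<close>

lemma ds_right_mult:
  assumes a: "a \<in> A" "v \<in> A" "nbound v 1" "0 \<le> s"
  shows "ds (graph (a * v)) s \<le> ds (graph a) s"
proof -
  interpret cdd_op "graph a" by (rule cdd_graph)
  let ?e = "1 - sproj (graph a) s"
  have eA: "?e \<in> A" "isproj ?e" by (intro A_closed sproj_A adm_graph a isproj_compl sproj_isproj)+
  have "ds (graph (a * v)) s \<le> tr (1 - kproj (?e * v))"
  proof (rule ds_graph_le)
    show "kproj (?e * v) \<in> A" by (intro kproj_A A_mult eA a)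
    fix u assume "kproj (?e * v) \<odot> u = u"
    then have "sproj (graph a) s \<odot> v \<odot> u = v \<odot> u" by (simp add: kproj_fixed)
    then have "norm (a \<odot> v \<odot> u) \<le> s * norm (v \<odot> u)" by (rule ds_graph_sproj[OF a(4)])
    also have "\<dots> \<le> s * norm u" using nboundD[OF a(3), of u] a(4) by (intro mult_left_mono) auto
    finally show "norm ((a * v) \<odot> u) \<le> s * norm u" by simp
  qed (use a in \<open>auto intro!: A_closed\<close>)
  also have "\<dots> \<le> tr ?e"
    by (rule tr_compl_kproj[OF A_mult[OF eA(1) a(2)] eA]) (simp only: mult.assoc[symmetric] isprojD(2)[OF eA(2)])
  finally show ?thesis by (simp only: ds_def)
qed

lemma ds_left_support:
  assumes "a \<in> A" "f \<in> A" "isproj f" "f * a = a" "0 \<le> s"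
  shows "ds (graph a) s \<le> tr f"
proof -
  have "ds (graph a) s \<le> tr (1 - kproj a)"
    by (rule ds_graph_le) (use assms in \<open>auto intro: kproj_A simp: kproj_fixed\<close>)
  also have "\<dots> \<le> tr f" by (rule tr_compl_kproj) (use assms in auto)
  finally show ?thesis .
qed

lemma ds_right_support:
  assumes "a \<in> A" "f \<in> A" "isproj f" "a * f = a" "0 \<le> s"
  shows "ds (graph a) s \<le> tr f"
proof -
  have "ds (graph a) s \<le> tr (1 - (1 - f))"
  proof (rule ds_graph_le)
    fix u assume x: "(1 - f) \<odot> u = u"
    have "a \<odot> u = a \<odot> f \<odot> u" using arg_cong[OF assms(4), of "\<lambda>a. a \<odot> u"] by simp
    then have "a \<odot> u = 0" using x by simp
    then show "norm (a \<odot> u) \<le> s * norm u" using assms(5) by simp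
  qed (use assms in \<open>auto intro: A_closed isproj_compl\<close>)
  then show ?thesis by simp
qed

lemma ds_large: "a \<in> A \<Longrightarrow> nbound a K \<Longrightarrow> K \<le> s \<Longrightarrow> ds (graph a) s = 0"
proof -
  assume a: "a \<in> A" "nbound a K" "K \<le> s"
  have "ds (graph a) s \<le> tr (1 - 1)"
  proof (rule ds_graph_le)
    show "0 \<le> s" using a by (simp add: nbound_def)
    fix u show "norm (a \<odot> u) \<le> s * norm u"
      using nboundD[OF a(2), of u] mult_right_mono[OF a(3), of "norm u"] by simp
  qed (use a A_one in auto)
  then show ?thesis by simp
qed

text \<open>The square of the norm of order two of the trace, possibly infinite.\<close>

definition t2 :: "'h bop \<Rightarrow> ennreal" where "t2 a = tr (adj a * a)"

lemma t2_adj: "a \<in> A \<Longrightarrow> t2 (adj a) = t2 a" by (simp add: t2_def tr_adj)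

lemma t2_add:
  assumes "a \<in> A" "b \<in> A" shows "t2 (a + b) \<le> 2 * t2 a + 2 * t2 b"
proof -
  have "t2 (a + b) \<le> t2 (a + b) + t2 (a - b)" by simp
  also have "\<dots> = tr (adj (a + b) * (a + b) + adj (a - b) * (a - b))"
    unfolding t2_def by (rule tr_add[symmetric]) (use assms in \<open>auto intro!: A_closed pos_adj_mult simp del: adj_simps\<close>)
  also have "adj (a + b) * (a + b) + adj (a - b) * (a - b) = 2 *\<^sub>R (adj a * a) + 2 *\<^sub>R (adj b * b)"
    by (simp add: algebra_simps scaleR_2)
  also have "tr \<dots> = 2 * t2 a + 2 * t2 b"
  proof -
    have m: "adj c * c \<in> A" "pos (adj c * c)" if "c \<in> A" for c using that by (auto intro: A_closed pos_adj_mult)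
    show ?thesis using m[OF assms(1)] m[OF assms(2)]
      by (subst tr_add) (auto intro: A_closed pos_scaleR simp: tr_scaleR t2_def)
  qed
  finally show ?thesis .
qed

lemma t2_left:
  assumes "a \<in> A" "u \<in> A" "nbound u K" shows "t2 (u * a) \<le> ennreal (K^2) * t2 a"
proof -
  have "tr (adj (u * a) * (u * a)) \<le> tr (K^2 *\<^sub>R (adj a * a))"
  proof (rule tr_mono)
    have "0 \<le> inner ((K^2 *\<^sub>R (adj a * a) - adj (u * a) * (u * a)) \<odot> x) x" for x
    proof -
      have "(norm (u \<odot> a \<odot> x))^2 \<le> (K * norm (a \<odot> x))^2" by (intro power_mono nboundD assms) simp
      then show ?thesis by (simp add: inner_diff_left inner_adj' power2_norm_eq_inner power_mult_distrib)
    qed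
    then show "pos (K^2 *\<^sub>R (adj a * a) - adj (u * a) * (u * a))" by (simp add: pos_def mult.assoc)
  qed (use assms in \<open>auto intro!: A_closed pos_adj_mult simp del: adj_simps\<close>)
  then show ?thesis using assms by (simp add: t2_def tr_scaleR A_closed pos_adj_mult)
qed

lemma t2_right:
  assumes "a \<in> A" "u \<in> A" "nbound u K" shows "t2 (a * u) \<le> ennreal (K^2) * t2 a"
proof -
  have "t2 (a * u) = t2 (adj u * adj a)" using t2_adj[of "a * u"] assms by (simp add: A_closed)
  also have "\<dots> \<le> ennreal (K^2) * t2 (adj a)" by (rule t2_left) (use assms in \<open>auto intro: A_closed nbound_adj\<close>)
  finally show ?thesis using assms by (simp add: t2_adj)
qed

lemma t2_proj: "isproj f \<Longrightarrow> t2 f = tr f" by (simp add: t2_def isprojD)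

lemma t2_bound:
  assumes "a \<in> A" "nbound a K" "f \<in> A" "isproj f" "a * f = a"
  shows "t2 a \<le> ennreal (K^2) * tr f"
  using t2_left[of f a K] assms by (simp add: t2_proj)

lemma t2_bound':
  assumes "a \<in> A" "nbound a K" "f \<in> A" "isproj f" "f * a = a"
  shows "t2 a \<le> ennreal (K^2) * tr f"
  using t2_right[of f a K] assms by (simp add: t2_proj)

lemma t2_pythagoras:
  assumes "a \<in> A" "q \<in> A" "isproj q" shows "t2 a = t2 (q * a) + t2 ((1 - q) * a)"
proof -
  have "tr (adj (q * a) * (q * a) + adj ((1 - q) * a) * ((1 - q) * a)) = t2 (q * a) + t2 ((1 - q) * a)"
    unfolding t2_def by (rule tr_add) (use assms in \<open>auto intro!: A_closed pos_adj_mult simp del: adj_simps\<close>)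
  moreover have "adj (q * a) * (q * a) + adj ((1 - q) * a) * ((1 - q) * a) = adj a * a"
  proof -
    have "adj (q * a) * (q * a) + adj ((1 - q) * a) * ((1 - q) * a) = adj a * (q * q) * a + adj a * ((1 - q) * (1 - q)) * a"
      using isprojD(1)[OF assms(3)] isprojD(1)[OF isproj_compl[OF assms(3)]] by (simp only: adj_simps mult.assoc)
    also have "\<dots> = adj a * q * a + adj a * (1 - q) * a"
      by (simp only: isprojD(2)[OF assms(3)] isprojD(2)[OF isproj_compl[OF assms(3)]])
    also have "\<dots> = adj a * a" by (simp add: algebra_simps)
    finally show ?thesis .
  qed
  ultimately show ?thesis by (simp add: t2_def)
qed

text \<open>Here D is the exact mass of a outside the corner at q. It is stated as a summand because
  subtraction of extended values loses information when \<open>t2 a\<close> is infinite.\<close>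

lemma t2_corner:
  assumes "a \<in> A" "q \<in> A" "isproj q"
  shows "\<exists>D. t2 a = t2 (q * a * q) + D \<and> t2 (a - q * a * q) \<le> 2 * D"
proof -
  let ?D = "t2 ((1 - q) * a) + t2 (q * a * (1 - q))"
  have "t2 (q * a) = t2 (q * adj (q * a)) + t2 ((1 - q) * adj (q * a))"
    using t2_pythagoras[of "adj (q * a)" q] t2_adj[of "q * a"] assms by (simp only: A_closed)
  also have "t2 (q * adj (q * a)) = t2 (q * a * q)"
    using t2_adj[of "q * a * q"] assms by (simp add: A_closed isprojD(1) mult.assoc)
  also have "t2 ((1 - q) * adj (q * a)) = t2 (q * a * (1 - q))"
    using t2_adj[of "q * a * (1 - q)"] assms by (simp add: A_closed isprojD(1) mult.assoc)
  finally have "t2 a = t2 (q * a * q) + ?D" using t2_pythagoras[OF assms] by (simp add: ac_simps)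
  moreover have "t2 (a - q * a * q) \<le> 2 * ?D"
  proof -
    have "a - q * a * q = (1 - q) * a + q * a * (1 - q)" by (simp add: algebra_simps)
    then show ?thesis using t2_add[of "(1 - q) * a" "q * a * (1 - q)"] assms
      by (simp only: A_closed distrib_left)
  qed
  ultimately show ?thesis by blast
qed

text \<open>The operator a* a dominates s^2 times the spectral projection of |a| above s, since a
  maps the two spectral parts of a vector to orthogonal vectors.\<close>

lemma chebyshev:
  assumes a: "a \<in> A" and s: "0 \<le> s" shows "ennreal (s^2) * ds (graph a) s \<le> t2 a"
proof -
  interpret cdd_op "graph a" by (rule cdd_graph)
  let ?e = "1 - sproj (graph a) s"
  have e: "?e \<in> A" "isproj ?e" by (intro A_closed sproj_A adm_graph a isproj_compl sproj_isproj)+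
  have "tr (s^2 *\<^sub>R ?e) \<le> tr (adj a * a)"
  proof (rule tr_mono)
    have "0 \<le> inner ((adj a * a - s^2 *\<^sub>R ?e) \<odot> x) x" for x
    proof -
      obtain u1 where h: "(sproj (graph a) s \<odot> x, u1) \<in> graph a" "(x - sproj (graph a) s \<odot> x, a \<odot> x - u1) \<in> graph a"
        "(norm (a \<odot> x))^2 = (norm u1)^2 + (norm (a \<odot> x - u1))^2"
        using sproj_split[of x "a \<odot> x" s] by auto
      have le: "s * norm (?e \<odot> x) \<le> norm (a \<odot> x - u1)"
      proof (cases "?e \<odot> x = 0")
        case False
        then show ?thesis using sproj_lower[OF s _ _ h(2)] by simp
      qed simp
      have "s^2 * (norm (?e \<odot> x))^2 \<le> (norm (a \<odot> x - u1))^2"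
        unfolding power_mult_distrib[symmetric] by (rule power_mono[OF le]) (use s in simp)
      also have "\<dots> \<le> (norm (a \<odot> x))^2" using h(3) by simp
      finally have "s^2 * inner (?e \<odot> x) x \<le> inner (a \<odot> x) (a \<odot> x)"
        by (simp only: isproj_form[OF e(2)] power2_norm_eq_inner)
      then show ?thesis by (simp add: inner_diff_left inner_adj')
    qed
    moreover have "adj (adj a * a - s^2 *\<^sub>R ?e) = adj a * a - s^2 *\<^sub>R ?e" using isprojD(1)[OF e(2)] by simp
    ultimately show "pos (adj a * a - s^2 *\<^sub>R ?e)" unfolding pos_def by blast
  qed (use e a pos_scaleR[OF isproj_pos[OF e(2)]] in \<open>auto intro!: A_closed\<close>)
  then show ?thesis using e by (simp add: t2_def ds_def tr_scaleR isproj_pos)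
qed

text \<open>The part of x above K is unbounded, so its left support is built as the join of the left
  supports of bounded truncations. Each has trace at most that of the right support, and the traces
  of an increasing sequence pass to the join.\<close>

lemma left_support_tail:
  assumes x: "adm x" and K: "0 \<le> K"
  shows "\<exists>l\<in>A. isproj l \<and> tr l \<le> ds x K \<and> (\<forall>u v. (u, v) \<in> x \<longrightarrow> sproj x K \<odot> u = 0 \<longrightarrow> l \<odot> v = v)"
proof -
  interpret cdd_op x by (rule adm_cdd[OF x])
  let ?r = "1 - sproj x K"
  have r: "?r \<in> A" "isproj ?r" by (intro A_closed sproj_A x isproj_compl sproj_isproj)+
  define a where "a n = trunc (real n) * ?r" for n
  have aA: "a n \<in> A" for n unfolding a_def by (intro A_mult trunc_A x r) simp
  define l where "l n = lsupp (a n)" for n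
  have "l (Suc n) * l n = l n" for n
    unfolding l_def[of n]
  proof (rule lsupp_least)
    show "isproj (l (Suc n))" by (simp add: l_def)
    have com: "sproj x (real n) * ?r = ?r * sproj x (real n)"
    proof (cases "real n \<le> K")
      case True
      then show ?thesis using sproj_mono[OF True] sproj_mono'[OF True] by (simp add: left_diff_distrib right_diff_distrib)
    next
      case False
      then have "K \<le> real n" by simp
      then show ?thesis using sproj_mono[of K "real n"] sproj_mono'[of K "real n"] by (simp add: left_diff_distrib right_diff_distrib)
    qed
    have "a n = trunc (real (Suc n)) * (sproj x (real n) * ?r)"
      using trunc_sproj[of "real n" "real (Suc n)"] by (simp add: a_def mult.assoc[symmetric])
    then have eq: "a n = a (Suc n) * sproj x (real n)" by (simp only: com a_def mult.assoc)
    show "l (Suc n) * a n = a n" unfolding eq l_def by (simp only: mult.assoc[symmetric] lsupp_mult)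
  qed
  note inc = this
  have lA: "l n \<in> A" "isproj (l n)" for n by (simp_all add: l_def lsupp_A aA)
  show ?thesis
  proof (intro bexI[of _ "join (range l)"] conjI allI impI)
    show "join (range l) \<in> A" using lA by (intro join_A) auto
    have "tr (l n) \<le> ds x K" for n
      unfolding ds_def l_def by (rule tr_lsupp[OF aA r]) (simp add: a_def mult.assoc isprojD(2)[OF r(2)])
    then show "tr (join (range l)) \<le> ds x K"
      unfolding tr_proj_limit[of l, OF lA inc] by (rule SUP_least)
    fix u v assume m: "(u, v) \<in> x" "sproj x K \<odot> u = 0"
    have "join (range l) \<odot> a n \<odot> z = a n \<odot> z" for n z
    proof -
      have 1: "join (range l) * l n = l n" by (rule join_upper) auto
      have "join (range l) * (l n * a n) = l n * a n" by (simp only: mult.assoc[symmetric] 1)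
      then have "join (range l) * a n = a n" by (simp only: l_def lsupp_mult)
      from arg_cong[OF this, of "\<lambda>a. a \<odot> z"] show ?thesis by simp
    qed
    moreover have "a n \<odot> u = trunc (real n) \<odot> u" for n using m(2) by (simp add: a_def)
    ultimately have "join (range l) \<odot> trunc (real n) \<odot> u = trunc (real n) \<odot> u" for n by metis
    then show "join (range l) \<odot> v = v"
      using LIMSEQ_unique[OF bapply_tendsto[OF trunc_limit[OF m(1)]]] trunc_limit[OF m(1)] by simp
  qed simp
qed

lemma ds_tau_measurable:
  assumes x: "tau_measurable M \<tau> x" and \<epsilon>: "0 < \<epsilon>"
  shows "\<exists>s\<ge>0. ds x s \<le> ennreal \<epsilon>"
proof -
  have adm: "adm x" using x by (simp add: tau_measurable_def adm_def)
  obtain p where p: "p \<in> projections M" "Range p \<subseteq> Domain x" "\<tau> (op_minus Id p) < ennreal \<epsilon>" "op_times x p \<in> M"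
    using x \<epsilon> unfolding tau_measurable_def by blast
  obtain q where q: "q \<in> A" "p = graph q" "isproj q" using p(1) by (auto simp: projections_def M_iff)
  obtain b where b: "op_times x p = graph b" using p(4) unfolding M_iff by blast
  obtain K where K: "nbound b K" using nbound_exists by blast
  have "ds x K \<le> tr (1 - q)"
  proof (rule ds_minmax[OF adm _ q(1,3)])
    show "0 \<le> K" using K by (simp add: nbound_def)
    fix u assume "q \<odot> u = u"
    moreover have "(u, b \<odot> u) \<in> op_times x p" by (simp add: b)
    ultimately have "(u, b \<odot> u) \<in> x" by (auto simp: op_times_def q(2))
    then show "\<exists>v. (u, v) \<in> x \<and> norm v \<le> K * norm u" using nboundD[OF K] by blast
  qed
  moreover have "tr (1 - q) = \<tau> (op_minus Id p)" by (simp add: tr_def q(2) Id_graph)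
  ultimately show ?thesis using p(3) K by (intro exI[of _ K]) (auto simp: nbound_def)
qed

lemma tau_measurable_graph: "a \<in> A \<Longrightarrow> tau_measurable M \<tau> (graph a)"
  unfolding tau_measurable_def
proof (intro conjI allI impI)
  assume a: "a \<in> A"
  show "closed_densely_defined (graph a)" "affiliated M (graph a)" using adm_graph[OF a] by (auto simp: adm_def)
  fix \<epsilon> :: real assume "0 < \<epsilon>"
  then show "\<exists>p\<in>projections M. Range p \<subseteq> Domain (graph a) \<and> \<tau> (op_minus Id p) < ennreal \<epsilon> \<and> op_times (graph a) p \<in> M"
    using a A_one tr_zero
    by (intro bexI[of _ "graph 1"]) (auto simp: Id_graph projections_def A_def tr_def[symmetric] simp flip: tr_def)
qed

text \<open>The complement of the join of the 1 - e_n lies below every e_n, so it is 0; infimum 0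
  thereby becomes strong convergence.\<close>

lemma decreasing_to_zero:
  assumes "proj_decreasing_to_zero M e"
  obtains e' where "\<And>n. e n = graph (e' n)" "\<And>n. e' n \<in> A" "\<And>n. isproj (e' n)"
    "\<And>n. e' n * e' (Suc n) = e' (Suc n)" "\<And>x. (\<lambda>n. e' n \<odot> x) \<longlonglongrightarrow> 0"
proof -
  have "\<forall>n. \<exists>a. a \<in> A \<and> e n = graph a \<and> isproj a"
  proof
    fix n
    have "e n \<in> M" "projection_op (e n)" using assms by (auto simp: proj_decreasing_to_zero_def projections_def)
    then show "\<exists>a. a \<in> A \<and> e n = graph a \<and> isproj a" by (auto simp: M_iff)
  qed
  from choice[OF this] obtain e' where e': "\<And>n. e n = graph (e' n)" "\<And>n. e' n \<in> A" "\<And>n. isproj (e' n)" by blast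
  have le: "e' n * e' (Suc n) = e' (Suc n)" for n
  proof -
    have "op_le (e (Suc n)) (e n)" using assms by (simp add: proj_decreasing_to_zero_def)
    then show ?thesis using isproj_le_iff[OF e'(3) e'(3)] by (simp add: e'(1))
  qed
  define q where "q n = 1 - e' n" for n
  have q: "isproj (q n)" "q n \<in> A" for n by (simp_all add: q_def isproj_compl e' A_closed)
  have inc: "q (Suc n) * q n = q n" for n
    using isproj_adj_le[OF e'(3) e'(3) le[of n]] by (simp add: q_def left_diff_distrib right_diff_distrib)
  define J where "J = join (range q)"
  have JA: "J \<in> A" unfolding J_def by (rule join_A) (use q in auto)
  have "graph (1 - J) = op_zero"
  proof -
    have "graph (1 - J) \<in> projections M"
      using A_diff[OF A_one JA] by (simp add: projections_def A_def isproj_compl J_def)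
    moreover have "op_le (graph (1 - J)) (e n)" for n
    proof -
      have qJ: "q n * J = q n" unfolding J_def by (rule isproj_adj_le[OF _ q(1) join_upper]) auto
      have "e' n * (1 - J) = (1 - q n) * (1 - J)" by (simp add: q_def)
      also have "\<dots> = 1 - J" by (simp add: left_diff_distrib right_diff_distrib qJ)
      finally have "pos (e' n - (1 - J))"
        by (subst isproj_le_iff) (simp_all add: e' isproj_compl J_def)
      then show ?thesis by (simp add: e'(1))
    qed
    ultimately show ?thesis using assms unfolding proj_decreasing_to_zero_def by blast
  qed
  then have J1: "J = 1" by (simp add: op_zero_graph)
  have "(\<lambda>n. e' n \<odot> x) \<longlonglongrightarrow> 0" for x
  proof -
    have "(\<lambda>n. q n \<odot> x) \<longlonglongrightarrow> x" using proj_increasing_limit[of q, OF q(1) inc, of x] J1 by (simp add: J_def)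
    from tendsto_diff[OF tendsto_const[of x] this] show ?thesis by (simp add: q_def)
  qed
  then show ?thesis using that[OF e' le] by blast
qed

text \<open>The operators g (1 - e_n) g increase to g, and normality gives convergence of their
  traces to tr g. Finiteness of tr g allows the subtraction.\<close>

lemma tr_compress_limit:
  assumes e: "\<And>n. e n \<in> A" "\<And>n. isproj (e n)" "\<And>n. e n * e (Suc n) = e (Suc n)" "\<And>x. (\<lambda>n. e n \<odot> x) \<longlonglongrightarrow> 0"
    and g: "g \<in> A" "isproj g" "tr g < \<infinity>"
  shows "(\<lambda>n. tr (g * e n * g)) \<longlonglongrightarrow> 0"
proof -
  define h where "h n = g * (1 - e n) * g" for n
  have hA: "h n \<in> A" for n unfolding h_def by (intro A_closed g e)
  have conj: "pos (g * a * g)" if "pos a" for a using pos_conj[OF that, of g] isprojD(1)[OF g(2)] by simp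
  have hp: "pos (h n)" for n unfolding h_def by (intro conj isproj_pos isproj_compl e)
  have inc: "pos (h (Suc n) - h n)" for n
  proof -
    have "pos (e n - e (Suc n))" using isproj_le_iff[OF e(2) e(2)] e(3) by simp
    then have "pos (g * (e n - e (Suc n)) * g)" by (rule conj)
    then show ?thesis by (simp add: h_def algebra_simps)
  qed
  have lim: "(\<lambda>n. h n \<odot> x) \<longlonglongrightarrow> g \<odot> x" for x
  proof -
    have "(\<lambda>n. g \<odot> (g \<odot> x - e n \<odot> g \<odot> x)) \<longlonglongrightarrow> g \<odot> (g \<odot> x - 0)"
      by (intro bapply_tendsto tendsto_diff tendsto_const e)
    then show ?thesis using g(2) by (simp add: h_def)
  qed
  have "tr g = (SUP n. tr (h n))" by (rule tr_normal[OF hA hp inc g(1) lim])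
  moreover have "incseq (\<lambda>n. tr (h n))" by (intro incseq_SucI tr_mono hA hp inc)
  ultimately have L: "(\<lambda>n. tr (h n)) \<longlonglongrightarrow> tr g" using LIMSEQ_SUP by fastforce
  have sum: "tr g = tr (h n) + tr (g * e n * g)" for n
  proof -
    have "tr (h n + g * e n * g) = tr (h n) + tr (g * e n * g)"
      by (rule tr_add[OF hA _ hp]) (intro A_closed g e, intro conj isproj_pos e)
    moreover have "h n + g * e n * g = g" using isprojD(2)[OF g(2)] by (simp add: h_def algebra_simps)
    ultimately show ?thesis by simp
  qed
  have fin: "tr (h n) \<noteq> \<infinity>" for n using sum[of n] g(3) by (metis ennreal_add_eq_top infinity_ennreal_def less_irrefl)
  have "tr (g * e n * g) = tr g - tr (h n)" for n using sum[of n] fin[of n] by simp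
  moreover have "(\<lambda>n. tr g - tr (h n)) \<longlonglongrightarrow> tr g - tr g"
    by (intro tendsto_diff_ennreal tendsto_const L) (use g(3) in auto)
  ultimately show ?thesis using g(3) by simp
qed

end

section \<open>Rearrangements in symmetric function spaces\<close>

definition dist_fun :: "(real \<Rightarrow> real) \<Rightarrow> real \<Rightarrow> ennreal"
  where "dist_fun f s = emeasure Rplus {u \<in> {0..}. s < \<bar>f u\<bar>}"

text \<open>The decreasing function whose distribution function is \<open>D\<close>; the value at \<open>0\<close> is junk
  when \<open>D\<close> vanishes nowhere.\<close>

definition gen_inverse :: "(real \<Rightarrow> ennreal) \<Rightarrow> real \<Rightarrow> real"
  where "gen_inverse D t = enn2real (Inf {ennreal s | s. 0 \<le> s \<and> D s \<le> ennreal t})"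

text \<open>Antitone, right continuous and vanishing at infinity. The last clause keeps the
  generalized inverse finite for positive arguments; \<open>D\<close> may be infinite near
  0.\<close>

definition is_dist :: "(real \<Rightarrow> ennreal) \<Rightarrow> bool"
  where "is_dist D \<longleftrightarrow> (\<forall>s t. 0 \<le> s \<longrightarrow> s \<le> t \<longrightarrow> D t \<le> D s) \<and>
    (\<forall>s\<ge>0. D s = (SUP n. D (s + 1 / real (Suc n)))) \<and> (\<forall>\<epsilon>>0. \<exists>s\<ge>0. D s \<le> ennreal \<epsilon>)"

lemma gen_inverse_nonneg: "0 \<le> gen_inverse D t"
  by (simp add: gen_inverse_def)

text \<open>The Galois connection between D and its inverse. Right continuity leaves a gap 1 / (n +
  1) that survives the infimum, and vanishing at infinity makes the infimum finite before
  \<open>enn2real\<close> is applied.\<close>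

lemma gen_inverse_less_iff:
  assumes D: "is_dist D" and s: "0 \<le> s" and t: "0 < t"
  shows "s < gen_inverse D t \<longleftrightarrow> ennreal t < D s"
proof
  let ?S = "{ennreal s | s. 0 \<le> s \<and> D s \<le> ennreal t}"
  have mono: "\<And>s t. 0 \<le> s \<Longrightarrow> s \<le> t \<Longrightarrow> D t \<le> D s" using D unfolding is_dist_def by blast
  assume "s < gen_inverse D t"
  show "ennreal t < D s"
  proof (rule ccontr)
    assume "\<not> ennreal t < D s"
    then have "Inf ?S \<le> ennreal s" using s by (intro Inf_lower) auto
    then have "gen_inverse D t \<le> s" unfolding gen_inverse_def
      using enn2real_mono[of "Inf ?S" "ennreal s"] s by simp
    then show False using \<open>s < gen_inverse D t\<close> by simp
  qed
next
  let ?S = "{ennreal s | s. 0 \<le> s \<and> D s \<le> ennreal t}"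
  have mono: "\<And>s t. 0 \<le> s \<Longrightarrow> s \<le> t \<Longrightarrow> D t \<le> D s" using D unfolding is_dist_def by blast
  assume lt: "ennreal t < D s"
  have "D s = (SUP n. D (s + 1 / real (Suc n)))" using D s unfolding is_dist_def by blast
  then obtain n where n: "ennreal t < D (s + 1 / real (Suc n))" using lt less_SUP_iff by (metis (no_types, lifting))
  obtain s1 where s1: "0 \<le> s1" "D s1 \<le> ennreal t" using D t unfolding is_dist_def by blast
  then have fin: "Inf ?S \<le> ennreal s1" by (intro Inf_lower) auto
  have "ennreal (s + 1 / real (Suc n)) \<le> Inf ?S"
  proof (rule Inf_greatest)
    fix x assume "x \<in> ?S"
    then obtain r where r: "x = ennreal r" "0 \<le> r" "D r \<le> ennreal t" by blast
    have "s + 1 / real (Suc n) \<le> r"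
    proof (rule ccontr)
      assume "\<not> ?thesis"
      then have "D (s + 1 / real (Suc n)) \<le> D r" using r(2) by (intro mono) auto
      then show False using n r(3) by simp
    qed
    then show "ennreal (s + 1 / real (Suc n)) \<le> x" unfolding r(1) by (rule ennreal_leI)
  qed
  moreover have "Inf ?S < top" using fin by (rule le_less_trans) simp
  ultimately have "enn2real (ennreal (s + 1 / real (Suc n))) \<le> gen_inverse D t"
    unfolding gen_inverse_def by (intro enn2real_mono) auto
  moreover have "0 \<le> s + 1 / real (Suc n)" using s by simp
  ultimately have "s + 1 / real (Suc n) \<le> gen_inverse D t" by (simp only: enn2real_ennreal)
  then show "s < gen_inverse D t" using zero_less_divide_1_iff[of "real (Suc n)"] by linarith
qed

lemma borel_measurable_Rplus: "f \<in> borel_measurable borel \<Longrightarrow> f \<in> borel_measurable Rplus"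
  by (intro measurable_restrict_space1 measurable_completion) simp

lemma emeasure_Rplus: "A \<in> sets borel \<Longrightarrow> A \<subseteq> {0..} \<Longrightarrow> emeasure Rplus A = emeasure lborel A"
  by (subst emeasure_restrict_space) (auto simp: emeasure_completion)

lemma space_Rplus [simp]: "space Rplus = {0..}" by (simp add: space_restrict_space)

lemma dist_sets:
  fixes g :: "real \<Rightarrow> real"
  assumes "g \<in> borel_measurable Rplus" shows "{u \<in> {0..}. s < \<bar>g u\<bar>} \<in> sets Rplus"
  using borel_measurable_abs[OF assms] unfolding borel_measurable_iff_greater space_Rplus by blast

lemma gen_inverse_superlevel:
  assumes "is_dist D" "0 \<le> s"
  shows "{u. 0 < u \<and> s < gen_inverse D u} = (if D s = \<infinity> then {0<..} else {0<..<enn2real (D s)})"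
proof -
  have "ennreal u < D s \<longleftrightarrow> u < enn2real (D s)" if "D s \<noteq> \<infinity>" "0 < u" for u
  proof (cases "D s")
    case (real r)
    then show ?thesis using that by (simp add: ennreal_less_iff)
  qed (use that in simp)
  moreover have "ennreal u < \<infinity>" for u by simp
  ultimately show ?thesis using gen_inverse_less_iff[OF assms] by auto
qed

lemma gen_inverse_borel:
  assumes D: "is_dist D" shows "(\<lambda>t. gen_inverse D t * indicator {0<..} t) \<in> borel_measurable borel"
proof (rule borel_measurableI_greater)
  fix a :: real
  show "{w \<in> space borel. a < gen_inverse D w * indicator {0<..} w} \<in> sets borel"
  proof (cases "a < 0")
    case True
    have "0 \<le> gen_inverse D w * indicator {0<..} w" for w
      by (intro mult_nonneg_nonneg gen_inverse_nonneg) simp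
    then have "{w \<in> space borel. a < gen_inverse D w * indicator {0<..} w} = UNIV"
      using True by (auto intro: less_le_trans)
    then show ?thesis by simp
  next
    case False
    then have "{w \<in> space borel. a < gen_inverse D w * indicator {0<..} w} = {u. 0 < u \<and> a < gen_inverse D u}"
      by (auto simp: indicator_def)
    then show ?thesis using gen_inverse_superlevel[OF D, of a] False by simp
  qed
qed

lemma AE_Rplus_positive: "AE u in Rplus. 0 < u"
proof (rule AE_I)
  show "emeasure Rplus {0} = 0" by (subst emeasure_Rplus) auto
  show "{0} \<in> sets Rplus" by (simp add: sets_restrict_space_iff)
qed auto

lemma gen_inverse_measurable:
  assumes D: "is_dist D" shows "gen_inverse D \<in> borel_measurable Rplus"
proof -
  have "(\<lambda>t. gen_inverse D t * indicator {0<..} t + gen_inverse D 0 * indicator {0} t) \<in> borel_measurable borel"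
    by (intro borel_measurable_add gen_inverse_borel[OF D]) simp
  from borel_measurable_Rplus[OF this] show ?thesis
    by (rule measurable_cong[THEN iffD1, rotated]) (auto simp: indicator_def)
qed

lemma dist_gen_inverse:
  assumes D: "is_dist D" and s: "0 \<le> s" shows "dist_fun (gen_inverse D) s = D s"
proof -
  let ?B = "{u. 0 < u \<and> s < gen_inverse D u}"
  have B: "?B \<in> sets borel" "?B \<subseteq> {0..}" by (simp add: gen_inverse_superlevel[OF D s], auto)
  have "{u \<in> {0..}. s < \<bar>gen_inverse D u\<bar>} \<in> sets Rplus"
    by (rule dist_sets[OF gen_inverse_measurable[OF D]])
  moreover have "?B \<in> sets Rplus" using B by (simp add: sets_restrict_space_iff)
  ultimately have "dist_fun (gen_inverse D) s = emeasure Rplus ?B"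
    unfolding dist_fun_def
    by (intro emeasure_eq_AE) (use AE_Rplus_positive in \<open>auto elim!: eventually_mono simp: gen_inverse_nonneg\<close>)
  also have "\<dots> = emeasure lborel ?B" by (rule emeasure_Rplus[OF B])
  also have "\<dots> = D s"
  proof (cases "D s = \<infinity>")
    case True
    then have "?B = {0<..}" using gen_inverse_superlevel[OF D s] by simp
    moreover have "emeasure lborel {0::real<..} = \<infinity>"
    proof (rule ccontr)
      assume "emeasure lborel {0::real<..} \<noteq> \<infinity>"
      then obtain r where r: "0 \<le> r" "emeasure lborel {0::real<..} = ennreal r"
        by (metis ennreal_cases infinity_ennreal_def)
      have "emeasure lborel {0<..<r + 1} \<le> emeasure lborel {0::real<..}" by (rule emeasure_mono) auto
      then show False using r by (simp add: ennreal_le_iff)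
    qed
    ultimately show ?thesis using True by simp
  next
    case False
    then have "?B = {0<..<enn2real (D s)}" using gen_inverse_superlevel[OF D s] by simp
    then show ?thesis using False by (simp add: less_top)
  qed
  finally show ?thesis .
qed

lemma dist_antimono: "g \<in> borel_measurable Rplus \<Longrightarrow> s \<le> t \<Longrightarrow> dist_fun g t \<le> dist_fun g s"
  unfolding dist_fun_def by (intro emeasure_mono dist_sets) auto

lemma dist_right:
  assumes g: "g \<in> borel_measurable Rplus" shows "dist_fun g s = (SUP n. dist_fun g (s + 1 / real (Suc n)))"
proof -
  let ?A = "\<lambda>n. {u \<in> {0..}. s + 1 / real (Suc n) < \<bar>g u\<bar>}"
  have "incseq ?A"
  proof (rule incseq_SucI)
    fix n
    have "1 / real (Suc (Suc n)) \<le> 1 / real (Suc n)" by (simp add: frac_le)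
    then show "?A n \<subseteq> ?A (Suc n)" by auto
  qed
  then have "(SUP n. emeasure Rplus (?A n)) = emeasure Rplus (\<Union>n. ?A n)"
    by (intro SUP_emeasure_incseq) (use dist_sets[OF g] in auto)
  also have "(\<Union>n. ?A n) = {u \<in> {0..}. s < \<bar>g u\<bar>}"
  proof (intro equalityI subsetI)
    fix u assume u: "u \<in> {u \<in> {0..}. s < \<bar>g u\<bar>}"
    then have "0 < \<bar>g u\<bar> - s" by simp
    then obtain n where "1 / real (Suc n) < \<bar>g u\<bar> - s" using nat_approx_posE by metis
    then show "u \<in> (\<Union>n. ?A n)" using u by (auto intro!: exI[of _ n])
  next
    fix u assume "u \<in> (\<Union>n. ?A n)"
    then obtain n where n: "0 \<le> u" "s + 1 / real (Suc n) < \<bar>g u\<bar>" by auto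
    have "0 < 1 / real (Suc n)" by simp
    then have "s < \<bar>g u\<bar>" using n(2) by linarith
    then show "u \<in> {u \<in> {0..}. s < \<bar>g u\<bar>}" using n(1) by simp
  qed
  finally show ?thesis by (simp add: dist_fun_def)
qed

text \<open>Finiteness at one level gives continuity of the measure from above, hence decay at
  infinity.\<close>

lemma is_dist_dist_fun:
  assumes g: "g \<in> borel_measurable Rplus" and fin: "dist_fun g s0 < \<infinity>"
  shows "is_dist (dist_fun g)"
  unfolding is_dist_def
proof (intro conjI allI impI)
  show "dist_fun g t \<le> dist_fun g s" if "s \<le> t" for s t by (rule dist_antimono[OF g that])
  show "dist_fun g s = (SUP n. dist_fun g (s + 1 / real (Suc n)))" for s by (rule dist_right[OF g])
  fix \<epsilon> :: real assume e: "0 < \<epsilon>"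
  let ?A = "\<lambda>n. {u \<in> {0..}. \<bar>s0\<bar> + real n < \<bar>g u\<bar>}"
  have "(\<lambda>n. emeasure Rplus (?A n)) \<longlonglongrightarrow> emeasure Rplus (\<Inter>n. ?A n)"
  proof (rule Lim_emeasure_decseq)
    show "range ?A \<subseteq> sets Rplus" using dist_sets[OF g] by auto
    show "decseq ?A" by (auto simp: decseq_def)
    show "emeasure Rplus (?A n) \<noteq> \<infinity>" for n
    proof -
      have "dist_fun g (\<bar>s0\<bar> + real n) \<le> dist_fun g s0" by (rule dist_antimono[OF g]) simp
      then have "dist_fun g (\<bar>s0\<bar> + real n) < \<infinity>" using fin by (rule le_less_trans)
      then show ?thesis by (simp add: dist_fun_def)
    qed
  qed
  moreover have "(\<Inter>n. ?A n) = {}"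
  proof -
    have "\<exists>n. \<not> \<bar>s0\<bar> + real n < \<bar>g u\<bar>" for u
    proof -
      obtain n where "\<bar>g u\<bar> \<le> real n" using real_arch_simple by blast
      then show ?thesis by (intro exI[of _ n]) auto
    qed
    then show ?thesis by auto
  qed
  ultimately have "(\<lambda>n. dist_fun g (\<bar>s0\<bar> + real n)) \<longlonglongrightarrow> 0" by (simp add: dist_fun_def)
  then have "\<forall>\<^sub>F n in sequentially. dist_fun g (\<bar>s0\<bar> + real n) < ennreal \<epsilon>"
    by (rule order_tendstoD) (use e in simp)
  then obtain n where "dist_fun g (\<bar>s0\<bar> + real n) < ennreal \<epsilon>" by (auto simp: eventually_sequentially)
  then show "\<exists>s\<ge>0. dist_fun g s \<le> ennreal \<epsilon>" by (intro exI[of _ "\<bar>s0\<bar> + real n"]) auto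
qed

text \<open>Equimeasurable copies of \<open>f\<close> supported by the unit intervals of even (\<open>j = 0\<close>) and odd
  (\<open>j = 1\<close>) index.\<close>

definition copy_fun :: "int \<Rightarrow> (real \<Rightarrow> real) \<Rightarrow> real \<Rightarrow> real"
  where "copy_fun j f t = (if 0 \<le> t \<and> \<lfloor>t\<rfloor> mod 2 = j then f (t - (of_int \<lfloor>t\<rfloor> + of_int j) / 2) else 0)"

text \<open>Where floor t = 2 k + j the shift equals k + j, so [k, k + 1) is translated onto [2 k +
  j, 2 k + j + 1): the set is cut into unit pieces that are spread out without changing their
  measure.\<close>

lemma emeasure_copy:
  fixes B :: "real set" and j :: int
  assumes B: "B \<in> sets borel" "B \<subseteq> {0..}" and j: "j = 0 \<or> j = 1"
  shows "emeasure lborel {t. 0 \<le> t \<and> \<lfloor>t\<rfloor> mod 2 = j \<and> t - (of_int \<lfloor>t\<rfloor> + of_int j) / 2 \<in> B} = emeasure lborel B"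
    (is "emeasure lborel ?T = _")
proof -
  define I where "I k = {real k..<real k + 1}" for k :: nat
  define e where "e k = {t. t - (real k + of_int j) \<in> B \<inter> I k}" for k
  have Bm: "B \<inter> I k \<in> sets borel" for k using B by (simp add: I_def)
  have em: "e k \<in> sets borel" for k
  proof -
    have "(\<lambda>t. t - (real k + of_int j)) -` (B \<inter> I k) \<inter> space borel \<in> sets borel"
      by (rule measurable_sets[OF _ Bm]) simp
    then show ?thesis by (simp add: e_def vimage_def)
  qed
  have ek: "emeasure lborel (e k) = emeasure lborel (B \<inter> I k)" for k
  proof -
    have "emeasure lborel (e k) = emeasure (distr lborel borel ((+) (real k + of_int j))) (e k)"
      by (simp add: lborel_distr_plus)
    also have "\<dots> = emeasure lborel ((+) (real k + of_int j) -` e k \<inter> space lborel)"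
      by (rule emeasure_distr) (simp_all add: em)
    also have "(+) (real k + of_int j) -` e k \<inter> space lborel = B \<inter> I k" by (auto simp: e_def)
    finally show ?thesis .
  qed
  have fl: "\<lfloor>t\<rfloor> = 2 * int k + j" if "t - (real k + of_int j) \<in> I k" for t k
    using that j unfolding I_def by (intro floor_unique) auto
  have T: "?T = (\<Union>k. e k)"
  proof (intro equalityI subsetI)
    fix t assume t: "t \<in> ?T"
    then have f: "0 \<le> \<lfloor>t\<rfloor>" "\<lfloor>t\<rfloor> mod 2 = j" by simp_all
    define k where "k = nat (\<lfloor>t\<rfloor> div 2)"
    have k: "\<lfloor>t\<rfloor> = 2 * int k + j" using f by (simp add: k_def) (metis mult_div_mod_eq)
    then have fr: "(of_int \<lfloor>t\<rfloor> :: real) = 2 * real k + of_int j" by simp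
    have eq: "t - (of_int \<lfloor>t\<rfloor> + of_int j) / 2 = t - (real k + of_int j)" by (simp add: fr field_simps)
    have "of_int \<lfloor>t\<rfloor> \<le> t" "t < of_int \<lfloor>t\<rfloor> + 1" by linarith+
    then have "t - (real k + of_int j) \<in> I k" by (simp add: I_def fr)
    then have "t \<in> e k" using t eq by (simp add: e_def)
    then show "t \<in> (\<Union>k. e k)" by blast
  next
    fix t assume "t \<in> (\<Union>k. e k)"
    then obtain k where k: "t - (real k + of_int j) \<in> B" "t - (real k + of_int j) \<in> I k" by (auto simp: e_def)
    have f: "\<lfloor>t\<rfloor> = 2 * int k + j" by (rule fl[OF k(2)])
    then have fr: "(of_int \<lfloor>t\<rfloor> :: real) = 2 * real k + of_int j" by simp
    have "\<lfloor>t\<rfloor> mod 2 = j" using f j by auto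
    moreover have "0 \<le> t" using k(2) j by (auto simp: I_def)
    moreover have "t - (of_int \<lfloor>t\<rfloor> + of_int j) / 2 = t - (real k + of_int j)" by (simp add: fr field_simps)
    ultimately show "t \<in> ?T" using k(1) by (simp only: mem_Collect_eq)
  qed
  have "disjoint_family e"
    unfolding disjoint_family_on_def
  proof (intro ballI impI)
    fix k l :: nat assume "k \<noteq> l"
    have "False" if "t \<in> e k" "t \<in> e l" for t
      using fl[of t k] fl[of t l] that \<open>k \<noteq> l\<close> by (auto simp: e_def)
    then show "e k \<inter> e l = {}" by auto
  qed
  then have "emeasure lborel ?T = (\<Sum>k. emeasure lborel (e k))"
    unfolding T by (intro suminf_emeasure[symmetric]) (use em in auto)
  also have "\<dots> = (\<Sum>k. emeasure lborel (B \<inter> I k))" by (simp add: ek)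
  also have "\<dots> = emeasure lborel (\<Union>k. B \<inter> I k)"
  proof (rule suminf_emeasure)
    show "disjoint_family (\<lambda>k. B \<inter> I k)"
      unfolding disjoint_family_on_def
    proof (intro ballI impI)
      fix k l :: nat assume kl: "k \<noteq> l"
      have "False" if "t \<in> I k" "t \<in> I l" for t
      proof -
        have "\<lfloor>t\<rfloor> = int k" "\<lfloor>t\<rfloor> = int l" using that by (auto simp: I_def intro!: floor_unique)
        then show False using kl by simp
      qed
      then show "B \<inter> I k \<inter> (B \<inter> I l) = {}" by auto
    qed
  qed (use Bm in auto)
  also have "(\<Union>k. B \<inter> I k) = B"
  proof (intro equalityI subsetI)
    fix t assume t: "t \<in> B"
    then have "0 \<le> t" using B(2) by auto
    then have "t \<in> I (nat \<lfloor>t\<rfloor>)" by (simp add: I_def)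
    then show "t \<in> (\<Union>k. B \<inter> I k)" using t by blast
  qed auto
  finally show ?thesis .
qed

context symmetric_quasi_banach_space
begin

lemma rearrangement:
  assumes "f \<in> E" "g \<in> borel_measurable Rplus" "\<And>s. 0 \<le> s \<Longrightarrow> dist_fun g s = dist_fun f s"
  shows "g \<in> E \<and> N g = N f"
proof (rule rearrangement_invariant[OF assms(1,2)])
  fix t :: real
  have "{ennreal s | s. 0 \<le> s \<and> emeasure Rplus {u \<in> {0..}. s < \<bar>g u\<bar>} \<le> ennreal t} =
      {ennreal s | s. 0 \<le> s \<and> emeasure Rplus {u \<in> {0..}. s < \<bar>f u\<bar>} \<le> ennreal t}"
    using assms(3) by (auto simp: dist_fun_def)
  then show "decreasing_rearrangement g t = decreasing_rearrangement f t"
    by (simp add: decreasing_rearrangement_def)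
qed

lemma restrict_mem:
  assumes f: "f \<in> E" and m: "g \<in> borel_measurable Rplus" and le: "\<And>t. \<bar>g t\<bar> \<le> \<bar>f t\<bar>"
  shows "g \<in> E" "N g \<le> N f"
  using ideal[OF f m] le by auto

end

section \<open>Consequences of order continuity and of the lower estimate\<close>

locale oc_space = symmetric_quasi_banach_space +
  fixes q :: real
  assumes oc: "order_continuous_space E N" and q0: "0 < q" and lower: "lower_estimate_const_one q E N"
begin

text \<open>The range of a decreasing sequence is a downward directed set, which gives the
  sequential form of order continuity.\<close>

lemma N_tendsto_zero:
  assumes h: "\<And>m. h m \<in> E" and nonneg: "\<And>m t. 0 \<le> h m t"
    and dec: "\<And>m n t. m \<le> n \<Longrightarrow> h n t \<le> h m t" and lim: "\<And>t. (\<lambda>m. h m t) \<longlonglongrightarrow> 0"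
  shows "(\<lambda>m. N (h m)) \<longlonglongrightarrow> (0::real)"
proof -
  define D where "D = range (h :: nat \<Rightarrow> real \<Rightarrow> real)"
  have ex: "\<exists>f\<in>D. \<forall>g\<in>D. (AE t in Rplus. g t \<le> f t) \<longrightarrow> N g < \<epsilon>" if "\<epsilon> > 0" for \<epsilon>
  proof -
    have c: "D \<subseteq> E" "D \<noteq> {}" using h by (auto simp: D_def)
    have dir: "\<exists>h\<in>D. (AE t in Rplus. h t \<le> f t) \<and> (AE t in Rplus. h t \<le> g t)" if "f \<in> D" "g \<in> D" for f g
    proof -
      obtain m n where "f = h m" "g = h n" using \<open>f \<in> D\<close> \<open>g \<in> D\<close> by (auto simp: D_def)
      then show ?thesis by (intro bexI[of _ "h (max m n)"]) (auto simp: D_def intro!: AE_I2 dec)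
    qed
    have inf: "AE t in Rplus. g t \<le> 0" if "\<forall>f\<in>D. AE t in Rplus. g t \<le> f t" for g
    proof -
      have "AE t in Rplus. \<forall>m. g t \<le> h m t" unfolding AE_all_countable using that by (auto simp: D_def)
      then show ?thesis
        by (rule eventually_mono) (rule LIMSEQ_le_const[OF lim], auto)
    qed
    have nn: "AE t in Rplus. 0 \<le> f t" if "f \<in> D" for f using that nonneg by (auto simp: D_def)
    have "\<forall>\<epsilon>>0. \<exists>f\<in>D. \<forall>g\<in>D. (AE t in Rplus. g t \<le> f t) \<longrightarrow> N g < \<epsilon>"
    proof (rule oc[unfolded order_continuous_space_def, THEN spec[of _ D], THEN mp])
      have "\<forall>f\<in>D. \<forall>g\<in>D. \<exists>h\<in>D. (AE t in Rplus. h t \<le> f t) \<and> (AE t in Rplus. h t \<le> g t)"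
        using dir by blast
      moreover have "\<forall>f\<in>D. AE t in Rplus. 0 \<le> f t" using nn by blast
      moreover have "\<forall>g\<in>E. (\<forall>f\<in>D. AE t in Rplus. g t \<le> f t) \<longrightarrow> (AE t in Rplus. g t \<le> 0)"
        using inf by blast
      ultimately show "D \<subseteq> E \<and> D \<noteq> {} \<and>
        (\<forall>f\<in>D. \<forall>g\<in>D. \<exists>h\<in>D. (AE t in Rplus. h t \<le> f t) \<and> (AE t in Rplus. h t \<le> g t)) \<and>
        (\<forall>f\<in>D. AE t in Rplus. 0 \<le> f t) \<and>
        (\<forall>g\<in>E. (\<forall>f\<in>D. AE t in Rplus. g t \<le> f t) \<longrightarrow> (AE t in Rplus. g t \<le> 0))"
        using c by blast
    qed
    then show ?thesis using that by blast
  qed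
  show ?thesis
  proof (rule LIMSEQ_I)
    fix r :: real assume "0 < r"
    from ex[OF this] obtain m0 where m0: "\<forall>g\<in>D. (AE t in Rplus. g t \<le> h m0 t) \<longrightarrow> N g < r" by (auto simp: D_def)
    have "N (h m) < r" if "m0 \<le> m" for m
      using m0 dec[OF that] by (auto simp: D_def)
    then show "\<exists>m0. \<forall>m\<ge>m0. norm (N (h m) - 0) < r" using norm_nonneg[OF h] by (intro exI[of _ m0]) simp
  qed
qed

lemma indicator_dist_infinite:
  assumes A: "A \<in> sets Rplus" "emeasure Rplus A = \<infinity>" and s: "0 \<le> s"
  shows "dist_fun (indicator A) s = (if s < 1 then \<infinity> else 0)"
proof -
  have "{u \<in> {0..}. s < \<bar>indicator A u\<bar>} = (if s < 1 then A else {})"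
    using s sets.sets_into_space[OF A(1)] by (auto simp: indicator_def split: if_splits)
  then show ?thesis using A by (simp add: dist_fun_def)
qed

text \<open>If a superlevel set A had infinite measure, the indicators of [m, \<infinity>) would be
  equimeasurable with that of A and share its norm. They decrease to 0, so by order continuity that
  norm would be 0.\<close>

lemma dist_finite:
  assumes f: "f \<in> E" and s: "0 < s" shows "dist_fun f s < \<infinity>"
proof (rule ccontr)
  assume "\<not> ?thesis"
  then have inf: "dist_fun f s = \<infinity>" using less_top by (metis infinity_ennreal_def)
  define A where "A = {u \<in> {0..}. s < \<bar>f u\<bar>}"
  have A: "A \<in> sets Rplus" unfolding A_def by (rule dist_sets[OF measurable[OF f]])
  have Ainf: "emeasure Rplus A = \<infinity>" using inf by (simp add: dist_fun_def A_def)
  have "indicator A \<in> E"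
  proof (rule restrict_mem(1)[OF scale_mem[OF f, of "1 / s"]])
    show "indicator A \<in> borel_measurable Rplus" using A by simp
    show "\<bar>indicator A t\<bar> \<le> \<bar>1 / s * f t\<bar>" for t
      using s by (auto simp: A_def indicator_def abs_mult)
  qed
  note AE1 = this
  define h where "h m = (indicator {real m..} :: real \<Rightarrow> real)" for m :: nat
  have sh: "{real m..} \<in> sets Rplus" for m by (auto simp: sets_restrict_space_iff)
  have hinf: "emeasure Rplus {real m..} = \<infinity>" for m
  proof (rule ccontr)
    assume "emeasure Rplus {real m..} \<noteq> \<infinity>"
    then obtain r where r: "0 \<le> r" "emeasure Rplus {real m..} = ennreal r"
      by (metis ennreal_cases infinity_ennreal_def)
    have "emeasure Rplus {real m..real m + r + 1} \<le> emeasure Rplus {real m..}" using sh by (intro emeasure_mono) auto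
    moreover have "emeasure Rplus {real m..real m + r + 1} = ennreal (r + 1)"
      using r(1) by (subst emeasure_Rplus) auto
    ultimately show False using r by (simp add: ennreal_le_iff)
  qed
  have hE: "h m \<in> E \<and> N (h m) = N (indicator A)" for m
    unfolding h_def
    by (rule rearrangement[OF AE1 borel_measurable_indicator[OF sh]]) (simp add: indicator_dist_infinite A Ainf sh hinf)
  have "(\<lambda>m. N (h m)) \<longlonglongrightarrow> 0"
  proof (rule N_tendsto_zero)
    show "(\<lambda>m. h m t) \<longlonglongrightarrow> 0" for t
    proof (rule tendsto_eventually)
      obtain n where "t < real n" using reals_Archimedean2 by blast
      then show "\<forall>\<^sub>F m in sequentially. h m t = 0"
        unfolding eventually_sequentially h_def by (intro exI[of _ n]) (auto simp: indicator_def)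
    qed
  qed (use hE in \<open>auto simp: h_def indicator_def\<close>)
  then have "N (indicator A) = 0" using hE by (simp add: LIMSEQ_const_iff)
  then have "AE t in Rplus. indicator A t = (0::real)" using norm_eq_0[OF AE1] by simp
  then have "AE t in Rplus. t \<notin> A" by (rule eventually_mono) (auto simp: indicator_def split: if_splits)
  then have "emeasure Rplus A = 0" using sets.sets_into_space[OF A]
    by (subst (asm) AE_iff_measurable[OF A]) auto
  then show False using Ainf by simp
qed

lemma is_dist_mem: "f \<in> E \<Longrightarrow> is_dist (dist_fun f)"
  by (rule is_dist_dist_fun[OF measurable dist_finite[of f 1]]) auto

lemma gen_inverse_mem:
  assumes f: "f \<in> E" shows "gen_inverse (dist_fun f) \<in> E" "N (gen_inverse (dist_fun f)) = N f"
  using rearrangement[OF f gen_inverse_measurable[OF is_dist_mem[OF f]]] dist_gen_inverse[OF is_dist_mem[OF f]] by auto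

lemma is_dist_le:
  assumes "is_dist D" "is_dist D'" "\<And>s. 0 \<le> s \<Longrightarrow> D s \<le> D' s" "0 < t"
  shows "gen_inverse D t \<le> gen_inverse D' t"
proof (rule ccontr)
  assume "\<not> ?thesis"
  then have "ennreal t < D (gen_inverse D' t)"
    using gen_inverse_less_iff[OF assms(1) gen_inverse_nonneg[of D' t] assms(4)] by simp
  also have "\<dots> \<le> D' (gen_inverse D' t)" by (rule assms(3)[OF gen_inverse_nonneg])
  finally show False using gen_inverse_less_iff[OF assms(2) gen_inverse_nonneg[of D' t] assms(4)] by blast
qed

lemma gen_inverse_dominated:
  assumes D: "is_dist D" and h: "h \<in> E" and le: "\<And>s. 0 \<le> s \<Longrightarrow> D s \<le> dist_fun h s"
  shows "gen_inverse D \<in> E" "N (gen_inverse D) \<le> N h"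
proof -
  have "AE t in Rplus. \<bar>gen_inverse D t\<bar> \<le> \<bar>gen_inverse (dist_fun h) t\<bar>"
    using AE_Rplus_positive
    by (rule eventually_mono) (simp add: gen_inverse_nonneg is_dist_le[OF D is_dist_mem[OF h] le])
  from ideal[OF gen_inverse_mem(1)[OF h] gen_inverse_measurable[OF D] this]
  show "gen_inverse D \<in> E" "N (gen_inverse D) \<le> N h" by (simp_all add: gen_inverse_mem(2)[OF h])
qed

lemma dist_dominated:
  assumes g: "g \<in> borel_measurable Rplus" and h: "h \<in> E" and le: "\<And>s. 0 \<le> s \<Longrightarrow> dist_fun g s \<le> dist_fun h s"
  shows "g \<in> E" "N g \<le> N h"
proof -
  have "dist_fun g 1 < \<infinity>" using le[of 1] dist_finite[OF h, of 1] by (simp add: le_less_trans)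
  then have D: "is_dist (dist_fun g)" by (rule is_dist_dist_fun[OF g])
  note 1 = gen_inverse_dominated[OF D h le]
  have "g \<in> E \<and> N g = N (gen_inverse (dist_fun g))"
    by (rule rearrangement[OF 1(1) g]) (simp_all add: dist_gen_inverse[OF D])
  then show "g \<in> E" "N g \<le> N h" using 1(2) by auto
qed

definition Cq :: real where "Cq = max 1 (SOME C. \<forall>f\<in>E. \<forall>g\<in>E. N (\<lambda>t. f t + g t) \<le> C * (N f + N g))"

lemma Cq_ge: "1 \<le> Cq" by (simp add: Cq_def)

lemma quasi_triangle': "f \<in> E \<Longrightarrow> g \<in> E \<Longrightarrow> N (\<lambda>t. f t + g t) \<le> Cq * (N f + N g)"
proof -
  assume fg: "f \<in> E" "g \<in> E"
  let ?C = "SOME C. \<forall>f\<in>E. \<forall>g\<in>E. N (\<lambda>t. f t + g t) \<le> C * (N f + N g)"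
  have "N (\<lambda>t. f t + g t) \<le> ?C * (N f + N g)" using someI_ex[OF quasi_triangle] fg by blast
  also have "\<dots> \<le> Cq * (N f + N g)"
    unfolding Cq_def by (intro mult_right_mono add_nonneg_nonneg norm_nonneg fg) simp
  finally show ?thesis .
qed

lemma copy_mem:
  assumes f: "f \<in> E" and j: "j = 0 \<or> j = 1"
  defines "g \<equiv> copy_fun j (\<lambda>t. gen_inverse (dist_fun f) t * indicator {0<..} t)"
  shows "g \<in> E" "N g = N f" "\<And>s. 0 \<le> s \<Longrightarrow> dist_fun g s = dist_fun f s"
    "\<And>s. 0 \<le> s \<Longrightarrow> {u \<in> {0..}. s < \<bar>g u\<bar>} \<in> sets Rplus"
proof -
  let ?f = "\<lambda>t. gen_inverse (dist_fun f) t * indicator {0<..} t :: real"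
  note D = is_dist_mem[OF f]
  have fb: "?f \<in> borel_measurable borel" by (rule gen_inverse_borel[OF D])
  have gb: "g \<in> borel_measurable borel"
    unfolding g_def copy_fun_def using fb by measurable
  then have gm: "g \<in> borel_measurable Rplus" by (rule borel_measurable_Rplus)
  show d: "dist_fun g s = dist_fun f s" if s: "0 \<le> s" for s
  proof -
    define B where "B = {u. 0 < u \<and> s < gen_inverse (dist_fun f) u}"
    have B: "B \<in> sets borel" "B \<subseteq> {0..}" unfolding B_def by (simp add: gen_inverse_superlevel[OF D s], auto)
    have eq: "{u \<in> {0..}. s < \<bar>g u\<bar>} = {t. 0 \<le> t \<and> \<lfloor>t\<rfloor> mod 2 = j \<and> t - (of_int \<lfloor>t\<rfloor> + of_int j) / 2 \<in> B}"
      using s by (auto simp: g_def copy_fun_def B_def gen_inverse_nonneg indicator_def split: if_splits)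
    have sb: "{u \<in> {0..}. s < \<bar>g u\<bar>} \<in> sets borel"
    proof -
      have "{u \<in> space borel. 0 \<le> u \<and> s < \<bar>g u\<bar>} \<in> sets borel" using gb by measurable
      then show ?thesis by simp
    qed
    have "dist_fun g s = emeasure lborel {u \<in> {0..}. s < \<bar>g u\<bar>}"
      unfolding dist_fun_def by (rule emeasure_Rplus[OF sb]) auto
    also have "\<dots> = emeasure lborel B" unfolding eq by (rule emeasure_copy[OF B j])
    also have "\<dots> = dist_fun (gen_inverse (dist_fun f)) s"
    proof -
      have "{u \<in> {0..}. s < \<bar>gen_inverse (dist_fun f) u\<bar>} \<in> sets Rplus" by (rule dist_sets[OF gen_inverse_measurable[OF D]])
      moreover have "B \<in> sets Rplus" using B by (simp add: sets_restrict_space_iff)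
      ultimately have "dist_fun (gen_inverse (dist_fun f)) s = emeasure Rplus B"
        unfolding dist_fun_def[of "gen_inverse _"]
        by (intro emeasure_eq_AE) (use AE_Rplus_positive in \<open>auto elim!: eventually_mono simp: gen_inverse_nonneg B_def\<close>)
      then show ?thesis using emeasure_Rplus[OF B] by simp
    qed
    also have "\<dots> = dist_fun f s" by (rule dist_gen_inverse[OF D s])
    finally show ?thesis .
  qed
  show "g \<in> E" "N g = N f" using rearrangement[OF f gm d] by auto
  show "{u \<in> {0..}. s < \<bar>g u\<bar>} \<in> sets Rplus" for s by (rule dist_sets[OF gm])
qed

text \<open>Copies on the even and the odd unit intervals are disjoint, so that distribution
  functions add. This realizes a sum of two distribution functions inside E.\<close>

lemma disjoint_sum:
  assumes f: "f \<in> E" and g: "g \<in> E"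
  shows "\<exists>h\<in>E. N h \<le> Cq * (N f + N g) \<and> (\<forall>s\<ge>0. dist_fun h s = dist_fun f s + dist_fun g s)"
proof -
  define a where "a = copy_fun 0 (\<lambda>t. gen_inverse (dist_fun f) t * indicator {0<..} t)"
  define b where "b = copy_fun 1 (\<lambda>t. gen_inverse (dist_fun g) t * indicator {0<..} t)"
  note a = copy_mem[OF f, of 0, simplified, folded a_def] and b = copy_mem[OF g, of 1, simplified, folded b_def]
  have disj: "a t = 0 \<or> b t = 0" for t by (auto simp: a_def b_def copy_fun_def)
  have "dist_fun (\<lambda>t. a t + b t) s = dist_fun f s + dist_fun g s" if s: "0 \<le> s" for s
  proof -
    have "{u \<in> {0..}. s < \<bar>a u + b u\<bar>} = {u \<in> {0..}. s < \<bar>a u\<bar>} \<union> {u \<in> {0..}. s < \<bar>b u\<bar>}"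
    proof -
      have "s < \<bar>a u + b u\<bar> \<longleftrightarrow> s < \<bar>a u\<bar> \<or> s < \<bar>b u\<bar>" for u using disj[of u] s by auto
      then show ?thesis by auto
    qed
    moreover have "{u \<in> {0..}. s < \<bar>a u\<bar>} \<inter> {u \<in> {0..}. s < \<bar>b u\<bar>} = {}"
    proof -
      have "\<not> (s < \<bar>a u\<bar> \<and> s < \<bar>b u\<bar>)" for u using disj[of u] s by auto
      then show ?thesis by blast
    qed
    ultimately have "dist_fun (\<lambda>t. a t + b t) s = dist_fun a s + dist_fun b s"
      unfolding dist_fun_def using a(4)[OF s] b(4)[OF s] by (simp add: plus_emeasure)
    then show ?thesis by (simp add: a(3)[OF s] b(3)[OF s])
  qed
  moreover have "N (\<lambda>t. a t + b t) \<le> Cq * (N f + N g)" using quasi_triangle'[OF a(1) b(1)] by (simp add: a(2) b(2))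
  ultimately show ?thesis using add_mem[OF a(1) b(1)] by blast
qed

lemma indicator_mem:
  assumes "0 \<le> a" "a \<le> b" shows "(\<lambda>u. c * indicator {a..<b} u) \<in> E"
proof -
  have "indicator {a..<b} \<in> E"
  proof (rule simple_mem)
    have "{a..<b} \<in> sets Rplus" using assms by (auto simp: sets_restrict_space_iff)
    then show "simple_function Rplus (indicator {a..<b})" by (rule simple_function_indicator)
    have "{u \<in> {0..}. indicator {a..<b} u \<noteq> (0::real)} = {a..<b}" using assms by (auto simp: indicator_def)
    then show "emeasure Rplus {u \<in> {0..}. indicator {a..<b} u \<noteq> (0::real)} < \<infinity>"
      using assms by (simp, subst emeasure_Rplus) auto
  qed
  then show ?thesis by (rule scale_mem)
qed

lemma dist_indicator:
  assumes "0 \<le> a" "a \<le> b" "0 \<le> s" "0 \<le> c"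
  shows "dist_fun (\<lambda>u. c * indicator {a..<b} u) s = (if s < c then ennreal (b - a) else 0)"
proof -
  have "{u \<in> {0..}. s < \<bar>c * indicator {a..<b} u\<bar>} = (if s < c then {a..<b} else {})"
    using assms by (auto simp: indicator_def split: if_splits)
  moreover have "emeasure Rplus {a..<b} = ennreal (b - a)" using assms by (subst emeasure_Rplus) auto
  ultimately show ?thesis by (simp add: dist_fun_def)
qed

text \<open>The fundamental function of E. The factor 1 keeps the shape for which
  \<open>indicator_mem\<close> and \<open>dist_indicator\<close> are stated.\<close>

definition phi :: "real \<Rightarrow> real" where "phi t = N (\<lambda>u. 1 * indicator {0..<t} u)"

lemma phi_scale: "0 \<le> t \<Longrightarrow> 0 \<le> c \<Longrightarrow> N (\<lambda>u. c * indicator {0..<t} u) = c * phi t"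
  using norm_scale[OF indicator_mem[of 0 t 1], of c] by (simp add: phi_def)

lemma phi_nonneg: "0 \<le> t \<Longrightarrow> 0 \<le> phi t"
  unfolding phi_def by (rule norm_nonneg[OF indicator_mem]) auto

lemma phi_mono:
  assumes "0 \<le> s" "s \<le> t" shows "phi s \<le> phi t"
  unfolding phi_def
proof (rule dist_dominated(2)[OF measurable[OF indicator_mem] indicator_mem])
  show "dist_fun (\<lambda>u. 1 * indicator {0..<s} u) r \<le> dist_fun (\<lambda>u. 1 * indicator {0..<t} u) r" if "0 \<le> r" for r
    unfolding dist_indicator[OF order_refl assms(1) that zero_le_one]
      dist_indicator[OF order_refl order_trans[OF assms] that zero_le_one]
    using assms by (auto intro: ennreal_leI)
qed (use assms in auto)

lemma phi_pos:
  assumes t: "0 < t" shows "0 < phi t"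
proof -
  have "phi t \<noteq> 0"
  proof
    assume "phi t = 0"
    then have AE: "AE u in Rplus. 1 * indicator {0..<t} u = (0::real)"
      unfolding phi_def using norm_eq_0[OF indicator_mem[of 0 t 1]] t by simp
    have s: "{0..<t} \<in> sets Rplus" by (auto simp: sets_restrict_space_iff)
    have "AE u in Rplus. u \<notin> {0..<t}"
      using AE by (rule eventually_mono) (auto simp: indicator_def split: if_splits)
    then have "emeasure Rplus {0..<t} = 0"
      using AE_iff_measurable[OF s, of "\<lambda>u. u \<notin> {0..<t}"] by (auto simp: set_eq_iff)
    moreover have "emeasure Rplus {0..<t} = ennreal t" using t by (subst emeasure_Rplus) auto
    ultimately show False using t by simp
  qed
  then show ?thesis using phi_nonneg[of t] t by simp
qed

lemma phi_small:
  assumes e: "0 < \<epsilon>" shows "\<exists>\<delta>>0. phi \<delta> < \<epsilon>"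
proof -
  have "(\<lambda>m. phi (1 / real (Suc m))) \<longlonglongrightarrow> 0"
  proof -
    \<comment> \<open>Open at 0, so that the sequence tends to 0 at every point, 0 included;
      \<open>N_tendsto_zero\<close> asks for convergence everywhere.\<close>
    define h where "h m = (\<lambda>u. indicator {0<..<1 / real (Suc m)} u :: real)" for m
    have sm: "{0<..<1 / real (Suc m)} \<in> sets Rplus" for m by (auto simp: sets_restrict_space_iff)
    have hE: "h m \<in> E \<and> N (h m) = phi (1 / real (Suc m))" for m
      unfolding phi_def
    proof (rule rearrangement[OF indicator_mem])
      show "h m \<in> borel_measurable Rplus" unfolding h_def using sm by simp
      fix s :: real assume s: "0 \<le> s"
      have "{u \<in> {0..}. s < \<bar>h m u\<bar>} = (if s < 1 then {0<..<1 / real (Suc m)} else {})"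
        using s by (auto simp: indicator_def h_def split: if_splits)
      moreover have "emeasure Rplus {0<..<1 / real (Suc m)} = ennreal (1 / real (Suc m))" by (subst emeasure_Rplus) auto
      ultimately have "dist_fun (h m) s = (if s < 1 then ennreal (1 / real (Suc m)) else 0)" by (simp add: dist_fun_def)
      then show "dist_fun (h m) s = dist_fun (\<lambda>u. 1 * indicator {0..<1 / real (Suc m)} u) s"
        by (subst dist_indicator) (use s in auto)
    qed auto
    have "(\<lambda>m. N (h m)) \<longlonglongrightarrow> 0"
    proof (rule N_tendsto_zero)
      show "h n t \<le> h m t" if "m \<le> n" for m n t
      proof -
        have "1 / real (Suc n) \<le> 1 / real (Suc m)" using that by (simp add: frac_le)
        then show ?thesis by (auto simp: h_def indicator_def)
      qed
      show "(\<lambda>m. h m t) \<longlonglongrightarrow> 0" for t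
      proof (rule tendsto_eventually)
        show "\<forall>\<^sub>F m in sequentially. h m t = 0"
        proof (cases "0 < t")
          case True
          then obtain n where n: "1 / real (Suc n) < t" using nat_approx_posE by metis
          have "h m t = 0" if "n \<le> m" for m
          proof -
            have "1 / real (Suc m) \<le> 1 / real (Suc n)" using that by (simp add: frac_le)
            then show ?thesis using n by (simp add: h_def indicator_def)
          qed
          then show ?thesis unfolding eventually_sequentially by blast
        qed (simp add: h_def indicator_def)
      qed
    qed (use hE in \<open>auto simp: h_def\<close>)
    then show ?thesis using hE by simp
  qed
  then have "\<forall>\<^sub>F m in sequentially. phi (1 / real (Suc m)) < \<epsilon>" using e by (rule order_tendstoD(2))
  then obtain m where "phi (1 / real (Suc m)) < \<epsilon>" by (auto simp: eventually_sequentially)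
  then show ?thesis by (intro exI[of _ "1 / real (Suc m)"]) simp
qed

text \<open>The lower estimate on n disjoint unit intervals gives n^(1/q) phi(1) \<le>
  phi(n).\<close>

lemma phi_large: "\<exists>t>0. B < phi t"
proof -
  have p1: "0 < phi 1" by (rule phi_pos) simp
  have main: "real n powr (1 / q) * phi 1 \<le> phi (real n)" for n
  proof -
    define f where "f i = (\<lambda>u. 1 * indicator {real i..<real i + 1} u :: real)" for i
    have f: "f i \<in> E" for i unfolding f_def by (rule indicator_mem) auto
    have fN: "N (f i) = phi 1" for i
    proof -
      have "f i \<in> E \<and> N (f i) = N (\<lambda>u. 1 * indicator {0..<1} u)"
        proof (rule rearrangement[OF indicator_mem measurable[OF f]])
        fix s :: real assume s: "0 \<le> s"
        have i: "0 \<le> real i" "real i \<le> real i + 1" by simp_all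
        show "dist_fun (f i) s = dist_fun (\<lambda>u. 1 * indicator {0..<1} u) s"
          unfolding f_def dist_indicator[OF i s zero_le_one] dist_indicator[OF order_refl zero_le_one s zero_le_one]
          by simp
      qed simp_all
      then show ?thesis by (simp add: phi_def)
    qed
    have disj: "AE t in Rplus. f i t = 0 \<or> f j t = 0" if "i \<noteq> j" for i j
      using that by (intro AE_I2) (auto simp: f_def indicator_def)
    have "(\<Sum>i<n. N (f i) powr q) powr (1 / q) \<le> N (\<lambda>t. \<Sum>i<n. f i t)"
      using lower f disj unfolding lower_estimate_const_one_def by blast
    moreover have "(\<lambda>t. \<Sum>i<n. f i t) = (\<lambda>t. 1 * indicator {0..<real n} t)"
    proof
      show "(\<Sum>i<n. f i t) = 1 * indicator {0..<real n} t" for t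
        by (induction n) (auto simp: f_def indicator_def)
    qed
    moreover have "(\<Sum>i<n. N (f i) powr q) powr (1 / q) = real n powr (1 / q) * phi 1"
      using p1 q0 by (simp add: fN powr_mult powr_powr)
    ultimately show ?thesis by (simp add: phi_def)
  qed
  obtain n where n: "(\<bar>B\<bar> / phi 1 + 1) powr q < real n" using reals_Archimedean2 by blast
  have pos: "0 < \<bar>B\<bar> / phi 1 + 1" using p1 by (simp add: add_nonneg_pos)
  have "\<bar>B\<bar> / phi 1 + 1 = ((\<bar>B\<bar> / phi 1 + 1) powr q) powr (1 / q)" using pos q0 by (simp add: powr_powr)
  also have "\<dots> \<le> real n powr (1 / q)" using n q0 by (intro powr_mono2) auto
  finally have "(\<bar>B\<bar> / phi 1 + 1) * phi 1 \<le> real n powr (1 / q) * phi 1" using p1 by (intro mult_right_mono) auto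
  also have "\<dots> \<le> phi (real n)" by (rule main)
  finally have "B < phi (real n)" using p1 by (simp add: distrib_right)
  moreover have "0 < real n" using n powr_ge_zero[of "\<bar>B\<bar> / phi 1 + 1" q] by linarith
  ultimately show ?thesis by blast
qed

text \<open>Markov's inequality in E: s times an indicator of length t has distribution function
  below that of f.\<close>

lemma phi_markov:
  assumes f: "f \<in> E" and s: "0 \<le> s" and t: "0 \<le> t" and le: "ennreal t \<le> dist_fun f s"
  shows "s * phi t \<le> N f"
proof -
  have "N (\<lambda>u. s * indicator {0..<t} u) \<le> N f"
  proof (rule dist_dominated(2)[OF measurable[OF indicator_mem] f])
    fix r :: real assume r: "0 \<le> r"
    have "ennreal t \<le> dist_fun f r" if "r < s"
      using dist_antimono[OF measurable[OF f], of r s] le that by (meson less_imp_le order_trans)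
    then show "dist_fun (\<lambda>u. s * indicator {0..<t} u) r \<le> dist_fun f r"
      unfolding dist_indicator[OF order_refl t r s] by simp
  qed (use t in auto)
  then show ?thesis by (simp add: phi_scale[OF t s])
qed

lemma lower_two:
  assumes f: "f \<in> E" and g: "g \<in> E" and d: "\<And>t. f t = 0 \<or> g t = 0"
  shows "N f powr q + N g powr q \<le> N (\<lambda>t. f t + g t) powr q"
proof -
  define F where "F i = (if i = 0 then f else g)" for i :: nat
  have "(\<Sum>i<2. N (F i) powr q) powr (1 / q) \<le> N (\<lambda>t. \<Sum>i<2. F i t)"
    using lower unfolding lower_estimate_const_one_def
  proof (elim allE[of _ 2] allE[of _ F] impE)
    show "\<forall>i<2. F i \<in> E" using f g by (simp add: F_def)
    show "\<forall>i<2. \<forall>j<2. i \<noteq> j \<longrightarrow> (AE t in Rplus. F i t = 0 \<or> F j t = 0)"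
      using d by (auto simp: F_def less_2_cases_iff intro!: AE_I2)
  qed
  then have "(N f powr q + N g powr q) powr (1 / q) \<le> N (\<lambda>t. f t + g t)"
    by (simp add: F_def numeral_2_eq_2)
  then have "((N f powr q + N g powr q) powr (1 / q)) powr q \<le> N (\<lambda>t. f t + g t) powr q"
    using q0 by (intro powr_mono2) auto
  then show ?thesis using q0 by (simp add: powr_powr)
qed

end

section \<open>Norm estimates in the noncommutative space\<close>

text \<open>The cut is by values, not by arguments, to match a spectral slice of |x|.\<close>

definition cutf :: "real set \<Rightarrow> (real \<Rightarrow> real) \<Rightarrow> real \<Rightarrow> real"
  where "cutf I f t = (if f t \<in> I then f t else 0)"

lemma cutf_measurable:
  assumes f: "f \<in> borel_measurable Rplus" and I: "I \<in> sets borel"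
  shows "cutf I f \<in> borel_measurable Rplus"
proof -
  have "f -` I \<inter> space Rplus \<in> sets Rplus" by (rule measurable_sets[OF f I])
  then have "{t \<in> space Rplus. f t \<in> I} \<in> sets Rplus" by (simp add: vimage_def Int_def conj_commute)
  then show ?thesis unfolding cutf_def by (intro measurable_If f) auto
qed

context oc_space
begin

lemma cutf_mem:
  assumes "f \<in> E" "I \<in> sets borel" shows "cutf I f \<in> E" "N (cutf I f) \<le> N f"
  by (rule restrict_mem[OF assms(1) cutf_measurable[OF measurable[OF assms(1)] assms(2)]]; simp add: cutf_def)+

lemma lower_cutf:
  assumes "f \<in> E" "I \<in> sets borel" "J \<in> sets borel" "I \<inter> J = {}"
  shows "N (cutf I f) powr q + N (cutf J f) powr q \<le> N (cutf (I \<union> J) f) powr q"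
proof -
  have "(\<lambda>t. cutf I f t + cutf J f t) = cutf (I \<union> J) f" using assms(4) by (auto simp: cutf_def fun_eq_iff)
  moreover have "cutf I f t = 0 \<or> cutf J f t = 0" for t using assms(4) by (auto simp: cutf_def)
  ultimately show ?thesis
    using lower_two[OF cutf_mem(1)[OF assms(1,2)] cutf_mem(1)[OF assms(1,3)]] by simp
qed

lemma cutf_small:
  assumes f: "f \<in> E" "\<And>t. 0 \<le> f t" and e: "0 < \<epsilon>" and L0: "0 < L0"
  shows "\<exists>L>0. L \<le> L0 \<and> N (cutf {0<..L} f) < \<epsilon>"
proof -
  define h where "h m = cutf {0<..L0 / real (Suc m)} f" for m
  have "(\<lambda>m. N (h m)) \<longlonglongrightarrow> 0"
  proof (rule N_tendsto_zero)
    show "h m \<in> E" for m unfolding h_def by (rule cutf_mem(1)[OF f(1)]) simp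
    show "0 \<le> h m t" for m t by (simp add: h_def cutf_def f(2))
    show "h n t \<le> h m t" if "m \<le> n" for m n t
    proof -
      have "L0 / real (Suc n) \<le> L0 / real (Suc m)" using that L0 by (simp add: frac_le)
      then show ?thesis using f(2)[of t] by (simp add: h_def cutf_def)
    qed
    show "(\<lambda>m. h m t) \<longlonglongrightarrow> 0" for t
    proof (cases "0 < f t")
      case True
      have "0 < f t / L0" using True L0 by simp
      then obtain n where n: "1 / real (Suc n) < f t / L0" using nat_approx_posE by metis
      have "h m t = 0" if "n \<le> m" for m
      proof -
        have "1 / real (Suc m) \<le> 1 / real (Suc n)" using that by (simp add: frac_le)
        then have "1 / real (Suc m) < f t / L0" using n by linarith
        then have "1 / real (Suc m) * L0 < f t" using L0 by (simp only: pos_less_divide_eq)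
        then show ?thesis by (simp add: h_def cutf_def)
      qed
      then show ?thesis by (intro tendsto_eventually) (auto simp: eventually_sequentially)
    next
      case False
      then show ?thesis by (simp add: h_def cutf_def)
    qed
  qed
  then have "\<forall>\<^sub>F m in sequentially. N (h m) < \<epsilon>" using e by (rule order_tendstoD(2))
  then obtain m where "N (h m) < \<epsilon>" by (auto simp: eventually_sequentially)
  then show ?thesis using L0
    by (intro exI[of _ "L0 / real (Suc m)"]) (auto simp: h_def field_simps)
qed

lemma dist_mono:
  assumes g: "g \<in> borel_measurable Rplus" and le: "\<And>t. \<bar>f t\<bar> \<le> \<bar>g t\<bar>" shows "dist_fun f s \<le> dist_fun g s"
  unfolding dist_fun_def by (rule emeasure_mono[OF _ dist_sets[OF g]]) (use le in \<open>auto intro: less_le_trans\<close>)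

end

locale nc_setting = semifinite_von_neumann_algebra M \<tau> + oc_space E N q
  for M :: "'h::chilbert_space op set" and \<tau> E N q
begin

abbreviation "X \<equiv> nc_space M \<tau> E"
abbreviation "nx x \<equiv> nc_norm \<tau> N x"
abbreviation "nn a \<equiv> nx (graph a)"
abbreviation "sv x \<equiv> gen_inverse (ds x)"
abbreviation "tc \<equiv> cdd_op.trunc"

text \<open>The bounded elements of the space. All norm estimates except those for x_n and z_k take
  place here.\<close>

definition EA :: "'h bop set" where "EA = {a \<in> A. graph a \<in> X}"

lemma tau_adm: "tau_measurable M \<tau> x \<Longrightarrow> adm x"
  by (simp add: tau_measurable_def adm_def)

lemma is_dist_ds:
  assumes x: "tau_measurable M \<tau> x" shows "is_dist (ds x)"
  unfolding is_dist_def using ds_antimono[OF tau_adm[OF x]] ds_right[OF tau_adm[OF x]] ds_tau_measurable[OF x]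
  by blast

lemma svf: "tau_measurable M \<tau> x \<Longrightarrow> singular_value_fun \<tau> x = sv x"
  by (simp add: singular_value_fun_def singular_value_ds[OF tau_adm] gen_inverse_def fun_eq_iff)

lemma nc_mem: "x \<in> X \<longleftrightarrow> tau_measurable M \<tau> x \<and> sv x \<in> E"
  using svf by (auto simp: nc_space_def)

lemma nc_norm_sv: "tau_measurable M \<tau> x \<Longrightarrow> nx x = N (sv x)"
  by (simp add: nc_norm_def svf)

lemma X_tau: "x \<in> X \<Longrightarrow> tau_measurable M \<tau> x" and X_adm: "x \<in> X \<Longrightarrow> adm x" and X_cdd: "x \<in> X \<Longrightarrow> cdd_op x"
  and sv_mem: "x \<in> X \<Longrightarrow> sv x \<in> E"
  using nc_mem tau_adm adm_cdd by auto

lemma sv_dist: "x \<in> X \<Longrightarrow> 0 \<le> s \<Longrightarrow> dist_fun (sv x) s = ds x s"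
  by (rule dist_gen_inverse[OF is_dist_ds[OF X_tau]])

lemma ds_finite: "x \<in> X \<Longrightarrow> 0 < s \<Longrightarrow> ds x s < \<infinity>"
  using dist_finite[OF sv_mem, of x s] sv_dist[of x s] by simp

lemma nc_dominated:
  assumes x: "tau_measurable M \<tau> x" and h: "h \<in> E" and le: "\<And>s. 0 \<le> s \<Longrightarrow> ds x s \<le> dist_fun h s"
  shows "x \<in> X" "nx x \<le> N h"
  using gen_inverse_dominated[OF is_dist_ds[OF x] h le] x by (simp_all add: nc_mem nc_norm_sv)

lemma nc_mono:
  assumes x: "tau_measurable M \<tau> x" and y: "y \<in> X" and le: "\<And>s. 0 \<le> s \<Longrightarrow> ds x s \<le> ds y s"
  shows "x \<in> X" "nx x \<le> nx y"
  using nc_dominated[OF x sv_mem[OF y]] le sv_dist[OF y] nc_norm_sv[OF X_tau[OF y]] by auto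

text \<open>Quasi-triangle constant for operators: \<open>Cq\<close> comes from adding disjoint
  copies, the factor 2 from the level s + s in \<open>ds_add\<close>.\<close>

definition C1 :: real where "C1 = 2 * Cq"

lemma C1_ge: "2 \<le> C1" using Cq_ge by (simp add: C1_def)

lemma nc_add:
  assumes x: "tau_measurable M \<tau> x" and y: "y \<in> X" and z: "z \<in> X"
    and le: "\<And>s. 0 \<le> s \<Longrightarrow> ds x (s + s) \<le> ds y s + ds z s"
  shows "x \<in> X" "nx x \<le> C1 * (nx y + nx z)"
proof -
  obtain h where h: "h \<in> E" "N h \<le> Cq * (N (sv y) + N (sv z))"
      "\<And>s. 0 \<le> s \<Longrightarrow> dist_fun h s = dist_fun (sv y) s + dist_fun (sv z) s"
    using disjoint_sum[OF sv_mem[OF y] sv_mem[OF z]] by blast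
  have "ds x s \<le> dist_fun (\<lambda>t. 2 * h t) s" if s: "0 \<le> s" for s
  proof -
    have "{u \<in> {0..}. s < \<bar>2 * h u\<bar>} = {u \<in> {0..}. s / 2 < \<bar>h u\<bar>}" by (auto simp: abs_mult)
    then have "dist_fun (\<lambda>t. 2 * h t) s = dist_fun h (s / 2)" by (simp add: dist_fun_def)
    also have "\<dots> = ds y (s / 2) + ds z (s / 2)" using h(3)[of "s / 2"] s by (simp add: sv_dist[OF y] sv_dist[OF z])
    finally show ?thesis using le[of "s / 2"] s by simp
  qed
  note 1 = nc_dominated[OF x scale_mem[OF h(1), of 2] this]
  show "x \<in> X" using 1(1) by simp
  have "nx x \<le> 2 * N h" using 1(2) norm_scale[OF h(1), of 2] by simp
  then show "nx x \<le> C1 * (nx y + nx z)"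
    using h(2) by (simp add: C1_def nc_norm_sv X_tau[OF y] X_tau[OF z])
qed

lemma EA_D: "a \<in> EA \<Longrightarrow> a \<in> A" "a \<in> EA \<Longrightarrow> graph a \<in> X"
  by (auto simp: EA_def)

lemma EA_dominated:
  assumes "a \<in> A" "h \<in> E" "\<And>s. 0 \<le> s \<Longrightarrow> ds (graph a) s \<le> dist_fun h s"
  shows "a \<in> EA" "nn a \<le> N h"
  using nc_dominated[OF tau_measurable_graph[OF assms(1)] assms(2,3)] assms(1) by (auto simp: EA_def)

lemma EA_add:
  assumes a: "a \<in> EA" and b: "b \<in> EA" shows "a + b \<in> EA" "nn (a + b) \<le> C1 * (nn a + nn b)"
  using nc_add[OF tau_measurable_graph[OF A_add[OF EA_D(1)[OF a] EA_D(1)[OF b]]] EA_D(2)[OF a] EA_D(2)[OF b]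
      ds_graph_add[OF EA_D(1)[OF a] EA_D(1)[OF b]]] EA_D(1)[OF a] EA_D(1)[OF b]
  by (auto simp: EA_def A_add)

lemma EA_left:
  assumes a: "a \<in> EA" and u: "u \<in> A" "nbound u 1" shows "u * a \<in> EA" "nn (u * a) \<le> nn a"
  using nc_mono[OF tau_measurable_graph[OF A_mult[OF u(1) EA_D(1)[OF a]]] EA_D(2)[OF a]
      ds_left_mult[OF EA_D(1)[OF a] u]] EA_D(1)[OF a] u(1)
  by (auto simp: EA_def A_mult)

lemma EA_right:
  assumes a: "a \<in> EA" and u: "u \<in> A" "nbound u 1" shows "a * u \<in> EA" "nn (a * u) \<le> nn a"
  using nc_mono[OF tau_measurable_graph[OF A_mult[OF EA_D(1)[OF a] u(1)]] EA_D(2)[OF a]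
      ds_right_mult[OF EA_D(1)[OF a] u]] EA_D(1)[OF a] u(1)
  by (auto simp: EA_def A_mult)

lemma EA_conj:
  assumes a: "a \<in> EA" and p: "p \<in> A" "isproj p" shows "p * a * p \<in> EA" "nn (p * a * p) \<le> nn a"
  using EA_right[OF EA_left(1)[OF a p(1) isproj_nbound[OF p(2)]] p(1) isproj_nbound[OF p(2)]]
    EA_left(2)[OF a p(1) isproj_nbound[OF p(2)]] by auto

lemma EA_minus:
  assumes a: "a \<in> EA" shows "- a \<in> EA" "nn (- a) \<le> nn a"
proof -
  have "nbound (- 1 :: 'h bop) 1" by (simp add: nbound_def)
  from EA_left[OF a A_minus[OF A_one] this] show "- a \<in> EA" "nn (- a) \<le> nn a" by simp_all
qed

text \<open>The operators \<open>y\<^sub>k\<close> of the theorem have the form \<open>cc p w\<close>.\<close>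

definition cc :: "'h bop \<Rightarrow> 'h bop \<Rightarrow> 'h bop" where "cc p a = a - p * a * p"

lemma cc_add: "cc p (a + b) = cc p a + cc p b"
  by (simp add: cc_def algebra_simps)

lemma EA_cc:
  assumes a: "a \<in> EA" and p: "p \<in> A" "isproj p" shows "cc p a \<in> EA" "nn (cc p a) \<le> 2 * C1 * nn a"
proof -
  have eq: "cc p a = a + - (p * a * p)" by (simp add: cc_def)
  note m = EA_minus[OF EA_conj(1)[OF a p]]
  show "cc p a \<in> EA" unfolding eq by (rule EA_add(1)[OF a m(1)])
  have "nn (cc p a) \<le> C1 * (nn a + nn (- (p * a * p)))" unfolding eq by (rule EA_add(2)[OF a m(1)])
  also have "\<dots> \<le> C1 * (nn a + nn a)" using m(2) EA_conj(2)[OF a p] C1_ge by (intro mult_left_mono) auto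
  finally show "nn (cc p a) \<le> 2 * C1 * nn a" by simp
qed

lemma trunc_zero: "x \<in> X \<Longrightarrow> tc x 0 = 0"
  using cdd_op.trunc_nbound[OF X_cdd, of x 0] by (intro bop_eqI) (auto simp: nbound_def)

lemma trunc_nbound_diff:
  assumes x: "x \<in> X" and ab: "0 \<le> a" "a \<le> b"
  shows "tc x b - tc x a = tc x b * (1 - sproj x a)" "nbound (tc x b - tc x a) b"
proof -
  interpret cdd_op x by (rule X_cdd[OF x])
  show eq: "trunc b - trunc a = trunc b * (1 - sproj x a)"
    using trunc_sproj[OF ab] by (simp add: algebra_simps)
  show "nbound (trunc b - trunc a) b"
    unfolding eq using nbound_mult[OF trunc_nbound isproj_nbound[OF isproj_compl[OF sproj_isproj]], of b] ab by simp
qed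

text \<open>The slice of x over (a, b] is controlled by the cut of its singular value function to
  the values in (a, b]: at each level the min-max principle bounds it by the trace of a spectral
  projection, which is the measure of the matching set of values.\<close>

lemma piece:
  assumes x: "x \<in> X" and a: "0 \<le> a" and ab: "a \<le> b"
  shows "tc x b - tc x a \<in> EA" "nn (tc x b - tc x a) \<le> N (cutf {a<..b} (sv x))"
proof -
  interpret cdd_op x by (rule X_cdd[OF x])
  note xa = X_adm[OF x]
  let ?d = "trunc b - trunc a" and ?f = "sv x"
  have b: "0 \<le> b" using a ab by simp
  have dA: "?d \<in> A" by (intro A_diff trunc_A[OF xa] a b)
  have "ds (graph ?d) s \<le> dist_fun (cutf {a<..b} ?f) s" if s: "0 \<le> s" for s
  proof (cases "a < b \<and> s < b")
    case True
    \<comment> \<open>Above level s only values beyond s count, and the slice has none at or below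
      a.\<close>
    define a' where "a' = max a s"
    have a': "0 \<le> a'" "a' < b" "a \<le> a'" using True a by (auto simp: a'_def)
    define p where "p = 1 - (sproj x b - sproj x a')"
    have bp: "isproj (sproj x b - sproj x a')" by (rule isproj_diff) (use a' in \<open>simp_all add: sproj_mono\<close>)
    have bA: "sproj x b - sproj x a' \<in> A" by (intro A_diff sproj_A[OF xa])
    have "ds (graph ?d) s \<le> tr (1 - p)"
    proof (rule ds_graph_le[OF dA s])
      show "p \<in> A" unfolding p_def by (intro A_diff A_one bA)
      show "isproj p" unfolding p_def by (rule isproj_compl[OF bp])
      fix v assume "p \<odot> v = v"
      then have eq: "sproj x b \<odot> v = sproj x a' \<odot> v" by (simp add: p_def)
      have "trunc b \<odot> v = trunc a' \<odot> v"
        by (rule linear_op_unique[OF linear_x trunc_mem[OF b, of v, unfolded eq] trunc_mem[OF a'(1)]])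
      then have d: "?d \<odot> v = (trunc a' - trunc a) \<odot> v" by simp
      show "norm (?d \<odot> v) \<le> s * norm v"
      proof (cases "a \<le> s")
        case True
        then show ?thesis unfolding d using nboundD[OF trunc_nbound_diff(2)[OF x a a'(3)]] by (simp add: a'_def)
      next
        case False
        then show ?thesis unfolding d using s by (simp add: a'_def)
      qed
    qed
    also have "1 - p = sproj x b - sproj x a'" by (simp add: p_def)
    finally have 1: "ds (graph ?d) s \<le> tr (sproj x b - sproj x a')" .
    have "tr ((1 - sproj x b) + (sproj x b - sproj x a')) = tr (1 - sproj x b) + tr (sproj x b - sproj x a')"
      by (rule tr_add) (auto intro!: A_diff A_one sproj_A[OF xa] isproj_pos bp isproj_compl)
    then have 2: "ds x a' = ds x b + tr (sproj x b - sproj x a')" by (simp add: ds_def)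
    note fm = measurable[OF sv_mem[OF x]]
    have "dist_fun ?f a' = dist_fun ?f b + dist_fun (cutf {a<..b} ?f) s"
    proof -
      have bs: "{u \<in> {0..}. s < \<bar>cutf {a<..b} ?f u\<bar>} \<in> sets Rplus" by (rule dist_sets[OF cutf_measurable[OF fm]]) simp
      have "{u \<in> {0..}. a' < \<bar>?f u\<bar>} = {u \<in> {0..}. b < \<bar>?f u\<bar>} \<union> {u \<in> {0..}. s < \<bar>cutf {a<..b} ?f u\<bar>}"
        using a' s gen_inverse_nonneg[of "ds x"] by (auto simp: cutf_def a'_def)
      moreover have "{u \<in> {0..}. b < \<bar>?f u\<bar>} \<inter> {u \<in> {0..}. s < \<bar>cutf {a<..b} ?f u\<bar>} = {}"
        using s gen_inverse_nonneg[of "ds x"] by (auto simp: cutf_def)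
      ultimately show ?thesis unfolding dist_fun_def using plus_emeasure[OF dist_sets[OF fm, of b] bs] by simp
    qed
    then have "ds x b + tr (sproj x b - sproj x a') = ds x b + dist_fun (cutf {a<..b} ?f) s"
      using 2 a'(1) b by (simp add: sv_dist[OF x])
    \<comment> \<open>Cancelling \<open>ds x b\<close> needs its finiteness, which holds because b >
      a' \<ge> 0.\<close>
    then have "tr (sproj x b - sproj x a') = dist_fun (cutf {a<..b} ?f) s"
      using ds_finite[OF x, of b] a' by (auto simp: ennreal_add_left_cancel)
    then show ?thesis using 1 by simp
  next
    case False
    have "ds (graph ?d) s = 0"
    proof (cases "a = b")
      case True
      then show ?thesis using ds_large[OF A_zero, of 0 s] s by (simp add: nbound_def)
    next
      case False
      then show ?thesis using \<open>\<not> (a < b \<and> s < b)\<close> ab ds_large[OF dA trunc_nbound_diff(2)[OF x a ab], of s] by simp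
    qed
    then show ?thesis by simp
  qed
  from EA_dominated[OF dA cutf_mem(1)[OF sv_mem[OF x]] this]
  show "?d \<in> EA" "nn ?d \<le> N (cutf {a<..b} ?f)" by auto
qed

lemma ds_piece_zero:
  assumes x: "x \<in> X" and a: "0 \<le> a" and ab: "a \<le> b"
  shows "ds (graph (tc x b - tc x a)) 0 \<le> ds x a"
  unfolding ds_def[of x]
proof (rule ds_right_support)
  interpret cdd_op x by (rule X_cdd[OF x])
  show "trunc b - trunc a \<in> A" using a ab by (intro A_diff trunc_A[OF X_adm[OF x]]) auto
  show "1 - sproj x a \<in> A" by (intro A_diff A_one sproj_A[OF X_adm[OF x]])
  show p: "isproj (1 - sproj x a)" by (rule isproj_compl[OF sproj_isproj])
  show "(trunc b - trunc a) * (1 - sproj x a) = trunc b - trunc a"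
    unfolding trunc_nbound_diff(1)[OF x a ab] mult.assoc isprojD(2)[OF p] ..
qed simp

text \<open>For operators of bounded norm and support, a small \<open>t2\<close> forces a small
  quasi-norm. Below s0 the distribution function is at most T, by Chebyshev it is at most \<delta>
  from s0 up to K, and beyond K it is 0; so \<open>K * indicator {0..<\<delta>}\<close> plus
  \<open>s0 * indicator {0..<T}\<close> dominates.\<close>

lemma small_core:
  assumes K: "0 \<le> K" and T: "0 \<le> T" and e: "0 < \<epsilon>"
  shows "\<exists>\<rho>>0. \<forall>d\<in>A. nbound d K \<longrightarrow> ds (graph d) 0 \<le> ennreal T \<longrightarrow> t2 d \<le> ennreal \<rho> \<longrightarrow> d \<in> EA \<and> nn d \<le> \<epsilon>"
proof -
  \<comment> \<open>Chosen so that the step of height s0 and length T costs at most half of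
    \<epsilon> after the factor \<open>Cq\<close>; the summand 1 covers
    \<open>phi T = 0\<close>.\<close>
  define s0 where "s0 = \<epsilon> / (2 * Cq * (1 + phi T))"
  have pT: "0 \<le> phi T" by (rule phi_nonneg[OF T])
  have s0: "0 < s0" using e Cq_ge pT by (simp add: s0_def)
  have "s0 * (1 + phi T) = \<epsilon> / (2 * Cq)" using pT Cq_ge by (simp add: s0_def)
  then have s0e: "s0 * phi T \<le> \<epsilon> / (2 * Cq)" using s0 by (simp add: distrib_left)
  obtain \<delta> where \<delta>: "0 < \<delta>" "phi \<delta> < \<epsilon> / (2 * Cq * (K + 1))"
    using phi_small[of "\<epsilon> / (2 * Cq * (K + 1))"] e Cq_ge K by auto
  have "K * phi \<delta> \<le> (K + 1) * phi \<delta>" using phi_nonneg[of \<delta>] \<delta> by (intro mult_right_mono) auto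
  also have "\<dots> \<le> (K + 1) * (\<epsilon> / (2 * Cq * (K + 1)))" using \<delta> K by (intro mult_left_mono) auto
  also have "\<dots> = \<epsilon> / (2 * Cq)" using K by simp
  finally have K\<delta>: "K * phi \<delta> \<le> \<epsilon> / (2 * Cq)" .
  \<comment> \<open>Exactly what Chebyshev needs to give distribution at most \<delta> at level
    s0.\<close>
  define \<rho> where "\<rho> = s0^2 * \<delta>"
  have \<rho>: "0 < \<rho>" using s0 \<delta> by (simp add: \<rho>_def)
  let ?h1 = "\<lambda>u. K * indicator {0..<\<delta>} u :: real" and ?h2 = "\<lambda>u. s0 * indicator {0..<T} u :: real"
  define h where "h = (\<lambda>u. ?h1 u + ?h2 u)"
  have h12: "?h1 \<in> E" "?h2 \<in> E" by (rule indicator_mem; use \<delta> T in simp)+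
  have hE: "h \<in> E" unfolding h_def by (rule add_mem[OF h12])
  have "N h \<le> Cq * (K * phi \<delta> + s0 * phi T)"
    using quasi_triangle'[OF h12] phi_scale[of \<delta> K] phi_scale[of T s0] \<delta> T K s0 by (simp add: h_def)
  also have "\<dots> \<le> Cq * (\<epsilon> / (2 * Cq) + \<epsilon> / (2 * Cq))" using K\<delta> s0e Cq_ge by (intro mult_left_mono) auto
  also have "\<dots> = \<epsilon>" using Cq_ge by (simp add: field_simps)
  finally have Nh: "N h \<le> \<epsilon>" .
  have "d \<in> EA \<and> nn d \<le> \<epsilon>" if d: "d \<in> A" "nbound d K" "ds (graph d) 0 \<le> ennreal T" "t2 d \<le> ennreal \<rho>" for d
  proof -
    have "ds (graph d) s \<le> dist_fun h s" if s: "0 \<le> s" for s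
    proof -
      consider "s < s0" | "s0 \<le> s" "s < K" | "K \<le> s" by linarith
      then show ?thesis
      proof cases
        case 1
        have "ds (graph d) s \<le> ds (graph d) 0" by (rule ds_antimono[OF adm_graph[OF d(1)] s])
        also have "\<dots> \<le> dist_fun ?h2 s"
          using d(3) dist_indicator[OF order_refl T s, of s0] s0 1 by simp
        also have "\<dots> \<le> dist_fun h s"
          by (rule dist_mono[OF measurable[OF hE]]) (use K s0 in \<open>auto simp: h_def indicator_def\<close>)
        finally show ?thesis .
      next
        case 2
        have "ennreal (s0^2) * ds (graph d) s \<le> ennreal (s0^2) * ds (graph d) s0"
          by (intro mult_left_mono ds_antimono[OF adm_graph[OF d(1)] 2(1)]) simp
        also have "\<dots> \<le> t2 d" by (rule chebyshev[OF d(1)]) (use s0 in simp)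
        also have "\<dots> \<le> ennreal (s0^2) * ennreal \<delta>" using d(4) by (simp add: \<rho>_def ennreal_mult')
        finally have "ds (graph d) s \<le> ennreal \<delta>"
          using s0 by (subst (asm) ennreal_mult_le_mult_iff) auto
        also have "\<dots> = dist_fun ?h1 s" using dist_indicator[OF order_refl less_imp_le[OF \<delta>(1)] s K] 2 by simp
        also have "\<dots> \<le> dist_fun h s"
          by (rule dist_mono[OF measurable[OF hE]]) (use K s0 in \<open>auto simp: h_def indicator_def\<close>)
        finally show ?thesis .
      next
        case 3
        then show ?thesis using ds_large[OF d(1,2), of s] by simp
      qed
    qed
    from EA_dominated[OF d(1) hE this] Nh show ?thesis by auto
  qed
  then show ?thesis using \<rho> by blast
qed

lemma small_bound:
  assumes d: "d \<in> A" "nbound d L" and T: "0 \<le> T" "ds (graph d) 0 \<le> ennreal T"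
  shows "d \<in> EA" "nn d \<le> L * phi T"
proof -
  have L: "0 \<le> L" using d(2) by (simp add: nbound_def)
  let ?h = "\<lambda>u. L * indicator {0..<T} u :: real"
  have h: "?h \<in> E" by (rule indicator_mem) (use T in auto)
  have "ds (graph d) s \<le> dist_fun ?h s" if s: "0 \<le> s" for s
  proof (cases "s < L")
    case True
    have "ds (graph d) s \<le> ds (graph d) 0" by (rule ds_antimono[OF adm_graph[OF d(1)] s])
    then show ?thesis using T(2) dist_indicator[OF order_refl T(1) s L] True by simp
  next
    case False
    then show ?thesis using ds_large[OF d, of s] by simp
  qed
  from EA_dominated[OF d(1) h this] show "d \<in> EA" "nn d \<le> L * phi T" by (simp_all add: phi_scale[OF T(1) L])
qed

text \<open>v - p v p is the sum of (1 - p) v and p v (1 - p). In both terms the factor 1 - p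
  replaces v by g v or v g, which are supported by finite trace, although v itself need not
  be.\<close>

lemma low_part:
  assumes v: "v \<in> A" "nbound v L" and g: "g \<in> A" "isproj g" "tr g = ennreal T" "0 \<le> T"
    and p: "p \<in> A" "isproj p" and pv: "(1 - p) * v = (1 - p) * (g * v)" "v * (1 - p) = v * g * (1 - p)"
  shows "cc p v \<in> EA" "nn (cc p v) \<le> 2 * C1 * (L * phi T)"
proof -
  have L: "0 \<le> L" using v(2) by (simp add: nbound_def)
  have q: "1 - p \<in> A" "nbound (1 - p) 1" by (auto intro: A_diff A_one p isproj_nbound isproj_compl)
  have gv: "g * v \<in> EA" "nn (g * v) \<le> L * phi T"
  proof -
    have n: "nbound (g * v) L" using nbound_mult[OF isproj_nbound[OF g(2)] v(2)] by simp
    have "ds (graph (g * v)) 0 \<le> tr g"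
      by (rule ds_left_support) (auto intro: A_mult g v simp: mult.assoc[symmetric] isprojD(2)[OF g(2)])
    then show "g * v \<in> EA" "nn (g * v) \<le> L * phi T"
      using small_bound[OF A_mult[OF g(1) v(1)] n g(4)] g(3) by simp_all
  qed
  have vg: "v * g \<in> EA" "nn (v * g) \<le> L * phi T"
  proof -
    have n: "nbound (v * g) L" using nbound_mult[OF v(2) isproj_nbound[OF g(2)]] by simp
    have "ds (graph (v * g)) 0 \<le> tr g"
      by (rule ds_right_support) (auto intro: A_mult g v simp: mult.assoc isprojD(2)[OF g(2)])
    then show "v * g \<in> EA" "nn (v * g) \<le> L * phi T"
      using small_bound[OF A_mult[OF v(1) g(1)] n g(4)] g(3) by simp_all
  qed
  note 1 = EA_left[OF gv(1) q] and 2 = EA_right[OF vg(1) q]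
  note 3 = EA_left[OF 2(1) p(1) isproj_nbound[OF p(2)]]
  have eq: "cc p v = (1 - p) * (g * v) + p * (v * g * (1 - p))"
    unfolding cc_def pv[symmetric] by (simp add: algebra_simps)
  show "cc p v \<in> EA" unfolding eq by (rule EA_add(1)[OF 1(1) 3(1)])
  have "nn (cc p v) \<le> C1 * (nn ((1 - p) * (g * v)) + nn (p * (v * g * (1 - p))))"
    unfolding eq by (rule EA_add(2)[OF 1(1) 3(1)])
  also have "\<dots> \<le> C1 * (L * phi T + L * phi T)"
    using 1(2) 2(2) 3(2) gv(2) vg(2) C1_ge by (intro mult_left_mono) auto
  finally show "nn (cc p v) \<le> 2 * C1 * (L * phi T)" by simp
qed

lemma t2_add3:
  assumes "a \<in> A" "b \<in> A" "c \<in> A" shows "t2 (a + b + c) \<le> 4 * t2 a + 4 * t2 b + 2 * t2 c"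
proof -
  have "t2 (a + b + c) \<le> 2 * t2 (a + b) + 2 * t2 c" by (intro t2_add A_add assms)
  also have "\<dots> \<le> 2 * (2 * t2 a + 2 * t2 b) + 2 * t2 c" by (intro add_mono mult_left_mono t2_add assms) auto
  finally show ?thesis by (simp add: distrib_left mult.assoc[symmetric])
qed

lemma t2_corner_le:
  assumes "a \<in> A" "p \<in> A" "isproj p" "t2 a < \<infinity>"
  shows "t2 (a - p * a * p) \<le> 2 * (t2 a - t2 (p * a * p))"
proof -
  obtain D where D: "t2 a = t2 (p * a * p) + D" "t2 (a - p * a * p) \<le> 2 * D" using t2_corner[OF assms(1-3)] by blast
  have "t2 (p * a * p) < \<infinity>" using D(1) assms(4) by (simp add: less_top[symmetric])
  then have "t2 a - t2 (p * a * p) = D" unfolding D(1) by simp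
  then show ?thesis using D(2) by simp
qed

end

section \<open>Splitting a bounded sequence\<close>

text \<open>Sequential compactness of a countable product of intervals gives pointwise limits l(i,
  m), which converge in m by monotonicity. A second thinning makes the k-th member close to the
  limit for all i, m \<le> k, so that even the moving index m = k is controlled.\<close>

lemma diagonal_subsequence:
  fixes F :: "nat \<Rightarrow> nat \<Rightarrow> nat \<Rightarrow> real"
  assumes bd: "\<And>i n m. 0 \<le> F i n m \<and> F i n m \<le> B i" and dec: "\<And>i n m m'. m \<le> m' \<Longrightarrow> F i n m' \<le> F i n m"
  shows "\<exists>r. strict_mono r \<and> (\<forall>i. \<forall>\<epsilon>>0. \<exists>m0. \<forall>m\<ge>m0. \<forall>k\<ge>m. F i (r k) m - F i (r k) k \<le> \<epsilon>)"
proof -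
  define S where "S = (\<Pi>\<^sub>E p\<in>(UNIV :: (nat \<times> nat) set). {0..B (fst p)})"
  have "compactin (product_topology (\<lambda>_. euclidean) UNIV) S"
    unfolding S_def by (subst compactin_PiE) auto
  then have "compact S" by (simp add: euclidean_product_topology)
  then have "seq_compact S" by (simp add: compact_eq_seq_compact_metric)
  moreover have "\<forall>n. (\<lambda>p. F (fst p) n (snd p)) \<in> S" using bd by (auto simp: S_def)
  ultimately obtain l r0 where r0: "strict_mono r0" "((\<lambda>n p. F (fst p) n (snd p)) \<circ> r0) \<longlonglongrightarrow> l"
    by (rule seq_compactE)
  have lim: "(\<lambda>n. F i (r0 n) m) \<longlonglongrightarrow> l (i, m)" for i m
  proof -
    have "(\<lambda>n. ((\<lambda>n p. F (fst p) n (snd p)) \<circ> r0) n (i, m)) \<longlonglongrightarrow> l (i, m)"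
      by (rule continuous_on_tendsto_compose[OF continuous_on_product_coordinates r0(2)]) auto
    then show ?thesis by simp
  qed
  have "\<exists>n0. \<forall>n\<ge>n0. \<forall>i\<le>k. \<forall>m\<le>k. \<bar>F i (r0 n) m - l (i, m)\<bar> < 1 / real (Suc k)" for k
  proof -
    have 0: "0 < 1 / real (Suc k)" by simp
    have "\<forall>\<^sub>F n in sequentially. \<forall>i\<in>{..k}. \<forall>m\<in>{..k}. \<bar>F i (r0 n) m - l (i, m)\<bar> < 1 / real (Suc k)"
      using tendstoD[OF lim 0] by (intro eventually_ball_finite finite_atMost ballI) (simp add: dist_real_def)
    then show ?thesis by (auto simp: eventually_sequentially)
  qed
  then have "\<forall>k. \<exists>n0. \<forall>n\<ge>n0. \<forall>i\<le>k. \<forall>m\<le>k. \<bar>F i (r0 n) m - l (i, m)\<bar> < 1 / real (Suc k)" ..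
  from choice[OF this] obtain n0
    where "\<forall>k. \<forall>n\<ge>n0 k. \<forall>i\<le>k. \<forall>m\<le>k. \<bar>F i (r0 n) m - l (i, m)\<bar> < 1 / real (Suc k)" ..
  then have n0: "\<And>k n i m. n0 k \<le> n \<Longrightarrow> i \<le> k \<Longrightarrow> m \<le> k \<Longrightarrow> \<bar>F i (r0 n) m - l (i, m)\<bar> < 1 / real (Suc k)" by simp
  \<comment> \<open>Strictly increasing and at least \<open>n0 k\<close>.\<close>
  define s where "s k = k + (\<Sum>i\<le>k. n0 i)" for k
  have "strict_mono s" by (rule strict_monoI_Suc) (simp add: s_def)
  have s: "n0 k \<le> s k" for k
    using member_le_sum[of k "{..k}" n0] by (simp add: s_def)
  have "\<exists>m0. \<forall>m\<ge>m0. \<forall>k\<ge>m. F i (r0 (s k)) m - F i (r0 (s k)) k \<le> \<epsilon>" if e: "0 < \<epsilon>" for i \<epsilon>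
  proof -
    have "decseq (\<lambda>m. l (i, m))"
      by (auto intro!: decseq_SucI LIMSEQ_le[OF lim lim] dec)
    moreover have "0 \<le> l (i, m)" for m by (rule LIMSEQ_le_const[OF lim]) (use bd in auto)
    ultimately obtain L where "(\<lambda>m. l (i, m)) \<longlonglongrightarrow> L"
      using decseq_convergent[of "\<lambda>m. l (i, m)" 0] by blast
    from LIMSEQ_imp_Cauchy[OF this, THEN metric_CauchyD, of "\<epsilon> / 2"] e
    obtain m1 where m1: "\<And>m k. m1 \<le> m \<Longrightarrow> m1 \<le> k \<Longrightarrow> dist (l (i, m)) (l (i, k)) < \<epsilon> / 2" by auto
    obtain m2 where m2: "1 / real (Suc m2) < \<epsilon> / 4" using e nat_approx_posE[of "\<epsilon> / 4"] by auto
    have "F i (r0 (s k)) m - F i (r0 (s k)) k \<le> \<epsilon>" if m: "max i (max m1 m2) \<le> m" "m \<le> k" for m k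
    proof -
      have "1 / real (Suc k) \<le> 1 / real (Suc m2)" using m by (simp add: frac_le)
      then have "1 / real (Suc k) < \<epsilon> / 4" using m2 by linarith
      moreover have "\<bar>F i (r0 (s k)) m - l (i, m)\<bar> < 1 / real (Suc k)" "\<bar>F i (r0 (s k)) k - l (i, k)\<bar> < 1 / real (Suc k)"
        using n0[OF s, of i k] m by auto
      moreover have "\<bar>l (i, m) - l (i, k)\<bar> < \<epsilon> / 2" using m1[of m k] m by (simp add: dist_real_def)
      ultimately show ?thesis by linarith
    qed
    then show ?thesis by blast
  qed
  moreover have "strict_mono (\<lambda>k. r0 (s k))" using strict_mono_o[OF r0(1) \<open>strict_mono s\<close>] by (simp add: o_def)
  ultimately show ?thesis by (intro exI[of _ "\<lambda>k. r0 (s k)"]) auto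
qed

text \<open>The graph of x - a. Since a is bounded and everywhere defined, the domain is that of x
  and closedness is inherited.\<close>

definition pert :: "'h::chilbert_space op \<Rightarrow> 'h bop \<Rightarrow> 'h op"
  where "pert x a = {(u, v). (u, v + a \<odot> u) \<in> x}"

section \<open>Subtraction of a bounded operator, and corner estimates\<close>

context nc_setting
begin

lemma projections_graph: "graph p \<in> projections M \<longleftrightarrow> p \<in> A \<and> isproj p"
  by (auto simp: projections_def M_iff)

lemma projections_obtain:
  assumes "p \<in> projections M" obtains p' where "p = graph p'" "p' \<in> A" "isproj p'"
  using assms by (auto simp: projections_def M_iff)

lemma pert_closed_dense:
  assumes x: "closed_densely_defined x" shows "closed_densely_defined (pert x a)"
proof -
  have lin: "linear_op x" and cl: "closed x" and de: "closure (Domain x) = UNIV"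
    using x by (auto simp: closed_densely_defined_def)
  have "linear_op (pert x a)"
    unfolding linear_op_def
  proof (intro conjI allI impI)
    show "single_valued (pert x a)"
    proof (rule single_valuedI)
      fix u w w' assume "(u, w) \<in> pert x a" "(u, w') \<in> pert x a"
      then show "w = w'" using linear_op_unique[OF lin, of u "w + a \<odot> u" "w' + a \<odot> u"] by (simp add: pert_def)
    qed
    show "(0, 0) \<in> pert x a" using linear_op_zero[OF lin] by (simp add: pert_def)
    show "(u + u', w + w') \<in> pert x a" if "(u, w) \<in> pert x a" "(u', w') \<in> pert x a" for u w u' w'
      using linear_op_add[OF lin, of u "w + a \<odot> u" u' "w' + a \<odot> u'"] that by (simp add: pert_def algebra_simps)
    show "(c *\<^sub>C u, c *\<^sub>C w) \<in> pert x a" if "(u, w) \<in> pert x a" for c u w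
      using linear_op_scaleC[OF lin, of u "w + a \<odot> u" c] that by (simp add: pert_def scaleC_add_right)
  qed
  moreover have "closed (pert x a)"
  proof -
    have "pert x a = (\<lambda>z. (fst z, snd z + a \<odot> fst z)) -` x" by (auto simp: pert_def)
    moreover have "continuous_on UNIV (\<lambda>z. (fst z, snd z + a \<odot> fst z))" by (intro continuous_intros)
    ultimately show ?thesis using closed_vimage[OF cl] by simp
  qed
  moreover have "Domain (pert x a) = Domain x"
  proof (intro equalityI subsetI)
    fix u assume "u \<in> Domain x"
    then obtain v where "(u, v) \<in> x" by blast
    then have "(u, v - a \<odot> u) \<in> pert x a" by (simp add: pert_def)
    then show "u \<in> Domain (pert x a)" by blast
  qed (auto simp: pert_def)
  ultimately show ?thesis using de by (simp add: closed_densely_defined_def)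
qed

lemma pert_tau:
  assumes x: "tau_measurable M \<tau> x" and a: "a \<in> A" shows "tau_measurable M \<tau> (pert x a)"
  unfolding tau_measurable_def
proof (intro conjI allI impI)
  show "closed_densely_defined (pert x a)" using x by (simp add: tau_measurable_def pert_closed_dense)
  show "affiliated M (pert x a)"
    unfolding affiliated_iff
  proof (intro ballI allI impI)
    fix u v y assume u: "u \<in> A'" "adj u * u = 1" "u * adj u = 1" and m: "(v, y) \<in> pert x a"
    from m have "(v, y + a \<odot> v) \<in> x" by (simp add: pert_def)
    from adm_unitary(1)[OF tau_adm[OF x] u this] show "(u \<odot> v, u \<odot> y) \<in> pert x a"
      by (simp add: pert_def A'_apply[OF u(1) a])
  qed
  fix \<epsilon> :: real assume "0 < \<epsilon>"
  then obtain p where p: "p \<in> projections M" "Range p \<subseteq> Domain x" "\<tau> (op_minus Id p) < ennreal \<epsilon>" "op_times x p \<in> M"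
    using x unfolding tau_measurable_def by blast
  obtain p' where p': "p = graph p'" "p' \<in> A" "isproj p'" using projections_obtain[OF p(1)] .
  obtain b where b: "b \<in> A" "op_times x p = graph b" using p(4) by (auto simp: M_iff)
  have mem: "(p' \<odot> v, w) \<in> x \<longleftrightarrow> w = b \<odot> v" for v w
  proof -
    have "(p' \<odot> v, w) \<in> x \<longleftrightarrow> (v, w) \<in> op_times x p" by (auto simp: op_times_def p'(1))
    then show ?thesis by (simp add: b(2))
  qed
  have "op_times (pert x a) p = graph (b - a * p')"
  proof (rule graph_eqI)
    fix v y
    have "(v, y) \<in> op_times (pert x a) p \<longleftrightarrow> (p' \<odot> v, y + a \<odot> p' \<odot> v) \<in> x" by (auto simp: op_times_def p'(1) pert_def)
    then show "(v, y) \<in> op_times (pert x a) p \<longleftrightarrow> y = (b - a * p') \<odot> v" by (auto simp: mem algebra_simps)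
  qed
  moreover have "b - a * p' \<in> A" by (intro A_diff A_mult b a p')
  ultimately have 1: "op_times (pert x a) p \<in> M" by (auto simp: M_iff)
  have "Range p \<subseteq> Domain (pert x a)"
  proof
    fix v assume "v \<in> Range p"
    then obtain w where "(v, w) \<in> x" using p(2) by blast
    then have "(v, w - a \<odot> v) \<in> pert x a" by (simp add: pert_def)
    then show "v \<in> Domain (pert x a)" by blast
  qed
  then show "\<exists>p\<in>projections M. Range p \<subseteq> Domain (pert x a) \<and> \<tau> (op_minus Id p) < ennreal \<epsilon> \<and> op_times (pert x a) p \<in> M"
    using p 1 by blast
qed

lemma pert_X:
  assumes x: "x \<in> X" and a: "a \<in> EA" shows "pert x a \<in> X" "nx (pert x a) \<le> C1 * (nx x + nn a)"
proof -
  note t = pert_tau[OF X_tau[OF x] EA_D(1)[OF a]] and m = EA_minus[OF a]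
  have le: "ds (pert x a) (s + s) \<le> ds x s + ds (graph (- a)) s" if "0 \<le> s" for s
    by (rule ds_add[OF X_adm[OF x] adm_graph[OF EA_D(1)[OF m(1)]] tau_adm[OF t] that that]) (simp add: pert_def)
  note 1 = nc_add[OF t x EA_D(2)[OF m(1)] le]
  show "pert x a \<in> X" by (rule 1(1))
  have "C1 * (nx x + nn (- a)) \<le> C1 * (nx x + nn a)" using m(2) C1_ge by (intro mult_left_mono) auto
  then show "nx (pert x a) \<le> C1 * (nx x + nn a)" using 1(2) by linarith
qed

lemma strong_plus_pert: "closed x \<Longrightarrow> strong_plus (graph a) (pert x a) = x"
proof -
  assume "closed x"
  moreover have "op_plus (graph a) (pert x a) = x"
  proof (intro equalityI subrelI)
    fix u v assume "(u, v) \<in> x"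
    then have "(u, v - a \<odot> u) \<in> pert x a" by (simp add: pert_def)
    moreover have "v = a \<odot> u + (v - a \<odot> u)" by simp
    ultimately show "(u, v) \<in> op_plus (graph a) (pert x a)" unfolding op_plus_def by force
  qed (auto simp: op_plus_def pert_def add.commute)
  ultimately show ?thesis by (simp add: strong_plus_def)
qed

lemma compress_graph: "compress (graph p) (graph a) = graph (p * a * p)"
  by (simp add: compress_def strong_times_def closed_graph)

text \<open>The two hypotheses say that the operator has its range under p and vanishes on the
  kernel of p, so each algebraic product with p is the closed operator itself and taking closures
  changes nothing.\<close>

lemma compress_pert:
  assumes x: "closed_densely_defined x" and p: "isproj p"
    and fix1: "\<And>u v. (u, v) \<in> pert x a \<Longrightarrow> p \<odot> v = v"
    and fix2: "\<And>u. p \<odot> u = 0 \<Longrightarrow> (u, 0) \<in> pert x a"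
  shows "compress (graph p) (pert x a) = pert x a"
proof -
  have cd: "closed_densely_defined (pert x a)" by (rule pert_closed_dense[OF x])
  then have lin: "linear_op (pert x a)" and cl: "closed (pert x a)" by (auto simp: closed_densely_defined_def)
  have "op_times (graph p) (pert x a) = pert x a"
    using fix1 by (auto simp: op_times_def relcomp_unfold)
  moreover have "op_times (pert x a) (graph p) = pert x a"
  proof -
    have "(p \<odot> u, v) \<in> pert x a \<longleftrightarrow> (u, v) \<in> pert x a" for u v
    proof -
      have m: "(u - p \<odot> u, 0) \<in> pert x a" by (rule fix2) (simp add: p)
      show ?thesis
        using linear_op_add[OF lin m, of "p \<odot> u" v] linear_op_diff[OF lin _ m, of u v] by auto
    qed
    then show ?thesis by (auto simp: op_times_def relcomp_unfold)
  qed
  ultimately show ?thesis using cl by (simp add: compress_def strong_times_def)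
qed

text \<open>A vector of the difference is orthogonal to p; if t also kills it, then so does the
  join. Hence t is injective there.\<close>

lemma join_two_diff:
  assumes p: "p \<in> A" "isproj p" and t: "t \<in> A" "isproj t"
  shows "isproj (join {p, t} - p)" "tr (join {p, t} - p) \<le> tr t"
proof -
  have jA: "join {p, t} \<in> A" by (rule join_A) (use p t in auto)
  have jp: "join {p, t} * p = p" and jt: "join {p, t} * t = t" by (auto intro: join_upper)
  have pj: "p * join {p, t} = p" by (rule isproj_adj_le[OF join_isproj p(2) jp])
  show d: "isproj (join {p, t} - p)" by (rule isproj_diff[OF join_isproj p(2) jp])
  show "tr (join {p, t} - p) \<le> tr t"
  proof (rule tr_le_of_injective[OF t(1) A_diff[OF jA p(1)] d t])
    show "t * t = t" by (rule isprojD(2)[OF t(2)])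
    fix u assume f: "(join {p, t} - p) \<odot> u = u" and z: "t \<odot> u = 0"
    have "p \<odot> (join {p, t} - p) \<odot> u = (p * join {p, t}) \<odot> u - p \<odot> u" using p(2) by simp
    then have "p \<odot> u = 0" unfolding f pj by simp
    moreover have "join {p, t} \<odot> u = 0" by (rule join_zero) (use p t z \<open>p \<odot> u = 0\<close> in auto)
    ultimately show "u = 0" using f by simp
  qed
qed

lemma ds_cc:
  assumes a: "a \<in> A" and p: "p \<in> A" "isproj p" shows "ds (graph (cc p a)) 0 \<le> 2 * ds (graph a) 0"
proof -
  have n: "nbound (- p) 1" using isproj_nbound[OF p(2)] by (simp add: nbound_def)
  have "ds (graph (a + (- p) * a * p)) (0 + 0) \<le> ds (graph a) 0 + ds (graph ((- p) * a * p)) 0"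
    by (rule ds_graph_add) (auto intro!: A_mult A_minus a p(1))
  also have "\<dots> \<le> ds (graph a) 0 + ds (graph ((- p) * a)) 0"
    by (intro add_left_mono ds_right_mult isproj_nbound p A_mult A_minus a) simp
  also have "\<dots> \<le> ds (graph a) 0 + ds (graph a) 0"
    by (intro add_left_mono ds_left_mult a A_minus p n) simp
  finally show ?thesis by (simp add: cc_def mult_2)
qed

lemma ds_conj_zero:
  assumes "a \<in> A" "p \<in> A" "isproj p" shows "ds (graph (p * a * p)) 0 \<le> ds (graph a) 0"
proof -
  note n = isproj_nbound[OF assms(3)]
  have "ds (graph (p * a * p)) 0 \<le> ds (graph (p * a)) 0" by (rule ds_right_mult[OF A_mult[OF assms(2,1)] assms(2) n order_refl])
  also have "\<dots> \<le> ds (graph a) 0" by (rule ds_left_mult[OF assms(1,2) n order_refl])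
  finally show ?thesis .
qed

lemma t2_conj:
  assumes "a \<in> A" "p \<in> A" "isproj p" shows "t2 (p * a * p) \<le> t2 a"
proof -
  have "t2 (p * a * p) \<le> ennreal (1^2) * t2 (p * a)" by (intro t2_right A_mult assms isproj_nbound)
  also have "\<dots> \<le> t2 a" using t2_left[OF assms(1,2) isproj_nbound[OF assms(3)]] by simp
  finally show ?thesis .
qed

lemma t2_proj_mult:
  assumes e: "e \<in> A" "isproj e" and g: "g \<in> A" "isproj g"
  shows "t2 (e * g) = tr (g * e * g)" "t2 (g * e) = tr (g * e * g)"
proof -
  have eg: "adj (e * g) * (e * g) = g * e * g"
    using arg_cong[OF isprojD(2)[OF e(2)], of "\<lambda>a. g * a * g"] by (simp add: isprojD(1)[OF e(2)] isprojD(1)[OF g(2)] mult.assoc)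
  show 1: "t2 (e * g) = tr (g * e * g)" unfolding t2_def eg ..
  have "adj (e * g) = g * e" by (simp add: isprojD(1)[OF e(2)] isprojD(1)[OF g(2)])
  then show "t2 (g * e) = tr (g * e * g)" using t2_adj[OF A_mult[OF e(1) g(1)]] 1 by simp
qed

text \<open>Telescoping from c to p c p through the corners at a and b, meant for a = G - g_i and b
  = G - g_k. The error c - a c a carries a factor g next to e and is governed by tr(g e g); the
  error between the corners at a and b is the Pythagorean drop of \<open>t2\<close>; the error
  between b and p is bounded through the trace of p - b.\<close>

lemma core_t2:
  assumes c: "c \<in> A" "nbound c K" and g: "g \<in> A" "isproj g" and a: "a \<in> A" "isproj a"
    and b: "b \<in> A" "isproj b" "a * b = b" and p: "p \<in> A" "isproj p" "p * b = b" and e: "e \<in> A" "isproj e"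
    and ac: "a * c = c - g * c" "c * a = c - c * g" and fin: "t2 (a * c * a) < \<infinity>"
    and d1: "tr (g * e * g) \<le> ennreal \<delta>1" and d2: "t2 (a * c * a) - t2 (b * c * b) \<le> ennreal \<delta>2"
    and d3: "tr (p - b) \<le> ennreal \<delta>3" and nonneg: "0 \<le> \<delta>1" "0 \<le> \<delta>2" "0 \<le> \<delta>3"
  shows "t2 (e * cc p c * e) \<le> ennreal (16 * K^2 * \<delta>1 + 8 * \<delta>2 + 8 * K^2 * \<delta>3)"
proof -
  have K: "0 \<le> K" using c(2) by (simp add: nbound_def)
  have n1: "nbound p 1" "nbound a 1" "nbound b 1" "nbound e 1" "nbound (1 - g) 1"
    using p a b e g by (auto intro: isproj_nbound isproj_compl)
  have pb: "isproj (p - b)" by (rule isproj_diff[OF p(2) b(2) p(3)])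
  define u where "u = e * (c - a * c * a) * e"
  define v where "v = e * (a * c * a - b * c * b) * e"
  define w where "w = e * (b * c * b - p * c * p) * e"
  have A: "u \<in> A" "v \<in> A" "w \<in> A" unfolding u_def v_def w_def by (intro A_mult A_diff c a b p e)+
  have "t2 u \<le> ennreal (4 * K^2 * \<delta>1)"
  proof -
    have "a * c * a = c - c * g - g * c * (1 - g)" unfolding ac by (simp add: algebra_simps ac(2))
    then have "c - a * c * a = g * c * (1 - g) + c * g" by simp
    then have "u = e * (g * c * (1 - g) + c * g) * e" unfolding u_def by simp
    then have u: "u = e * g * (c * (1 - g) * e) + e * c * (g * e)" by (simp add: algebra_simps)
    have "t2 u \<le> 2 * t2 (e * g * (c * (1 - g) * e)) + 2 * t2 (e * c * (g * e))"
      unfolding u by (intro t2_add A_mult A_diff A_one c g e)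
    also have "\<dots> \<le> 2 * (ennreal (K^2) * t2 (e * g)) + 2 * (ennreal (K^2) * t2 (g * e))"
    proof (intro add_mono mult_left_mono)
      have "nbound (c * (1 - g) * e) K" using nbound_mult[OF nbound_mult[OF c(2) n1(5)] n1(4)] by simp
      then show "t2 (e * g * (c * (1 - g) * e)) \<le> ennreal (K^2) * t2 (e * g)"
        by (intro t2_right A_mult A_diff A_one c g e)
      have "nbound (e * c) K" using nbound_mult[OF n1(4) c(2)] by simp
      then show "t2 (e * c * (g * e)) \<le> ennreal (K^2) * t2 (g * e)" by (intro t2_left A_mult c g e)
    qed simp_all
    also have "\<dots> = ennreal (4 * K^2) * tr (g * e * g)"
      unfolding t2_proj_mult[OF e g] by (simp add: ennreal_mult' distrib_right[symmetric] mult.assoc[symmetric] mult_2[symmetric])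
    also have "\<dots> \<le> ennreal (4 * K^2) * ennreal \<delta>1" by (intro mult_left_mono d1) simp
    finally show ?thesis by (simp add: ennreal_mult'[symmetric])
  qed
  moreover have "t2 v \<le> ennreal (2 * \<delta>2)"
  proof -
    have ba: "b * a = b" by (rule isproj_adj_le[OF a(2) b(2,3)])
    have "b * (a * c * a) * b = b * c * b" unfolding mult.assoc b(3) unfolding mult.assoc[symmetric] ba ..
    then have "t2 (a * c * a - b * c * b) \<le> 2 * (t2 (a * c * a) - t2 (b * c * b))"
      using t2_corner_le[OF A_mult[OF A_mult[OF a(1) c(1)] a(1)] b(1,2) fin] by simp
    also have "\<dots> \<le> 2 * ennreal \<delta>2" by (intro mult_left_mono d2) simp
    also have "\<dots> = ennreal (2 * \<delta>2)" by (simp add: ennreal_mult')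
    finally have "t2 (a * c * a - b * c * b) \<le> ennreal (2 * \<delta>2)" .
    moreover have "t2 v \<le> t2 (a * c * a - b * c * b)"
      unfolding v_def by (intro t2_conj A_diff A_mult a b c e)
    ultimately show ?thesis by (rule order_trans[rotated])
  qed
  moreover have "t2 w \<le> ennreal (4 * K^2 * \<delta>3)"
  proof -
    have eq: "b * c * b - p * c * p = (- (p - b) * c * p) + (- b * c * (p - b))" by (simp add: algebra_simps)
    have "t2 w \<le> t2 (b * c * b - p * c * p)" unfolding w_def by (intro t2_conj A_diff A_mult b p c e)
    also have "\<dots> \<le> 2 * t2 (- (p - b) * c * p) + 2 * t2 (- b * c * (p - b))"
      unfolding eq by (intro t2_add A_mult A_minus A_diff p b c)
    also have "\<dots> \<le> 2 * (ennreal (K^2) * tr (p - b)) + 2 * (ennreal (K^2) * tr (p - b))"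
    proof (intro add_mono mult_left_mono)
      have m: "nbound (- (p - b)) 1" "nbound (- b) 1"
        using isproj_nbound[OF pb] n1(3) by (auto simp: nbound_def norm_minus_commute)
      show "t2 (- (p - b) * c * p) \<le> ennreal (K^2) * tr (p - b)"
      proof (rule t2_bound'[OF _ _ _ pb])
        show "nbound (- (p - b) * c * p) K" using nbound_mult[OF nbound_mult[OF m(1) c(2)] n1(1)] by simp
        have "(p - b) * - (p - b) = - (p - b)" by (simp only: mult_minus_right isprojD(2)[OF pb])
        then show "(p - b) * (- (p - b) * c * p) = - (p - b) * c * p" unfolding mult.assoc[symmetric] by simp
      qed (intro A_mult A_minus A_diff p b c)+
      show "t2 (- b * c * (p - b)) \<le> ennreal (K^2) * tr (p - b)"
      proof (rule t2_bound[OF _ _ _ pb])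
        show "nbound (- b * c * (p - b)) K" using nbound_mult[OF nbound_mult[OF m(2) c(2)] isproj_nbound[OF pb]] by simp
        show "- b * c * (p - b) * (p - b) = - b * c * (p - b)" unfolding mult.assoc isprojD(2)[OF pb] ..
      qed (intro A_mult A_minus A_diff p b c)+
    qed simp_all
    also have "\<dots> = ennreal (4 * K^2) * tr (p - b)"
      by (simp add: ennreal_mult' distrib_right[symmetric] mult.assoc[symmetric] mult_2[symmetric])
    also have "\<dots> \<le> ennreal (4 * K^2) * ennreal \<delta>3" by (intro mult_left_mono d3) simp
    finally show ?thesis by (simp add: ennreal_mult'[symmetric])
  qed
  moreover have "e * cc p c * e = u + v + w" by (simp add: u_def v_def w_def cc_def algebra_simps)
  \<comment> \<open>The weights 4, 4, 2 are those of \<open>t2_add3\<close>; multiplied by the three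
    bounds they produce 16, 8 and 8.\<close>
  ultimately have "t2 (e * cc p c * e) \<le> 4 * ennreal (4 * K^2 * \<delta>1) + 4 * ennreal (2 * \<delta>2) + 2 * ennreal (4 * K^2 * \<delta>3)"
    using t2_add3[OF A] by (auto elim!: order_trans intro!: add_mono mult_left_mono)
  also have "\<dots> = ennreal (4 * (4 * K^2 * \<delta>1) + 4 * (2 * \<delta>2) + 2 * (4 * K^2 * \<delta>3))"
    using nonneg by (simp only: ennreal_plus ennreal_mult' ennreal_numeral mult_nonneg_nonneg zero_le_power2 zero_le_numeral add_nonneg_nonneg)
  also have "4 * (4 * K^2 * \<delta>1) + 4 * (2 * \<delta>2) + 2 * (4 * K^2 * \<delta>3) = 16 * K^2 * \<delta>1 + 8 * \<delta>2 + 8 * K^2 * \<delta>3" by simp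
  finally show ?thesis .
qed

lemma conj_add:
  assumes a: "a \<in> EA" and b: "b \<in> EA" and p: "p \<in> A" "isproj p"
  shows "nn (p * (a + b) * p) \<le> C1 * (nn a + nn (p * b * p))"
proof -
  have "nn (p * (a + b) * p) \<le> C1 * (nn (p * a * p) + nn (p * b * p))"
    using EA_add(2)[OF EA_conj(1)[OF a p] EA_conj(1)[OF b p]] by (simp add: algebra_simps)
  also have "\<dots> \<le> C1 * (nn a + nn (p * b * p))" using EA_conj(2)[OF a p] C1_ge by (intro mult_left_mono) auto
  finally show ?thesis .
qed

text \<open>The right support g of d has finite trace, so \<open>t2\<close> of e_n d e_n is at most
  K^2 tr(g e_n g), which tends to 0.\<close>

lemma single_core:
  assumes d: "d \<in> A" "ds (graph d) 0 < \<infinity>" and \<epsilon>: "0 < \<epsilon>"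
    and e: "\<And>n. e n \<in> A" "\<And>n. isproj (e n)" "\<And>n. e n * e (Suc n) = e (Suc n)" "\<And>x. (\<lambda>n. e n \<odot> x) \<longlonglongrightarrow> 0"
  shows "\<forall>\<^sub>F n in sequentially. nn (e n * d * e n) \<le> \<epsilon>"
proof -
  obtain K where K: "nbound d K" using nbound_exists by blast
  then have K0: "0 \<le> K" by (simp add: nbound_def)
  define T where "T = enn2real (ds (graph d) 0)"
  have T: "ds (graph d) 0 = ennreal T" "0 \<le> T" using d(2) by (simp_all add: T_def)
  define g where "g = 1 - sproj (graph d) 0"
  have g: "g \<in> A" "isproj g"
    unfolding g_def by (auto intro!: A_diff A_one sproj_A[OF adm_graph[OF d(1)]] isproj_compl cdd_op.sproj_isproj[OF cdd_graph])
  have dg: "d * g = d"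
  proof (rule bop_eqI)
    fix u
    have "sproj (graph d) 0 \<odot> sproj (graph d) 0 \<odot> u = sproj (graph d) 0 \<odot> u" by (simp add: cdd_op.sproj_isproj[OF cdd_graph])
    from ds_graph_sproj[OF order_refl this] have "d \<odot> sproj (graph d) 0 \<odot> u = 0" by simp
    then show "(d * g) \<odot> u = d \<odot> u" by (simp add: g_def)
  qed
  have "tr g < \<infinity>" using d(2) by (simp add: g_def ds_def)
  note lim = tr_compress_limit[OF e g this]
  obtain \<rho> where \<rho>: "0 < \<rho>" "\<And>d. d \<in> A \<Longrightarrow> nbound d K \<Longrightarrow> ds (graph d) 0 \<le> ennreal T \<Longrightarrow> t2 d \<le> ennreal \<rho> \<Longrightarrow> nn d \<le> \<epsilon>"
    using small_core[OF K0 T(2) \<epsilon>] by blast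
  have K1: "0 < K^2 + 1" using zero_le_power2[of K] by linarith
  have "0 < ennreal (\<rho> / (K^2 + 1))" unfolding ennreal_less_zero_iff by (rule divide_pos_pos[OF \<rho>(1) K1])
  from order_tendstoD(2)[OF lim this] show ?thesis
  proof (rule eventually_mono)
    fix n assume n: "tr (g * e n * g) < ennreal (\<rho> / (K^2 + 1))"
    have "t2 (e n * d * e n) = t2 (e n * d * (g * e n))" using dg by (metis mult.assoc)
    also have "\<dots> \<le> ennreal (K^2) * t2 (g * e n)"
      using nbound_mult[OF isproj_nbound[OF e(2)] K] by (intro t2_left A_mult g e d) simp
    also have "\<dots> \<le> ennreal (K^2) * ennreal (\<rho> / (K^2 + 1))"
      unfolding t2_proj_mult(2)[OF e(1,2) g] by (rule mult_left_mono[OF less_imp_le[OF n]]) simp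
    also have "\<dots> = ennreal (K^2 * (\<rho> / (K^2 + 1)))" by (rule ennreal_mult'[symmetric]) simp
    also have "\<dots> \<le> ennreal \<rho>"
    proof (rule ennreal_leI)
      have "K^2 * \<rho> \<le> \<rho> * (K^2 + 1)" using \<rho>(1) by (simp add: distrib_left mult.commute)
      then show "K^2 * (\<rho> / (K^2 + 1)) \<le> \<rho>" by (simp only: times_divide_eq_right pos_divide_le_eq[OF K1])
    qed
    finally have t: "t2 (e n * d * e n) \<le> ennreal \<rho>" .
    show "nn (e n * d * e n) \<le> \<epsilon>"
    proof (rule \<rho>(2)[OF _ _ _ t])
      show "e n * d * e n \<in> A" by (intro A_mult e d)
      show "nbound (e n * d * e n) K" using nbound_mult[OF nbound_mult[OF isproj_nbound[OF e(2)] K] isproj_nbound[OF e(2)]] by simp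
      show "ds (graph (e n * d * e n)) 0 \<le> ennreal T" using ds_conj_zero[OF d(1) e(1,2)] T(1) by simp
    qed
  qed
qed

end

section \<open>Levels, supports and monotone quantities attached to the sequence\<close>

locale bounded_sequence = nc_setting M \<tau> E N q
  for M :: "'h::chilbert_space op set" and \<tau> E N q +
  fixes x :: "nat \<Rightarrow> 'h op" and B :: real
  assumes xX: "x n \<in> X" and xB: "nx (x n) \<le> B"
begin

text \<open>Makes Kl(m) phi(2^-m) exceed |B|, so that Markov's inequality bounds the trace above
  this level by 2^-m for every member of the sequence. The leading 1 keeps the level above all
  \<open>Ll\<close>.\<close>

definition Kl :: "nat \<Rightarrow> real" where "Kl m = 1 + (\<bar>B\<bar> + 1) / phi ((1 / 2) ^ m)"

lemma Kl_ge: "1 \<le> Kl m"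
  using phi_nonneg[of "(1 / 2) ^ m"] by (simp add: Kl_def)

lemma Kl_mono: "m \<le> k \<Longrightarrow> Kl m \<le> Kl k"
  unfolding Kl_def
  by (intro add_left_mono divide_left_mono phi_mono power_decreasing mult_pos_pos phi_pos) auto

lemma ds_markov:
  assumes s: "0 \<le> s" and t: "0 \<le> t" and b: "\<bar>B\<bar> < s * phi t" shows "ds (x n) s \<le> ennreal t"
proof (rule ccontr)
  assume "\<not> ?thesis"
  then have "ennreal t \<le> dist_fun (sv (x n)) s" by (simp add: sv_dist[OF xX s])
  from phi_markov[OF sv_mem[OF xX] s t this] have "s * phi t \<le> nx (x n)" by (simp add: nc_norm_sv[OF X_tau[OF xX]])
  then show False using xB[of n] b by linarith
qed

lemma Kl_ds: "ds (x n) (Kl m) \<le> ennreal ((1 / 2) ^ m)"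
proof (rule ds_markov)
  have p: "0 < phi ((1 / 2) ^ m)" by (rule phi_pos) simp
  then have "Kl m * phi ((1 / 2) ^ m) = phi ((1 / 2) ^ m) + (\<bar>B\<bar> + 1)" by (simp add: Kl_def field_simps)
  then show "\<bar>B\<bar> < Kl m * phi ((1 / 2) ^ m)" using p by linarith
qed (use Kl_ge[of m] in auto)

text \<open>The fundamental function is unbounded, so Markov's inequality yields one T for all n.
  This makes the supports of the middle parts uniformly finite.\<close>

lemma tail_bound:
  assumes s: "0 < s" shows "\<exists>T\<ge>0. \<forall>n. ds (x n) s \<le> ennreal T"
proof -
  obtain T where T: "0 < T" "\<bar>B\<bar> / s < phi T" using phi_large by blast
  then have "\<bar>B\<bar> < s * phi T" using s by (simp add: pos_divide_less_eq mult.commute)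
  then show ?thesis using ds_markov[of s T] s T by (intro exI[of _ T]) auto
qed

definition ls :: "nat \<Rightarrow> real \<Rightarrow> 'h bop" where
  "ls n s = (SOME l. l \<in> A \<and> isproj l \<and> tr l \<le> ds (x n) s \<and>
    (\<forall>u v. (u, v) \<in> x n \<longrightarrow> sproj (x n) s \<odot> u = 0 \<longrightarrow> l \<odot> v = v))"

lemma ls:
  assumes s: "0 \<le> s"
  shows "ls n s \<in> A \<and> isproj (ls n s) \<and> tr (ls n s) \<le> ds (x n) s \<and>
    (\<forall>u v. (u, v) \<in> x n \<longrightarrow> sproj (x n) s \<odot> u = 0 \<longrightarrow> ls n s \<odot> v = v)"
  unfolding ls_def by (rule someI_ex) (use left_support_tail[OF X_adm[OF xX[of n]] s] in blast)

text \<open>Left and right supports together: z_k must be reproduced by p_k on both sides.\<close>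

definition qp :: "nat \<Rightarrow> real \<Rightarrow> 'h bop" where "qp n s = join {ls n s, 1 - sproj (x n) s}"

lemma
  assumes s: "0 \<le> s"
  shows qp_A: "qp n s \<in> A" and qp_proj: "isproj (qp n s)" and qp_tr: "tr (qp n s) \<le> 2 * ds (x n) s"
    and qp_right: "qp n s * (1 - sproj (x n) s) = 1 - sproj (x n) s"
    and qp_left: "(u, v) \<in> x n \<Longrightarrow> sproj (x n) s \<odot> u = 0 \<Longrightarrow> qp n s \<odot> v = v"
proof -
  note l = ls[OF s, of n]
  have sA: "1 - sproj (x n) s \<in> A" "isproj (1 - sproj (x n) s)"
    by (auto intro: A_diff A_one sproj_A[OF X_adm[OF xX]] isproj_compl cdd_op.sproj_isproj[OF X_cdd[OF xX]])
  show "qp n s \<in> A" unfolding qp_def by (rule join_A) (use l sA in auto)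
  show "isproj (qp n s)" by (simp add: qp_def)
  have "tr (qp n s) \<le> tr (ls n s) + tr (1 - sproj (x n) s)"
    unfolding qp_def by (rule tr_join_two) (use l sA in auto)
  also have "\<dots> \<le> ds (x n) s + ds (x n) s" unfolding ds_def[symmetric] using l by (intro add_right_mono) auto
  finally show "tr (qp n s) \<le> 2 * ds (x n) s" by (simp add: mult_2)
  show "qp n s * (1 - sproj (x n) s) = 1 - sproj (x n) s" unfolding qp_def by (rule join_upper) simp
  have "qp n s * ls n s = ls n s" unfolding qp_def by (rule join_upper) simp
  from arg_cong[OF this, of "\<lambda>a. a \<odot> v"] have "qp n s \<odot> ls n s \<odot> v = ls n s \<odot> v" by simp
  then show "qp n s \<odot> v = v" if "(u, v) \<in> x n" "sproj (x n) s \<odot> u = 0" using l that by auto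
qed

text \<open>Runs through all pairs (n, j) with level 1 / (j + 1). Positive levels keep the traces
  finite; the full supports are exhausted only in the join.\<close>

definition qi :: "nat \<Rightarrow> 'h bop"
  where "qi i = qp (fst (prod_decode i)) (1 / real (Suc (snd (prod_decode i))))"

definition gs :: "nat \<Rightarrow> 'h bop" where "gs m = join (qi ` {..<m})"

definition G :: "'h bop" where "G = join (range qi)"

lemma qi_A: "qi i \<in> A" and qi_proj: "isproj (qi i)" and qi_tr: "tr (qi i) < \<infinity>"
proof -
  have s: "0 < 1 / real (Suc (snd (prod_decode i)))" by simp
  show "qi i \<in> A" "isproj (qi i)" unfolding qi_def by (rule qp_A qp_proj; simp)+
  have "tr (qi i) \<le> 2 * ds (x (fst (prod_decode i))) (1 / real (Suc (snd (prod_decode i))))"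
    unfolding qi_def by (rule qp_tr) simp
  also have "\<dots> < \<infinity>" using ds_finite[OF xX s, of "fst (prod_decode i)"] by (simp add: ennreal_mult_less_top)
  finally show "tr (qi i) < \<infinity>" .
qed

lemma gs_A: "gs m \<in> A" and gs_proj [simp]: "isproj (gs m)" and G_A: "G \<in> A" and G_proj [simp]: "isproj G"
  unfolding gs_def G_def by (auto intro!: join_A qi_A)

lemma gs_tr: "tr (gs m) < \<infinity>"
proof -
  have "tr (gs m) \<le> (\<Sum>p\<in>qi ` {..<m}. tr p)" unfolding gs_def by (rule tr_join_finite) (use qi_A qi_proj in auto)
  also have "\<dots> < \<infinity>" using qi_tr by (auto simp: less_top[symmetric])
  finally show ?thesis .
qed

lemma gs_mono: "i \<le> k \<Longrightarrow> gs k * gs i = gs i"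
  unfolding gs_def by (rule join_mono) auto

lemma G_gs: "G * gs m = gs m" and gs_G: "gs m * G = gs m"
proof -
  show 1: "G * gs m = gs m" unfolding G_def gs_def by (rule join_mono) auto
  show "gs m * G = gs m" by (rule isproj_adj_le[OF G_proj gs_proj 1])
qed

lemma gs_mono': "i \<le> k \<Longrightarrow> gs i * gs k = gs i"
  by (rule isproj_adj_le[OF gs_proj gs_proj gs_mono])

lemma gs_limit: "(\<lambda>m. gs m \<odot> u) \<longlonglongrightarrow> G \<odot> u"
proof -
  have "G = join (range gs)" unfolding G_def gs_def by (rule join_of_partial_joins[symmetric])
  then show ?thesis using proj_increasing_limit[of gs] gs_mono by simp
qed

lemma Gm: "G - gs m \<in> A" "isproj (G - gs m)"
  by (auto intro: A_diff G_A gs_A isproj_diff G_gs)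

lemma G_qp: "G * qp n (1 / real (Suc j)) = qp n (1 / real (Suc j))"
proof -
  have "qi (prod_encode (n, j)) = qp n (1 / real (Suc j))" by (simp add: qi_def)
  then show ?thesis unfolding G_def by (intro join_upper) (metis rangeI)
qed

lemma zero_if_small:
  fixes z :: "'h" assumes "\<And>j. norm z \<le> 1 / real (Suc j) * c" shows "z = 0"
proof -
  have "(\<lambda>j. 1 / real (Suc j) * c) \<longlonglongrightarrow> 0 * c" by (intro tendsto_intros LIMSEQ_Suc lim_1_over_n)
  then have "norm z \<le> 0 * c" by (rule LIMSEQ_le_const) (use assms in auto)
  then show ?thesis by simp
qed

text \<open>Above level 1 / (j + 1) both supports lie under G, and what remains below that level has
  norm at most 1 / (j + 1). Letting j grow puts every truncation under G on both sides.\<close>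

lemma G_trunc:
  assumes L: "0 \<le> L" shows "G * tc (x n) L = tc (x n) L" "tc (x n) L * G = tc (x n) L"
proof -
  interpret cdd_op "x n" by (rule X_cdd[OF xX])
  let ?s = "\<lambda>j. 1 / real (Suc j)"
  have s0: "0 \<le> ?s j" for j by simp
  have d: "trunc L = trunc L * (1 - sproj (x n) s) + trunc (min s L)" if "0 \<le> s" for s
  proof (cases "s \<le> L")
    case True
    then show ?thesis using trunc_sproj[OF that True] by (simp add: algebra_simps)
  next
    case False
    then have "sproj (x n) L = sproj (x n) s * sproj (x n) L" using sproj_mono[of L s] by simp
    then have "trunc L * (1 - sproj (x n) s) = trunc L * sproj (x n) L * (1 - sproj (x n) s)" using trunc_sproj[OF L order_refl] by simp
    also have "\<dots> = 0" using sproj_mono'[of L s] False by (simp add: algebra_simps)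
    finally show ?thesis using False by simp
  qed
  have small: "norm (trunc (min s L) \<odot> u) \<le> s * norm u" if "0 \<le> s" for s u
  proof -
    have "norm (trunc (min s L) \<odot> u) \<le> min s L * norm u" by (rule nboundD[OF trunc_nbound]) (use L that in simp)
    also have "\<dots> \<le> s * norm u" by (intro mult_right_mono) auto
    finally show ?thesis .
  qed
  have "G \<odot> trunc L \<odot> u - trunc L \<odot> u = 0" for u
  proof (rule zero_if_small)
    fix j
    let ?v = "u - sproj (x n) (?s j) \<odot> u"
    have z: "sproj (x n) (?s j) \<odot> sproj (x n) L \<odot> ?v = 0"
    proof (cases "?s j \<le> L")
      case True
      then show ?thesis by (simp add: sproj_sproj)
    next
      case False
      then have "sproj (x n) L \<odot> ?v = 0" by (simp add: sproj_sproj)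
      then show ?thesis by simp
    qed
    have "qp n (?s j) \<odot> trunc L \<odot> ?v = trunc L \<odot> ?v" by (rule qp_left[OF s0 trunc_mem[OF L] z])
    with arg_cong[OF G_qp[of n j], of "\<lambda>a. a \<odot> trunc L \<odot> ?v"]
    have 1: "G \<odot> trunc L \<odot> ?v = trunc L \<odot> ?v" by (simp del: bapply_diff)
    have 2: "trunc L \<odot> u = trunc L \<odot> ?v + trunc (min (?s j) L) \<odot> u"
      using arg_cong[OF d[OF s0, of j], of "\<lambda>a. a \<odot> u"] by (simp only: bop_apply)
    have "G \<odot> trunc L \<odot> u - trunc L \<odot> u = - ((1 - G) \<odot> trunc (min (?s j) L) \<odot> u)"
      unfolding 2 bapply_add 1 by simp
    then have "norm (G \<odot> trunc L \<odot> u - trunc L \<odot> u) \<le> norm (trunc (min (?s j) L) \<odot> u)"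
      using isproj_norm[OF isproj_compl[OF G_proj]] by (simp only: norm_minus_cancel)
    then show "norm (G \<odot> trunc L \<odot> u - trunc L \<odot> u) \<le> ?s j * norm u" using small[OF s0, of j u] by linarith
  qed
  then show "G * trunc L = trunc L" by (intro bop_eqI) simp
  have "trunc L \<odot> (u - G \<odot> u) = 0" for u
  proof (rule zero_if_small)
    fix j
    have "(1 - sproj (x n) (?s j)) * G = 1 - sproj (x n) (?s j)"
    proof (rule isproj_adj_le[OF G_proj isproj_compl[OF sproj_isproj]])
      show "G * (1 - sproj (x n) (?s j)) = 1 - sproj (x n) (?s j)"
        using qp_right[OF s0, of n j] G_qp[of n j] by (metis mult.assoc)
    qed
    from arg_cong[OF this, of "\<lambda>a. a \<odot> u"] have "(1 - sproj (x n) (?s j)) \<odot> (u - G \<odot> u) = 0" by simp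
    then have "trunc L \<odot> (u - G \<odot> u) = trunc (min (?s j) L) \<odot> (u - G \<odot> u)"
      using arg_cong[OF d[OF s0, of j], of "\<lambda>a. a \<odot> (u - G \<odot> u)"] by (simp only: bop_apply bapply_zero add_0)
    then show "norm (trunc L \<odot> (u - G \<odot> u)) \<le> ?s j * norm (u - G \<odot> u)" by (simp only: small[OF s0])
  qed
  then show "trunc L * G = trunc L" by (intro bop_eqI) simp
qed

text \<open>Normalized by the fundamental function at tr(g_m), so that an operator of norm Ll(m)
  supported by g_m costs at most 2^-m, see \<open>Ll_phi\<close>.\<close>

definition Ll :: "nat \<Rightarrow> real" where "Ll m = (1 / 2) ^ m / (1 + phi (enn2real (tr (gs m))))"

lemma Ll_pos: "0 < Ll m"
  using phi_nonneg[of "enn2real (tr (gs m))"] by (simp add: Ll_def add_pos_nonneg)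

lemma gs_tr_mono: "i \<le> k \<Longrightarrow> tr (gs i) \<le> tr (gs k)"
  by (rule tr_proj_mono[OF gs_A gs_A gs_proj gs_proj gs_mono])

lemma Ll_mono: "m \<le> k \<Longrightarrow> Ll k \<le> Ll m"
proof -
  assume mk: "m \<le> k"
  have p: "0 \<le> phi (enn2real (tr (gs m)))" by (rule phi_nonneg) simp
  have "phi (enn2real (tr (gs m))) \<le> phi (enn2real (tr (gs k)))"
    by (intro phi_mono enn2real_mono gs_tr_mono mk gs_tr[unfolded infinity_ennreal_def]) simp
  then show ?thesis unfolding Ll_def using mk p by (intro frac_le power_decreasing) auto
qed

lemma Ll_Kl: "Ll m \<le> Kl k"
proof -
  have "(1 / 2 :: real) ^ m \<le> 1" by (rule power_le_one) auto
  moreover have "0 \<le> phi (enn2real (tr (gs m)))" by (rule phi_nonneg) simp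
  ultimately have "Ll m \<le> 1 / 1" unfolding Ll_def by (intro frac_le) auto
  then show ?thesis using Kl_ge[of k] by linarith
qed

lemma Ll_phi: "Ll m * phi (enn2real (tr (gs m))) \<le> (1 / 2) ^ m"
proof -
  have p: "0 \<le> phi (enn2real (tr (gs m)))" by (rule phi_nonneg) simp
  have "Ll m * phi (enn2real (tr (gs m))) \<le> Ll m * (1 + phi (enn2real (tr (gs m))))" using Ll_pos[of m] by (intro mult_left_mono) auto
  also have "\<dots> = (1 / 2) ^ m" using p by (simp add: Ll_def)
  finally show ?thesis .
qed

definition cmid :: "nat \<Rightarrow> nat \<Rightarrow> 'h bop" where "cmid j n = tc (x n) (Kl j) - tc (x n) (Ll j)"

definition Tl :: "nat \<Rightarrow> real" where "Tl j = (SOME T. 0 \<le> T \<and> (\<forall>n. ds (x n) (Ll j) \<le> ennreal T))"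

lemma Tl: "0 \<le> Tl j" "ds (x n) (Ll j) \<le> ennreal (Tl j)"
  using someI_ex[OF tail_bound[OF Ll_pos, of j]] unfolding Tl_def by auto

lemma cmid_A: "cmid j n \<in> A" and cmid_nbound: "nbound (cmid j n) (Kl j)" and cmid_EA: "cmid j n \<in> EA"
  and cmid_ds: "ds (graph (cmid j n)) 0 \<le> ennreal (Tl j)" and cmid_G: "G * cmid j n = cmid j n" "cmid j n * G = cmid j n"
proof -
  note L = less_imp_le[OF Ll_pos[of j]] Ll_Kl[of j j]
  show "cmid j n \<in> EA" unfolding cmid_def by (rule piece(1)[OF xX L])
  then show "cmid j n \<in> A" by (rule EA_D)
  show "nbound (cmid j n) (Kl j)" unfolding cmid_def by (rule trunc_nbound_diff(2)[OF xX L])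
  show "ds (graph (cmid j n)) 0 \<le> ennreal (Tl j)"
    unfolding cmid_def by (rule order_trans[OF ds_piece_zero[OF xX L] Tl(2)])
  have K: "0 \<le> Kl j" using Kl_ge[of j] by simp
  show "G * cmid j n = cmid j n" "cmid j n * G = cmid j n"
    unfolding cmid_def using G_trunc[OF K, of n] G_trunc[OF L(1), of n] by (simp_all add: algebra_simps)
qed

lemma cmid_t2: "t2 (cmid j n) \<le> ennreal ((Kl j)^2 * Tl j)"
proof -
  note L = less_imp_le[OF Ll_pos[of j]] Ll_Kl[of j j]
  have p: "1 - sproj (x n) (Ll j) \<in> A" "isproj (1 - sproj (x n) (Ll j))"
    by (auto intro: A_diff A_one sproj_A[OF X_adm[OF xX]] isproj_compl cdd_op.sproj_isproj[OF X_cdd[OF xX]])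
  have "cmid j n * (1 - sproj (x n) (Ll j)) = cmid j n"
    unfolding cmid_def trunc_nbound_diff(1)[OF xX L] mult.assoc isprojD(2)[OF p(2)] ..
  from t2_bound[OF cmid_A cmid_nbound p this] have "t2 (cmid j n) \<le> ennreal ((Kl j)^2) * ds (x n) (Ll j)" by (simp add: ds_def)
  also have "\<dots> \<le> ennreal ((Kl j)^2) * ennreal (Tl j)" by (rule mult_left_mono[OF Tl(2)]) simp
  finally show ?thesis by (simp add: ennreal_mult')
qed

text \<open>The part of the middle operator not yet seen by g_m, in the trace norm of order two. It
  decreases in m, and its drops are what \<open>core_t2\<close> needs as the second error.\<close>

definition psi :: "nat \<Rightarrow> nat \<Rightarrow> nat \<Rightarrow> ennreal"
  where "psi j n m = t2 ((G - gs m) * cmid j n * (G - gs m))"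

lemma psi_le: "psi j n m \<le> ennreal ((Kl j)^2 * Tl j)"
  unfolding psi_def by (rule order_trans[OF t2_conj[OF cmid_A Gm] cmid_t2])

lemma psi_finite: "psi j n m < \<infinity>"
  using psi_le[of j n m] by (simp add: le_less_trans)

lemma Gm_mono: "i \<le> k \<Longrightarrow> (G - gs i) * (G - gs k) = G - gs k" "i \<le> k \<Longrightarrow> (G - gs k) * (G - gs i) = G - gs k"
  by (simp_all add: algebra_simps isprojD(2)[OF G_proj] G_gs gs_G gs_mono gs_mono')

lemma psi_mono:
  assumes "i \<le> k" shows "psi j n k \<le> psi j n i"
proof -
  have "(G - gs k) * ((G - gs i) * cmid j n * (G - gs i)) * (G - gs k) = (G - gs k) * cmid j n * (G - gs k)"
    unfolding mult.assoc Gm_mono(1)[OF assms] unfolding mult.assoc[symmetric] Gm_mono(2)[OF assms] ..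
  then show ?thesis
    unfolding psi_def using t2_conj[OF A_mult[OF A_mult[OF Gm(1)[of i] cmid_A[of j n]] Gm(1)[of i]] Gm[of k]] by simp
qed

lemma N_cutf_mono:
  assumes "J \<in> sets borel" "I \<in> sets borel" "I \<subseteq> J" shows "N (cutf I (sv (x n))) \<le> N (cutf J (sv (x n)))"
  by (rule restrict_mem(2)[OF cutf_mem(1)[OF sv_mem[OF xX] assms(1)]
        cutf_measurable[OF measurable[OF sv_mem[OF xX]] assms(2)]]) (use assms in \<open>auto simp: cutf_def\<close>)

text \<open>Index \<open>0\<close> measures the part of \<open>x\<^sub>n\<close> above \<open>K\<^sub>m\<close>, index \<open>1\<close> the part below \<open>L\<^sub>m\<close>, and
  index \<open>j + 2\<close> the part between \<open>L\<^sub>j\<close> and \<open>K\<^sub>j\<close>, compressed to \<open>G - g\<^sub>m\<close>.\<close>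

definition Phi :: "nat \<Rightarrow> nat \<Rightarrow> nat \<Rightarrow> real" where
  "Phi i n m = (case i of 0 \<Rightarrow> N (cutf {Kl m<..} (sv (x n))) powr q
    | Suc 0 \<Rightarrow> N (cutf {0<..Ll m} (sv (x n))) powr q
    | Suc (Suc j) \<Rightarrow> enn2real (psi j n m))"

lemma Phi_decreasing: "m \<le> k \<Longrightarrow> Phi i n k \<le> Phi i n m"
proof -
  assume mk: "m \<le> k"
  have "N (cutf {Kl k<..} (sv (x n))) \<le> N (cutf {Kl m<..} (sv (x n)))"
    by (rule N_cutf_mono) (use Kl_mono[OF mk] in auto)
  moreover have "N (cutf {0<..Ll k} (sv (x n))) \<le> N (cutf {0<..Ll m} (sv (x n)))"
    by (rule N_cutf_mono) (use Ll_mono[OF mk] in auto)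
  moreover have "enn2real (psi j n k) \<le> enn2real (psi j n m)" for j
    using psi_mono[OF mk] psi_finite by (intro enn2real_mono) auto
  ultimately show ?thesis using q0
    by (auto simp: Phi_def split: nat.split intro!: powr_mono2 norm_nonneg cutf_mem(1)[OF sv_mem[OF xX]])
qed

lemma Phi_bounded: "0 \<le> Phi i n m \<and> Phi i n m \<le> (case i of Suc (Suc j) \<Rightarrow> (Kl j)^2 * Tl j | _ \<Rightarrow> \<bar>B\<bar> powr q)"
proof -
  have "N (cutf I (sv (x n))) powr q \<le> \<bar>B\<bar> powr q" if "I \<in> sets borel" for I
  proof (rule powr_mono2)
    show "0 \<le> N (cutf I (sv (x n)))" by (rule norm_nonneg[OF cutf_mem(1)[OF sv_mem[OF xX] that]])
    show "N (cutf I (sv (x n))) \<le> \<bar>B\<bar>"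
      using cutf_mem(2)[OF sv_mem[OF xX[of n]] that] xB[of n] by (simp add: nc_norm_sv[OF X_tau[OF xX]])
  qed (use q0 in simp)
  moreover have "enn2real (psi j n m) \<le> (Kl j)^2 * Tl j" for j
    using enn2real_mono[OF psi_le[of j n m]] Tl(1)[of j] by simp
  ultimately show ?thesis by (auto simp: Phi_def split: nat.split)
qed

lemma selection:
  "\<exists>r. strict_mono r \<and> (\<forall>i. \<forall>\<epsilon>>0. \<exists>m0. \<forall>m\<ge>m0. \<forall>k\<ge>m. Phi i (r k) m - Phi i (r k) k \<le> \<epsilon>)"
  by (rule diagonal_subsequence[of Phi, OF Phi_bounded Phi_decreasing])

end

lemma ennreal_diff_le:
  assumes "a < \<infinity>" "b < \<infinity>" "enn2real a - enn2real b \<le> \<delta>" shows "a - b \<le> ennreal \<delta>"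
proof -
  have "a - b = ennreal (enn2real a) - ennreal (enn2real b)" using assms(1,2) by (simp add: ennreal_enn2real)
  also have "\<dots> = ennreal (enn2real a - enn2real b)" by (simp add: ennreal_minus)
  also have "\<dots> \<le> ennreal \<delta>" by (rule ennreal_leI[OF assms(3)])
  finally show ?thesis .
qed

section \<open>The decomposition along the selected subsequence\<close>

locale selected_sequence = bounded_sequence M \<tau> E N q x B
  for M :: "'h::chilbert_space op set" and \<tau> E N q x B +
  fixes r :: "nat \<Rightarrow> nat"
  assumes sel: "0 < \<epsilon> \<Longrightarrow> \<exists>m0. \<forall>m\<ge>m0. \<forall>k\<ge>m. Phi i (r k) m - Phi i (r k) k \<le> \<epsilon>"
begin

text \<open>The level Kl(m) works for every member of the sequence, so it can be paired with the
  member r(m) after the subsequence has been chosen. Joining over all later indices makes these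
  projections decrease.\<close>

definition Vk :: "nat \<Rightarrow> 'h bop" where "Vk k = join (range (\<lambda>i. qp (r (k + i)) (Kl (k + i))))"
definition pk :: "nat \<Rightarrow> 'h bop" where "pk k = join {G - gs k, Vk k}"
definition wk :: "nat \<Rightarrow> 'h bop" where "wk k = tc (x (r k)) (Kl k)"
definition yk :: "nat \<Rightarrow> 'h bop" where "yk k = cc (pk k) (wk k)"
definition zk :: "nat \<Rightarrow> 'h op" where "zk k = pert (x (r k)) (yk k)"

lemma Kl0: "0 \<le> Kl m" and Kl_pos: "0 < Kl m"
  using Kl_ge[of m] by simp_all

lemma Vk_A: "Vk k \<in> A" and Vk_proj [simp]: "isproj (Vk k)"
  unfolding Vk_def by (auto intro!: join_A qp_A Kl0)

lemma pk_A: "pk k \<in> A" and pk_proj [simp]: "isproj (pk k)"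
  unfolding pk_def by (auto intro!: join_A Vk_A Gm)

lemma Vk_tr: "tr (Vk k) \<le> ennreal (4 * (1 / 2) ^ k)"
proof -
  have t: "tr (qp (r m) (Kl m)) \<le> ennreal (2 * (1 / 2) ^ m)" for m
  proof -
    have "tr (qp (r m) (Kl m)) \<le> 2 * ds (x (r m)) (Kl m)" by (rule qp_tr[OF Kl0])
    also have "\<dots> \<le> 2 * ennreal ((1 / 2) ^ m)" by (rule mult_left_mono[OF Kl_ds]) simp
    finally show ?thesis by (simp add: ennreal_mult')
  qed
  have "(\<lambda>i. (1 / 2 :: real) ^ i) sums (1 / (1 - 1 / 2))" by (rule geometric_sums) simp
  \<comment> \<open>One factor 2 comes from the two supports in \<open>qp_tr\<close>, the other from
    the geometric series.\<close>
  from sums_mult[OF this, of "2 * (1 / 2) ^ k"] have s: "(\<lambda>i. 2 * (1 / 2 :: real) ^ (k + i)) sums (4 * (1 / 2) ^ k)"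
    by (simp add: power_add mult.assoc)
  have "tr (Vk k) \<le> (\<Sum>i. tr (qp (r (k + i)) (Kl (k + i))))"
    unfolding Vk_def by (rule tr_join_countable) (auto intro: qp_A qp_proj Kl0)
  also have "\<dots> \<le> (\<Sum>i. ennreal (2 * (1 / 2) ^ (k + i)))" by (intro suminf_le t) auto
  also have "\<dots> = ennreal (4 * (1 / 2) ^ k)" by (rule suminf_ennreal_eq[OF _ s]) simp
  finally show ?thesis .
qed

lemma pk_G: "pk k * (G - gs k) = G - gs k" and G_pk: "(G - gs k) * pk k = G - gs k"
  and pk_Vk: "pk k * Vk k = Vk k"
proof -
  show 1: "pk k * (G - gs k) = G - gs k" "pk k * Vk k = Vk k" unfolding pk_def by (auto intro: join_upper)
  show "(G - gs k) * pk k = G - gs k" by (rule isproj_adj_le[OF pk_proj Gm(2) 1(1)])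
qed

lemma pk_qp: "pk k * qp (r k) (Kl k) = qp (r k) (Kl k)"
proof -
  have "Vk k * qp (r k) (Kl k) = qp (r k) (Kl k)"
    unfolding Vk_def by (rule join_upper) (auto intro: image_eqI[of _ _ 0])
  then show ?thesis using pk_Vk[of k] by (metis mult.assoc)
qed

lemma pk_diff: "isproj (pk k - (G - gs k))" "tr (pk k - (G - gs k)) \<le> ennreal (4 * (1 / 2) ^ k)"
  using join_two_diff[OF Gm[of k] Vk_A[of k] Vk_proj] Vk_tr[of k] unfolding pk_def by auto

lemma pk_mono: "pk k * pk (Suc k) = pk (Suc k)"
  unfolding pk_def[of "Suc k"]
proof (rule join_least[OF pk_proj])
  fix p assume "p \<in> {G - gs (Suc k), Vk (Suc k)}"
  moreover have "pk k * (G - gs (Suc k)) = G - gs (Suc k)"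
    using pk_G[of k] Gm_mono(1)[OF le_SucI[OF order_refl], of k] by (metis mult.assoc)
  moreover have "pk k * Vk (Suc k) = Vk (Suc k)"
  proof -
    have "Vk k * Vk (Suc k) = Vk (Suc k)"
      unfolding Vk_def by (rule join_mono) (auto intro!: image_eqI[of _ _ "Suc _"])
    then show ?thesis using pk_Vk[of k] by (metis mult.assoc)
  qed
  ultimately show "pk k * p = p" by auto
qed

lemma small_trace_zero:
  assumes e: "e \<in> A" "isproj e" and le: "\<And>k. i \<le> k \<Longrightarrow> tr e \<le> ennreal (4 * (1 / 2) ^ k)" shows "e = 0"
proof -
  have "(\<lambda>k. 4 * (1 / 2 :: real) ^ k) \<longlonglongrightarrow> 4 * 0" by (intro tendsto_intros) simp
  then have "(\<lambda>k. ennreal (4 * (1 / 2) ^ k)) \<longlonglongrightarrow> ennreal (4 * 0)" by (rule tendsto_ennrealI)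
  then have "tr e \<le> ennreal (4 * 0)" by (rule LIMSEQ_le_const) (use le in blast)
  then have "tr e = 0" by simp
  then show ?thesis using tr_faithful[OF e(1) isproj_pos[OF e(2)]] by simp
qed

text \<open>A projection below every \<open>p\<^sub>k\<close> has a compression to \<open>g\<^sub>i\<close> whose support embeds into
  \<open>p\<^sub>k - (G - g\<^sub>k)\<close>, a projection of small trace; so it is orthogonal to \<open>G\<close>, and then it embeds
  itself.\<close>

lemma pk_zero: "proj_decreasing_to_zero M (\<lambda>k. graph (pk k))"
  unfolding proj_decreasing_to_zero_def
proof (intro conjI allI ballI impI)
  show "graph (pk n) \<in> projections M" for n by (simp add: projections_graph pk_A)
  show "op_le (graph (pk (Suc n))) (graph (pk n))" for n by (simp add: isproj_le_iff pk_mono)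
  fix R assume R: "R \<in> projections M" and le: "\<forall>n. op_le R (graph (pk n))"
  obtain b where b: "R = graph b" "b \<in> A" "isproj b" using projections_obtain[OF R] .
  have pb: "pk k * b = b" for k using le by (simp add: b isproj_le_iff)
  have pbx: "pk k \<odot> u = u" if "b \<odot> u = u" for k u using arg_cong[OF pb[of k], of "\<lambda>a. a \<odot> u"] that by simp
  have DA: "pk k - (G - gs k) \<in> A" for k by (intro A_diff pk_A Gm)
  note D = pk_diff(1)
  have gb: "gs i * b = 0" for i
  proof -
    define e where "e = lsupp (b * gs i)"
    have eA: "e \<in> A" "isproj e" unfolding e_def by (auto intro!: lsupp_A A_mult b gs_A)
    have be: "b * e = e"
      unfolding e_def by (rule lsupp_least[OF b(3)]) (simp add: mult.assoc[symmetric] isprojD(2)[OF b(3)])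
    have "tr e \<le> ennreal (4 * (1 / 2) ^ k)" if k: "i \<le> k" for k
    proof (rule order_trans[OF tr_le_of_injective[OF DA eA DA D isprojD(2)[OF D]] pk_diff(2)])
      fix u assume u: "e \<odot> u = u" and z: "(pk k - (G - gs k)) \<odot> u = 0"
      have bx: "b \<odot> u = u" using arg_cong[OF be, of "\<lambda>a. a \<odot> u"] u by simp
      have "(G - gs k) \<odot> u = u" using z pbx[OF bx, of k] by simp
      moreover have "gs i * (G - gs k) = 0" by (simp add: algebra_simps gs_G gs_mono'[OF k])
      from arg_cong[OF this, of "\<lambda>a. a \<odot> u"] have "gs i \<odot> (G - gs k) \<odot> u = 0" by (simp only: bop_apply)
      ultimately have "gs i \<odot> u = 0" by simp
      then have "adj (b * gs i) \<odot> u = 0" using bx by (simp add: isprojD(1)[OF b(3)] isprojD(1)[OF gs_proj])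
      then show "u = 0" using lsupp_adj_inj[of "b * gs i" u] u by (simp only: e_def)
    qed
    then have "e = 0" by (rule small_trace_zero[OF eA])
    then have "b * gs i = 0" using lsupp_mult[of "b * gs i"] by (simp add: e_def)
    from arg_cong[OF this, of adj] show ?thesis by (simp add: isprojD(1)[OF b(3)] isprojD(1)[OF gs_proj])
  qed
  have Gb: "G \<odot> b \<odot> u = 0" for u
  proof (rule LIMSEQ_unique[OF gs_limit])
    have "gs m \<odot> b \<odot> u = 0" for m using arg_cong[OF gb[of m], of "\<lambda>a. a \<odot> u"] by simp
    then show "(\<lambda>m. gs m \<odot> b \<odot> u) \<longlonglongrightarrow> 0" by simp
  qed
  have "tr b \<le> ennreal (4 * (1 / 2) ^ k)" if "0 \<le> k" for k
  proof (rule order_trans[OF tr_le_of_injective[OF DA b(2,3) DA D isprojD(2)[OF D]] pk_diff(2)])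
    fix u assume u: "b \<odot> u = u" and z: "(pk k - (G - gs k)) \<odot> u = 0"
    have "gs k \<odot> u = 0" using arg_cong[OF gb[of k], of "\<lambda>a. a \<odot> u"] u by simp
    then show "u = 0" using z pbx[OF u, of k] Gb[of u] u by simp
  qed
  then have "b = 0" by (rule small_trace_zero[OF b(2,3), of 0])
  then show "R = op_zero" by (simp add: b(1) op_zero_graph)
qed

lemma cutf_le: "I \<in> sets borel \<Longrightarrow> N (cutf I (sv (x n))) \<le> B"
  using cutf_mem(2)[OF sv_mem[OF xX[of n]], of I] xB[of n] by (simp add: nc_norm_sv[OF X_tau[OF xX]])

lemma wk_EA: "wk k \<in> EA" "nn (wk k) \<le> B"
  using piece[OF xX order_refl Kl0[of k], of "r k"] cutf_le[of "{0<..Kl k}" "r k"] by (simp_all add: wk_def trunc_zero[OF xX])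

lemma yk_EA: "yk k \<in> EA" and yk_bound: "nn (yk k) \<le> 2 * C1 * B"
proof -
  note c = EA_cc[OF wk_EA(1)[of k] pk_A[of k] pk_proj]
  show "yk k \<in> EA" unfolding yk_def by (rule c(1))
  have "2 * C1 * nn (wk k) \<le> 2 * C1 * B" using wk_EA(2)[of k] C1_ge by (intro mult_left_mono) auto
  then show "nn (yk k) \<le> 2 * C1 * B" using c(2) by (simp add: yk_def)
qed

lemma zk_X: "zk k \<in> X" and zk_bound: "nx (zk k) \<le> C1 * (B + 2 * C1 * B)"
proof -
  note p = pert_X[OF xX[of "r k"] yk_EA[of k]]
  show "zk k \<in> X" unfolding zk_def by (rule p(1))
  have "C1 * (nx (x (r k)) + nn (yk k)) \<le> C1 * (B + 2 * C1 * B)"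
    by (intro mult_left_mono add_mono xB yk_bound) (use C1_ge in simp)
  then show "nx (zk k) \<le> C1 * (B + 2 * C1 * B)" using p(2) by (simp add: zk_def)
qed

lemma x_closed: "closed_densely_defined (x n)"
  using X_adm[OF xX] by (simp add: adm_def)

lemma split_sum: "x (r k) = strong_plus (graph (yk k)) (zk k)"
  unfolding zk_def using strong_plus_pert[of "x (r k)" "yk k"] x_closed[of "r k"] by (simp add: closed_densely_defined_def)

lemma compress_yk: "compress (graph (pk k)) (graph (yk k)) = op_zero"
proof -
  have "pk k * yk k * pk k = pk k * wk k * pk k - (pk k * pk k) * wk k * (pk k * pk k)"
    by (simp add: yk_def cc_def algebra_simps)
  then show ?thesis unfolding compress_graph isprojD(2)[OF pk_proj] by (simp add: op_zero_graph)
qed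

text \<open>z_k is the part of x above Kl(k) plus p_k w_k p_k. The first term has its range under
  \<open>qp\<close> and vanishes where the cut at Kl(k) is the identity, and \<open>qp\<close> lies
  under p_k; the second is a corner already.\<close>

lemma compress_zk: "compress (graph (pk k)) (zk k) = zk k"
  unfolding zk_def
proof (rule compress_pert[OF x_closed pk_proj])
  interpret cdd_op "x (r k)" by (rule X_cdd[OF xX])
  let ?F = "sproj (x (r k)) (Kl k)"
  show "pk k \<odot> w = w" if m: "(u, w) \<in> pert (x (r k)) (yk k)" for u w
  proof -
    let ?v = "w + yk k \<odot> u"
    have "(u, ?v) \<in> x (r k)" using m by (simp add: pert_def)
    from linear_op_diff[OF linear_x this trunc_mem[OF Kl0]] have "(u - ?F \<odot> u, ?v - wk k \<odot> u) \<in> x (r k)"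
      by (simp add: wk_def)
    from qp_left[OF Kl0 this] have "qp (r k) (Kl k) \<odot> (?v - wk k \<odot> u) = ?v - wk k \<odot> u" by simp
    moreover have "pk k \<odot> qp (r k) (Kl k) \<odot> (?v - wk k \<odot> u) = qp (r k) (Kl k) \<odot> (?v - wk k \<odot> u)"
      using arg_cong[OF pk_qp[of k], of "\<lambda>a. a \<odot> (?v - wk k \<odot> u)"] by (simp only: bop_apply)
    ultimately have 1: "pk k \<odot> (?v - wk k \<odot> u) = ?v - wk k \<odot> u" by (simp only:)
    have w: "w = (?v - wk k \<odot> u) + pk k \<odot> wk k \<odot> pk k \<odot> u" by (simp add: yk_def cc_def)
    have "pk k \<odot> w = pk k \<odot> (?v - wk k \<odot> u) + pk k \<odot> pk k \<odot> wk k \<odot> pk k \<odot> u"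
      by (subst w) (simp only: bapply_add)
    then show ?thesis unfolding 1 using w by (simp del: bapply_add bapply_diff)
  qed
  show "(u, 0) \<in> pert (x (r k)) (yk k)" if z: "pk k \<odot> u = 0" for u
  proof -
    have "pk k * (1 - ?F) = 1 - ?F" using qp_right[OF Kl0, of "r k" k] pk_qp[of k] by (metis mult.assoc)
    then have "(1 - ?F) * pk k = 1 - ?F" by (rule isproj_adj_le[OF pk_proj isproj_compl[OF sproj_isproj]])
    from arg_cong[OF this, of "\<lambda>a. a \<odot> u"] have "?F \<odot> u = u" using z by simp
    then have "(u, wk k \<odot> u) \<in> x (r k)" using trunc_mem[OF Kl0, of k u] by (simp add: wk_def)
    then show ?thesis using z by (simp add: pert_def yk_def cc_def)
  qed
qed

lemma powr_le_cancel: "a powr q \<le> b powr q \<Longrightarrow> 0 < b \<Longrightarrow> a \<le> b"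
  using powr_less_mono2[OF q0, of b a] by force

text \<open>By the lower estimate for two disjoint pieces, the q-th power of the norm of the slice
  over (K_m, K_k] is at most the drop of the q-th power of the norm of the tail, which the selection
  makes small uniformly in k.\<close>

lemma high_small:
  assumes e: "0 < \<epsilon>"
  shows "\<exists>m0. \<forall>m\<ge>m0. \<forall>k\<ge>m. N (cutf {Kl m<..Kl k} (sv (x (r k)))) \<le> \<epsilon>"
proof -
  obtain m0 where m0: "\<And>m k. m0 \<le> m \<Longrightarrow> m \<le> k \<Longrightarrow> Phi 0 (r k) m - Phi 0 (r k) k \<le> \<epsilon> powr q"
    using sel[of "\<epsilon> powr q" 0] e by auto
  have "N (cutf {Kl m<..Kl k} (sv (x (r k)))) \<le> \<epsilon>" if mk: "m0 \<le> m" "m \<le> k" for m k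
  proof -
    have "{Kl m<..Kl k} \<union> {Kl k<..} = {Kl m<..}" using Kl_mono[OF mk(2)] by auto
    moreover have "{Kl m<..Kl k} \<inter> {Kl k<..} = {}" by auto
    ultimately have "N (cutf {Kl m<..Kl k} (sv (x (r k)))) powr q \<le> \<epsilon> powr q"
      using lower_cutf[OF sv_mem[OF xX[of "r k"]], of "{Kl m<..Kl k}" "{Kl k<..}"] m0[OF mk] by (simp add: Phi_def)
    then show ?thesis using e by (rule powr_le_cancel)
  qed
  then show ?thesis by blast
qed

lemma low_small:
  assumes e: "0 < \<epsilon>"
  shows "\<exists>m0. \<forall>m\<ge>m0. \<forall>k\<ge>m. N (cutf {Ll k<..Ll m} (sv (x (r k)))) \<le> \<epsilon>"
proof -
  obtain m0 where m0: "\<And>m k. m0 \<le> m \<Longrightarrow> m \<le> k \<Longrightarrow> Phi (Suc 0) (r k) m - Phi (Suc 0) (r k) k \<le> \<epsilon> powr q"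
    using sel[of "\<epsilon> powr q" "Suc 0"] e by auto
  have "N (cutf {Ll k<..Ll m} (sv (x (r k)))) \<le> \<epsilon>" if mk: "m0 \<le> m" "m \<le> k" for m k
  proof -
    have "{Ll k<..Ll m} \<union> {0<..Ll k} = {0<..Ll m}" using Ll_mono[OF mk(2)] Ll_pos[of k] by auto
    moreover have "{Ll k<..Ll m} \<inter> {0<..Ll k} = {}" by auto
    ultimately have "N (cutf {Ll k<..Ll m} (sv (x (r k)))) powr q \<le> \<epsilon> powr q"
      using lower_cutf[OF sv_mem[OF xX[of "r k"]], of "{Ll k<..Ll m}" "{0<..Ll k}"] m0[OF mk] by (simp add: Phi_def)
    then show ?thesis using e by (rule powr_le_cancel)
  qed
  then show ?thesis by blast
qed

lemma psi_small:
  assumes e: "0 < \<epsilon>"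
  shows "\<exists>m0. \<forall>m\<ge>m0. \<forall>k\<ge>m. psi j (r k) m - psi j (r k) k \<le> ennreal \<epsilon>"
proof -
  obtain m0 where "\<forall>m\<ge>m0. \<forall>k\<ge>m. enn2real (psi j (r k) m) - enn2real (psi j (r k) k) \<le> \<epsilon>"
    using sel[OF e, of "Suc (Suc j)"] by (auto simp: Phi_def)
  then show ?thesis by (intro exI[of _ m0]) (simp add: ennreal_diff_le psi_finite[unfolded infinity_ennreal_def])
qed

text \<open>1 - p_k annihilates G - g_k, and the truncation lies under G, so next to 1 - p_k it may
  be replaced by its part in g_k. The choice of \<open>Ll\<close> then gives 2^-k.\<close>

lemma rest_small:
  shows "cc (pk k) (tc (x (r k)) (Ll k)) \<in> EA" "nn (cc (pk k) (tc (x (r k)) (Ll k))) \<le> 2 * C1 * (1 / 2) ^ k"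
proof -
  interpret cdd_op "x (r k)" by (rule X_cdd[OF xX])
  let ?v = "trunc (Ll k)"
  have L: "0 \<le> Ll k" using Ll_pos[of k] by simp
  have Gv: "G * ?v = ?v" "?v * G = ?v" by (rule G_trunc[OF L])+
  have t: "tr (gs k) = ennreal (enn2real (tr (gs k)))" using gs_tr by (simp add: ennreal_enn2real)
  have "(1 - pk k) * (G - gs k) = 0" "(G - gs k) * (1 - pk k) = 0" by (simp_all add: algebra_simps pk_G G_pk del: G_gs)
      (use pk_G[of k] G_pk[of k] in \<open>simp_all add: algebra_simps\<close>)
  then have "(1 - pk k) * (G - gs k) * ?v = 0" "?v * ((G - gs k) * (1 - pk k)) = 0" by simp_all
  moreover have "(1 - pk k) * (G - gs k) * ?v = (1 - pk k) * ?v - (1 - pk k) * (gs k * ?v)"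
  proof -
    have "(G - gs k) * ?v = ?v - gs k * ?v" by (simp add: left_diff_distrib Gv)
    then show ?thesis by (simp only: mult.assoc right_diff_distrib[of "1 - pk k" ?v])
  qed
  moreover have "?v * ((G - gs k) * (1 - pk k)) = ?v * (1 - pk k) - ?v * gs k * (1 - pk k)"
  proof -
    have "?v * (G - gs k) = ?v - ?v * gs k" by (simp add: right_diff_distrib Gv)
    then show ?thesis by (simp only: mult.assoc[symmetric] left_diff_distrib[of ?v])
  qed
  ultimately have pv: "(1 - pk k) * ?v = (1 - pk k) * (gs k * ?v)" "?v * (1 - pk k) = ?v * gs k * (1 - pk k)" by simp_all
  note l = low_part[OF trunc_A[OF X_adm[OF xX] L] trunc_nbound[OF L] gs_A gs_proj t enn2real_nonneg pk_A pk_proj pv]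
  show "cc (pk k) ?v \<in> EA" by (rule l(1))
  have "2 * C1 * (Ll k * phi (enn2real (tr (gs k)))) \<le> 2 * C1 * (1 / 2) ^ k"
    by (rule mult_left_mono[OF Ll_phi]) (use C1_ge in simp)
  then show "nn (cc (pk k) ?v) \<le> 2 * C1 * (1 / 2) ^ k" using l(2) by linarith
qed

section \<open>Uniform smallness along a decreasing sequence of projections\<close>

context
  fixes e :: "nat \<Rightarrow> 'h bop"
  assumes e: "\<And>n. e n \<in> A" "\<And>n. isproj (e n)" "\<And>n. e n * e (Suc n) = e (Suc n)" "\<And>x. (\<lambda>n. e n \<odot> x) \<longlonglongrightarrow> 0"
begin

text \<open>The index i is fixed before n grows: it makes the last two errors of
  \<open>core_t2\<close> small for all k \<ge> i, and afterwards the finite trace of g_i makes the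
  first one small. Norm and support bounds are doubled because \<open>cc\<close> subtracts a
  corner.\<close>

lemma core_small:
  assumes \<epsilon>: "0 < \<epsilon>"
  shows "\<exists>k0. \<forall>\<^sub>F n in sequentially. \<forall>k\<ge>k0. nn (e n * cc (pk k) (cmid m (r k)) * e n) \<le> \<epsilon>"
proof -
  let ?K = "Kl m" and ?T = "Tl m"
  have "0 \<le> 2 * ?K" "0 \<le> 2 * ?T" using Kl0 Tl(1) by simp_all
  from small_core[OF this \<epsilon>] obtain \<rho> where \<rho>: "0 < \<rho>"
    "\<And>d. d \<in> A \<Longrightarrow> nbound d (2 * ?K) \<Longrightarrow> ds (graph d) 0 \<le> ennreal (2 * ?T) \<Longrightarrow> t2 d \<le> ennreal \<rho> \<Longrightarrow> nn d \<le> \<epsilon>"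
    by blast
  have K2: "0 < ?K^2" using Kl_pos[of m] by simp
  \<comment> \<open>The constants here and in the next two choices give each of the three errors of
    \<open>core_t2\<close> one third of \<rho>.\<close>
  obtain i0 where i0: "\<And>i k. i0 \<le> i \<Longrightarrow> i \<le> k \<Longrightarrow> psi m (r k) i - psi m (r k) k \<le> ennreal (\<rho> / 24)"
    using psi_small[of "\<rho> / 24" m] \<rho>(1) by auto
  obtain i1 where i1: "(1 / 2 :: real) ^ i1 < \<rho> / (96 * ?K^2)"
    using real_arch_pow_inv[of "\<rho> / (96 * ?K^2)" "1 / 2"] \<rho>(1) K2 by auto
  define i where "i = max i0 i1"
  have d1: "0 < \<rho> / (48 * ?K^2)" using \<rho>(1) K2 by simp
  have "0 < ennreal (\<rho> / (48 * ?K^2))" unfolding ennreal_less_zero_iff by (rule d1)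
  from order_tendstoD(2)[OF tr_compress_limit[OF e gs_A gs_proj gs_tr] this, of i]
  have "\<forall>\<^sub>F n in sequentially. \<forall>k\<ge>i. nn (e n * cc (pk k) (cmid m (r k)) * e n) \<le> \<epsilon>"
  proof (rule eventually_mono)
    fix n assume n: "tr (gs i * e n * gs i) < ennreal (\<rho> / (48 * ?K^2))"
    show "\<forall>k\<ge>i. nn (e n * cc (pk k) (cmid m (r k)) * e n) \<le> \<epsilon>"
    proof (intro allI impI)
      fix k assume k: "i \<le> k"
      let ?c = "cmid m (r k)"
      have ccA: "cc (pk k) ?c \<in> A" unfolding cc_def by (intro A_diff A_mult cmid_A pk_A)
      have "t2 (e n * cc (pk k) ?c * e n) \<le> ennreal (16 * ?K^2 * (\<rho> / (48 * ?K^2)) + 8 * (\<rho> / 24) + 8 * ?K^2 * (4 * (1 / 2) ^ k))"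
      proof (rule core_t2[OF cmid_A cmid_nbound gs_A gs_proj Gm[of i] Gm[of k] Gm_mono(1)[OF k] pk_A pk_proj pk_G e(1,2)])
        show "(G - gs i) * ?c = ?c - gs i * ?c" by (simp add: left_diff_distrib cmid_G)
        show "?c * (G - gs i) = ?c - ?c * gs i" by (simp add: right_diff_distrib cmid_G)
        show "t2 ((G - gs i) * ?c * (G - gs i)) < \<infinity>" using psi_finite[of m "r k" i] by (simp add: psi_def)
        show "tr (gs i * e n * gs i) \<le> ennreal (\<rho> / (48 * ?K^2))" by (rule less_imp_le[OF n])
        show "t2 ((G - gs i) * ?c * (G - gs i)) - t2 ((G - gs k) * ?c * (G - gs k)) \<le> ennreal (\<rho> / 24)"
          using i0[of i k] k by (simp add: psi_def i_def)
        show "tr (pk k - (G - gs k)) \<le> ennreal (4 * (1 / 2) ^ k)" by (rule pk_diff(2))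
      qed (use \<rho>(1) d1 in auto)
      also have "\<dots> \<le> ennreal \<rho>"
      proof (rule ennreal_leI)
        have "(1 / 2 :: real) ^ k \<le> (1 / 2) ^ i1" by (rule power_decreasing) (use k in \<open>auto simp: i_def\<close>)
        then have "(1 / 2 :: real) ^ k \<le> \<rho> / (96 * ?K^2)" using i1 by linarith
        from mult_left_mono[OF this, of "32 * ?K^2"] have "8 * ?K^2 * (4 * (1 / 2) ^ k) \<le> 32 * ?K^2 * (\<rho> / (96 * ?K^2))" by simp
        also have "\<dots> = \<rho> / 3" using K2 by simp
        finally have "8 * ?K^2 * (4 * (1 / 2) ^ k) \<le> \<rho> / 3" .
        moreover have "16 * ?K^2 * (\<rho> / (48 * ?K^2)) = \<rho> / 3" using K2 by simp
        ultimately show "16 * ?K^2 * (\<rho> / (48 * ?K^2)) + 8 * (\<rho> / 24) + 8 * ?K^2 * (4 * (1 / 2) ^ k) \<le> \<rho>" by linarith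
      qed
      finally have t: "t2 (e n * cc (pk k) ?c * e n) \<le> ennreal \<rho>" .
      show "nn (e n * cc (pk k) ?c * e n) \<le> \<epsilon>"
      proof (rule \<rho>(2)[OF _ _ _ t])
        show "e n * cc (pk k) ?c * e n \<in> A" by (intro A_mult e ccA)
        have p: "nbound (pk k) 1" "nbound (e n) 1" by (auto intro: isproj_nbound e)
        have "nbound (cc (pk k) ?c) (?K + ?K)"
          unfolding cc_def
          using nbound_minus[OF cmid_nbound[of m "r k"] nbound_mult[OF nbound_mult[OF p(1) cmid_nbound[of m "r k"]] p(1)]] by simp
        then show "nbound (e n * cc (pk k) ?c * e n) (2 * ?K)" using nbound_mult[OF nbound_mult[OF p(2)] p(2)] by force
        have "ds (graph (e n * cc (pk k) ?c * e n)) 0 \<le> 2 * ds (graph ?c) 0"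
          using ds_conj_zero[OF ccA e(1,2)] ds_cc[OF cmid_A pk_A pk_proj] by (rule order_trans)
        also have "\<dots> \<le> 2 * ennreal ?T" by (rule mult_left_mono[OF cmid_ds]) simp
        finally show "ds (graph (e n * cc (pk k) ?c * e n)) 0 \<le> ennreal (2 * ?T)" by (simp add: ennreal_mult')
      qed
    qed
  qed
  then show ?thesis by blast
qed

lemma tail_equi:
  assumes \<epsilon>: "0 < \<epsilon>"
  shows "\<exists>k0. \<forall>\<^sub>F n in sequentially. \<forall>k\<ge>k0. nn (e n * yk k * e n) \<le> \<epsilon>"
proof -
  \<comment> \<open>Each of the four parts costs at most 2 C1 d, and three nested quasi-triangle
    inequalities raise the total to at most 8 C1^4 d.\<close>
  define d where "d = \<epsilon> / (8 * C1 ^ 4)"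
  have C0: "0 < C1" using C1_ge by simp
  have d: "0 < d" using \<epsilon> C0 by (simp add: d_def)
  obtain m0 where m0: "\<And>m k. m0 \<le> m \<Longrightarrow> m \<le> k \<Longrightarrow> N (cutf {Kl m<..Kl k} (sv (x (r k)))) \<le> d" using high_small[OF d] by blast
  obtain m1 where m1: "\<And>m k. m1 \<le> m \<Longrightarrow> m \<le> k \<Longrightarrow> N (cutf {Ll k<..Ll m} (sv (x (r k)))) \<le> d" using low_small[OF d] by blast
  obtain m2 where m2: "(1 / 2 :: real) ^ m2 < d" using real_arch_pow_inv[OF d, of "1 / 2"] by auto
  define m where "m = max m0 (max m1 m2)"
  obtain k0 where k0: "\<forall>\<^sub>F n in sequentially. \<forall>k\<ge>k0. nn (e n * cc (pk k) (cmid m (r k)) * e n) \<le> d" using core_small[OF d] by blast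
  have "\<forall>\<^sub>F n in sequentially. \<forall>k\<ge>max m k0. nn (e n * yk k * e n) \<le> \<epsilon>"
    using k0
  proof (rule eventually_mono, intro allI impI)
    fix n k assume n: "\<forall>k\<ge>k0. nn (e n * cc (pk k) (cmid m (r k)) * e n) \<le> d" and k: "max m k0 \<le> k"
    let ?x = "x (r k)" and ?c = "cmid m (r k)"
    let ?h = "tc ?x (Kl k) - tc ?x (Kl m)" and ?l = "tc ?x (Ll m) - tc ?x (Ll k)" and ?v = "tc ?x (Ll k)"
    have mk: "m \<le> k" and mm: "m0 \<le> m" "m1 \<le> m" using k by (simp_all add: m_def)
    have h: "?h \<in> EA" "nn ?h \<le> d"
      using piece[OF xX Kl0 Kl_mono[OF mk], of "r k"] m0[OF mm(1) mk] by auto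
    have l: "?l \<in> EA" "nn ?l \<le> d"
      using piece[OF xX less_imp_le[OF Ll_pos] Ll_mono[OF mk], of "r k"] m1[OF mm(2) mk] by auto
    note ch = EA_cc[OF h(1) pk_A[of k] pk_proj] and cl = EA_cc[OF l(1) pk_A[of k] pk_proj] and cv = rest_small[of k]
    note ct = EA_cc(1)[OF cmid_EA[of m "r k"] pk_A[of k] pk_proj]
    have eq: "yk k = cc (pk k) ?h + (cc (pk k) ?l + (cc (pk k) ?v + cc (pk k) ?c))"
      unfolding cc_add[symmetric] by (simp add: yk_def wk_def cmid_def)
    define b where "b = 2 * C1 * d"
    have b1: "nn (cc (pk k) ?h) \<le> b" "nn (cc (pk k) ?l) \<le> b"
      unfolding b_def using C0
      by (auto intro!: order_trans[OF ch(2)] order_trans[OF cl(2)] mult_left_mono h(2) l(2))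
    have "(1 / 2 :: real) ^ k \<le> (1 / 2) ^ m2" by (rule power_decreasing) (use mk in \<open>auto simp: m_def\<close>)
    then have "(1 / 2) ^ k \<le> d" using m2 by linarith
    then have "2 * C1 * (1 / 2) ^ k \<le> 2 * C1 * d" using C0 by (intro mult_left_mono) auto
    then have b2: "nn (cc (pk k) ?v) \<le> b" using cv(2) by (simp add: b_def)
    have "1 * d \<le> 2 * C1 * d" using C1_ge d by (intro mult_right_mono) auto
    then have b3: "nn (e n * cc (pk k) ?c * e n) \<le> b" using n k by (force simp: b_def)
    have s1: "cc (pk k) ?v + cc (pk k) ?c \<in> EA" by (rule EA_add(1)[OF cv(1) ct])
    have s2: "cc (pk k) ?l + (cc (pk k) ?v + cc (pk k) ?c) \<in> EA" by (rule EA_add(1)[OF cl(1) s1])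
    have "nn (e n * (cc (pk k) ?v + cc (pk k) ?c) * e n) \<le> C1 * (b + b)"
      by (rule order_trans[OF conj_add[OF cv(1) ct e(1,2)] mult_left_mono[OF add_mono[OF b2 b3]]]) (use C0 in simp)
    then have "nn (e n * (cc (pk k) ?l + (cc (pk k) ?v + cc (pk k) ?c)) * e n) \<le> C1 * (b + C1 * (b + b))"
      by (intro order_trans[OF conj_add[OF cl(1) s1 e(1,2)] mult_left_mono[OF add_mono[OF b1(2)]]]) (use C0 in auto)
    then have "nn (e n * yk k * e n) \<le> C1 * (b + C1 * (b + C1 * (b + b)))"
      unfolding eq by (intro order_trans[OF conj_add[OF ch(1) s2 e(1,2)] mult_left_mono[OF add_mono[OF b1(1)]]]) (use C0 in auto)
    also have "\<dots> = d * (2 * C1 ^ 2 + 2 * C1 ^ 3 + 4 * C1 ^ 4)" by (simp add: b_def algebra_simps power_numeral_reduce)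
    also have "\<dots> \<le> d * (2 * C1 ^ 4 + 2 * C1 ^ 4 + 4 * C1 ^ 4)"
      using C1_ge d by (intro mult_left_mono add_mono power_increasing) auto
    also have "\<dots> = \<epsilon>" using C0 by (simp add: d_def)
    finally show "nn (e n * yk k * e n) \<le> \<epsilon>" .
  qed
  then show ?thesis by blast
qed

text \<open>Deals with the finitely many k before the uniform range. For fixed k, order continuity
  makes the part below a small level L small, and the part above L is bounded with support of finite
  trace.\<close>

lemma single_equi:
  assumes \<epsilon>: "0 < \<epsilon>" shows "\<forall>\<^sub>F n in sequentially. nn (e n * yk k * e n) \<le> \<epsilon>"
proof -
  have C0: "0 < C1" using C1_ge by simp
  let ?x = "x (r k)"
  have "0 < \<epsilon> / (4 * C1^2)" using \<epsilon> C0 by simp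
  from cutf_small[OF sv_mem[OF xX] gen_inverse_nonneg this Kl_pos[of k], of "r k"]
  obtain L where L: "0 < L" "L \<le> Kl k" "N (cutf {0<..L} (sv ?x)) < \<epsilon> / (4 * C1^2)" by blast
  note v = piece[OF xX order_refl less_imp_le[OF L(1)], of "r k"]
  note c = piece(1)[OF xX less_imp_le[OF L(1)] L(2), of "r k"]
  note cv = EA_cc[OF v(1) pk_A[of k] pk_proj] and cc = EA_cc(1)[OF c pk_A[of k] pk_proj]
  let ?d = "cc (pk k) (tc ?x (Kl k) - tc ?x L)" and ?v = "cc (pk k) (tc ?x L - tc ?x 0)"
  have eq: "yk k = ?v + ?d"
    unfolding cc_add[symmetric] by (simp add: yk_def wk_def trunc_zero[OF xX])
  have "ds (graph ?d) 0 \<le> 2 * ds ?x L"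
    by (rule order_trans[OF ds_cc[OF EA_D(1)[OF c] pk_A pk_proj]])
      (rule mult_left_mono[OF ds_piece_zero[OF xX less_imp_le[OF L(1)] L(2)]], simp)
  also have "\<dots> < \<infinity>" using ds_finite[OF xX L(1), of "r k"] by (simp add: ennreal_mult_less_top)
  finally have fin: "ds (graph ?d) 0 < \<infinity>" .
  have "0 < \<epsilon> / (2 * C1)" using \<epsilon> C0 by simp
  from single_core[OF EA_D(1)[OF cc] fin this e] show ?thesis
  proof (rule eventually_mono)
    fix n assume n: "nn (e n * ?d * e n) \<le> \<epsilon> / (2 * C1)"
    have "nn ?v \<le> 2 * C1 * (\<epsilon> / (4 * C1^2))"
      using cv(2) mult_left_mono[of "nn (tc ?x L - tc ?x 0)" "\<epsilon> / (4 * C1^2)" "2 * C1"] v(2) L(3) C0 by linarith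
    also have "\<dots> = \<epsilon> / (2 * C1)" using C0 by (simp add: power2_eq_square)
    finally have "nn (e n * yk k * e n) \<le> C1 * (\<epsilon> / (2 * C1) + \<epsilon> / (2 * C1))"
      unfolding eq using n C0
      by (intro order_trans[OF conj_add[OF cv(1) cc e(1,2)] mult_left_mono[OF add_mono]]) auto
    also have "\<dots> = \<epsilon>" using C0 by (simp add: field_simps)
    finally show "nn (e n * yk k * e n) \<le> \<epsilon>" .
  qed
qed

lemma all_equi:
  assumes \<epsilon>: "0 < \<epsilon>" shows "\<forall>\<^sub>F n in sequentially. \<forall>k. nn (e n * yk k * e n) \<le> \<epsilon>"
proof -
  obtain k0 where "\<forall>\<^sub>F n in sequentially. \<forall>k\<ge>k0. nn (e n * yk k * e n) \<le> \<epsilon>" using tail_equi[OF \<epsilon>] by blast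
  moreover have "\<forall>\<^sub>F n in sequentially. \<forall>k\<in>{..<k0}. nn (e n * yk k * e n) \<le> \<epsilon>"
    by (intro eventually_ball_finite ballI single_equi \<epsilon>) simp
  ultimately show ?thesis
  proof (rule eventually_elim2)
    fix n assume "\<forall>k\<ge>k0. nn (e n * yk k * e n) \<le> \<epsilon>" "\<forall>k\<in>{..<k0}. nn (e n * yk k * e n) \<le> \<epsilon>"
    then show "\<forall>k. nn (e n * yk k * e n) \<le> \<epsilon>" by (meson lessThan_iff not_le)
  qed
qed

end

lemma yk_nc_bounded: "nc_bounded M \<tau> E N (range (\<lambda>k. graph (yk k)))"
  unfolding nc_bounded_def using EA_D(2)[OF yk_EA] yk_bound by (auto intro!: exI[of _ "2 * C1 * B"])

lemma zk_nc_bounded: "nc_bounded M \<tau> E N (range zk)"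
  unfolding nc_bounded_def using zk_X zk_bound by (auto intro!: exI[of _ "C1 * (B + 2 * C1 * B)"])

lemma yk_equi: "equi_integrable M \<tau> E N (range (\<lambda>k. graph (yk k)))"
  unfolding equi_integrable_def
proof (intro conjI allI impI yk_nc_bounded)
  fix e' assume "proj_decreasing_to_zero M e'"
  then obtain e where e': "\<And>n. e' n = graph (e n)" and e: "\<And>n. e n \<in> A" "\<And>n. isproj (e n)"
    "\<And>n. e n * e (Suc n) = e (Suc n)" "\<And>x. (\<lambda>n. e n \<odot> x) \<longlonglongrightarrow> 0" by (rule decreasing_to_zero) blast
  show "(\<lambda>n. SUP y\<in>range (\<lambda>k. graph (yk k)). ennreal (nx (compress (e' n) y))) \<longlonglongrightarrow> 0"
  proof (rule order_tendstoI)
    fix a :: ennreal assume "0 < a"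
    then obtain b where b: "0 < b" "b < a" using dense by blast
    then have bf: "b < \<infinity>" by (auto intro: less_le_trans)
    define \<epsilon> where "\<epsilon> = enn2real b"
    have \<epsilon>: "b = ennreal \<epsilon>" "0 < \<epsilon>" using b(1) bf by (simp_all add: \<epsilon>_def ennreal_enn2real enn2real_positive_iff)
    show "\<forall>\<^sub>F n in sequentially. (SUP y\<in>range (\<lambda>k. graph (yk k)). ennreal (nx (compress (e' n) y))) < a"
      using all_equi[OF e \<epsilon>(2)]
    proof (rule eventually_mono)
      fix n assume n: "\<forall>k. nn (e n * yk k * e n) \<le> \<epsilon>"
      have "(SUP y\<in>range (\<lambda>k. graph (yk k)). ennreal (nx (compress (e' n) y))) \<le> ennreal \<epsilon>"
        using n by (intro SUP_least) (auto simp: e' compress_graph intro!: ennreal_leI)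
      also have "\<dots> < a" using b(2) by (simp add: \<epsilon>(1))
      finally show "(SUP y\<in>range (\<lambda>k. graph (yk k)). ennreal (nx (compress (e' n) y))) < a" .
    qed
  qed simp
qed

end

theorem theorem3p1:
  fixes M :: "'h::chilbert_space op set"
    and \<tau> :: "'h op \<Rightarrow> ennreal"
    and E :: "(real \<Rightarrow> real) set"
    and N :: "(real \<Rightarrow> real) \<Rightarrow> real"
    and \<alpha> q :: real
    and x :: "nat \<Rightarrow> 'h op"
  assumes "semifinite_von_neumann_algebra M \<tau>"
    and "symmetric_quasi_banach_space E N"
    and "order_continuous_space E N"
    and "0 < \<alpha>" and "\<alpha> \<le> 1"
    and "convex_const_one \<alpha> E N"
    and "\<alpha> \<le> q"
    and "lower_estimate_const_one q E N"
    and "nc_bounded M \<tau> E N (range x)"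
  shows "\<exists>(r :: nat \<Rightarrow> nat) (y :: nat \<Rightarrow> 'h op) (z :: nat \<Rightarrow> 'h op) (p :: nat \<Rightarrow> 'h op).
    strict_mono r \<and>
    nc_bounded M \<tau> E N (range y) \<and>
    nc_bounded M \<tau> E N (range z) \<and>
    proj_decreasing_to_zero M p \<and>
    (\<forall>k. x (r k) = strong_plus (y k) (z k)) \<and>
    equi_integrable M \<tau> E N (range y) \<and>
    (\<forall>k. compress (p k) (y k) = op_zero) \<and>
    (\<forall>k. compress (p k) (z k) = z k)"
proof -
  obtain B where xB: "\<And>n. x n \<in> nc_space M \<tau> E" "\<And>n. nc_norm \<tau> N (x n) \<le> B"
    using assms(9) by (auto simp: nc_bounded_def)
  interpret semifinite_von_neumann_algebra M \<tau> by (rule assms(1))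
  interpret symmetric_quasi_banach_space E N by (rule assms(2))
  \<comment> \<open>Positivity of \<open>q\<close> comes from 0 < \<alpha> \<le> q.\<close>
  interpret oc_space E N q by unfold_locales (use assms in auto)
  interpret nc_setting M \<tau> E N q ..
  interpret bounded_sequence M \<tau> E N q x B by unfold_locales (fact xB)+
  obtain r where r: "strict_mono r"
    "\<And>i \<epsilon>. 0 < \<epsilon> \<Longrightarrow> \<exists>m0. \<forall>m\<ge>m0. \<forall>k\<ge>m. Phi i (r k) m - Phi i (r k) k \<le> \<epsilon>"
    using selection by blast
  interpret selected_sequence M \<tau> E N q x B r by unfold_locales (fact r(2))
  show ?thesis
    using r(1) yk_nc_bounded zk_nc_bounded pk_zero split_sum yk_equi compress_yk compress_zk
    by (intro exI[of _ r] exI[of _ "\<lambda>k. graph (yk k)"] exI[of _ zk] exI[of _ "\<lambda>k. graph (pk k)"]) blast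
qed

end
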